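(* Let $(X_n)_{n=0}^\infty$ be a sequence of pairwise disjoint compact sets in $\mathbb{C}$ with $\inf\{|z| : z\in X_n\}\to\infty$ as $n\to\infty$, and let $(C_n)_{n=0}^{\infty}$ be a sequence of finite sets $C_n\subseteq X_n$. Let $\varphi$ be a holomorphic function defined on a neighbourhood of $X:=\bigcup_{n=0}^\infty X_n$ such that $\varphi(X_{n-1})\subseteq X_n$ and $\varphi(\partial X_{n-1})\subseteq \partial X_n$ for all $n\geq 1$. Let $(\varepsilon_n)_{n=0}^\infty$ be a sequence of positive numbers. Suppose that $\mathbb{C}\setminus X$ is connected. Then both of the following hold. (I) (Escaping case.) There exist a transcendental entire function $f$ and a $\mathcal{C}^{\infty}$ diffeomorphism $\theta\colon\mathbb{C}\to\mathbb{C}$ such that (a) $f\circ\theta=\theta\circ\varphi$ on $X$; (b) $|\theta(z)-z|\leq\varepsilon_n$ on $X_n$ for all $n\geq 0$; (c) $\partial\theta(X)\subseteq J(f)$; (d) $\theta$ satisfies the Cauchy--Riemann equations on $X$; in particular, it is conformal on $\operatorname{int}(X)$; (e) $\theta(c)=c$ for $c\in\bigcup_{n=0}^\infty C_n$. In particular, $\theta(X)\subseteq I(f)$ and each $\theta(X_n)$ is a wandering compact set of $f$. (II) (Oscillating case.) There exist a transcendental entire function $f$, a $\mathcal{C}^{\infty}$ diffeomorphism $\theta\colon\mathbb{C}\to\mathbb{C}$ and a sequence $(k_n)_{n=0}^\infty$ of positive integers such that $f^{k_n}\circ\theta=\theta\circ\varphi$ on $X_n$ for all $n\geq 0$, such that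 (b), (c), (d) and (e) of part (I) hold for these $f$ and $\theta$, and such that the set $f(\theta(X))$ is bounded. In particular, $\theta(X)\subseteq BU(f)$ and each $\theta(X_n)$ is a wandering compact set of $f$.
   Context: Boundaries and closures are taken in $\mathbb{C}$. A transcendental entire function is a holomorphic function $f\colon\mathbb{C}\to\mathbb{C}$ for which $\infty$ is an essential singularity (i.e. which is not a polynomial). The Fatou set $F(f)$ is the set of points having a neighbourhood on which the iterates $f^n$ form a normal family; the Julia set is $J(f)=\mathbb{C}\setminus F(f)$. The escaping set is $I(f)=\{z\in\mathbb{C}: f^n(z)\to\infty\text{ as }n\to\infty\}$ and the bungee set is $BU(f)=\{z\in\mathbb{C}: \liminf_{n\to\infty}|f^n(z)|<\infty=\limsup_{n\to\infty}|f^n(z)|\}$. A compact set $K\subseteq\mathbb{C}$ is a wandering compact set of $f$ if $\partial K\subseteq J(f)$ and $f^n(K)\cap f^m(K)=\emptyset$ for all $n\neq m$.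
   Formalization: It is additionally assumed that φ is not constant near any limit point of X; otherwise the claim fails (e.g. X_n disjoint closed discs and φ constant near each, with value in ∂X_{n+1}), since f or an iterate of f would have to be constant. *)

theory Defs
  imports "HOL-Complex_Analysis.Complex_Analysis"
begin

definition transcendental_entire :: "(complex \<Rightarrow> complex) \<Rightarrow> bool" where
  "transcendental_entire f \<longleftrightarrow>
     f holomorphic_on UNIV \<and> \<not> not_essential (\<lambda>w. f (inverse w)) 0"

(* Inverse stereographic projection onto the unit sphere of the 3-dimensional Euclidean space
   complex * real. The Euclidean distance of the images of two points is their chordal distance
   on the Riemann sphere, and (0, 1) represents infinity. *)
definition to_sphere :: "complex \<Rightarrow> complex \<times> real" where
  "to_sphere z = ((2 / ((norm z)\<^sup>2 + 1)) *\<^sub>R z, ((norm z)\<^sup>2 - 1) / ((norm z)\<^sup>2 + 1))"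

(* Normality with respect to the chordal metric: the limit g automatically takes values in the
   (closed) unit sphere on U and may attain the value infinity. *)
definition normal_family_on :: "complex set \<Rightarrow> (complex \<Rightarrow> complex) set \<Rightarrow> bool" where
  "normal_family_on U \<F> \<longleftrightarrow>
     (\<forall>s :: nat \<Rightarrow> complex \<Rightarrow> complex. range s \<subseteq> \<F> \<longrightarrow>
        (\<exists>(r :: nat \<Rightarrow> nat) g. strict_mono r \<and>
           (\<forall>K. compact K \<and> K \<subseteq> U \<longrightarrow>
              uniform_limit K (\<lambda>n z. to_sphere (s (r n) z)) g sequentially)))"

definition fatou_set :: "(complex \<Rightarrow> complex) \<Rightarrow> complex set" where
  "fatou_set f = {z. \<exists>U. open U \<and> z \<in> U \<and> normal_family_on U (range (\<lambda>n. f ^^ n))}"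

definition julia_set :: "(complex \<Rightarrow> complex) \<Rightarrow> complex set" where
  "julia_set f = - fatou_set f"

definition escaping_set :: "(complex \<Rightarrow> complex) \<Rightarrow> complex set" where
  "escaping_set f = {z. filterlim (\<lambda>n. (f ^^ n) z) at_infinity sequentially}"

definition bungee_set :: "(complex \<Rightarrow> complex) \<Rightarrow> complex set" where
  "bungee_set f =
     {z. liminf (\<lambda>n. ereal (norm ((f ^^ n) z))) < \<infinity> \<and>
         limsup (\<lambda>n. ereal (norm ((f ^^ n) z))) = \<infinity>}"

definition wandering_compact :: "(complex \<Rightarrow> complex) \<Rightarrow> complex set \<Rightarrow> bool" where
  "wandering_compact f K \<longleftrightarrow>
     compact K \<and> frontier K \<subseteq> julia_set f \<and>
     (\<forall>n m. n \<noteq> m \<longrightarrow> (f ^^ n) ` K \<inter> (f ^^ m) ` K = {})"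

(* Differentiability is real (Frechet) differentiability of maps of the plane: k-fold
   differentiability is expressed by the directional derivatives. *)
primrec times_differentiable :: "nat \<Rightarrow> (complex \<Rightarrow> complex) \<Rightarrow> bool" where
  "times_differentiable 0 f \<longleftrightarrow> continuous_on UNIV f"
| "times_differentiable (Suc k) f \<longleftrightarrow>
     (\<forall>z. f differentiable (at z)) \<and>
     (\<forall>v. times_differentiable k (\<lambda>z. frechet_derivative f (at z) v))"

definition smooth_diffeomorphism :: "(complex \<Rightarrow> complex) \<Rightarrow> bool" where
  "smooth_diffeomorphism \<theta> \<longleftrightarrow>
     bij \<theta> \<and> (\<forall>k. times_differentiable k \<theta>) \<and> (\<forall>k. times_differentiable k (inv \<theta>))"

(* With D the real derivative of u + i v at x + i y, D 1 = u_x + i v_x and D i = u_y + i v_y. *)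
definition cauchy_riemann_at :: "(complex \<Rightarrow> complex) \<Rightarrow> complex \<Rightarrow> bool" where
  "cauchy_riemann_at \<theta> z \<longleftrightarrow>
     \<theta> differentiable (at z) \<and>
     Re (frechet_derivative \<theta> (at z) 1) = Im (frechet_derivative \<theta> (at z) \<i>) \<and>
     Re (frechet_derivative \<theta> (at z) \<i>) = - Im (frechet_derivative \<theta> (at z) 1)"

definition conformal_on :: "(complex \<Rightarrow> complex) \<Rightarrow> complex set \<Rightarrow> bool" where
  "conformal_on \<theta> S \<longleftrightarrow>
     \<theta> holomorphic_on S \<and> inj_on \<theta> S \<and> (\<forall>z\<in>S. deriv \<theta> z \<noteq> 0)"

(* A holomorphic map that is constant near a limit point z of X cannot be conjugated on X by a
   homeomorphism to a transcendental entire function f, or to an iterate of f: that iterate would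
   be constant on a set accumulating at the image of z, hence constant. The word ``holomorphic
   function'' is therefore understood to exclude such maps (e.g. maps that are constant near
   each of a sequence of disjoint closed discs). Local constancy at isolated points of X is
   harmless and is not excluded. *)
definition nondegenerate_on :: "(complex \<Rightarrow> complex) \<Rightarrow> complex set \<Rightarrow> bool" where
  "nondegenerate_on \<phi> X \<longleftrightarrow>
     (\<forall>z. z islimpt X \<longrightarrow> \<not> (\<exists>r>0. \<phi> constant_on ball z r))"

end

(* A transcendental entire function f is built as the limit of polynomials f_N, and the diffeomorphism
   theta as id plus a series of small cut-off holomorphic functions. An exhaustion of the plane by compact
   sets A_N with connected complement separates X_0, ..., X_(N-1) from X_N, X_(N+1), ... At step N the model
   map equals f_N on A_N and phi near X_N (oscillating case: X_N is first sent into a small disc around a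
   repelling fixed point p and is carried from there by f_N out of A_N before it is moved to X_(N+1)).
   Runge's theorem with interpolation at finitely many marked points replaces the model by a polynomial
   f_(N+1). If the critical points of phi, the points of C_n and their orbits are among the marked points,
   with high multiplicity, then the small error can be absorbed by changing theta holomorphically near
   X_N, ..., X_0. Near each frontier point of theta(X_n) some point is mapped to p in finitely many steps
   while the frontier point itself has an unbounded orbit, so that the iterates are not normal there. *)

theory Submission
  imports Defs
begin

section \<open>Nonseparating compact sets\<close>

text \<open>The obstacle is the critical points of \<phi>. Absorbing an error means solving \<open>F
  (\<theta> + u) = \<theta> \<circ> \<phi> + u' \<circ> \<phi>\<close> for \<open>u\<close>, which
  divides by the derivative of \<open>F\<close> along \<theta>; near a critical point this yields a
  small holomorphic \<open>u\<close> provided that the errors vanish there to a sufficiently high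
  order. Errors are therefore measured against powers of the distance to a finite marked set, and
  the interpolation in Runge's theorem is what makes a polynomial close to the model in this
  weighted sense. As \<open>u'\<close> is itself the solution at the next set, the required orders
  and accuracies are determined from the last set back to the first, whereas the neighbourhoods
  carrying the solutions are fixed earlier: the cut-offs, and with them the admissible size of
  \<open>u\<close>, depend on them. Marked points also freeze finite data exactly: the orbits that
  end at \<open>p\<close>, the multiplier 2 at \<open>p\<close>, thanks to which small discs around
  \<open>p\<close> keep leaving every \<open>A N\<close>, and points outside every
  \<open>A N\<close> with the values \<open>p\<close> and \<open>p + 1\<close>, which prevent the
  limit from being a polynomial.\<close>

definition nonseparating :: "complex set \<Rightarrow> bool" where
  "nonseparating K \<longleftrightarrow> compact K \<and> connected (- K)"

text \<open>Janiszewski's theorem asks for a connected intersection; the empty one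
  qualifies.\<close>

lemma nonseparating_Un:
  assumes "nonseparating K" "nonseparating L" "K \<inter> L = {}"
  shows "nonseparating (K \<union> L)"
  using assms Janiszewski_connected [of K L] unfolding nonseparating_def
  by (auto intro: compact_Un compact_imp_closed)

lemma nonseparating_cball: "nonseparating (cball a r)"
  unfolding nonseparating_def using connected_complement_bounded_convex [of "cball a r"] by auto

lemma nonseparating_finite:
  assumes "finite W"
  shows "nonseparating W"
  using assms
proof (induction W)
  case empty
  then show ?case by (simp add: nonseparating_def connected_UNIV)
next
  case (insert x F)
  have "nonseparating ({x} \<union> F)"
    using insert nonseparating_cball [of x 0] by (intro nonseparating_Un) auto
  then show ?case by simp
qed

text \<open>If \<open>A\<close> and \<open>B\<close> separated \<open>- P\<close>, the connected set
  \<open>- (P \<union> Q)\<close> would lie in one of them, say \<open>A\<close>, and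
  \<open>B\<close> in \<open>Q\<close>. The closure of \<open>B\<close> then avoids both
  \<open>P\<close> and \<open>A\<close>, so \<open>B\<close> is open, closed and nonempty, hence the
  whole plane.\<close>

lemma connected_Compl_part:
  fixes P Q :: "complex set"
  assumes "closed P" "closed Q" "P \<inter> Q = {}" "connected (- (P \<union> Q))"
  shows "connected (- P)"
proof -
  have no_split: False
    if A: "open A" and B: "open B" and AB: "A \<inter> B = {}" and cov: "- P = A \<union> B"
      and ne: "A \<noteq> {}" "B \<noteq> {}" and sub: "- (P \<union> Q) \<subseteq> A" for A B
  proof -
    have "B \<subseteq> Q"
      using sub AB cov by blast
    then have "closure B \<subseteq> - P"
      using assms by (metis closure_minimal disjoint_eq_subset_Compl inf_commute subset_trans)
    moreover have "closure B \<inter> A = {}"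
      using A AB open_Int_closure_eq_empty by blast
    ultimately have "closure B = B"
      using cov closure_subset by blast
    then have "closed B" by (metis closed_closure)
    then have "B = UNIV"
      using B ne clopen by blast
    then show False using AB ne by auto
  qed
  show ?thesis
  proof (rule ccontr)
    assume "\<not> connected (- P)"
    then obtain A' B' where "open A'" "open B'" "- P \<subseteq> A' \<union> B'" "A' \<inter> B' \<inter> - P = {}"
        "A' \<inter> - P \<noteq> {}" "B' \<inter> - P \<noteq> {}"
      unfolding connected_def by blast
    then have "open (A' \<inter> - P)" "open (B' \<inter> - P)" "(A' \<inter> - P) \<inter> (B' \<inter> - P) = {}"
       "- P = (A' \<inter> - P) \<union> (B' \<inter> - P)" "A' \<inter> - P \<noteq> {}" "B' \<inter> - P \<noteq> {}"
      using assms(1) by (auto simp: open_Compl intro: open_Int)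
    then obtain A B where AB: "open A" "open B" "A \<inter> B = {}" "- P = A \<union> B" "A \<noteq> {}" "B \<noteq> {}"
      by metis
    then have "- (P \<union> Q) \<subseteq> A \<or> - (P \<union> Q) \<subseteq> B"
      using connectedD [OF assms(4), of A B] by blast
    then show False
      using no_split [of A B] no_split [of B A] AB by (auto simp: Un_commute Int_commute)
  qed
qed

text \<open>\<open>- outside B\<close> is \<open>B\<close> together with the bounded components of
  its complement; in the plane only one component is unbounded.\<close>

lemma nonseparating_hull:
  fixes B :: "complex set"
  assumes "compact B"
  shows "nonseparating (- outside B)"
proof -
  have "bounded (- outside B)"
    using assms cobounded_outside compact_imp_bounded by blast
  moreover have "closed (- outside B)"
    using assms open_outside [of B] by (auto simp: closed_def dest: compact_imp_closed)
  moreover have "connected (outside B)"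
    using assms by (simp add: compact_imp_bounded connected_outside)
  ultimately show ?thesis
    by (simp add: nonseparating_def compact_eq_bounded_closed)
qed

lemma frontier_hull_subset:
  fixes B :: "complex set"
  assumes "closed B"
  shows "frontier (- outside B) \<subseteq> B"
  using frontier_outside_subset [OF assms] by (simp add: frontier_complement)

text \<open>The complement of a disc containing \<open>S\<close> is connected and unbounded, so a
  single path that reaches it without meeting \<open>S\<close> certifies that its starting point is
  outside.\<close>

lemma outside_if_path_far:
  fixes S :: "complex set"
  assumes "S \<subseteq> ball 0 R" "path g" "path_image g \<inter> S = {}" "norm (pathfinish g) \<ge> R"
  shows "pathstart g \<in> outside S"
proof -
  have "connected (- ball 0 R :: complex set)"
    using connected_complement_bounded_convex [of "ball (0::complex) R"] by auto
  moreover have "- ball 0 R \<subseteq> - S" "pathfinish g \<in> - ball 0 R"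
    using assms by auto
  ultimately have sub: "- ball 0 R \<subseteq> connected_component_set (- S) (pathfinish g)"
    by (intro connected_component_maximal) auto
  have eq: "connected_component_set (- S) (pathfinish g) = connected_component_set (- S) (pathstart g)"
  proof (rule connected_component_eq)
    have "connected_component (- S) (pathstart g) (pathfinish g)"
      using assms(2,3) by (intro connected_componentI [of "path_image g"]) (auto simp: connected_path_image)
    then show "pathfinish g \<in> connected_component_set (- S) (pathstart g)"
      by simp
  qed
  have "\<not> bounded (- ball 0 R :: complex set)"
    using cobounded_imp_unbounded by fastforce
  then have "\<not> bounded (connected_component_set (- S) (pathstart g))"
    using sub bounded_subset unfolding eq by blast
  then show ?thesis by (simp add: outside)
qed

text \<open>The complements of the filled closed neighbourhoods of \<open>K\<close> increase to \<open>- K\<close>, so finitely many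
  of them cover a given compact subset of \<open>- K\<close>.\<close>

lemma nonseparating_fatten:
  assumes K: "nonseparating K" and O: "open O'" "K \<subseteq> O'"
  obtains L where "nonseparating L" "K \<subseteq> interior L" "L \<subseteq> O'"
proof (cases "K = {}")
  case True
  then show ?thesis using that[of "{}"] by (simp add: nonseparating_def connected_UNIV)
next
  case False
  have cK: "compact K" and conK: "connected (- K)"
    using K by (auto simp: nonseparating_def)
  obtain R where R: "R > 0" "K \<subseteq> ball 0 R"
    using cK by (metis bounded_subset_ballD compact_imp_bounded)
  define D where "D n = {y. infdist y K \<le> 1 / real (Suc n)}" for n
  have D_dec: "D n \<subseteq> D m" if "m \<le> n" for m n
  proof -
    have "1 / real (Suc n) \<le> 1 / real (Suc m)"
      using that by (simp add: field_simps)
    then show ?thesis unfolding D_def by force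
  qed
  have D_sub: "D n \<subseteq> ball 0 (R + 1)" for n
  proof
    fix y assume "y \<in> D n"
    then have "infdist y K \<le> 1" 
      unfolding D_def by (smt (verit) divide_le_eq_1 mem_Collect_eq of_nat_Suc of_nat_0_le_iff)
    moreover obtain k where "k \<in> K" "infdist y K = dist y k"
      using infdist_attains_inf [OF compact_imp_closed [OF cK] False] by blast
    ultimately have "dist y k \<le> 1" "norm k < R" using R by auto
    then show "y \<in> ball 0 (R + 1)"
      using norm_triangle_sub [of y k] by (auto simp: dist_norm)
  qed
  have closed_D: "closed (D n)" for n
    unfolding D_def by (intro closed_Collect_le continuous_intros)
  have compD: "compact (D n)" for n
    using closed_D bounded_subset [OF bounded_ball D_sub] by (simp add: compact_eq_bounded_closed)
  have cover: "\<exists>n. y \<in> outside (D n)" if y: "y \<notin> K" for y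
  proof -
    \<comment> \<open>The point \<open>q\<close> lies beyond all the neighbourhoods
      \<open>D n\<close>. A path from \<open>y\<close> to \<open>q\<close> in \<open>- K\<close> has
      positive distance to \<open>K\<close> and therefore misses \<open>D n\<close> for large
      \<open>n\<close>.\<close>
    define q where "q = (of_real (max (R + 2) (norm y)) :: complex)"
    have "norm q \<ge> R + 1" unfolding q_def by (simp add: norm_of_real)
    then have "q \<notin> K" using R by force
    moreover have "path_connected (- K)"
      using conK cK by (simp add: compact_imp_closed connected_open_path_connected open_Compl)
    ultimately obtain g where g: "path g" "path_image g \<subseteq> - K" "pathstart g = y" "pathfinish g = q"
      using y unfolding path_connected_def by blast
    have "compact (path_image g)" using g by (simp add: compact_path_image)
    moreover have "path_image g \<inter> K = {}" using g by auto
    ultimately obtain d where d: "d > 0" "\<And>x k. x \<in> path_image g \<Longrightarrow> k \<in> K \<Longrightarrow> d \<le> dist x k"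
      using separate_compact_closed [of "path_image g" K] compact_imp_closed [OF cK] by blast
    obtain n where n: "1 / real (Suc n) < d" using d(1) by (metis nat_approx_posE inverse_eq_divide)
    have "path_image g \<inter> D n = {}"
    proof -
      have False if "x \<in> path_image g" "x \<in> D n" for x
      proof -
        obtain k where "k \<in> K" "infdist x K = dist x k"
          using infdist_attains_inf [OF compact_imp_closed [OF cK] False] by blast
        then show False using that d(2)[of x k] n unfolding D_def by auto
      qed
      then show ?thesis by auto
    qed
    then have "pathstart g \<in> outside (D n)"
      using outside_if_path_far [OF D_sub g(1)] g(4) \<open>norm q \<ge> R + 1\<close> by auto
    then show ?thesis using g by auto
  qed
  have "compact (cball 0 (R + 1) - O')"
    using O by (simp add: compact_diff)
  moreover have "cball 0 (R + 1) - O' \<subseteq> (\<Union>n. outside (D n))"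
    using cover O by blast
  moreover have "open (outside (D n))" for n
    using closed_D by (simp add: open_outside)
  ultimately obtain F where F: "finite F" "cball 0 (R + 1) - O' \<subseteq> (\<Union>n\<in>F. outside (D n))"
    using compactE_image [of "cball 0 (R+1) - O'" UNIV "\<lambda>n. outside (D n)"] by auto
  define N where "N = Max (insert 0 F)"
  have sub: "cball 0 (R + 1) - O' \<subseteq> outside (D N)"
  proof
    fix x assume "x \<in> cball 0 (R + 1) - O'"
    then obtain n where "n \<in> F" "x \<in> outside (D n)" using F by auto
    moreover have "D N \<subseteq> D n" 
      using \<open>n \<in> F\<close> F(1) by (intro D_dec) (auto simp: N_def)
    ultimately show "x \<in> outside (D N)" using outside_mono by blast
  qed
  show ?thesis
  proof
    show "nonseparating (- outside (D N))"
      using compD by (rule nonseparating_hull)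
    have "open {y. infdist y K < 1 / real (Suc N)}"
      by (intro open_Collect_less continuous_intros)
    moreover have "K \<subseteq> {y. infdist y K < 1 / real (Suc N)}" by auto
    moreover have "{y. infdist y K < 1 / real (Suc N)} \<subseteq> - outside (D N)"
    proof -
      have "{y. infdist y K < 1 / real (Suc N)} \<subseteq> D N" by (auto simp: D_def)
      then show ?thesis using outside_no_overlap[of "D N"] by blast
    qed
    ultimately show "K \<subseteq> interior (- outside (D N))" 
      using interior_maximal by (meson subset_trans)
    have "x \<in> outside (D N)" if "x \<notin> cball 0 (R + 1)" for x
    proof -
      have "x \<notin> D N" using that D_sub [of N] by auto
      then show ?thesis
        using outside_if_path_far [OF D_sub, of "linepath x x" N] that by auto
    qed
    then show "- outside (D N) \<subseteq> O'"
      using sub by blast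
  qed
qed

section \<open>Separators and the exhaustion of the plane\<close>

definition separator :: "(nat \<Rightarrow> complex set) \<Rightarrow> nat \<Rightarrow> complex set \<Rightarrow> bool" where
  "separator X N A \<longleftrightarrow> nonseparating A \<and> (\<forall>n<N. X n \<subseteq> interior A) \<and> (\<forall>n\<ge>N. X n \<inter> A = {})"

locale compact_sequence =
  fixes X :: "nat \<Rightarrow> complex set"
  assumes compact_X: "compact (X n)"
    and disjoint_X: "n \<noteq> m \<Longrightarrow> X n \<inter> X m = {}"
    and avoids: "compact B \<Longrightarrow> \<exists>N. \<forall>n\<ge>N. X n \<inter> B = {}"
    and connected_Compl: "connected (- (\<Union>n. X n))"
begin

lemma closed_each: "closed (X n)"
  using compact_X by (rule compact_imp_closed)

text \<open>Local finiteness: by \<open>avoids\<close>, a closed disc meets only finitely many of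
  the sets.\<close>

lemma closed_tail: "closed (\<Union>n\<in>{N..}. X n)"
proof -
  have "\<exists>e>0. ball x e \<inter> (\<Union>n\<in>{N..}. X n) = {}" if x: "x \<notin> (\<Union>n\<in>{N..}. X n)" for x
  proof -
    obtain M where M: "\<And>n. n \<ge> M \<Longrightarrow> X n \<inter> cball x 1 = {}"
      using avoids [of "cball x 1"] by auto
    have "closed (\<Union>n\<in>{N..<M}. X n)"
      by (intro closed_UN closed_each ballI) auto
    moreover have "x \<notin> (\<Union>n\<in>{N..<M}. X n)"
      using x by auto
    ultimately obtain e where e: "e > 0" "ball x e \<subseteq> - (\<Union>n\<in>{N..<M}. X n)"
      by (meson ComplI open_Compl open_contains_ball)
    have "ball x (min e 1) \<inter> X n = {}" if "n \<ge> N" for n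
    proof (cases "n < M")
      case True
      then show ?thesis using e(2) that by fastforce
    next
      case False
      then show ?thesis using M [of n] by auto
    qed
    then show ?thesis using e(1) by (intro exI[of _ "min e 1"]) auto
  qed
  then show ?thesis
    unfolding closed_def open_contains_ball by (metis (no_types, lifting) ComplD ComplI disjoint_eq_subset_Compl)
qed

lemma closed_X: "closed (\<Union>n. X n)"
  using closed_tail [of 0] by (simp add: atLeast_0)

lemma disjoint_Union: "n \<notin> S \<Longrightarrow> (\<Union>m\<in>S. X m) \<inter> X n = {}"
proof -
  assume n: "n \<notin> S"
  have "X m \<inter> X n = {}" if "m \<in> S" for m
    using that n by (intro disjoint_X) auto
  then show ?thesis by blast
qed

text \<open>The rest of \<open>X n\<close> and the other members of the sequence form a closed set
  disjoint from \<open>P\<close>, so \<open>connected_Compl_part\<close> passes the connectedness of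
  the complement of the whole union on to \<open>- P\<close>.\<close>

lemma nonseparating_part:
  assumes "closed P" "closed Q" "P \<inter> Q = {}" "P \<union> Q = X n"
  shows "nonseparating P"
proof -
  have "compact P"
    using assms compact_X [of n] by (metis closed_Int_compact inf_commute inf_sup_absorb sup_inf_absorb)
  define Z where "Z = (\<Union>m\<in>{..<n}. X m) \<union> (\<Union>m\<in>{Suc n..}. X m)"
  have "closed Z"
    unfolding Z_def by (intro closed_Un closed_tail closed_UN closed_each ballI) auto
  moreover have "(\<Union>m. X m) = P \<union> (Q \<union> Z)"
  proof -
    have "UNIV = {..<n} \<union> {n} \<union> {Suc n..}" by auto
    then have "(\<Union>m. X m) = (\<Union>m\<in>{..<n} \<union> {n} \<union> {Suc n..}. X m)" by (rule arg_cong)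
    then show ?thesis unfolding Z_def using assms(4) by auto
  qed
  moreover have "Z \<inter> X n = {}"
    unfolding Z_def using disjoint_Union [of n "{..<n}"] disjoint_Union [of n "{Suc n..}"] by auto
  ultimately show ?thesis
    using connected_Compl assms(1-3) connected_Compl_part [of P "Q \<union> Z"] \<open>compact P\<close> assms(4)
    unfolding nonseparating_def by (auto simp: closed_Un)
qed

lemma nonseparating_X: "nonseparating (X n)"
  using nonseparating_part [of "X n" "{}" n] compact_X by (simp add: compact_imp_closed)

text \<open>Only the finitely many sets that meet \<open>B\<close> can create holes together with \<open>B\<close>; filling these
  holes gives \<open>H\<close>, and the remaining sets meet \<open>H\<close> in relatively open pieces.\<close>

lemma separator_containing:
  assumes "compact B"
  obtains N where "\<And>M. M \<ge> N \<Longrightarrow> \<exists>A. separator X M A \<and> B \<subseteq> interior A"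
proof -
  obtain N1 where N1: "\<And>n. n \<ge> N1 \<Longrightarrow> X n \<inter> B = {}"
    using avoids assms by blast
  define B' where "B' = B \<union> (\<Union>n\<in>{..<N1}. X n)"
  have "compact B'"
    unfolding B'_def by (intro compact_Un assms compact_UN compact_X) auto
  define H where "H = - outside B'"
  have H: "nonseparating H"
    using nonseparating_hull \<open>compact B'\<close> by (simp add: H_def)
  then have "compact H" by (simp add: nonseparating_def)
  have "B' \<subseteq> H" unfolding H_def using outside_no_overlap[of B'] by blast
  obtain N2 where N2: "\<And>n. n \<ge> N2 \<Longrightarrow> X n \<inter> H = {}"
    using avoids \<open>compact H\<close> by blast
  have frontier_H: "X n \<inter> frontier H = {}" if "n \<ge> N1" for n
  proof -
    have "frontier H \<subseteq> B'"
      unfolding H_def by (rule frontier_hull_subset [OF compact_imp_closed [OF \<open>compact B'\<close>]])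
    moreover have "X n \<inter> (\<Union>n\<in>{..<N1}. X n) = {}"
      using that disjoint_Union [of n "{..<N1}"] by auto
    ultimately show ?thesis unfolding B'_def using N1 [OF that] by blast
  qed
  have part: "nonseparating (X n - H)" if "n \<ge> N1" for n
  proof (rule nonseparating_part)
    \<comment> \<open>The frontier of \<open>H\<close> is contained in \<open>B'\<close>, which
      \<open>X n\<close> avoids. Hence \<open>H\<close> and its interior cut the same piece out of
      \<open>X n\<close>, and both \<open>X n - H\<close> and \<open>X n \<inter> H\<close> are
      closed.\<close>
    have eq: "X n - H = X n - interior H"
      using frontier_H [OF that] interior_subset [of H] by (auto simp: frontier_def \<open>compact H\<close> closure_closed compact_imp_closed)
    show "closed (X n - H)"
      unfolding eq using compact_X by (simp add: closed_Diff compact_imp_closed)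
    show "closed (X n \<inter> H)"
      using compact_X \<open>compact H\<close> by (simp add: closed_Int compact_imp_closed)
  qed auto
  have base: "nonseparating (H \<union> (\<Union>n\<in>{N1..<M}. X n - H))" for M
  proof (induction M)
    case 0
    then show ?case using H by simp
  next
    case (Suc M)
    show ?case
    proof (cases "N1 \<le> M")
      case True
      then have "{N1..<Suc M} = insert M {N1..<M}" by auto
      then have "H \<union> (\<Union>n\<in>{N1..<Suc M}. X n - H) = (H \<union> (\<Union>n\<in>{N1..<M}. X n - H)) \<union> (X M - H)"
        by auto
      moreover have "(H \<union> (\<Union>n\<in>{N1..<M}. X n - H)) \<inter> (X M - H) = {}"
        using disjoint_Union [of M "{N1..<M}"] by auto
      ultimately show ?thesis
        using nonseparating_Un [OF Suc part [OF True]] by simp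
    next
      case False
      then show ?thesis using Suc by simp
    qed
  qed
  show ?thesis
  proof (rule that [of "max N1 N2"])
    fix M assume M: "max N1 N2 \<le> M"
    let ?K = "H \<union> (\<Union>n\<in>{N1..<M}. X n - H)"
    \<comment> \<open>From \<open>N2\<close> on the sets miss \<open>H\<close>, and they are
      disjoint from the finitely many pieces added to it; the whole tail can thus be excluded when
      the union is fattened.\<close>
    have "?K \<inter> (\<Union>n\<in>{M..}. X n) = {}"
    proof -
      have "?K \<inter> X m = {}" if "m \<ge> M" for m
        using N2 [of m] M that disjoint_Union [of m "{N1..<M}"] by auto
      then show ?thesis by blast
    qed
    then have "?K \<subseteq> - (\<Union>n\<in>{M..}. X n)" by blast
    then obtain A where A: "nonseparating A" "?K \<subseteq> interior A" "A \<subseteq> - (\<Union>n\<in>{M..}. X n)"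
      using nonseparating_fatten [OF base] closed_tail by (metis open_Compl)
    have sub: "X n \<subseteq> ?K" if "n < M" for n
    proof (cases "n < N1")
      case True
      then show ?thesis using \<open>B' \<subseteq> H\<close> B'_def by blast
    next
      case False
      then show ?thesis using that by auto
    qed
    then have "separator X M A"
    proof -
      have "X n \<subseteq> interior A" if "n < M" for n
        using sub [OF that] A(2) by (rule subset_trans)
      then show ?thesis using A(1,3) unfolding separator_def by auto
    qed
    moreover have "B \<subseteq> interior A"
      using A \<open>B' \<subseteq> H\<close> B'_def by blast
    ultimately show "\<exists>A. separator X M A \<and> B \<subseteq> interior A" by blast
  qed
qed

text \<open>The bound \<open>W\<close> serves to keep the new separator inside a later one that has
  been chosen beforehand.\<close>

lemma separator_step:
  assumes "separator X N A" "open W" "A \<subseteq> W" "X N \<subseteq> W"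
  obtains A' where "separator X (Suc N) A'" "A \<subseteq> interior A'" "A' \<subseteq> W"
proof -
  have K: "nonseparating (A \<union> X N)"
    using assms(1) nonseparating_X by (intro nonseparating_Un) (auto simp: separator_def)
  have "open (W - (\<Union>n\<in>{Suc N..}. X n))"
    using assms(2) closed_tail by (rule open_Diff)
  moreover have "A \<union> X N \<subseteq> W - (\<Union>n\<in>{Suc N..}. X n)"
  proof -
    have "(A \<union> X N) \<inter> X m = {}" if "m \<ge> Suc N" for m
    proof -
      have "X m \<inter> A = {}" "X N \<inter> X m = {}"
        using assms(1) disjoint_X [of N m] that by (auto simp: separator_def)
      then show ?thesis by blast
    qed
    then show ?thesis using assms(3,4) by blast
  qed
  ultimately obtain A' where A': "nonseparating A'" "A \<union> X N \<subseteq> interior A'" "A' \<subseteq> W - (\<Union>n\<in>{Suc N..}. X n)"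
    using nonseparating_fatten [OF K] by metis
  have "A \<subseteq> interior A'" using A'(2) by simp
  then have "X n \<subseteq> interior A'" if "n < Suc N" for n
  proof (cases "n = N")
    case True
    then show ?thesis using A'(2) by simp
  next
    case False
    then have "X n \<subseteq> interior A" using assms(1) that by (simp add: separator_def)
    then show ?thesis using A'(2) interior_subset [of A] by blast
  qed
  moreover have "X n \<inter> A' = {}" if "n \<ge> Suc N" for n
    using A'(3) that by auto
  ultimately have "separator X (Suc N) A'"
    using A'(1) unfolding separator_def by blast
  then show ?thesis using that A' by blast
qed

text \<open>\<open>separator_containing\<close> produces separators that swallow prescribed discs,
  but only at sufficiently large indices. A sparse sequence \<open>B j\<close> of these, at the
  indices \<open>N j\<close>, is chosen before the others; the missing indices are then filled by
  \<open>separator_step\<close>, always staying inside the next \<open>B j\<close>.\<close>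

lemma exhaustion:
  assumes "nonseparating D" "D \<inter> (\<Union>n. X n) = {}"
  obtains A where "\<And>n. separator X n (A n)" "\<And>n. A n \<subseteq> interior (A (Suc n))"
    "(\<Union>n. interior (A n)) = UNIV" "D \<subseteq> interior (A 0)"
proof -
  obtain A0 where A0: "nonseparating A0" "D \<subseteq> interior A0" "A0 \<subseteq> - (\<Union>n. X n)"
    using nonseparating_fatten [OF assms(1), of "- (\<Union>n. X n)"] assms(2) closed_X
    by (metis disjoint_eq_subset_Compl open_Compl)
  have sep0: "separator X 0 A0"
    using A0 unfolding separator_def by auto
  \<comment> \<open>Each sparse separator contains its predecessor and the disc of radius
    \<open>j\<close> in its interior, so that the interiors exhaust the plane.\<close>
  define R where "R j q q' \<longleftrightarrow> fst q < fst q' \<and> snd q \<union> cball 0 (real j) \<subseteq> interior (snd q')"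
    for j :: nat and q q' :: "nat \<times> complex set"
  have "\<exists>g. \<forall>j. (separator X (fst (g j)) (snd (g j)) \<and> (j = 0 \<longrightarrow> g j = (0, A0))) \<and> R j (g j) (g (Suc j))"
  proof (rule dependent_nat_choice)
    show "\<exists>q. separator X (fst q) (snd q) \<and> (0 = (0::nat) \<longrightarrow> q = (0, A0))"
      using sep0 by auto
  next
    fix q and j :: nat
    assume q: "separator X (fst q) (snd q) \<and> (j = 0 \<longrightarrow> q = (0, A0))"
    then have "compact (snd q \<union> cball 0 (real j))"
      by (auto simp: separator_def nonseparating_def)
    then obtain N where N: "\<And>M. M \<ge> N \<Longrightarrow> \<exists>A. separator X M A \<and> snd q \<union> cball 0 (real j) \<subseteq> interior A"
      using separator_containing by metis
    then obtain A where "separator X (max N (Suc (fst q))) A \<and> snd q \<union> cball 0 (real j) \<subseteq> interior A"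
      by (meson max.cobounded1)
    then show "\<exists>q'. (separator X (fst q') (snd q') \<and> (Suc j = 0 \<longrightarrow> q' = (0, A0))) \<and> R j q q'"
      by (intro exI [of _ "(max N (Suc (fst q)), A)"]) (auto simp: R_def)
  qed
  then obtain g where g: "\<And>j. separator X (fst (g j)) (snd (g j))" "g 0 = (0, A0)" "\<And>j. R j (g j) (g (Suc j))"
    by auto
  define N where "N j = fst (g j)" for j :: nat
  define B where "B j = snd (g j)" for j :: nat
  have sepB: "separator X (N j) (B j)" and NB0: "N 0 = 0" "B 0 = A0" for j :: nat
    using g by (auto simp: N_def B_def)
  have NB: "N j < N (Suc j)" "B j \<union> cball 0 (real j) \<subseteq> interior (B (Suc j))" for j :: nat
    using g(3) [of j] by (auto simp: R_def N_def B_def)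
  have N_mono: "strict_mono N"
    using NB by (simp add: strict_mono_Suc_iff)
  have B_mono: "B i \<subseteq> B j" if "i \<le> j" for i j
    using that
  proof (rule lift_Suc_mono_le [of B, rotated])
    show "B n \<subseteq> B (Suc n)" for n using NB(2) [of n] interior_subset by blast
  qed
  have B_int: "B i \<subseteq> interior (B j)" if "i < j" for i j
  proof -
    have "B i \<subseteq> interior (B (Suc i))" using NB(2) [of i] by blast
    also have "\<dots> \<subseteq> interior (B j)" using that by (intro interior_mono B_mono) auto
    finally show ?thesis .
  qed
  \<comment> \<open>\<open>A\<close> is squeezed between the sparse separators with index at most
    \<open>n\<close> and those with larger index.\<close>
  define P where "P n A \<longleftrightarrow> separator X n A \<and> (\<forall>j. n < N j \<longrightarrow> A \<subseteq> interior (B j)) \<and> (\<forall>j. N j \<le> n \<longrightarrow> B j \<subseteq> A)" for n A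
  have "\<exists>A. \<forall>n. P n (A n) \<and> A n \<subseteq> interior (A (Suc n)) \<and> (n = 0 \<longrightarrow> A n = A0)"
  proof -
    have "\<exists>A. \<forall>n. (P n (A n) \<and> (n = 0 \<longrightarrow> A n = A0)) \<and> A n \<subseteq> interior (A (Suc n))"
    proof (rule dependent_nat_choice)
      have "A0 \<subseteq> interior (B j)" if "0 < N j" for j
        using that NB0 B_int [of 0 j] by (cases j) auto
      moreover have "B j \<subseteq> A0" if "N j \<le> 0" for j
        using that NB0 N_mono by (metis le_zero_eq strict_mono_eq order_refl)
      ultimately show "\<exists>A. P 0 A \<and> (0 = (0::nat) \<longrightarrow> A = A0)"
        using sep0 unfolding P_def by blast
    next
      fix A n assume "P n A \<and> (n = 0 \<longrightarrow> A = A0)"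
      then have P: "separator X n A" "\<And>j. n < N j \<Longrightarrow> A \<subseteq> interior (B j)" "\<And>j. N j \<le> n \<Longrightarrow> B j \<subseteq> A"
        unfolding P_def by auto
      have "\<exists>A'. P (Suc n) A' \<and> A \<subseteq> interior A'"
      proof (cases "\<exists>j. N j = Suc n")
        case True
        then obtain j where j: "N j = Suc n" by blast
        have "P (Suc n) (B j)"
          unfolding P_def using sepB [of j] j B_int B_mono N_mono
          by (metis strict_mono_less strict_mono_less_eq)
        then show ?thesis using P(2) [of j] j by auto
      next
        case False
        \<comment> \<open>The nearest sparse separator ahead: whatever lies in its interior lies in
          the interior of all later ones.\<close>
        define j where "j = (LEAST j. n < N j)"
        have j: "n < N j"
          unfolding j_def by (rule LeastI [of _ "Suc n"]) (meson N_mono less_le_trans lessI strict_mono_imp_increasing)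
        have least: "j \<le> i" if "n < N i" for i
          unfolding j_def using that by (rule Least_le)
        have "X n \<subseteq> interior (B j)"
          using sepB [of j] j unfolding separator_def by auto
        then obtain A' where A': "separator X (Suc n) A'" "A \<subseteq> interior A'" "A' \<subseteq> interior (B j)"
          using separator_step [OF P(1), of "interior (B j)"] P(2) [OF j] by auto
        have "A' \<subseteq> interior (B i)" if "Suc n < N i" for i
        proof -
          have "interior (B j) \<subseteq> interior (B i)"
            using least [of i] that by (intro interior_mono B_mono) auto
          then show ?thesis using A'(3) by (rule subset_trans [rotated])
        qed
        moreover have "B i \<subseteq> A'" if "N i \<le> Suc n" for i
        proof -
          have "N i \<noteq> Suc n" using False by blast
          then have "B i \<subseteq> A" using that by (intro P(3)) auto
          then show ?thesis using A'(2) interior_subset by blast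
        qed
        ultimately show ?thesis using A' unfolding P_def by blast
      qed
      then show "\<exists>A'. (P (Suc n) A' \<and> (Suc n = 0 \<longrightarrow> A' = A0)) \<and> A \<subseteq> interior A'"
        by simp
    qed
    then show ?thesis by blast
  qed
  then obtain A where A: "\<And>n. P n (A n)" "\<And>n. A n \<subseteq> interior (A (Suc n))" "A 0 = A0"
    by metis
  show ?thesis
  proof
    show "separator X n (A n)" for n using A(1) by (simp add: P_def)
    show "A n \<subseteq> interior (A (Suc n))" for n by (rule A(2))
    have "x \<in> (\<Union>n. interior (A n))" for x
    proof -
      obtain j where j: "norm x \<le> real j" using real_arch_simple by blast
      have "x \<in> interior (B (Suc j))" using NB(2) [of j] j by auto
      moreover have "B (Suc j) \<subseteq> A (N (Suc j))" using A(1) [of "N (Suc j)"] by (simp add: P_def)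
      ultimately show ?thesis using interior_mono by blast
    qed
    then show "(\<Union>n. interior (A n)) = UNIV" by blast
    show "D \<subseteq> interior (A 0)" using A0 A(3) by simp
  qed
qed

end

section \<open>Runge approximation with interpolation\<close>

definition poly_approximable :: "complex set \<Rightarrow> (complex \<Rightarrow> complex) \<Rightarrow> bool" where
  "poly_approximable K h \<longleftrightarrow> (\<forall>\<epsilon>>0. \<exists>p. \<forall>z\<in>K. norm (h z - poly p z) < \<epsilon>)"

lemma poly_approximableD:
  assumes "poly_approximable K h" "\<epsilon> > 0"
  obtains p where "\<And>z. z \<in> K \<Longrightarrow> norm (h z - poly p z) < \<epsilon>"
  using assms unfolding poly_approximable_def by blast

lemma poly_approximable_poly: "poly_approximable K (poly p)"
  unfolding poly_approximable_def by (intro allI impI exI [of _ p]) simp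

lemma poly_approximable_const: "poly_approximable K (\<lambda>z. c)"
proof -
  have "poly [:c:] = (\<lambda>z. c)" by auto
  then show ?thesis using poly_approximable_poly [of K "[:c:]"] by simp
qed

lemma poly_approximable_limit:
  assumes "\<And>\<epsilon>. \<epsilon> > 0 \<Longrightarrow> \<exists>g. poly_approximable K g \<and> (\<forall>z\<in>K. norm (h z - g z) \<le> \<epsilon>)"
  shows "poly_approximable K h"
  unfolding poly_approximable_def
proof (intro allI impI)
  fix \<epsilon> :: real assume "\<epsilon> > 0"
  then obtain g where g: "poly_approximable K g" "\<forall>z\<in>K. norm (h z - g z) \<le> \<epsilon> / 2"
    using assms [of "\<epsilon> / 2"] by auto
  obtain p where p: "\<And>z. z \<in> K \<Longrightarrow> norm (g z - poly p z) < \<epsilon> / 2"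
    using poly_approximableD [OF g(1), of "\<epsilon> / 2"] \<open>\<epsilon> > 0\<close> by auto
  have "norm (h z - poly p z) < \<epsilon>" if "z \<in> K" for z
  proof -
    have "norm (h z - poly p z) \<le> norm (h z - g z) + norm (g z - poly p z)"
      using norm_triangle_ineq [of "h z - g z" "g z - poly p z"] by simp
    then show ?thesis using g(2) p [OF that] that by fastforce
  qed
  then show "\<exists>p. \<forall>z\<in>K. norm (h z - poly p z) < \<epsilon>" by blast
qed

lemma poly_approximable_cong:
  "poly_approximable K g \<Longrightarrow> (\<And>z. z \<in> K \<Longrightarrow> h z = g z) \<Longrightarrow> poly_approximable K h"
  unfolding poly_approximable_def by auto

lemma poly_approximable_add:
  assumes "poly_approximable K g" "poly_approximable K h"
  shows "poly_approximable K (\<lambda>z. g z + h z)"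
  unfolding poly_approximable_def
proof (intro allI impI)
  fix \<epsilon> :: real assume "\<epsilon> > 0"
  obtain p where p: "\<And>z. z \<in> K \<Longrightarrow> norm (g z - poly p z) < \<epsilon> / 2"
    using poly_approximableD [OF assms(1), of "\<epsilon> / 2"] \<open>\<epsilon> > 0\<close> by auto
  obtain q where q: "\<And>z. z \<in> K \<Longrightarrow> norm (h z - poly q z) < \<epsilon> / 2"
    using poly_approximableD [OF assms(2), of "\<epsilon> / 2"] \<open>\<epsilon> > 0\<close> by auto
  have "norm (g z + h z - poly (p + q) z) < \<epsilon>" if "z \<in> K" for z
  proof -
    have "g z + h z - poly (p + q) z = (g z - poly p z) + (h z - poly q z)" by simp
    then have "norm (g z + h z - poly (p + q) z) \<le> norm (g z - poly p z) + norm (h z - poly q z)"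
      by (metis norm_triangle_ineq)
    then show ?thesis using p [OF that] q [OF that] by simp
  qed
  then show "\<exists>p. \<forall>z\<in>K. norm (g z + h z - poly p z) < \<epsilon>" by blast
qed

lemma poly_approximable_bounded:
  assumes "compact K" "poly_approximable K h"
  obtains B where "B > 0" "\<And>z. z \<in> K \<Longrightarrow> norm (h z) \<le> B"
proof -
  obtain p where p: "\<And>z. z \<in> K \<Longrightarrow> norm (h z - poly p z) < 1"
    using poly_approximableD [OF assms(2), of 1] by auto
  have "bounded (poly p ` K)"
    using assms(1) by (intro compact_imp_bounded compact_continuous_image continuous_intros)
  then obtain B where B: "B > 0" "\<And>z. z \<in> K \<Longrightarrow> norm (poly p z) \<le> B"
    unfolding bounded_pos by auto
  have "norm (h z) \<le> B + 1" if "z \<in> K" for z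
    using norm_triangle_ineq [of "h z - poly p z" "poly p z"] p [OF that] B(2) [OF that] by simp
  then show ?thesis using that [of "B + 1"] B(1) by auto
qed

lemma poly_approximable_mult:
  assumes "compact K" "poly_approximable K g" "poly_approximable K h"
  shows "poly_approximable K (\<lambda>z. g z * h z)"
proof (rule poly_approximable_limit)
  fix \<epsilon> :: real assume "\<epsilon> > 0"
  obtain B where B: "B > 0" "\<And>z. z \<in> K \<Longrightarrow> norm (h z) \<le> B"
    using poly_approximable_bounded assms(1,3) by blast
  obtain p where p: "\<And>z. z \<in> K \<Longrightarrow> norm (g z - poly p z) < \<epsilon> / (2 * B)"
    using poly_approximableD [OF assms(2), of "\<epsilon> / (2 * B)"] \<open>\<epsilon> > 0\<close> B by auto
  obtain C where C: "C > 0" "\<And>z. z \<in> K \<Longrightarrow> norm (poly p z) \<le> C"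
    using poly_approximable_bounded [OF assms(1) poly_approximable_poly] by blast
  obtain q where q: "\<And>z. z \<in> K \<Longrightarrow> norm (h z - poly q z) < \<epsilon> / (2 * C)"
    using poly_approximableD [OF assms(3), of "\<epsilon> / (2 * C)"] \<open>\<epsilon> > 0\<close> C by auto
  have "norm (g z * h z - poly (p * q) z) \<le> \<epsilon>" if "z \<in> K" for z
  proof -
    have "g z * h z - poly (p * q) z = (g z - poly p z) * h z + poly p z * (h z - poly q z)"
      by (simp add: algebra_simps)
    then have "norm (g z * h z - poly (p * q) z) \<le> norm (g z - poly p z) * norm (h z) + norm (poly p z) * norm (h z - poly q z)"
      by (metis norm_mult norm_triangle_ineq)
    also have "\<dots> \<le> \<epsilon> / (2 * B) * B + C * (\<epsilon> / (2 * C))"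
      using p [OF that] q [OF that] B C that \<open>\<epsilon> > 0\<close> by (intro add_mono mult_mono) (auto simp: less_imp_le)
    also have "\<dots> = \<epsilon>" using B C by simp
    finally show ?thesis .
  qed
  then show "\<exists>f. poly_approximable K f \<and> (\<forall>z\<in>K. norm (g z * h z - f z) \<le> \<epsilon>)"
    using poly_approximable_poly by blast
qed

lemma poly_approximable_cmult:
  "compact K \<Longrightarrow> poly_approximable K h \<Longrightarrow> poly_approximable K (\<lambda>z. c * h z)"
  by (rule poly_approximable_mult) (auto intro: poly_approximable_const)

lemma poly_approximable_sum:
  "(\<And>i. i \<in> F \<Longrightarrow> poly_approximable K (h i)) \<Longrightarrow> poly_approximable K (\<lambda>z. \<Sum>i\<in>F. h i z)"
  by (induction F rule: infinite_finite_induct) (auto intro: poly_approximable_add poly_approximable_const)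

lemma poly_approximable_power:
  "compact K \<Longrightarrow> poly_approximable K h \<Longrightarrow> poly_approximable K (\<lambda>z. h z ^ n)"
  by (induction n) (auto intro: poly_approximable_mult poly_approximable_const)

text \<open>The partial sums of the geometric series are polynomials in \<open>q\<close>, and the
  bound 1/2 makes their convergence uniform on \<open>K\<close>.\<close>

lemma poly_approximable_geometric:
  assumes "compact K" "poly_approximable K q" "\<And>z. z \<in> K \<Longrightarrow> norm (q z) \<le> 1/2"
  shows "poly_approximable K (\<lambda>z. 1 / (1 - q z))"
proof (rule poly_approximable_limit)
  fix \<epsilon> :: real assume "\<epsilon> > 0"
  obtain n where n: "(1/2) ^ n < \<epsilon> / 2"
    using real_arch_pow_inv [of "\<epsilon> / 2" "1/2"] \<open>\<epsilon> > 0\<close> by auto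
  have "norm (1 / (1 - q z) - (\<Sum>i<n. q z ^ i)) \<le> \<epsilon>" if "z \<in> K" for z
  proof -
    have q: "norm (q z) \<le> 1/2" using assms(3) that .
    then have ne: "1 - q z \<noteq> 0" by (auto simp: right_minus_eq)
    have "norm (1 - q z) \<ge> 1/2" using norm_triangle_ineq2 [of 1 "q z"] q by simp
    have "1 / (1 - q z) - (\<Sum>i<n. q z ^ i) = q z ^ n / (1 - q z)"
      using ne by (simp add: sum_gp_strict divide_simps)
    also have "norm \<dots> \<le> (1/2) ^ n / (1/2)"
      unfolding norm_divide norm_power using q \<open>norm (1 - q z) \<ge> 1/2\<close>
      by (intro frac_le power_mono) auto
    finally show ?thesis using n by simp
  qed
  moreover have "poly_approximable K (\<lambda>z. \<Sum>i<n. q z ^ i)"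
    by (intro poly_approximable_sum poly_approximable_power assms)
  ultimately show "\<exists>g. poly_approximable K g \<and> (\<forall>z\<in>K. norm (1 / (1 - q z) - g z) \<le> \<epsilon>)"
    by blast
qed

text \<open>Pole pushing: the admissible poles form a relatively clopen subset of \<open>- K\<close> that contains all
  points of large modulus.\<close>

lemma poly_approximable_pole:
  assumes "nonseparating K" "w \<notin> K"
  shows "poly_approximable K (\<lambda>z. 1 / (z - w))"
proof (cases "K = {}")
  case True
  then show ?thesis by (simp add: poly_approximable_def)
next
  case False
  have K: "compact K" "connected (- K)" using assms by (auto simp: nonseparating_def)
  define S where "S = {w. w \<notin> K \<and> poly_approximable K (\<lambda>z. 1 / (z - w))}"
  \<comment> \<open>Re-expansion at a nearby pole: \<open>1 / (z - v')\<close> is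
    \<open>1 / (z - v)\<close> times a geometric series with ratio
    \<open>(v' - v) / (z - v)\<close>, which is at most 1/2 on \<open>K\<close> because
    \<open>v'\<close> is within half the distance from \<open>v\<close> to \<open>K\<close>.\<close>
  have move: "v' \<in> S" if v: "v \<in> S" and v': "dist v v' \<le> infdist v K / 2" "v' \<notin> K" for v v'
  proof -
    have vS: "v \<notin> K" "poly_approximable K (\<lambda>z. 1 / (z - v))" using v by (auto simp: S_def)
    have le: "norm ((v' - v) * (1 / (z - v))) \<le> 1/2" if "z \<in> K" for z
    proof -
      have "infdist v K \<le> norm (z - v)" using infdist_le [OF that, of v] by (simp add: dist_norm norm_minus_commute)
      moreover have "norm (v' - v) \<le> infdist v K / 2" using v'(1) by (simp add: dist_norm norm_minus_commute)
      moreover have "norm (z - v) > 0" using that vS by auto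
      ultimately show ?thesis by (simp add: norm_mult norm_divide divide_le_eq)
    qed
    have "poly_approximable K (\<lambda>z. 1 / (z - v) * (1 / (1 - (v' - v) * (1 / (z - v)))))"
      by (intro poly_approximable_mult poly_approximable_geometric poly_approximable_cmult K vS le)
    then have "poly_approximable K (\<lambda>z. 1 / (z - v'))"
    proof (rule poly_approximable_cong)
      fix z assume "z \<in> K"
      then have ne: "z - v \<noteq> 0" "z - v' \<noteq> 0" using vS v'(2) by auto
      then have "1 - (v' - v) * (1 / (z - v)) = (z - v') / (z - v)" by (simp add: field_simps)
      then show "1 / (z - v') = 1 / (z - v) * (1 / (1 - (v' - v) * (1 / (z - v))))"
        using ne by simp
    qed
    then show ?thesis using v'(2) by (simp add: S_def)
  qed
  have pos: "infdist v K > 0" if "v \<notin> K" for v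
    using that False K(1) infdist_pos_not_in_closed compact_imp_closed by blast
  have ball_free: "dist v v' < infdist v K \<Longrightarrow> v' \<notin> K" for v v'
    using infdist_le [of v' K v] by auto
  have "open S"
    unfolding open_contains_ball
  proof
    fix v assume v: "v \<in> S"
    then have "infdist v K > 0" using pos by (auto simp: S_def)
    moreover have "ball v (infdist v K / 2) \<subseteq> S"
      using move [OF v] ball_free [of v] \<open>infdist v K > 0\<close> by auto
    ultimately show "\<exists>e>0. ball v e \<subseteq> S" by (intro exI [of _ "infdist v K / 2"]) auto
  qed
  moreover have "open (- K - S)"
    unfolding open_contains_ball
  proof
    fix v assume v: "v \<in> - K - S"
    then have p: "infdist v K > 0" using pos by auto
    have "v' \<in> - K - S" if "v' \<in> ball v (infdist v K / 4)" for v'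
    proof -
      \<comment> \<open>At a quarter of the distance the roles can be exchanged: \<open>v\<close> is
        within half the distance from \<open>v'\<close> to \<open>K\<close>, so membership of
        \<open>v'\<close> in \<open>S\<close> would pass to \<open>v\<close>.\<close>
      have d: "dist v v' < infdist v K / 4" using that by simp
      have "v' \<notin> K" using ball_free [of v v'] d p by auto
      moreover have "v' \<notin> S"
      proof
        assume "v' \<in> S"
        have "infdist v K \<le> infdist v' K + dist v v'" by (rule infdist_triangle)
        then have "dist v' v \<le> infdist v' K / 2" using d zero_le_dist [of v' v] dist_commute [of v v'] by linarith
        then show False using move [OF \<open>v' \<in> S\<close>] v by auto
      qed
      ultimately show ?thesis by simp
    qed
    then show "\<exists>e>0. ball v e \<subseteq> - K - S" using p by (intro exI [of _ "infdist v K / 4"]) auto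
  qed
  moreover have "S \<noteq> {}"
  proof -
    obtain R where R: "R > 0" "\<And>z. z \<in> K \<Longrightarrow> norm z \<le> R"
      using compact_imp_bounded [OF K(1)] unfolding bounded_pos by auto
    \<comment> \<open>For a pole at twice the radius of \<open>K\<close>, the expansion in powers of
      \<open>z / v\<close> converges with ratio at most 1/2.\<close>
    define v where "v = complex_of_real (2 * R)"
    have nv: "norm v = 2 * R" using R by (simp add: v_def norm_mult)
    then have "v \<notin> K" using R by force
    have "v \<noteq> 0" using nv R by auto
    have "poly_approximable K (\<lambda>z. (- inverse v) * (1 / (1 - inverse v * z)))"
    proof (intro poly_approximable_cmult poly_approximable_geometric K)
      have "poly [:0, 1:] = (\<lambda>z::complex. z)" by auto
      then show "poly_approximable K (\<lambda>z. z)" using poly_approximable_poly [of K "[:0, 1:]"] by simp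
      show "norm (inverse v * z) \<le> 1/2" if "z \<in> K" for z
        using R(1) R(2) [OF that] nv by (simp add: norm_mult norm_inverse norm_divide divide_le_eq) (simp add: field_simps)
    qed
    then have "poly_approximable K (\<lambda>z. 1 / (z - v))"
    proof (rule poly_approximable_cong)
      fix z assume "z \<in> K"
      then have "z - v \<noteq> 0" using \<open>v \<notin> K\<close> by auto
      moreover have "1 - inverse v * z = - inverse v * (z - v)" using \<open>v \<noteq> 0\<close> by (simp add: field_simps)
      ultimately show "1 / (z - v) = (- inverse v) * (1 / (1 - inverse v * z))"
        using \<open>v \<noteq> 0\<close> by simp
    qed
    then show ?thesis using \<open>v \<notin> K\<close> by (auto simp: S_def)
  qed
  moreover have "S \<subseteq> - K" by (auto simp: S_def)
  ultimately have "- K \<subseteq> S"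
    using connectedD [OF K(2), of S "- K - S"] by blast
  then show ?thesis using assms by (auto simp: S_def)
qed

section \<open>Cauchy transforms of segments and Runge's theorem\<close>

lemma riemann_sum_uniform:
  fixes F :: "real \<Rightarrow> complex \<Rightarrow> complex"
  assumes "compact L" "continuous_on ({0..1} \<times> L) (\<lambda>(t, z). F t z)" "\<epsilon> > 0"
  obtains m where "m > 0" "\<And>z. z \<in> L \<Longrightarrow>
     norm (integral {0..1} (\<lambda>t. F t z) - (\<Sum>i<m. F (real i / real m) z / of_nat m)) \<le> \<epsilon>"
proof -
  have "compact ({0..1::real} \<times> L)" using assms(1) by (intro compact_Times) auto
  then have "uniformly_continuous_on ({0..1} \<times> L) (\<lambda>(t, z). F t z)"
    using assms(2) compact_uniformly_continuous by blast
  then obtain d where d: "d > 0" "\<And>x y. x \<in> {0..1} \<times> L \<Longrightarrow> y \<in> {0..1} \<times> L \<Longrightarrow> dist y x < d \<Longrightarrow>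
      dist ((\<lambda>(t, z). F t z) y) ((\<lambda>(t, z). F t z) x) < \<epsilon>"
    unfolding uniformly_continuous_on_def using assms(3) by metis
  obtain m :: nat where m: "m > 0" "1 / real m < d"
    using d(1) by (metis nat_approx_posE inverse_eq_divide zero_less_Suc)
  have "norm (integral {0..1} (\<lambda>t. F t z) - (\<Sum>i<m. F (real i / real m) z / of_nat m)) \<le> \<epsilon>" if z: "z \<in> L" for z
  proof -
    have close: "norm (F s z - F t z) \<le> \<epsilon>" if "s \<in> {0..1}" "t \<in> {0..1}" "\<bar>s - t\<bar> \<le> 1 / real m" for s t
      using d(2) [of "(t, z)" "(s, z)"] that z m(2) by (auto simp: dist_Pair_Pair dist_norm)
    have cont: "continuous_on {0..1} (\<lambda>t. F t z)"
    proof -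
      have "continuous_on {0..1} (\<lambda>t. case (t, z) of (t, z) \<Rightarrow> F t z)"
        by (rule continuous_on_compose2 [OF assms(2)]) (use z in \<open>auto intro!: continuous_on_Pair\<close>)
      then show ?thesis by simp
    qed
    have int: "(\<lambda>t. F t z) integrable_on {a..b}" if "0 \<le> a" "b \<le> 1" for a b
      using cont that by (intro integrable_continuous_real) (auto elim: continuous_on_subset)
    \<comment> \<open>Induction on the number of subintervals: each one contributes at most
      \<epsilon> times its length. The mesh comes from uniform continuity on the compact product and
      so does not depend on \<open>z\<close>.\<close>
    have "norm (integral {0..real j / real m} (\<lambda>t. F t z) - (\<Sum>i<j. F (real i / real m) z / of_nat m)) \<le> \<epsilon> * (real j / real m)"
      if "j \<le> m" for j
      using that
    proof (induction j)
      case (Suc j)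
      let ?a = "real j / real m" and ?b = "real (Suc j) / real m"
      have ab: "0 \<le> ?a" "?a \<le> ?b" "?b \<le> 1" "?b - ?a = 1 / real m"
        using Suc.prems m(1) by (auto simp: divide_simps algebra_simps)
      have "norm (integral {?a..?b} (\<lambda>t. F t z - F ?a z)) \<le> \<epsilon> * (?b - ?a)"
      proof (rule integral_bound)
        show "continuous_on {?a..?b} (\<lambda>t. F t z - F ?a z)"
        proof -
          have "{?a..?b} \<subseteq> {0..1}" using ab by auto
          then show ?thesis by (intro continuous_on_diff continuous_on_subset [OF cont] continuous_on_const)
        qed
        show "norm (F t z - F ?a z) \<le> \<epsilon>" if "t \<in> {?a..?b}" for t
        proof -
          have "?a \<le> t" "t \<le> ?b" using that by auto
          then have "0 \<le> t" "t \<le> 1" "0 \<le> ?a" "?a \<le> 1" "\<bar>t - ?a\<bar> \<le> 1 / real m"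
            using ab by linarith+
          then show ?thesis by (intro close) auto
        qed
      qed (rule ab(2))
      moreover have "integral {?a..?b} (\<lambda>t. F t z - F ?a z) = integral {?a..?b} (\<lambda>t. F t z) - F ?a z / of_nat m"
        using int [of ?a ?b] ab by (subst integral_diff) (auto simp: scaleR_conv_of_real divide_inverse mult.commute)
      ultimately have step: "norm (integral {?a..?b} (\<lambda>t. F t z) - F ?a z / of_nat m) \<le> \<epsilon> * (1 / real m)"
        using ab(4) by simp
      have "integral {0..?b} (\<lambda>t. F t z) = integral {0..?a} (\<lambda>t. F t z) + integral {?a..?b} (\<lambda>t. F t z)"
        using int [of 0 ?b] ab by (intro Henstock_Kurzweil_Integration.integral_combine [symmetric]) auto
      then have "integral {0..?b} (\<lambda>t. F t z) - (\<Sum>i<Suc j. F (real i / real m) z / of_nat m) =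
          (integral {0..?a} (\<lambda>t. F t z) - (\<Sum>i<j. F (real i / real m) z / of_nat m)) + (integral {?a..?b} (\<lambda>t. F t z) - F ?a z / of_nat m)"
        by simp
      also have "norm \<dots> \<le> \<epsilon> * ?a + \<epsilon> * (1 / real m)"
        using Suc step by (intro norm_triangle_mono) auto
      also have "\<dots> = \<epsilon> * ?b" by (simp add: add_divide_distrib algebra_simps)
      finally show ?case .
    qed simp
    from this [of m] show ?thesis using m(1) by simp
  qed
  then show ?thesis using that m(1) by blast
qed

text \<open>The Cauchy transform of the density \<open>c\<close> on a segment, without the factor
  \<open>1 / (2 * pi * \<i>)\<close>.\<close>

definition segment_transform :: "(complex \<Rightarrow> complex) \<Rightarrow> complex \<Rightarrow> complex \<Rightarrow> complex \<Rightarrow> complex" where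
  "segment_transform c a b z = contour_integral (linepath a b) (\<lambda>w. c w / (w - z))"

text \<open>The Riemann sums of the integral are combinations of simple poles on the segment, hence
  off \<open>L\<close>. If \<open>L\<close> does not separate the plane, each of them is
  approximable by pole pushing; their uniform convergence on \<open>L\<close> transfers
  approximability as well as continuity to the transform.\<close>

lemma
  assumes "compact L" "closed_segment a b \<inter> L = {}" "continuous_on (closed_segment a b) c"
  shows segment_transform_approximable: "nonseparating L \<Longrightarrow> poly_approximable L (segment_transform c a b)"
    and segment_transform_continuous: "continuous_on L (segment_transform c a b)"
proof -
  define F where "F t z = c (linepath a b t) / (linepath a b t - z) * (b - a)" for t z
  have in_seg: "linepath a b t \<in> closed_segment a b" if "t \<in> {0..1}" for t
    using that linepath_in_path by blast
  have ne: "linepath a b t - z \<noteq> 0" if "t \<in> {0..1}" "z \<in> L" for t z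
    using in_seg [OF that(1)] that(2) assms(2) by auto
  have eq: "segment_transform c a b z = integral {0..1} (\<lambda>t. F t z)" for z
    unfolding segment_transform_def contour_integral_integral F_def
    by (intro integral_cong) (simp add: vector_derivative_linepath_within)
  have contF: "continuous_on ({0..1} \<times> L) (\<lambda>(t, z). F t z)"
  proof -
    have "continuous_on ({0..1} \<times> L) (\<lambda>x. linepath a b (fst x))"
      by (intro continuous_on_compose2 [OF continuous_on_linepath [of UNIV a b]] continuous_intros) auto
    moreover from this have "continuous_on ({0..1} \<times> L) (\<lambda>x. c (linepath a b (fst x)))"
      using in_seg by (intro continuous_on_compose2 [OF assms(3)]) auto
    ultimately show ?thesis
      unfolding F_def case_prod_unfold using ne by (intro continuous_intros) auto
  qed
  show "poly_approximable L (segment_transform c a b)" if L: "nonseparating L"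
  proof (rule poly_approximable_limit)
    fix \<epsilon> :: real assume "\<epsilon> > 0"
    then obtain m where m: "m > 0" "\<And>z. z \<in> L \<Longrightarrow>
     norm (integral {0..1} (\<lambda>t. F t z) - (\<Sum>i<m. F (real i / real m) z / of_nat m)) \<le> \<epsilon>"
      using riemann_sum_uniform [OF assms(1) contF] by blast
    have "poly_approximable L (\<lambda>z. F (real i / real m) z / of_nat m)" if "i < m" for i
    proof -
      define w where "w = linepath a b (real i / real m)"
      have "w \<notin> L" using in_seg [of "real i / real m"] that assms(2) by (auto simp: w_def)
      then have "poly_approximable L (\<lambda>z. (- c w * (b - a) / of_nat m) * (1 / (z - w)))"
        by (intro poly_approximable_cmult poly_approximable_pole L assms)
      then show ?thesis
      proof (rule poly_approximable_cong)
        fix z assume "z \<in> L"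
        then have "z - w \<noteq> 0" using \<open>w \<notin> L\<close> by auto
        moreover have "w - z = - (z - w)" by simp
        ultimately show "F (real i / real m) z / of_nat m = (- c w * (b - a) / of_nat m) * (1 / (z - w))"
          unfolding F_def w_def [symmetric] by (simp only: divide_minus_right) simp
      qed
    qed
    then have "poly_approximable L (\<lambda>z. \<Sum>i<m. F (real i / real m) z / of_nat m)"
      by (intro poly_approximable_sum) auto
    then show "\<exists>g. poly_approximable L g \<and> (\<forall>z\<in>L. norm (segment_transform c a b z - g z) \<le> \<epsilon>)"
      using m(2) unfolding eq by blast
  qed
  show "continuous_on L (segment_transform c a b)"
  proof (rule uniform_limit_theorem [where F = "at_right (0::real)"])
    \<comment> \<open>The Riemann sums are indexed by their accuracy \<open>e\<close>; the uniform
      limit is taken as \<open>e\<close> tends to 0 from the right.\<close>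
    define m where "m e = (SOME m. m > 0 \<and> (\<forall>z\<in>L. norm (integral {0..1} (\<lambda>t. F t z) - (\<Sum>i<m. F (real i / real m) z / of_nat m)) \<le> e))" for e
    have m: "m e > 0 \<and> (\<forall>z\<in>L. norm (integral {0..1} (\<lambda>t. F t z) - (\<Sum>i<m e. F (real i / real (m e)) z / of_nat (m e))) \<le> e)" if "e > 0" for e
      unfolding m_def by (rule someI_ex) (use riemann_sum_uniform [OF assms(1) contF that] in metis)
    show "uniform_limit L (\<lambda>e z. \<Sum>i<m e. F (real i / real (m e)) z / of_nat (m e)) (segment_transform c a b) (at_right 0)"
    proof (rule uniform_limitI)
      fix e :: real assume "e > 0"
      have "\<forall>\<^sub>F x in at_right 0. x > 0 \<and> x < e"
        using \<open>e > 0\<close> eventually_at_right_real by (auto simp: eventually_at_filter)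
      then show "\<forall>\<^sub>F n in at_right 0. \<forall>x\<in>L. dist (\<Sum>i<m n. F (real i / real (m n)) x / of_nat (m n)) (segment_transform c a b x) < e"
      proof eventually_elim
        case (elim n)
        then show ?case using m [of n] unfolding eq by (auto simp: dist_norm norm_minus_commute intro: le_less_trans)
      qed
    qed
    show "\<forall>\<^sub>F e in at_right 0. continuous_on L (\<lambda>z. \<Sum>i<m e. F (real i / real (m e)) z / of_nat (m e))"
    proof -
      have "continuous_on L (F t)" if "t \<in> {0..1}" for t
      proof -
        have "continuous_on L (\<lambda>z. case (t, z) of (t, z) \<Rightarrow> F t z)"
          by (rule continuous_on_compose2 [OF contF]) (use that in \<open>auto intro!: continuous_on_Pair\<close>)
        then show ?thesis by simp
      qed
      then have "continuous_on L (\<lambda>z. \<Sum>i<m e. F (real i / real (m e)) z / of_nat (m e))" if "e > 0" for e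
        using m [OF that] by (intro continuous_intros) auto
      then show ?thesis by (auto simp: eventually_at_filter)
    qed
  qed auto
qed

lemma segment_transform_reverse:
  assumes "continuous_on (closed_segment a b) c" "z \<notin> closed_segment a b"
  shows "segment_transform c b a z = - segment_transform c a b z"
proof -
  have "continuous_on (closed_segment a b) (\<lambda>w. c w / (w - z))"
    using assms by (intro continuous_intros) auto
  then show ?thesis
    unfolding segment_transform_def by (subst contour_integral_reverse_linepath) (auto simp: closed_segment_commute)
qed

text \<open>Cauchy's integral formula with the upper and the left side traversed in the directions
  of the axes. In a grid, an edge common to two cells then contributes the same transform to both,
  with opposite signs.\<close>

lemma rectangle_transform:
  assumes ab: "Re a < Re b" "Im a < Im b" and hol: "f holomorphic_on cbox a b" and z: "z \<notin> cbox a b - box a b"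
  defines "a2 \<equiv> Complex (Re b) (Im a)" and "a4 \<equiv> Complex (Re a) (Im b)"
  shows "segment_transform f a a2 z + segment_transform f a2 b z - segment_transform f a4 b z - segment_transform f a a4 z
    = (if z \<in> box a b then 2 * of_real pi * \<i> * f z else 0)"
proof -
  let ?g = "\<lambda>w. f w / (w - z)"
  have img: "path_image (rectpath a b) = cbox a b - box a b"
    using ab by (intro path_image_rectpath_cbox_minus_box) auto
  have img': "path_image (rectpath a b) = closed_segment a a2 \<union> closed_segment a2 b \<union> closed_segment b a4 \<union> closed_segment a4 a"
    by (simp add: rectpath_def Let_def path_image_join Un_assoc a2_def a4_def)
  have cont: "continuous_on (cbox a b - box a b) ?g"
    using holomorphic_on_imp_continuous_on [OF hol] z
    by (intro continuous_intros) (auto elim: continuous_on_subset)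
  have cint: "?g contour_integrable_on linepath u v" if "closed_segment u v \<subseteq> cbox a b - box a b" for u v
    using continuous_on_subset [OF cont that] by (rule contour_integrable_continuous_linepath)
  have sub: "closed_segment a a2 \<subseteq> cbox a b - box a b" "closed_segment a2 b \<subseteq> cbox a b - box a b"
    "closed_segment b a4 \<subseteq> cbox a b - box a b" "closed_segment a4 a \<subseteq> cbox a b - box a b"
    using img img' by auto
  have "contour_integral (rectpath a b) ?g =
      segment_transform f a a2 z + (segment_transform f a2 b z + (segment_transform f b a4 z + segment_transform f a4 a z))"
    unfolding rectpath_def Let_def a2_def [symmetric] a4_def [symmetric] segment_transform_def
    using cint [OF sub(1)] cint [OF sub(2)] cint [OF sub(3)] cint [OF sub(4)] by simp
  moreover have "segment_transform f b a4 z = - segment_transform f a4 b z" "segment_transform f a4 a z = - segment_transform f a a4 z"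
    using sub z holomorphic_on_imp_continuous_on [OF hol] closed_segment_commute
    by (intro segment_transform_reverse; fastforce intro: continuous_on_subset)+
  moreover have "contour_integral (rectpath a b) ?g = (if z \<in> box a b then 2 * of_real pi * \<i> * f z else 0)"
  proof (cases "z \<in> box a b")
    case True
    have "(?g has_contour_integral (2 * pi * \<i> * winding_number (rectpath a b) z * f z)) (rectpath a b)"
      using True z hol img by (intro Cauchy_integral_formula_convex_simple [of "cbox a b"]) auto
    moreover have "winding_number (rectpath a b) z = 1"
      using True by (rule winding_number_rectpath)
    ultimately show ?thesis using True by (auto dest: contour_integral_unique)
  next
    case False
    then have "z \<notin> cbox a b" using z by auto
    then have "?g holomorphic_on cbox a b"
      using hol by (intro holomorphic_intros) auto
    then have "(?g has_contour_integral 0) (rectpath a b)"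
      using img by (intro Cauchy_theorem_convex_simple [of _ "cbox a b"]) auto
    then show ?thesis using False by (auto dest: contour_integral_unique)
  qed
  ultimately show ?thesis by simp
qed

text \<open>This carries out the cancellation of common edges: what two index sets share drops out
  of the difference.\<close>

lemma sum_minus_sum_image:
  fixes h :: "'a \<Rightarrow> 'b :: ab_group_add"
  assumes "finite S" "finite T"
  shows "sum h S - sum h T = sum h (S - T) - sum h (T - S)"
proof -
  have "sum h S = sum h (S - T) + sum h (S \<inter> T)" "sum h T = sum h (T - S) + sum h (S \<inter> T)"
    using assms by (subst sum.union_disjoint [symmetric]; auto intro!: arg_cong [of _ _ "sum h"])+
  then show ?thesis by simp
qed

text \<open>In the sum over all cells of a fine square grid that meet a neighbourhood \<open>K'\<close> of \<open>K\<close>, the edges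
  common to two cells cancel, and the remaining edges do not meet \<open>K'\<close>. The formula is valid off
  the grid lines only and extends to \<open>K\<close> by continuity.\<close>

theorem runge:
  assumes K: "nonseparating K" and \<Omega>: "open \<Omega>" "K \<subseteq> \<Omega>" and f: "f holomorphic_on \<Omega>"
  shows "poly_approximable K f"
proof (cases "K = {}")
  case True
  then show ?thesis by (simp add: poly_approximable_def)
next
  case False
  have compK: "compact K" using K by (simp add: nonseparating_def)
  obtain e where e: "e > 0" "(\<Union>x\<in>K. ball x e) \<subseteq> \<Omega>"
    using compact_subset_open_imp_ball_epsilon_subset [OF compK \<Omega>] by blast
  \<comment> \<open>A cell of side \<delta> that meets \<open>K'\<close> stays within
    \<open>3 * \<delta>\<close> of \<open>K\<close>: \<delta> for the width of \<open>K'\<close> and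
    \<open>2 * \<delta>\<close> for the cell. This is less than \<open>e\<close>.\<close>
  define \<delta> where "\<delta> = e / 4"
  have \<delta>: "\<delta> > 0" using e by (simp add: \<delta>_def)
  define K' where "K' = {y. infdist y K \<le> \<delta>}"
  have near: "\<exists>k\<in>K. dist y k \<le> \<delta>" if "y \<in> K'" for y
  proof -
    obtain k where "k \<in> K" "infdist y K = dist y k"
      using infdist_attains_inf [OF compact_imp_closed [OF compK] False] by blast
    then show ?thesis using that by (auto simp: K'_def)
  qed
  obtain R0 where R0: "\<And>z. z \<in> K \<Longrightarrow> norm z \<le> R0"
    using compact_imp_bounded [OF compK] unfolding bounded_iff by auto
  have R: "norm y \<le> R0 + \<delta>" if y: "y \<in> K'" for y
  proof -
    obtain k where "k \<in> K" "dist y k \<le> \<delta>" using near [OF y] by blast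
    then show ?thesis using R0 [of k] norm_triangle_sub [of y k] by (simp add: dist_norm)
  qed
  have "closed K'"
    unfolding K'_def by (intro closed_Collect_le continuous_intros)
  then have compK': "compact K'"
    using R by (auto simp: compact_eq_bounded_closed bounded_iff)
  define P where "P i j = Complex (\<delta> * of_int i) (\<delta> * of_int j)" for i j :: int
  define Q where "Q i j = cbox (P i j) (P (i + 1) (j + 1))" for i j
  define S where "S = {(i, j). Q i j \<inter> K' \<noteq> {}}"
  have Q_iff: "w \<in> Q i j \<longleftrightarrow> \<delta> * of_int i \<le> Re w \<and> Re w \<le> \<delta> * of_int i + \<delta> \<and>
     \<delta> * of_int j \<le> Im w \<and> Im w \<le> \<delta> * of_int j + \<delta>" for w i j
    by (auto simp: Q_def P_def in_cbox_complex_iff algebra_simps)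
  have finS: "finite S"
  proof -
    define N where "N = \<lceil>(R0 + \<delta>) / \<delta>\<rceil> + 1"
    have bd: "i \<in> {- N..N}" if "\<delta> * of_int i \<le> x" "x \<le> \<delta> * of_int i + \<delta>" "\<bar>x\<bar> \<le> R0 + \<delta>" for i :: int and x
    proof -
      have "of_int i \<le> (R0 + \<delta>) / \<delta>" "- (of_int i + 1) \<le> (R0 + \<delta>) / \<delta>"
        using that \<delta> by (simp_all add: le_divide_eq algebra_simps)
      moreover have "(R0 + \<delta>) / \<delta> \<le> of_int \<lceil>(R0 + \<delta>) / \<delta>\<rceil>" by (rule le_of_int_ceiling)
      ultimately have "i \<le> \<lceil>(R0 + \<delta>) / \<delta>\<rceil>" "- (i + 1) \<le> \<lceil>(R0 + \<delta>) / \<delta>\<rceil>"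
        by linarith+
      then show ?thesis unfolding N_def by auto
    qed
    have "S \<subseteq> {- N..N} \<times> {- N..N}"
    proof
      fix x assume "x \<in> S"
      then obtain i j y where x: "x = (i, j)" "y \<in> Q i j" "y \<in> K'" by (auto simp: S_def)
      then show "x \<in> {- N..N} \<times> {- N..N}"
        using bd [of i "Re y"] bd [of j "Im y"] R [OF x(3)] abs_Re_le_cmod [of y] abs_Im_le_cmod [of y]
        by (auto simp: Q_iff)
    qed
    then show ?thesis using finite_subset by blast
  qed
  have Q_sub: "Q i j \<subseteq> \<Omega>" if ij: "(i, j) \<in> S" for i j
  proof
    fix w assume w: "w \<in> Q i j"
    obtain y where y: "y \<in> Q i j" "y \<in> K'" using ij by (auto simp: S_def)
    obtain k where k: "k \<in> K" "dist y k \<le> \<delta>" using near y by blast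
    have "norm (w - y) \<le> \<bar>Re (w - y)\<bar> + \<bar>Im (w - y)\<bar>" by (rule cmod_le)
    also have "\<dots> \<le> \<delta> + \<delta>" using w y by (intro add_mono) (auto simp: Q_iff)
    finally have "dist k w < e" using k dist_triangle [of k w y] \<delta> by (simp add: \<delta>_def dist_norm norm_minus_commute)
    then have "w \<in> ball k e" by simp
    then show "w \<in> \<Omega>" using e(2) k(1) by blast
  qed
  \<comment> \<open>\<open>h\<close> and \<open>v\<close> are the transforms of the horizontal and
    vertical edges that start at a grid node. \<open>S1\<close> and \<open>S2\<close> index the
    upper and right edges of the cells in \<open>S\<close>, so \<open>B\<close> collects the edges
    that do not cancel.\<close>
  define h where "h = (\<lambda>(i, j). segment_transform f (P i j) (P (i + 1) j))"
  define v where "v = (\<lambda>(i, j). segment_transform f (P i j) (P i (j + 1)))"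
  define S1 where "S1 = (\<lambda>(i, j). (i, j + 1)) ` S"
  define S2 where "S2 = (\<lambda>(i, j). (i + 1, j)) ` S"
  define B where "B z = (\<Sum>x\<in>S - S1. h x z) - (\<Sum>x\<in>S1 - S. h x z) + ((\<Sum>x\<in>S2 - S. v x z) - (\<Sum>x\<in>S - S2. v x z))" for z
  have fin12: "finite S1" "finite S2" using finS by (auto simp: S1_def S2_def)
  have B_eq: "B z = (\<Sum>(i, j)\<in>S. h (i, j) z + v (i + 1, j) z - h (i, j + 1) z - v (i, j) z)" for z
  proof -
    have "(\<Sum>x\<in>S1. h x z) = (\<Sum>(i, j)\<in>S. h (i, j + 1) z)"
      unfolding S1_def by (subst sum.reindex) (auto intro: inj_onI simp: case_prod_unfold)
    moreover have "(\<Sum>x\<in>S2. v x z) = (\<Sum>(i, j)\<in>S. v (i + 1, j) z)"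
      unfolding S2_def by (subst sum.reindex) (auto intro: inj_onI simp: case_prod_unfold)
    moreover have "B z = ((\<Sum>x\<in>S. h x z) - (\<Sum>x\<in>S1. h x z)) + ((\<Sum>x\<in>S2. v x z) - (\<Sum>x\<in>S. v x z))"
      unfolding B_def by (simp only: sum_minus_sum_image [OF finS fin12(1)] sum_minus_sum_image [OF fin12(2) finS])
    ultimately show ?thesis
      by (simp add: case_prod_unfold sum.distrib sum_subtractf)
  qed
  \<comment> \<open>Off the grid lines exactly one cell has \<open>z\<close> in its interior, and
    this cell belongs to \<open>S\<close> because \<open>z\<close> lies in
    \<open>K'\<close>.\<close>
  have B_off: "B z = 2 * of_real pi * \<i> * f z" if z: "z \<in> K'" and off: "\<And>k::int. Re z \<noteq> \<delta> * of_int k \<and> Im z \<noteq> \<delta> * of_int k" for z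
  proof -
    define i0 where "i0 = \<lfloor>Re z / \<delta>\<rfloor>"
    define j0 where "j0 = \<lfloor>Im z / \<delta>\<rfloor>"
    have fl: "\<delta> * of_int \<lfloor>x / \<delta>\<rfloor> \<le> x" "x < \<delta> * of_int \<lfloor>x / \<delta>\<rfloor> + \<delta>" for x
      using floor_divide_lower [OF \<delta>, of x] floor_divide_upper [OF \<delta>, of x] by (simp_all add: algebra_simps)
    have zQ: "z \<in> Q i0 j0" using fl [of "Re z"] fl [of "Im z"] by (auto simp: Q_iff i0_def j0_def)
    then have ij0: "(i0, j0) \<in> S" using z by (auto simp: S_def)
    have box_iff: "z \<in> box (P i j) (P (i + 1) (j + 1)) \<longleftrightarrow> (i, j) = (i0, j0)" for i j
    proof
      assume "z \<in> box (P i j) (P (i + 1) (j + 1))"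
      then have "of_int i \<le> Re z / \<delta>" "Re z / \<delta> < of_int i + 1" "of_int j \<le> Im z / \<delta>" "Im z / \<delta> < of_int j + 1"
        using \<delta> by (auto simp: in_box_complex_iff P_def field_simps)
      then show "(i, j) = (i0, j0)" unfolding i0_def j0_def by (simp add: floor_unique)
    next
      assume "(i, j) = (i0, j0)"
      then show "z \<in> box (P i j) (P (i + 1) (j + 1))"
        using zQ off [of i0] off [of "i0 + 1"] off [of j0] off [of "j0 + 1"]
        by (auto simp: in_box_complex_iff P_def Q_iff less_le algebra_simps)
    qed
    have "h (i, j) z + v (i + 1, j) z - h (i, j + 1) z - v (i, j) z = (if (i, j) = (i0, j0) then 2 * of_real pi * \<i> * f z else 0)"
      if ij: "(i, j) \<in> S" for i j
    proof -
      have "z \<notin> cbox (P i j) (P (i + 1) (j + 1)) - box (P i j) (P (i + 1) (j + 1))"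
        using off [of i] off [of "i + 1"] off [of j] off [of "j + 1"]
        by (auto simp: in_box_complex_iff in_cbox_complex_iff P_def less_le)
      moreover have "f holomorphic_on cbox (P i j) (P (i + 1) (j + 1))"
        using Q_sub [OF ij] f holomorphic_on_subset by (auto simp: Q_def)
      ultimately have "segment_transform f (P i j) (P (i + 1) j) z + segment_transform f (P (i + 1) j) (P (i + 1) (j + 1)) z
          - segment_transform f (P i (j + 1)) (P (i + 1) (j + 1)) z - segment_transform f (P i j) (P i (j + 1)) z
          = (if z \<in> box (P i j) (P (i + 1) (j + 1)) then 2 * of_real pi * \<i> * f z else 0)"
        using rectangle_transform [of "P i j" "P (i + 1) (j + 1)" f z] \<delta> by (simp add: P_def)
      then show ?thesis unfolding h_def v_def box_iff by simp
    qed
    then have "B z = (\<Sum>x\<in>S. if x = (i0, j0) then 2 * of_real pi * \<i> * f z else 0)"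
      unfolding B_eq by (intro sum.cong) (auto split: if_splits)
    then show ?thesis using finS ij0 by simp
  qed
  have seg_h: "closed_segment (P i j) (P (i + 1) j) \<subseteq> Q i j \<inter> Q i (j - 1)" for i j
    unfolding Q_def by (intro Int_greatest closed_segment_subset convex_box) (use \<delta> in \<open>auto simp: P_def in_cbox_complex_iff\<close>)
  have seg_v: "closed_segment (P i j) (P i (j + 1)) \<subseteq> Q i j \<inter> Q (i - 1) j" for i j
    unfolding Q_def by (intro Int_greatest closed_segment_subset convex_box) (use \<delta> in \<open>auto simp: P_def in_cbox_complex_iff\<close>)
  \<comment> \<open>An uncancelled edge borders exactly one cell of \<open>S\<close>. The other
    adjacent cell misses \<open>K'\<close>, hence so does the edge, while the cell in
    \<open>S\<close> places it inside \<Omega>.\<close>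
  have hx: "poly_approximable K (h x) \<and> continuous_on K' (h x)" if x: "x \<in> (S - S1) \<union> (S1 - S)" for x
  proof -
    obtain i j where ij: "x = (i, j)" by force
    let ?s = "closed_segment (P i j) (P (i + 1) j)"
    have "(i, j) \<in> S \<and> (i, j - 1) \<notin> S \<or> (i, j) \<notin> S \<and> (i, j - 1) \<in> S"
      using x unfolding ij S1_def by (force simp: image_iff)
    then have "?s \<inter> K' = {}" "?s \<subseteq> \<Omega>"
      using seg_h [of i j] Q_sub [of i j] Q_sub [of i "j - 1"] by (auto simp: S_def)
    moreover have "K \<subseteq> K'" using \<delta> by (auto simp: K'_def)
    moreover have "continuous_on ?s f"
      using \<open>?s \<subseteq> \<Omega>\<close> f holomorphic_on_imp_continuous_on continuous_on_subset by blast
    ultimately show ?thesis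
      unfolding h_def ij using compK compK' K
      by (auto intro!: segment_transform_approximable segment_transform_continuous)
  qed
  have vx: "poly_approximable K (v x) \<and> continuous_on K' (v x)" if x: "x \<in> (S2 - S) \<union> (S - S2)" for x
  proof -
    obtain i j where ij: "x = (i, j)" by force
    let ?s = "closed_segment (P i j) (P i (j + 1))"
    have "(i, j) \<in> S \<and> (i - 1, j) \<notin> S \<or> (i, j) \<notin> S \<and> (i - 1, j) \<in> S"
      using x unfolding ij S2_def by (force simp: image_iff)
    then have "?s \<inter> K' = {}" "?s \<subseteq> \<Omega>"
      using seg_v [of i j] Q_sub [of i j] Q_sub [of "i - 1" j] by (auto simp: S_def)
    moreover have "K \<subseteq> K'" using \<delta> by (auto simp: K'_def)
    moreover have "continuous_on ?s f"
      using \<open>?s \<subseteq> \<Omega>\<close> f holomorphic_on_imp_continuous_on continuous_on_subset by blast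
    ultimately show ?thesis
      unfolding v_def ij using compK compK' K
      by (auto intro!: segment_transform_approximable segment_transform_continuous)
  qed
  have B_approx: "poly_approximable K B"
  proof -
    have "poly_approximable K (\<lambda>z. ((\<Sum>x\<in>S - S1. h x z) + (- 1) * (\<Sum>x\<in>S1 - S. h x z)) + ((\<Sum>x\<in>S2 - S. v x z) + (- 1) * (\<Sum>x\<in>S - S2. v x z)))"
      using hx vx by (intro poly_approximable_add poly_approximable_cmult poly_approximable_sum compK) auto
    then show ?thesis by (rule poly_approximable_cong) (simp add: B_def)
  qed
  have B_cont: "continuous_on K' B"
    unfolding B_def using hx vx by (intro continuous_intros) auto
  have K'_sub: "K' \<subseteq> \<Omega>"
  proof
    fix y assume "y \<in> K'"
    then obtain k where "k \<in> K" "dist y k \<le> \<delta>" using near by blast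
    then have "y \<in> ball k e" using \<delta> by (simp add: \<delta>_def dist_commute)
    then show "y \<in> \<Omega>" using e(2) \<open>k \<in> K\<close> by blast
  qed
  have "B z = 2 * of_real pi * \<i> * f z" if z: "z \<in> K" for z
  proof -
    \<comment> \<open>Approach along the diagonal: both coordinates exceed those of \<open>z\<close>
      by an amount that is eventually smaller than the gap to the next grid line, so these points
      are off the grid even if \<open>z\<close> is on it.\<close>
    define zs where "zs n = z + of_real (1 / real (Suc n)) * (1 + \<i>)" for n
    have lim: "zs \<longlonglongrightarrow> z"
    proof -
      have "(\<lambda>n. z + of_real (1 / real (Suc n)) * (1 + \<i>)) \<longlonglongrightarrow> z + of_real 0 * (1 + \<i>)"
        by (intro tendsto_intros LIMSEQ_Suc [OF lim_1_over_n])
      then show ?thesis by (simp only: zs_def [abs_def] of_real_0 mult_zero_left add_0_right)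
    qed
    have "z \<in> K'" using z \<delta> by (auto simp: K'_def)
    have "\<forall>\<^sub>F n in sequentially. dist (zs n) z < \<delta>"
      using lim \<delta> tendstoD by blast
    then have ev: "\<forall>\<^sub>F n in sequentially. zs n \<in> K'"
    proof eventually_elim
      case (elim n)
      then show ?case using infdist_le [OF z, of "zs n"] by (simp add: K'_def)
    qed
    have off1: "\<forall>\<^sub>F n in sequentially. \<forall>k::int. x + 1 / real (Suc n) \<noteq> \<delta> * of_int k" for x
    proof -
      define d where "d = \<delta> * of_int (\<lfloor>x / \<delta>\<rfloor> + 1) - x"
      have "d > 0" using floor_divide_upper [OF \<delta>, of x] by (simp add: d_def algebra_simps)
      have "\<forall>\<^sub>F n in sequentially. 1 / real (Suc n) < d"
        using LIMSEQ_Suc [OF lim_1_over_n] \<open>d > 0\<close> by (rule order_tendstoD)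
      then show ?thesis
      proof eventually_elim
        case (elim n)
        show ?case
        proof (intro allI notI)
          fix k :: int assume k: "x + 1 / real (Suc n) = \<delta> * of_int k"
          have "1 / real (Suc n) > 0" by simp
          then have "x < \<delta> * of_int k" "\<delta> * of_int k < \<delta> * of_int (\<lfloor>x / \<delta>\<rfloor> + 1)" using k elim unfolding d_def by linarith+
          then have "x / \<delta> < of_int k" "real_of_int k < of_int (\<lfloor>x / \<delta>\<rfloor> + 1)"
            using \<delta> mult_less_cancel_left_pos [OF \<delta>] by (simp_all add: divide_less_eq mult.commute)
          then have "k \<le> \<lfloor>x / \<delta>\<rfloor>" by (simp only: of_int_less_iff)
          then show False using \<open>x / \<delta> < of_int k\<close> by (simp add: le_floor_iff)
        qed
      qed
    qed
    have "\<forall>\<^sub>F n in sequentially. B (zs n) = 2 * of_real pi * \<i> * f (zs n)"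
      using ev off1 [of "Re z"] off1 [of "Im z"]
    proof eventually_elim
      case (elim n)
      then show ?case by (intro B_off) (auto simp: zs_def)
    qed
    moreover have "(\<lambda>n. B (zs n)) \<longlonglongrightarrow> B z"
      by (rule continuous_on_tendsto_compose [OF B_cont lim \<open>z \<in> K'\<close> ev])
    ultimately have "(\<lambda>n. 2 * of_real pi * \<i> * f (zs n)) \<longlonglongrightarrow> B z"
      by (rule Lim_transform_eventually [rotated])
    moreover have "(\<lambda>n. 2 * of_real pi * \<i> * f (zs n)) \<longlonglongrightarrow> 2 * of_real pi * \<i> * f z"
      using continuous_on_subset [OF holomorphic_on_imp_continuous_on [OF f] K'_sub]
      by (intro tendsto_intros continuous_on_tendsto_compose [OF _ lim \<open>z \<in> K'\<close> ev])
    ultimately show ?thesis by (rule LIMSEQ_unique)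
  qed
  moreover define c where "c = 2 * of_real pi * \<i>"
  ultimately have Bc: "\<And>z. z \<in> K \<Longrightarrow> B z = c * f z" by blast
  have "c \<noteq> 0" by (simp add: c_def)
  have "poly_approximable K (\<lambda>z. inverse c * B z)"
    by (intro poly_approximable_cmult compK B_approx)
  then show ?thesis
    by (rule poly_approximable_cong) (simp add: Bc \<open>c \<noteq> 0\<close>)
qed

section \<open>Hermite interpolation in Runge's theorem\<close>

definition interpolatory :: "complex set \<Rightarrow> complex poly \<Rightarrow> bool" where
  "interpolatory \<Omega> P \<longleftrightarrow> (\<forall>f. f holomorphic_on \<Omega> \<longrightarrow>
     (\<exists>g t. t holomorphic_on \<Omega> \<and> (\<forall>z\<in>\<Omega>. f z = poly g z + poly P z * t z)))"

text \<open>One Newton step: the quotient \<open>t\<close> is replaced by its difference quotient at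
  \<open>c\<close>, and the value \<open>t c\<close> moves into the polynomial part. If
  \<open>c\<close> is outside \<Omega>, \<open>t c\<close> is some constant and the identity remains
  valid.\<close>

lemma interpolatory_mult_linear:
  assumes "open \<Omega>" "interpolatory \<Omega> P"
  shows "interpolatory \<Omega> (P * [:- c, 1:])"
  unfolding interpolatory_def
proof (intro allI impI)
  fix f assume "f holomorphic_on \<Omega>"
  then obtain g t where g: "t holomorphic_on \<Omega>" "\<And>z. z \<in> \<Omega> \<Longrightarrow> f z = poly g z + poly P z * t z"
    using assms(2) unfolding interpolatory_def by blast
  define s where "s z = (if z = c then deriv t c else (t z - t c) / (z - c))" for z
  have "s holomorphic_on \<Omega>"
    unfolding s_def using pole_lemma_open [OF g(1) assms(1)] by simp
  moreover have t: "t z = t c + (z - c) * s z" for z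
    by (simp add: s_def)
  have "f z = poly (g + smult (t c) P) z + poly (P * [:- c, 1:]) z * s z" if "z \<in> \<Omega>" for z
    unfolding g(2) [OF that] by (subst t) (simp add: algebra_simps)
  ultimately show "\<exists>g t. t holomorphic_on \<Omega> \<and> (\<forall>z\<in>\<Omega>. f z = poly g z + poly (P * [:- c, 1:]) z * t z)"
    by blast
qed

definition marking_poly :: "complex set \<Rightarrow> nat \<Rightarrow> complex poly" where
  "marking_poly M a = (\<Prod>c\<in>M. [:- c, 1:] ^ a)"

lemma interpolatory_marking:
  assumes "open \<Omega>"
  shows "interpolatory \<Omega> (marking_poly M a)"
proof -
  have pow: "interpolatory \<Omega> (P * [:- c, 1:] ^ n)" if "interpolatory \<Omega> P" for P c n
  proof (induction n)
    case (Suc n)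
    then show ?case using interpolatory_mult_linear [OF assms Suc, of c] by (simp add: mult_ac)
  qed (use that in simp)
  have one: "interpolatory \<Omega> 1"
    unfolding interpolatory_def by (intro allI impI) (auto intro!: exI [of _ 0])
  show ?thesis
    unfolding marking_poly_def
  proof (induction M rule: infinite_finite_induct)
    case (insert x F)
    then show ?case using pow [OF insert.IH, of x a] by (simp add: mult.commute)
  qed (use one in auto)
qed

text \<open>Runge's theorem is applied to the quotient \<open>t\<close> instead of \<open>f\<close>;
  the error then carries the marking polynomial as a factor.\<close>

theorem runge_hermite:
  assumes "nonseparating K" "open \<Omega>" "K \<subseteq> \<Omega>" "f holomorphic_on \<Omega>" "\<epsilon> > 0"
  obtains p where "\<And>z. z \<in> K \<Longrightarrow> norm (poly p z - f z) \<le> \<epsilon> * norm (poly (marking_poly M a) z)"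
proof -
  let ?P = "marking_poly M a"
  obtain g t where g: "t holomorphic_on \<Omega>" "\<And>z. z \<in> \<Omega> \<Longrightarrow> f z = poly g z + poly ?P z * t z"
    using interpolatory_marking [OF assms(2), of M a] assms(4) unfolding interpolatory_def by blast
  obtain r where r: "\<And>z. z \<in> K \<Longrightarrow> norm (t z - poly r z) < \<epsilon>"
    using poly_approximableD [OF runge [OF assms(1-3) g(1)] assms(5)] by blast
  show ?thesis
  proof (rule that [of "g + ?P * r"])
    fix z assume z: "z \<in> K"
    then have "poly (g + ?P * r) z - f z = - (poly ?P z * (t z - poly r z))"
      using g(2) [of z] assms(3) by (auto simp: algebra_simps)
    then have "norm (poly (g + ?P * r) z - f z) = norm (poly ?P z) * norm (t z - poly r z)"
      by (simp add: norm_mult)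
    also have "\<dots> \<le> norm (poly ?P z) * \<epsilon>"
      using r [OF z] by (intro mult_left_mono) auto
    finally show "norm (poly (g + ?P * r) z - f z) \<le> \<epsilon> * norm (poly ?P z)"
      by (simp add: mult.commute)
  qed
qed

section \<open>Smooth maps of the plane\<close>

abbreviation dird :: "(complex \<Rightarrow> complex) \<Rightarrow> complex \<Rightarrow> complex \<Rightarrow> complex" where
  "dird f v \<equiv> (\<lambda>z. frechet_derivative f (at z) v)"

lemma times_differentiable_SucI:
  assumes "\<And>z. (f has_derivative (\<lambda>v. D v z)) (at z)" "\<And>v. times_differentiable k (D v)"
  shows "times_differentiable (Suc k) f"
proof -
  have "frechet_derivative f (at z) = (\<lambda>v. D v z)" for z
    using frechet_derivative_at [OF assms(1)] by simp
  then have "dird f v = D v" for v by auto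
  then show ?thesis using assms by (auto simp: differentiable_def)
qed

lemma times_differentiable_has_derivative:
  "times_differentiable (Suc k) f \<Longrightarrow> (f has_derivative (\<lambda>v. dird f v z)) (at z)"
  using frechet_derivative_works by auto

lemma dird_eqI: "(f has_derivative (\<lambda>v. D v)) (at z) \<Longrightarrow> dird f v z = D v"
  using frechet_derivative_at by metis

lemma times_differentiable_continuous:
  "times_differentiable k f \<Longrightarrow> continuous_on UNIV f"
  by (cases k) (auto simp: continuous_on_eq_continuous_at differentiable_imp_continuous_within)

lemma times_differentiable_Suc_imp: "times_differentiable (Suc k) f \<Longrightarrow> times_differentiable k f"
proof (induction k arbitrary: f)
  case 0
  then show ?case by (auto simp: continuous_on_eq_continuous_at differentiable_imp_continuous_within)
next
  case (Suc k)
  then show ?case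
    using times_differentiable.simps(2) by blast
qed

lemma times_differentiable_const: "times_differentiable k (\<lambda>z. c)"
proof (induction k arbitrary: c)
  case (Suc k)
  show ?case
    by (rule times_differentiable_SucI [where D = "\<lambda>v z. 0"]) (auto simp: Suc)
qed auto

lemma times_differentiable_bounded_linear:
  assumes "bounded_linear L"
  shows "times_differentiable k L"
proof (cases k)
  case 0
  then show ?thesis using assms by (simp add: linear_continuous_on)
next
  case (Suc j)
  show ?thesis unfolding Suc
    by (rule times_differentiable_SucI [where D = "\<lambda>v z. L v"])
       (use assms times_differentiable_const bounded_linear_imp_has_derivative in auto)
qed

lemma times_differentiable_add:
  "times_differentiable k f \<Longrightarrow> times_differentiable k g \<Longrightarrow> times_differentiable k (\<lambda>z. f z + g z)"
proof (induction k arbitrary: f g)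
  case 0
  then show ?case by (auto intro: continuous_on_add)
next
  case (Suc k)
  show ?case
    by (rule times_differentiable_SucI [where D = "\<lambda>v z. dird f v z + dird g v z"])
       (use Suc in \<open>auto intro!: has_derivative_add times_differentiable_has_derivative\<close>)
qed

lemma times_differentiable_mult:
  "times_differentiable k f \<Longrightarrow> times_differentiable k g \<Longrightarrow> times_differentiable k (\<lambda>z. f z * g z)"
proof (induction k arbitrary: f g)
  case 0
  then show ?case by (auto intro: continuous_on_mult)
next
  case (Suc k)
  note d = times_differentiable_Suc_imp [OF Suc.prems(1)] times_differentiable_Suc_imp [OF Suc.prems(2)]
  show ?case
  proof (rule times_differentiable_SucI [where D = "\<lambda>v z. f z * dird g v z + dird f v z * g z"])
    show "((\<lambda>z. f z * g z) has_derivative (\<lambda>v. f z * dird g v z + dird f v z * g z)) (at z)" for z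
      using Suc.prems times_differentiable_has_derivative by (intro has_derivative_mult) auto
    show "times_differentiable k (\<lambda>z. f z * dird g v z + dird f v z * g z)" for v
      using Suc d by (intro times_differentiable_add Suc.IH) auto
  qed
qed

lemma times_differentiable_cmult:
  "times_differentiable k f \<Longrightarrow> times_differentiable k (\<lambda>z. c * f z)"
  by (intro times_differentiable_mult times_differentiable_const)

lemma times_differentiable_diff:
  "times_differentiable k f \<Longrightarrow> times_differentiable k g \<Longrightarrow> times_differentiable k (\<lambda>z. f z - g z)"
  using times_differentiable_add [of k f "\<lambda>z. -1 * g z"] times_differentiable_cmult [of k g "-1"] by simp

lemma times_differentiable_sum:
  "(\<And>i. i \<in> F \<Longrightarrow> times_differentiable k (f i)) \<Longrightarrow> times_differentiable k (\<lambda>z. \<Sum>i\<in>F. f i z)"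
  by (induction F rule: infinite_finite_induct)
     (auto intro: times_differentiable_add times_differentiable_const)

lemma times_differentiable_prod:
  "(\<And>i. i \<in> F \<Longrightarrow> times_differentiable k (f i)) \<Longrightarrow> times_differentiable k (\<lambda>z. \<Prod>i\<in>F. f i z)"
  by (induction F rule: infinite_finite_induct)
     (auto intro: times_differentiable_mult times_differentiable_const)

lemma linear_complex_expand:
  fixes L :: "complex \<Rightarrow> complex"
  assumes "linear L"
  shows "L w = of_real (Re w) * L 1 + of_real (Im w) * L \<i>"
proof -
  have "w = Re w *\<^sub>R 1 + Im w *\<^sub>R \<i>" by (simp add: complex_eq_iff)
  then have "L w = L (Re w *\<^sub>R 1 + Im w *\<^sub>R \<i>)" by simp
  also have "\<dots> = Re w *\<^sub>R L 1 + Im w *\<^sub>R L \<i>"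
    using assms by (simp add: linear_add linear_cmul)
  finally show ?thesis by (simp add: scaleR_conv_of_real)
qed

lemma times_differentiable_linear_image:
  assumes "bounded_linear L"
  shows "times_differentiable k f \<Longrightarrow> times_differentiable k (\<lambda>z. L (f z))"
proof (induction k arbitrary: f)
  case 0
  then show ?case using assms by (auto intro: bounded_linear.continuous_on)
next
  case (Suc k)
  show ?case
  proof (rule times_differentiable_SucI [where D = "\<lambda>v z. L (dird f v z)"])
    show "((\<lambda>z. L (f z)) has_derivative (\<lambda>v. L (dird f v z))) (at z)" for z
      by (rule bounded_linear.has_derivative [OF assms times_differentiable_has_derivative [OF Suc.prems]])
    show "times_differentiable k (\<lambda>z. L (dird f v z))" for v
      by (rule Suc.IH) (use Suc.prems in simp)
  qed
qed

lemma bounded_linear_of_Re: "bounded_linear (\<lambda>z. of_real (Re z) :: complex)"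
  by (intro bounded_linear_compose [OF bounded_linear_of_real] bounded_linear_Re)

lemma bounded_linear_of_Im: "bounded_linear (\<lambda>z. of_real (Im z) :: complex)"
  by (intro bounded_linear_compose [OF bounded_linear_of_real] bounded_linear_Im)

text \<open>In the chain rule the direction \<open>dird g v z\<close> varies with the point.
  Expanding the real linear derivative of \<open>f\<close> in the basis 1, \<open>\<i>\<close> turns
  the rule into a sum of products of functions to which the induction hypothesis applies.\<close>

lemma times_differentiable_compose:
  "times_differentiable k f \<Longrightarrow> times_differentiable k g \<Longrightarrow> times_differentiable k (\<lambda>z. f (g z))"
proof (induction k arbitrary: f g)
  case 0
  then show ?case
    by (auto intro: continuous_on_compose2 [of UNIV f UNIV g])
next
  case (Suc k)
  note d = times_differentiable_Suc_imp [OF Suc.prems(2)]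
  let ?D = "\<lambda>v z. of_real (Re (dird g v z)) * dird f 1 (g z) + of_real (Im (dird g v z)) * dird f \<i> (g z)"
  show ?case
  proof (rule times_differentiable_SucI [where D = ?D])
    fix z
    have "((\<lambda>z. f (g z)) has_derivative (\<lambda>v. dird f (dird g v z) (g z))) (at z)"
      by (rule has_derivative_compose [OF times_differentiable_has_derivative [OF Suc.prems(2)]
            times_differentiable_has_derivative [OF Suc.prems(1)]])
    moreover have "dird f w (g z) = of_real (Re w) * dird f 1 (g z) + of_real (Im w) * dird f \<i> (g z)" for w
      using Suc.prems(1) linear_complex_expand [OF linear_frechet_derivative, of f "at (g z)" w] by simp
    then have "(\<lambda>v. dird f (dird g v z) (g z)) = (\<lambda>v. ?D v z)" by (rule ext)
    ultimately show "((\<lambda>z. f (g z)) has_derivative (\<lambda>v. ?D v z)) (at z)" by (rule back_subst)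
  next
    fix v
    have "times_differentiable k (\<lambda>z. dird f w (g z))" for w
      by (rule Suc.IH [of "dird f w" g]) (use Suc.prems d in auto)
    moreover have "times_differentiable k (dird g v)"
      using Suc.prems(2) by simp
    ultimately show "times_differentiable k (?D v)"
      by (intro times_differentiable_add times_differentiable_mult
        times_differentiable_linear_image [OF bounded_linear_of_Re]
        times_differentiable_linear_image [OF bounded_linear_of_Im])
  qed
qed

lemma times_differentiable_inverse:
  assumes "\<And>z. f z \<noteq> 0"
  shows "times_differentiable k f \<Longrightarrow> times_differentiable k (\<lambda>z. inverse (f z))"
proof (induction k)
  case 0
  then show ?case using assms by (auto intro: continuous_on_inverse)
next
  case (Suc k)
  note d = Suc.IH [OF times_differentiable_Suc_imp [OF Suc.prems]]
  show ?case
  proof (rule times_differentiable_SucI [where D = "\<lambda>v z. (-1) * (inverse (f z) * dird f v z * inverse (f z))"])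
    show "((\<lambda>z. inverse (f z)) has_derivative (\<lambda>v. (-1) * (inverse (f z) * dird f v z * inverse (f z)))) (at z)" for z
      using Deriv.has_derivative_inverse [OF assms times_differentiable_has_derivative [OF Suc.prems]] by simp
    show "times_differentiable k (\<lambda>z. (-1) * (inverse (f z) * dird f v z * inverse (f z)))" for v
      using Suc d by (intro times_differentiable_mult times_differentiable_const) auto
  qed
qed

section \<open>Flat functions, bumps and cut-offs\<close>

definition smooth :: "(complex \<Rightarrow> complex) \<Rightarrow> bool" where
  "smooth f \<longleftrightarrow> (\<forall>k. times_differentiable k f)"

lemma smooth_has_derivative: "smooth f \<Longrightarrow> (f has_derivative (\<lambda>v. dird f v z)) (at z)"
  unfolding smooth_def by (rule times_differentiable_has_derivative) blast

lemma smooth_linear: "smooth f \<Longrightarrow> linear (\<lambda>v. dird f v z)"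
  using smooth_has_derivative has_derivative_linear by blast

lemma smooth_dird: "smooth f \<Longrightarrow> smooth (dird f v)"
  unfolding smooth_def using times_differentiable.simps(2) by blast

text \<open>The classical flat function; admitting division by powers of \<open>x\<close> makes the
  linear span of the family closed under differentiation.\<close>

definition flat_exp :: "nat \<Rightarrow> real \<Rightarrow> real" where
  "flat_exp m x = (if x > 0 then exp (- 1 / x) / x ^ m else 0)"

text \<open>The bound \<open>(1 + 1 / (n * x)) ^ n \<le> exp (1 / x)\<close> is used with
  \<open>n = m + 2\<close>: the two powers of \<open>x\<close> left over after division by
  \<open>x ^ m\<close> make the derivative at 0 vanish.\<close>

lemma flat_exp_le: "\<bar>flat_exp m x\<bar> \<le> real (m + 2) ^ (m + 2) * x\<^sup>2"
proof (cases "x > 0")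
  case True
  define n where "n = m + 2"
  have n: "n > 0" by (simp add: n_def)
  have "(1 / (real n * x)) ^ n \<le> (1 + (1 / x) / real n) ^ n"
    using True n by (intro power_mono) (auto simp: field_simps)
  also have "\<dots> \<le> exp (1 / x)"
    using True n by (intro exp_ge_one_plus_x_over_n_power_n) (auto intro: order_trans [of _ 0])
  finally have "exp (- 1 / x) \<le> (real n * x) ^ n"
    using True n by (simp add: exp_minus field_simps power_divide)
  also have "\<dots> = (real n ^ n * x\<^sup>2) * x ^ m"
    by (simp add: n_def power_mult_distrib power_add power2_eq_square)
  finally have "exp (- 1 / x) / x ^ m \<le> real n ^ n * x\<^sup>2"
    using True by (simp add: divide_le_eq)
  then show ?thesis using True by (simp add: flat_exp_def n_def)
qed (simp add: flat_exp_def)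

lemma flat_exp_DERIV:
  "(flat_exp m has_real_derivative (flat_exp (m + 2) x - real m * flat_exp (m + 1) x)) (at x)"
proof -
  consider "x > 0" | "x < 0" | "x = 0" by linarith
  then show ?thesis
  proof cases
    case 1
    have "((\<lambda>x. exp (- 1 / x) / x ^ m) has_real_derivative
            (flat_exp (m + 2) x - real m * flat_exp (m + 1) x)) (at x)"
    proof -
      have "((\<lambda>x. exp (- 1 / x)) has_real_derivative exp (- 1 / x) / x\<^sup>2) (at x)"
        using 1 by (auto intro!: derivative_eq_intros simp: power2_eq_square)
      from DERIV_divide [OF this DERIV_pow [of m x]] 1
      have "((\<lambda>x. exp (- 1 / x) / x ^ m) has_real_derivative
          (exp (- 1 / x) / x\<^sup>2 * x ^ m - exp (- 1 / x) * (real m * x ^ (m - Suc 0))) / (x ^ m * x ^ m)) (at x)"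
        by simp
      moreover have "(exp (- 1 / x) / x\<^sup>2 * x ^ m - exp (- 1 / x) * (real m * x ^ (m - Suc 0))) / (x ^ m * x ^ m)
          = flat_exp (m + 2) x - real m * flat_exp (m + 1) x"
      proof (cases m)
        case (Suc j)
        have "x \<noteq> 0" using 1 by simp
        then show ?thesis using 1 unfolding flat_exp_def Suc
          by (simp add: divide_simps) (simp add: algebra_simps power2_eq_square)
      qed (use 1 in \<open>simp add: flat_exp_def power2_eq_square\<close>)
      ultimately show ?thesis by simp
    qed
    then show ?thesis
      by (rule has_field_derivative_transform_within_open [of _ _ _ "{0<..}"]) (use 1 in \<open>auto simp: flat_exp_def\<close>)
  next
    case 2
    have "((\<lambda>x. 0) has_real_derivative (flat_exp (m + 2) x - real m * flat_exp (m + 1) x)) (at x)"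
      using 2 by (auto simp: flat_exp_def)
    then show ?thesis
      by (rule has_field_derivative_transform_within_open [of _ _ _ "{..<0}"]) (use 2 in \<open>auto simp: flat_exp_def\<close>)
  next
    case 3
    define C where "C = real (m + 2) ^ (m + 2)"
    have "(\<lambda>h. flat_exp m h / h) \<midarrow>0\<rightarrow> 0"
    proof (rule Lim_null_comparison)
      show "\<forall>\<^sub>F h in at 0. norm (flat_exp m h / h) \<le> C * \<bar>h\<bar>"
        unfolding eventually_at_filter
      proof (intro always_eventually allI impI)
        fix h :: real assume "h \<noteq> 0"
        then show "norm (flat_exp m h / h) \<le> C * \<bar>h\<bar>"
          using flat_exp_le [of m h]
          by (simp add: C_def divide_le_eq power2_eq_square abs_mult [symmetric] mult.assoc)
      qed
      show "((\<lambda>h. C * \<bar>h\<bar>) \<longlongrightarrow> 0) (at 0)" by (auto intro!: tendsto_eq_intros)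
    qed
    then show ?thesis using 3 by (simp add: DERIV_def flat_exp_def)
  qed
qed

lemma smooth_flat_exp: "times_differentiable k (\<lambda>z. of_real (flat_exp m (Re z)))"
proof (induction k arbitrary: m)
  case 0
  have "isCont (flat_exp m) x" for x
    using flat_exp_DERIV DERIV_isCont by blast
  then have "continuous_on UNIV (flat_exp m)" by (simp add: continuous_on_eq_continuous_at)
  then show ?case
    by (auto intro!: continuous_intros continuous_on_compose2 [of UNIV "flat_exp m" UNIV Re])
next
  case (Suc k)
  let ?D = "\<lambda>v z. of_real (Re v) * (of_real (flat_exp (m + 2) (Re z)) - of_real (real m) * of_real (flat_exp (m + 1) (Re z)))"
  show ?case
  proof (rule times_differentiable_SucI [where D = ?D])
    fix z
    have "((\<lambda>z. flat_exp m (Re z)) has_derivative (\<lambda>v. (flat_exp (m + 2) (Re z) - real m * flat_exp (m + 1) (Re z)) * Re v)) (at z)"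
      using has_derivative_compose [OF bounded_linear_imp_has_derivative [OF bounded_linear_Re]
        flat_exp_DERIV [unfolded has_field_derivative_def]] by simp
    from has_derivative_of_real [OF this]
    show "((\<lambda>z. complex_of_real (flat_exp m (Re z))) has_derivative (\<lambda>v. ?D v z)) (at z)"
      by (simp add: mult.commute)
  next
    show "times_differentiable k (?D v)" for v
      by (intro times_differentiable_mult times_differentiable_const times_differentiable_diff Suc)
  qed
qed

text \<open>The inner flat function is 0 on the disc of radius \<open>r\<close> and at least its
  value at 1 outside the disc of radius \<open>2 * r\<close>. The outer one, after normalization,
  converts this into 1 and 0. Using the square of the modulus keeps the function smooth at
  \<open>a\<close>.\<close>

definition bump :: "complex \<Rightarrow> real \<Rightarrow> complex \<Rightarrow> complex" where
  "bump a r z = of_real (flat_exp 0 (flat_exp 0 1 - flat_exp 0 ((norm (z - a))\<^sup>2 / r\<^sup>2 - 1)) / flat_exp 0 (flat_exp 0 1))"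

lemma smooth_bump: "times_differentiable k (bump a r)"
proof -
  let ?q = "\<lambda>z. (z - a) * cnj (z - a) * of_real (inverse (r\<^sup>2)) - 1"
  let ?E = "\<lambda>z. complex_of_real (flat_exp 0 (Re z))"
  have "times_differentiable k (\<lambda>z. z - a)"
    by (rule times_differentiable_diff [OF times_differentiable_bounded_linear [OF bounded_linear_ident] times_differentiable_const])
  then have q: "times_differentiable k ?q"
    by (intro times_differentiable_diff [of k "\<lambda>z. (z - a) * cnj (z - a) * of_real (inverse (r\<^sup>2))"]
      times_differentiable_mult times_differentiable_const times_differentiable_linear_image [OF bounded_linear_cnj])
  have "times_differentiable k (\<lambda>z. inverse (of_real (flat_exp 0 (flat_exp 0 1))) * ?E (of_real (flat_exp 0 1) - ?E (?q z)))"
    by (intro times_differentiable_cmult times_differentiable_compose [OF smooth_flat_exp]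
      times_differentiable_diff times_differentiable_const q)
  moreover have "bump a r = (\<lambda>z. inverse (of_real (flat_exp 0 (flat_exp 0 1))) * ?E (of_real (flat_exp 0 1) - ?E (?q z)))"
  proof
    fix z
    have "(z - a) * cnj (z - a) * of_real (inverse (r\<^sup>2)) - 1 = of_real ((norm (z - a))\<^sup>2 / r\<^sup>2 - 1)"
      by (simp only: complex_norm_square [symmetric] divide_inverse) simp
    then have "Re (?q z) = (norm (z - a))\<^sup>2 / r\<^sup>2 - 1" by (simp only: Re_complex_of_real)
    then show "bump a r z = inverse (of_real (flat_exp 0 (flat_exp 0 1))) * ?E (of_real (flat_exp 0 1) - ?E (?q z))"
      by (simp add: bump_def divide_inverse mult.commute)
  qed
  ultimately show ?thesis by simp
qed

lemma bump_eq_1: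
  assumes "r > 0" "z \<in> cball a r"
  shows "bump a r z = 1"
proof -
  have "(norm (z - a))\<^sup>2 \<le> r\<^sup>2" using assms by (intro power_mono) (auto simp: dist_norm norm_minus_commute)
  then have "(norm (z - a))\<^sup>2 / r\<^sup>2 - 1 \<le> 0" using assms by (simp add: divide_le_eq)
  then show ?thesis by (simp add: bump_def flat_exp_def)
qed

lemma bump_eq_0:
  assumes "r > 0" "z \<notin> cball a (2 * r)"
  shows "bump a r z = 0"
proof -
  have "(2 * r)\<^sup>2 \<le> (norm (z - a))\<^sup>2" using assms by (intro power_mono) (auto simp: dist_norm norm_minus_commute)
  then have "4 * r\<^sup>2 \<le> (norm (z - a))\<^sup>2" by (simp add: power_mult_distrib)
  then have "4 \<le> (norm (z - a))\<^sup>2 / r\<^sup>2" using assms(1) by (simp add: le_divide_eq)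
  then have le: "2 \<le> (norm (z - a))\<^sup>2 / r\<^sup>2" by simp
  define y where "y = (norm (z - a))\<^sup>2 / r\<^sup>2 - 1"
  have "y \<ge> 1" using le by (simp add: y_def)
  then have "flat_exp 0 1 \<le> flat_exp 0 y" by (simp add: flat_exp_def divide_le_eq)
  then show ?thesis unfolding bump_def y_def [symmetric] by (simp add: flat_exp_def [of 0 "flat_exp 0 1 - flat_exp 0 y"])
qed

text \<open>For a finite cover by discs, one minus the product of the \<open>1 - bump\<close> is 1
  wherever one bump is 1 and 0 wherever all bumps vanish. It is 1 on a whole neighbourhood of
  \<open>K\<close> because \<theta> has to remain holomorphic near the sets where it is
  changed.\<close>

lemma smooth_cutoff:
  assumes "compact K" "open O'" "K \<subseteq> O'"
  obtains \<beta> S W where "smooth \<beta>" "compact S" "S \<subseteq> O'" "open W" "K \<subseteq> W" "W \<subseteq> S"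
    "\<And>z. z \<in> W \<Longrightarrow> \<beta> z = 1" "\<And>z. z \<notin> S \<Longrightarrow> \<beta> z = 0"
proof -
  have "\<forall>a\<in>K. \<exists>r>0. cball a (2 * r) \<subseteq> O'"
  proof
    fix a assume "a \<in> K"
    then obtain e where "e > 0" "cball a e \<subseteq> O'" using assms open_contains_cball by blast
    then show "\<exists>r>0. cball a (2 * r) \<subseteq> O'" by (intro exI [of _ "e / 2"]) auto
  qed
  then obtain r where r: "\<And>a. a \<in> K \<Longrightarrow> r a > 0" "\<And>a. a \<in> K \<Longrightarrow> cball a (2 * r a) \<subseteq> O'" by metis
  have "K \<subseteq> (\<Union>a\<in>K. ball a (r a))" using r(1) by fastforce
  then obtain F where F: "F \<subseteq> K" "finite F" "K \<subseteq> (\<Union>a\<in>F. ball a (r a))"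
    using compactE_image [OF assms(1), of K "\<lambda>a. ball a (r a)"] by auto
  define \<beta> where "\<beta> z = 1 - (\<Prod>a\<in>F. 1 - bump a (r a) z)" for z
  show ?thesis
  proof (rule that [of \<beta> "\<Union>a\<in>F. cball a (2 * r a)" "\<Union>a\<in>F. ball a (r a)"])
    show "smooth \<beta>" unfolding smooth_def \<beta>_def
      by (intro allI times_differentiable_diff times_differentiable_const times_differentiable_prod smooth_bump)
    show "compact (\<Union>a\<in>F. cball a (2 * r a))" using F by (intro compact_UN) auto
    show "(\<Union>a\<in>F. cball a (2 * r a)) \<subseteq> O'" using F r by blast
    show "open (\<Union>a\<in>F. ball a (r a))" by auto
    show "K \<subseteq> (\<Union>a\<in>F. ball a (r a))" by (rule F)
    have "ball a (r a) \<subseteq> cball a (2 * r a)" if "a \<in> F" for a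
      using r(1) [of a] F(1) that by auto
    then show "(\<Union>a\<in>F. ball a (r a)) \<subseteq> (\<Union>a\<in>F. cball a (2 * r a))" by blast
    show "\<beta> z = 1" if z: "z \<in> (\<Union>a\<in>F. ball a (r a))" for z
    proof -
      obtain a where a: "a \<in> F" "z \<in> ball a (r a)" using z by auto
      then have "1 - bump a (r a) z = 0" using bump_eq_1 [of "r a" z a] r(1) F(1) by auto
      then have "(\<Prod>a\<in>F. 1 - bump a (r a) z) = 0" using F(2) a(1) by (intro prod_zero) auto
      then show ?thesis by (simp add: \<beta>_def)
    qed
    show "\<beta> z = 0" if "z \<notin> (\<Union>a\<in>F. cball a (2 * r a))" for z
    proof -
      have "1 - bump a (r a) z = 1" if "a \<in> F" for a
        using bump_eq_0 [of "r a" z a] r(1) F(1) that \<open>z \<notin> _\<close> by auto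
      then show ?thesis by (simp add: \<beta>_def)
    qed
  qed
qed

section \<open>Bounds for all derivatives up to a given order\<close>

primrec derivatives_bounded :: "nat \<Rightarrow> real \<Rightarrow> (complex \<Rightarrow> complex) \<Rightarrow> bool" where
  "derivatives_bounded 0 B f \<longleftrightarrow> (\<forall>z. norm (f z) \<le> B)"
| "derivatives_bounded (Suc k) B f \<longleftrightarrow> (\<forall>z. norm (f z) \<le> B) \<and>
     derivatives_bounded k B (dird f 1) \<and> derivatives_bounded k B (dird f \<i>)"

lemma derivatives_bounded_norm: "derivatives_bounded k B f \<Longrightarrow> norm (f z) \<le> B"
  by (cases k) auto

lemma derivatives_bounded_mono_B: "derivatives_bounded k B f \<Longrightarrow> B \<le> B' \<Longrightarrow> derivatives_bounded k B' f"
proof (induction k arbitrary: f)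
  case 0
  then show ?case by (fastforce intro: order_trans)
next
  case (Suc k)
  then show ?case by (fastforce intro: order_trans)
qed

lemma derivatives_bounded_Suc_imp: "derivatives_bounded (Suc k) B f \<Longrightarrow> derivatives_bounded k B f"
proof (induction k arbitrary: f)
  case (Suc k)
  have "derivatives_bounded k B (dird f v)" if "v = 1 \<or> v = \<i>" for v
    using that Suc.prems by (intro Suc.IH) auto
  then show ?case using Suc.prems by simp
qed simp

lemma derivatives_bounded_mono: "derivatives_bounded k B f \<Longrightarrow> j \<le> k \<Longrightarrow> derivatives_bounded j B f"
proof (induction k)
  case (Suc k)
  then show ?case
    using derivatives_bounded_Suc_imp [of k B f] by (cases "j = Suc k") auto
qed auto

lemma dird_add:
  assumes "\<And>z. f differentiable at z" "\<And>z. g differentiable at z"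
  shows "dird (\<lambda>z. f z + g z) v = (\<lambda>z. dird f v z + dird g v z)"
proof
  fix z
  show "dird (\<lambda>z. f z + g z) v z = dird f v z + dird g v z"
    by (rule dird_eqI, rule has_derivative_add) (use assms frechet_derivative_works in auto)
qed

lemma dird_cmult:
  assumes "\<And>z. f differentiable at z"
  shows "dird (\<lambda>z. c * f z) v = (\<lambda>z. c * dird f v z)"
proof
  fix z
  show "dird (\<lambda>z. c * f z) v z = c * dird f v z"
    by (rule dird_eqI, rule has_derivative_mult_right) (use assms frechet_derivative_works in auto)
qed

lemma derivatives_bounded_add:
  assumes "derivatives_bounded k B f" "derivatives_bounded k B' g" 
    "times_differentiable k f" "times_differentiable k g"
  shows "derivatives_bounded k (B + B') (\<lambda>z. f z + g z)"
  using assms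
proof (induction k arbitrary: f g)
  case 0
  then show ?case by (auto intro: norm_triangle_mono)
next
  case (Suc k)
  have "derivatives_bounded k (B + B') (\<lambda>z. dird f v z + dird g v z)" if "v = 1 \<or> v = \<i>" for v
    using that Suc.prems by (intro Suc.IH) auto
  then show ?case using Suc.prems by (auto simp: dird_add intro: norm_triangle_mono)
qed

lemma derivatives_bounded_cmult:
  assumes "derivatives_bounded k B f" "times_differentiable k f" "norm c \<le> 1"
  shows "derivatives_bounded k B (\<lambda>z. c * f z)"
  using assms
proof (induction k arbitrary: f)
  case 0
  then show ?case by (auto simp: norm_mult intro: order_trans [OF mult_left_le_one_le])
next
  case (Suc k)
  have "derivatives_bounded k B (\<lambda>z. c * dird f v z)" if "v = 1 \<or> v = \<i>" for v
    using that Suc.prems by (intro Suc.IH) auto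
  then show ?case using Suc.prems
    by (auto simp: dird_cmult norm_mult intro: order_trans [OF mult_left_le_one_le])
qed

lemma smooth_add: "smooth f \<Longrightarrow> smooth g \<Longrightarrow> smooth (\<lambda>z. f z + g z)"
  by (simp add: smooth_def times_differentiable_add)

lemma smooth_sum: "(\<And>i. i \<in> F \<Longrightarrow> smooth (f i)) \<Longrightarrow> smooth (\<lambda>z. \<Sum>i\<in>F. f i z)"
  by (simp add: smooth_def times_differentiable_sum)

lemma derivatives_bounded_zero: "B \<ge> 0 \<Longrightarrow> derivatives_bounded k B (\<lambda>z. 0)"
  by (induction k) auto

lemma derivatives_bounded_sum:
  assumes "finite F" "\<And>i. i \<in> F \<Longrightarrow> derivatives_bounded k B (f i)" "\<And>i. i \<in> F \<Longrightarrow> times_differentiable k (f i)"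
  shows "derivatives_bounded k (real (card F) * B) (\<lambda>z. \<Sum>i\<in>F. f i z)"
  using assms
proof (induction F rule: finite_induct)
  case (insert x F)
  have "derivatives_bounded k (B + real (card F) * B) (\<lambda>z. f x z + (\<Sum>i\<in>F. f i z))"
    using insert by (intro derivatives_bounded_add times_differentiable_sum) auto
  then show ?case using insert by (simp add: algebra_simps)
qed (simp add: derivatives_bounded_zero)

lemma smooth_vanishing_dird:
  assumes "smooth f" "closed S" "\<And>z. z \<notin> S \<Longrightarrow> f z = 0" "z \<notin> S"
  shows "dird f v z = 0"
proof (rule dird_eqI)
  have "((\<lambda>z. 0) has_derivative (\<lambda>v. 0)) (at z)" by simp
  then show "(f has_derivative (\<lambda>v. 0)) (at z)"
    by (rule has_derivative_transform_within_open [of _ _ _ _ "- S"]) (use assms in auto)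
qed

text \<open>Cauchy's estimate on the circle of radius \<open>R / 2\<close>: it costs a factor 2 but
  needs no information on the boundary of the disc.\<close>

lemma deriv_norm_le:
  assumes "f holomorphic_on ball z R" "R > 0" "\<And>w. w \<in> ball z R \<Longrightarrow> norm (f w) \<le> B"
  shows "norm (deriv f z) \<le> 2 * B / R"
proof -
  have sub: "cball z (R / 2) \<subseteq> ball z R" "ball z (R / 2) \<subseteq> ball z R" using assms(2) by auto
  have "norm ((deriv ^^ 1) f z) \<le> fact 1 * B / (R / 2) ^ 1"
  proof (rule Cauchy_inequality)
    show "f holomorphic_on ball z (R / 2)" using holomorphic_on_subset assms(1) sub by blast
    show "continuous_on (cball z (R / 2)) f"
      using holomorphic_on_subset [OF assms(1) sub(1)] holomorphic_on_imp_continuous_on by blast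
    show "norm (f x) \<le> B" if "norm (z - x) = R / 2" for x
      using assms(2) that by (intro assms(3)) (auto simp: dist_norm)
  qed (use assms(2) in auto)
  then show ?thesis by (simp add: field_simps)
qed

text \<open>Since the derivative of \<open>\<beta> u\<close> in direction \<open>v\<close> is \<open>(D\<^sub>v \<beta>) u + v \<beta> u'\<close>, the statement for \<open>k\<close> applied to
  the pairs \<open>(D\<^sub>v \<beta>, u)\<close> and \<open>(\<beta>, u')\<close> gives the one for \<open>k + 1\<close>; \<open>u'\<close> is controlled on a smaller
  neighbourhood by Cauchy's estimate.\<close>

lemma cutoff_times_holomorphic:
  assumes "smooth \<beta>" "open O'" "compact S" "S \<subseteq> O'" "\<And>z. z \<notin> S \<Longrightarrow> \<beta> z = 0"
  shows "\<exists>C\<ge>0. \<forall>u \<delta>. u holomorphic_on O' \<longrightarrow> \<delta> \<ge> 0 \<longrightarrow> (\<forall>z\<in>O'. norm (u z) \<le> \<delta>) \<longrightarrow>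
     times_differentiable k (\<lambda>z. \<beta> z * u z) \<and> derivatives_bounded k (C * \<delta>) (\<lambda>z. \<beta> z * u z)"
  using assms
proof (induction k arbitrary: \<beta> O')
  case (0 \<beta> O')
  have "continuous_on UNIV \<beta>"
    using \<open>smooth \<beta>\<close> times_differentiable_continuous unfolding smooth_def by blast
  then have "bounded (\<beta> ` S)"
    using \<open>compact S\<close> compact_continuous_image compact_imp_bounded continuous_on_subset by (metis subset_UNIV)
  then obtain C where C: "C > 0" "\<And>z. z \<in> S \<Longrightarrow> norm (\<beta> z) \<le> C"
    unfolding bounded_pos by auto
  have "continuous_on UNIV (\<lambda>z. \<beta> z * u z) \<and> (\<forall>z. norm (\<beta> z * u z) \<le> C * \<delta>)"
    if u: "u holomorphic_on O'" "\<delta> \<ge> 0" "\<forall>z\<in>O'. norm (u z) \<le> \<delta>" for u \<delta>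
  proof
    have "continuous_on (O' \<union> - S) (\<lambda>z. \<beta> z * u z)"
    proof (rule continuous_on_open_Un)
      show "open O'" "open (- S)" using 0 by (auto simp: compact_imp_closed)
      show "continuous_on O' (\<lambda>z. \<beta> z * u z)"
        using u(1) holomorphic_on_imp_continuous_on continuous_on_subset [OF \<open>continuous_on UNIV \<beta>\<close>]
        by (intro continuous_on_mult) auto
      show "continuous_on (- S) (\<lambda>z. \<beta> z * u z)"
        using 0 by (subst continuous_on_cong [where g = "\<lambda>z. 0"]) auto
    qed
    moreover have "O' \<union> - S = UNIV" using 0 by blast
    ultimately show "continuous_on UNIV (\<lambda>z. \<beta> z * u z)" by simp
    show "\<forall>z. norm (\<beta> z * u z) \<le> C * \<delta>"
    proof
      fix z
      show "norm (\<beta> z * u z) \<le> C * \<delta>"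
      proof (cases "z \<in> S")
        case True
        then show ?thesis using C u 0 by (auto simp: norm_mult intro!: mult_mono)
      next
        case False
        then show ?thesis using 0 C u by simp
      qed
    qed
  qed
  then show ?case using C(1) by (intro exI [of _ C]) auto
next
  case (Suc k \<beta> O')
  note \<beta> = \<open>smooth \<beta>\<close>
  have closS: "closed S" using Suc by (simp add: compact_imp_closed)
  \<comment> \<open>Twice the radius is reserved so that discs of radius \<open>r\<close> around
    points of the \<open>r\<close>-neighbourhood \<open>O1\<close> of \<open>S\<close> still lie in
    \<open>O'\<close>; there Cauchy's estimate for \<open>u\<close> applies.\<close>
  obtain r where r: "r > 0" "\<And>s. s \<in> S \<Longrightarrow> ball s (2 * r) \<subseteq> O'"
  proof (cases "S = {} \<or> O' = UNIV")
    case True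
    then show ?thesis using that [of 1] by auto
  next
    case False
    then have "setdist S (- O') > 0"
      using Suc by (subst setdist_gt_0_compact_closed) (auto simp: closed_Compl)
    then have "ball s (setdist S (- O')) \<subseteq> O'" if "s \<in> S" for s
      using setdist_le_dist [OF that, of _ "- O'"] by (force simp: subset_iff)
    then show ?thesis
      using that [of "setdist S (- O') / 2"] \<open>setdist S (- O') > 0\<close> by auto
  qed
  define O1 where "O1 = (\<Union>s\<in>S. ball s r)"
  have O1: "open O1" "S \<subseteq> O1" using r by (auto simp: O1_def)
  have dird0: "dird \<beta> v z = 0" if "z \<notin> S" for v z
    using smooth_vanishing_dird \<beta> closS Suc.prems(5) that by blast
  obtain C1 where C1: "C1 \<ge> 0" "\<And>u \<delta>. u holomorphic_on O' \<Longrightarrow> \<delta> \<ge> 0 \<Longrightarrow> \<forall>z\<in>O'. norm (u z) \<le> \<delta> \<Longrightarrow>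
      times_differentiable k (\<lambda>z. dird \<beta> 1 z * u z) \<and> derivatives_bounded k (C1 * \<delta>) (\<lambda>z. dird \<beta> 1 z * u z)"
    using Suc.IH [OF smooth_dird [OF \<beta>] Suc.prems(2,3,4) dird0] by meson
  obtain C2 where C2: "C2 \<ge> 0" "\<And>u \<delta>. u holomorphic_on O' \<Longrightarrow> \<delta> \<ge> 0 \<Longrightarrow> \<forall>z\<in>O'. norm (u z) \<le> \<delta> \<Longrightarrow>
      times_differentiable k (\<lambda>z. dird \<beta> \<i> z * u z) \<and> derivatives_bounded k (C2 * \<delta>) (\<lambda>z. dird \<beta> \<i> z * u z)"
    using Suc.IH [OF smooth_dird [OF \<beta>] Suc.prems(2,3,4) dird0] by meson
  obtain C3 where C3: "C3 \<ge> 0" "\<And>u \<delta>. u holomorphic_on O1 \<Longrightarrow> \<delta> \<ge> 0 \<Longrightarrow> \<forall>z\<in>O1. norm (u z) \<le> \<delta> \<Longrightarrow>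
      times_differentiable k (\<lambda>z. \<beta> z * u z) \<and> derivatives_bounded k (C3 * \<delta>) (\<lambda>z. \<beta> z * u z)"
    using Suc.IH [OF \<beta> O1(1) Suc.prems(3) O1(2) Suc.prems(5)] by meson
  obtain C0 where C0: "C0 \<ge> 0" "\<And>u \<delta> z. u holomorphic_on O' \<Longrightarrow> \<delta> \<ge> 0 \<Longrightarrow> \<forall>z\<in>O'. norm (u z) \<le> \<delta> \<Longrightarrow>
     norm (\<beta> z * u z) \<le> C0 * \<delta>"
  proof -
    have "continuous_on UNIV \<beta>"
      using \<beta> times_differentiable_continuous unfolding smooth_def by blast
    then have "bounded (\<beta> ` S)"
      using \<open>compact S\<close> compact_continuous_image compact_imp_bounded continuous_on_subset by (metis subset_UNIV)
    then obtain C where C: "C > 0" "\<And>z. z \<in> S \<Longrightarrow> norm (\<beta> z) \<le> C"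
      unfolding bounded_pos by auto
    show ?thesis
    proof (rule that [of C])
      fix u \<delta> z
      assume "u holomorphic_on O'" "\<delta> \<ge> 0" "\<forall>z\<in>O'. norm (u z) \<le> \<delta>"
      then show "norm (\<beta> z * u z) \<le> C * \<delta>"
        using C Suc.prems by (cases "z \<in> S") (auto simp: norm_mult intro!: mult_mono)
    qed (use C in auto)
  qed
  \<comment> \<open>\<open>C0\<close> bounds the function itself, \<open>C1\<close> and
    \<open>C2\<close> the terms with the derivatives of \<beta> in the directions 1 and
    \<open>\<i>\<close>, and \<open>C3\<close> the term with the derivative of \<open>u\<close>,
    where Cauchy's estimate adds the factor \<open>2 / r\<close>.\<close>
  define C where "C = C0 + C1 + C2 + C3 * (2 / r)"
  have Cge: "C0 \<le> C" "C1 + C3 * (2 / r) \<le> C" "C2 + C3 * (2 / r) \<le> C"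
    using C0(1) C1(1) C2(1) C3(1) r(1) by (auto simp: C_def)
  have "times_differentiable (Suc k) (\<lambda>z. \<beta> z * u z) \<and> derivatives_bounded (Suc k) (C * \<delta>) (\<lambda>z. \<beta> z * u z)"
    if u: "u holomorphic_on O'" "\<delta> \<ge> 0" "\<forall>z\<in>O'. norm (u z) \<le> \<delta>" for u \<delta>
  proof -
    have du: "deriv u holomorphic_on O1"
      using u(1) Suc.prems r unfolding O1_def
      by (intro holomorphic_on_subset [OF holomorphic_deriv [OF u(1) \<open>open O'\<close>]]) (force simp: subset_iff)
    have du_le: "norm (deriv u z) \<le> 2 / r * \<delta>" if z1: "z \<in> O1" for z
    proof -
      have z: "ball z r \<subseteq> O'"
      proof
        fix w assume w: "w \<in> ball z r"
        obtain s where s: "s \<in> S" "dist s z < r" using z1 by (auto simp: O1_def)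
        then have "dist s w < 2 * r" using w dist_triangle [of s w z] by auto
        then show "w \<in> O'" using r(2) [OF s(1)] by auto
      qed
      have "norm (deriv u z) \<le> 2 * \<delta> / r"
        by (rule deriv_norm_le) (use u z r(1) holomorphic_on_subset in auto)
      then show ?thesis by simp
    qed
    define D where "D v z = dird \<beta> v z * u z + v * (\<beta> z * deriv u z)" for v z
    have der: "((\<lambda>z. \<beta> z * u z) has_derivative (\<lambda>v. D v z)) (at z)" for z
    proof (cases "z \<in> O'")
      case True
      have "(u has_field_derivative deriv u z) (at z)"
        using u(1) True \<open>open O'\<close> holomorphic_derivI by blast
      from has_derivative_mult [OF smooth_has_derivative [OF \<beta>] this [unfolded has_field_derivative_def]]
      show ?thesis by (simp add: D_def algebra_simps)
    next
      case False
      then have "z \<notin> S" using Suc.prems by blast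
      \<comment> \<open>Off \<open>O'\<close> nothing is known about \<open>u\<close>, but \<beta>
        vanishes identically on the open complement of \<open>S\<close>.\<close>
      have "((\<lambda>z. 0) has_derivative (\<lambda>v. D v z)) (at z)"
        using \<open>z \<notin> S\<close> dird0 Suc.prems by (simp add: D_def)
      then show ?thesis
        by (rule has_derivative_transform_within_open [of _ _ _ _ "- S"]) (use Suc.prems closS \<open>z \<notin> S\<close> in auto)
    qed
    have dir: "dird (\<lambda>z. \<beta> z * u z) v = D v" for v
      using dird_eqI [OF der] by auto
    have "\<delta>' \<ge> 0" if "\<delta>' = 2 / r * \<delta>" for \<delta>' using that u(2) r(1) by simp
    then have t3: "times_differentiable k (\<lambda>z. \<beta> z * deriv u z)"
        "derivatives_bounded k (C3 * (2 / r * \<delta>)) (\<lambda>z. \<beta> z * deriv u z)"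
      using C3(2) [OF du, of "2 / r * \<delta>"] du_le by auto
    have t1: "times_differentiable k (\<lambda>z. dird \<beta> v z * u z)" for v
      using Suc.IH [OF smooth_dird [OF \<beta>] Suc.prems(2,3,4) dird0] u by meson
    have td: "times_differentiable (Suc k) (\<lambda>z. \<beta> z * u z)"
      by (rule times_differentiable_SucI [OF der]) (unfold D_def, intro times_differentiable_add times_differentiable_cmult t1 t3)
    have bd: "derivatives_bounded k (C * \<delta>) (D v)" if v: "v = 1 \<or> v = \<i>" for v
    proof -
      obtain C' where C': "C' + C3 * (2 / r) \<le> C" "derivatives_bounded k (C' * \<delta>) (\<lambda>z. dird \<beta> v z * u z)"
      proof (cases "v = 1")
        case True
        then show ?thesis using that [of C1] C1(2) [OF u] Cge by blast
      next
        case False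
        then have "v = \<i>" using v by blast
        then show ?thesis using that [of C2] C2(2) [OF u] Cge by blast
      qed
      have "derivatives_bounded k (C' * \<delta> + C3 * (2 / r * \<delta>)) (D v)"
        unfolding D_def using v
        by (intro derivatives_bounded_add derivatives_bounded_cmult C' t3 t1 times_differentiable_cmult) auto
      moreover have "C' * \<delta> + C3 * (2 / r * \<delta>) \<le> C * \<delta>"
        using mult_right_mono [OF C'(1) u(2)] by (simp add: algebra_simps)
      ultimately show ?thesis by (rule derivatives_bounded_mono_B)
    qed
    have "norm (\<beta> z * u z) \<le> C * \<delta>" for z
      using C0(2) [OF u, of z] mult_right_mono [OF Cge(1) u(2)] by linarith
    then show ?thesis using td bd by (simp add: dir)
  qed
  then show ?case using Cge(1) C0(1) by (intro exI [of _ C]) auto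
qed

lemma smooth_cutoff_times_holomorphic:
  assumes "smooth \<beta>" "open O'" "compact S" "S \<subseteq> O'" "\<And>z. z \<notin> S \<Longrightarrow> \<beta> z = 0"
    "u holomorphic_on O'" "\<delta> \<ge> 0" "\<And>z. z \<in> O' \<Longrightarrow> norm (u z) \<le> \<delta>"
  shows "smooth (\<lambda>z. \<beta> z * u z)"
  unfolding smooth_def using cutoff_times_holomorphic [OF assms(1-5)] assms(6-8) by meson

lemma dird_norm_le:
  assumes "smooth f" "derivatives_bounded 1 B f"
  shows "norm (dird f v z) \<le> 2 * B * norm v"
proof -
  have "norm (dird f v z) \<le> norm (of_real (Re v) * dird f 1 z) + norm (of_real (Im v) * dird f \<i> z)"
    by (subst linear_complex_expand [OF smooth_linear [OF assms(1)]]) (rule norm_triangle_ineq)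
  also have "\<dots> \<le> norm v * B + norm v * B"
    using assms(2) abs_Re_le_cmod [of v] abs_Im_le_cmod [of v]
    by (intro add_mono) (auto simp: norm_mult intro!: mult_mono)
  finally show ?thesis by (simp add: algebra_simps)
qed

lemma smooth_lipschitz:
  assumes "smooth f" "\<And>v z. norm (dird f v z) \<le> B * norm v"
  shows "norm (f x - f y) \<le> B * norm (x - y)"
proof (rule differentiable_bound [of UNIV])
  fix z
  show "(f has_derivative (\<lambda>v. dird f v z)) (at z within UNIV)"
    using smooth_has_derivative [OF assms(1)] by simp
  show "onorm (\<lambda>v. dird f v z) \<le> B"
    by (rule onorm_le) (rule assms(2))
qed auto

text \<open>Term-by-term differentiation: the tails of the series of derivatives are at most twice
  the tails of \<open>b\<close>, uniformly in the point and relative to the length of the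
  direction.\<close>

lemma sums_dird:
  assumes "\<And>n. smooth (f n)" "\<And>n. derivatives_bounded 1 (b n) (f n)" "summable b"
  shows "((\<lambda>z. \<Sum>n. f n z) has_derivative (\<lambda>v. \<Sum>n. dird (f n) v z)) (at z)"
proof -
  have le: "norm (dird (f n) v z) \<le> 2 * b n * norm v" for n v z
    by (rule dird_norm_le [OF assms(1,2)])
  have summ: "summable (\<lambda>n. dird (f n) v z)" for v z
    by (rule summable_comparison_test' [of "\<lambda>n. 2 * b n * norm v" 0])
       (use le assms(3) in \<open>auto intro!: summable_mult summable_mult2\<close>)
  have summf: "summable (\<lambda>n. f n z)" for z
    by (rule summable_comparison_test' [of b 0])
       (use derivatives_bounded_norm [OF assms(2)] assms(3) in auto)
  have tail: "norm ((\<Sum>i<n. dird (f i) h x) - (\<Sum>i. dird (f i) h x)) \<le> 2 * (\<Sum>i. b (i + n)) * norm h" for n h x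
  proof -
    have "(\<Sum>i. dird (f i) h x) - (\<Sum>i<n. dird (f i) h x) = (\<Sum>i. dird (f (i + n)) h x)"
      using suminf_minus_initial_segment [OF summ] by simp
    also have "norm \<dots> \<le> (\<Sum>i. 2 * b (i + n) * norm h)"
      using assms(3) le
      by (intro norm_suminf_le) (auto intro!: summable_mult summable_mult2 summable_ignore_initial_segment)
    also have "\<dots> = 2 * (\<Sum>i. b (i + n)) * norm h"
      using assms(3) by (simp add: suminf_mult suminf_mult2 [symmetric] summable_ignore_initial_segment summable_mult summable_mult2 mult.assoc)
    finally show ?thesis by (simp add: norm_minus_commute)
  qed
  have "\<exists>g. \<forall>x\<in>UNIV. (\<lambda>n. f n x) sums (g x) \<and> (g has_derivative (\<lambda>h. \<Sum>n. dird (f n) h x)) (at x within UNIV)"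
  proof (rule has_derivative_series)
    show "((f n) has_derivative (\<lambda>h. dird (f n) h x)) (at x within UNIV)" for n x
      using smooth_has_derivative [OF assms(1)] by simp
    show "(\<lambda>n. f n 0) sums (\<Sum>n. f n 0)" using summf by (rule summable_sums)
    fix e :: real assume "e > 0"
    have "(\<lambda>n. \<Sum>i. b (i + n)) \<longlonglongrightarrow> 0" using suminf_exist_split2 assms(3) by blast
    then have "\<forall>\<^sub>F n in sequentially. (\<Sum>i. b (i + n)) < e / 2"
      using \<open>e > 0\<close> by (intro order_tendstoD) auto
    then show "\<forall>\<^sub>F n in sequentially. \<forall>x\<in>UNIV. \<forall>h. norm ((\<Sum>i<n. dird (f i) h x) - (\<Sum>n. dird (f n) h x)) \<le> e * norm h"
    proof eventually_elim
      case (elim n)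
      have "2 * (\<Sum>i. b (i + n)) * norm h \<le> e * norm h" for h :: complex
        using elim by (intro mult_right_mono) auto
      then show ?case using tail order_trans by blast
    qed
  qed auto
  then obtain g where g: "\<And>x. (\<lambda>n. f n x) sums (g x)" "\<And>x. (g has_derivative (\<lambda>h. \<Sum>n. dird (f n) h x)) (at x)"
    by auto
  then have "g = (\<lambda>x. \<Sum>n. f n x)" by (auto simp: sums_iff)
  then show ?thesis using g(2) by simp
qed

lemma times_differentiable_suminf_aux:
  assumes "\<And>n. smooth (f n)" "\<And>n. derivatives_bounded k (b n) (f n)" "summable b"
  shows "times_differentiable k (\<lambda>z. \<Sum>n. f n z)"
  using assms
proof (induction k arbitrary: f)
  case 0
  have "uniform_limit UNIV (\<lambda>n z. \<Sum>i<n. f i z) (\<lambda>z. \<Sum>i. f i z) sequentially"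
    by (rule Weierstrass_m_test [of _ _ b]) (use 0 in auto)
  moreover have "continuous_on UNIV (\<lambda>z. \<Sum>i<n. f i z)" for n
  proof (intro continuous_on_sum)
    show "continuous_on UNIV (f i)" for i
      using 0(1) [of i] times_differentiable_continuous unfolding smooth_def by blast
  qed
  ultimately have "continuous_on UNIV (\<lambda>z. \<Sum>i. f i z)"
    by (intro uniform_limit_theorem [of _ "\<lambda>n z. \<Sum>i<n. f i z" sequentially]) auto
  then show ?case by simp
next
  case (Suc k)
  have d1: "derivatives_bounded 1 (b n) (f n)" for n
    by (rule derivatives_bounded_mono [OF Suc.prems(2)]) simp
  note der = sums_dird [OF Suc.prems(1) d1 Suc.prems(3)]
  have v1: "times_differentiable k (\<lambda>z. \<Sum>n. dird (f n) v z)" if "v = 1 \<or> v = \<i>" for v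
    using that Suc.prems by (intro Suc.IH smooth_dird) auto
  have lin: "linear (\<lambda>v. \<Sum>n. dird (f n) v z)" for z
    using der has_derivative_linear by blast
  show ?case
  proof (rule times_differentiable_SucI [OF der])
    fix v
    have "times_differentiable k (\<lambda>z. of_real (Re v) * (\<Sum>n. dird (f n) 1 z) + of_real (Im v) * (\<Sum>n. dird (f n) \<i> z))"
      by (intro times_differentiable_add times_differentiable_cmult v1) auto
    moreover have "(\<lambda>z. \<Sum>n. dird (f n) v z) = (\<lambda>z. of_real (Re v) * (\<Sum>n. dird (f n) 1 z) + of_real (Im v) * (\<Sum>n. dird (f n) \<i> z))"
    proof
      show "(\<Sum>n. dird (f n) v z) = of_real (Re v) * (\<Sum>n. dird (f n) 1 z) + of_real (Im v) * (\<Sum>n. dird (f n) \<i> z)" for z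
        by (rule linear_complex_expand [OF lin])
    qed
    ultimately show "times_differentiable k (\<lambda>z. \<Sum>n. dird (f n) v z)" by simp
  qed
qed

text \<open>The \<open>n\<close>-th term is controlled only up to order \<open>n\<close>. For
  differentiability of order \<open>k\<close> the first \<open>k\<close> terms are split off as a
  finite sum of smooth functions.\<close>

lemma smooth_suminf:
  assumes "\<And>n. smooth (f n)" "\<And>n. derivatives_bounded n (b n) (f n)" "summable b"
  shows "smooth (\<lambda>z. \<Sum>n. f n z)"
  unfolding smooth_def
proof
  fix k
  have "times_differentiable k (\<lambda>z. \<Sum>n. f (n + k) z)"
  proof (rule times_differentiable_suminf_aux [where b = "\<lambda>n. b (n + k)"])
    show "derivatives_bounded k (b (n + k)) (f (n + k))" for n
      using derivatives_bounded_mono [OF assms(2)] by simp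
  qed (use assms in \<open>auto simp: summable_ignore_initial_segment\<close>)
  then have "times_differentiable k (\<lambda>z. (\<Sum>n. f (n + k) z) + (\<Sum>n<k. f n z))"
    using assms(1) by (intro times_differentiable_add times_differentiable_sum) (auto simp: smooth_def)
  moreover have "(\<Sum>n. f n z) = (\<Sum>n. f (n + k) z) + (\<Sum>n<k. f n z)" for z
  proof (rule suminf_split_initial_segment)
    show "summable (\<lambda>n. f n z)"
      by (rule summable_comparison_test' [of b 0])
         (use derivatives_bounded_norm [OF assms(2)] assms(3) in auto)
  qed
  ultimately show "times_differentiable k (\<lambda>z. \<Sum>n. f n z)" by simp
qed

section \<open>Diffeomorphisms close to the identity\<close>

lemma cross_product_eq:
  fixes a b v :: complex
  shows "of_real (Im (cnj v * b)) * a + of_real (Im (cnj a * v)) * b = of_real (Im (cnj a * b)) * v"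
  by (simp add: complex_eq_iff) (simp add: algebra_simps)

text \<open>Since \<open>h\<close> is a contraction with constant 1/2, surjectivity follows from
  Banach's fixed point theorem applied to \<open>w - h z\<close>, and the inverse is Lipschitz with
  constant 2. An explicit inverse of the derivative then gives smoothness of the inverse map by
  bootstrapping.\<close>

theorem smooth_diffeomorphism_near_identity:
  assumes h: "smooth h" and le: "\<And>v z. norm (dird h v z) \<le> 1/2 * norm v"
  shows "smooth_diffeomorphism (\<lambda>z. z + h z)"
proof -
  define \<theta> where "\<theta> z = z + h z" for z
  have \<theta>: "smooth \<theta>"
    unfolding \<theta>_def smooth_def using h times_differentiable_add times_differentiable_bounded_linear [OF bounded_linear_ident]
    by (auto simp: smooth_def)
  have lip: "norm (h x - h y) \<le> 1/2 * norm (x - y)" for x y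
    by (rule smooth_lipschitz [OF h le])
  have expand: "norm (x - y) \<le> 2 * norm (\<theta> x - \<theta> y)" for x y
  proof -
    have "x - y = (\<theta> x - \<theta> y) - (h x - h y)" by (simp add: \<theta>_def)
    then have "norm (x - y) \<le> norm (\<theta> x - \<theta> y) + norm (h x - h y)"
      by (metis norm_triangle_ineq4)
    then show ?thesis using lip [of x y] by simp
  qed
  have "inj \<theta>"
  proof (rule injI)
    show "x = y" if "\<theta> x = \<theta> y" for x y using expand [of x y] that by simp
  qed
  moreover have "surj \<theta>"
    unfolding surj_def
  proof
    fix w
    have "\<exists>!z. w - h z = z"
    proof (rule banach_fix_type [of "1/2"])
      show "\<forall>x y. dist (w - h x) (w - h y) \<le> 1/2 * dist x y"
        using lip by (simp add: dist_norm norm_minus_commute)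
    qed auto
    then obtain z where "w - h z = z" by blast
    then have "w = \<theta> z" by (simp add: \<theta>_def algebra_simps)
    then show "\<exists>x. w = \<theta> x" by blast
  qed
  ultimately have bij: "bij \<theta>" by (simp add: bij_def)
  define I where "I = inv \<theta>"
  have I: "\<theta> (I w) = w" "I (\<theta> z) = z" for w z
    using bij by (auto simp: I_def bij_def surj_f_inv_f)
  have contI: "continuous_on UNIV I"
  proof (rule lipschitz_on_continuous_on)
    show "2-lipschitz_on UNIV I"
      using expand [of "I _" "I _"] I by (auto simp: lipschitz_on_def dist_norm)
  qed
  define a where "a = dird \<theta> 1"
  define b where "b = dird \<theta> \<i>"
  \<comment> \<open>\<open>d\<close> is the Jacobian determinant, and \<open>G v z\<close> solves
    \<open>dird \<theta> w z = v\<close> for \<open>w\<close> by Cramer's rule, which is the content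
    of \<open>cross_product_eq\<close>.\<close>
  define d where "d z = complex_of_real (Im (cnj (a z) * b z))" for z
  define G where "G v z = of_real (Im (cnj v * b z)) * inverse (d z) + \<i> * (of_real (Im (cnj (a z) * v)) * inverse (d z))" for v z
  have L: "dird \<theta> v z = v + dird h v z" for v z
    unfolding \<theta>_def by (rule dird_eqI) (auto intro!: has_derivative_add smooth_has_derivative [OF h])
  have Lexp: "dird \<theta> v z = of_real (Re v) * a z + of_real (Im v) * b z" for v z
    unfolding a_def b_def by (rule linear_complex_expand [OF smooth_linear [OF \<theta>]])
  have Lge: "norm v \<le> 2 * norm (dird \<theta> v z)" for v z
  proof -
    have "v = dird \<theta> v z - dird h v z" by (simp add: L)
    then have "norm v \<le> norm (dird \<theta> v z) + norm (dird h v z)" by (metis norm_triangle_ineq4)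
    then show ?thesis using le [where v = v and z = z] by simp
  qed
  have d0: "d z \<noteq> 0" for z
  proof
    assume "d z = 0"
    then have Im0: "Im (cnj (a z) * b z) = 0" unfolding d_def by (simp only: of_real_eq_0_iff)
    have a0: "a z \<noteq> 0" using Lge [of 1 z] by (auto simp: a_def)
    define t where "t = Re (cnj (a z) * b z)"
    \<comment> \<open>If the determinant vanishes, \<open>b z\<close> is a real multiple of
      \<open>a z\<close>, and this nonzero \<open>w\<close> lies in the kernel of the derivative,
      against the lower bound \<open>Lge\<close>.\<close>
    define w where "w = Complex t (- (norm (a z))\<^sup>2)"
    have ab: "cnj (a z) * b z = of_real t"
      unfolding t_def using Im0 by (intro complex_eqI) (simp_all only: Re_complex_of_real Im_complex_of_real)
    have "cnj (a z) * dird \<theta> w z = of_real t * (cnj (a z) * a z) - of_real ((norm (a z))\<^sup>2) * (cnj (a z) * b z)"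
      unfolding Lexp w_def complex.sel by (simp add: algebra_simps)
    also have "\<dots> = of_real t * (cnj (a z) * a z) - of_real ((norm (a z))\<^sup>2) * of_real t"
      unfolding ab ..
    also have "cnj (a z) * a z = of_real ((norm (a z))\<^sup>2)"
      by (metis complex_norm_square mult.commute)
    finally have "cnj (a z) * dird \<theta> w z = 0" by simp
    then have "dird \<theta> w z = 0" using a0 by simp
    then have "w = 0" using Lge [of w z] by simp
    then show False using a0 by (simp add: w_def complex_eq_iff)
  qed
  have LG: "dird \<theta> (G v z) z = v" for v z
  proof -
    have "d z = of_real (Im (cnj (a z) * b z))" by (simp add: d_def)
    then have inv_d: "inverse (d z) = of_real (inverse (Im (cnj (a z) * b z)))" by simp
    have "Re (G v z) = Im (cnj v * b z) * inverse (Im (cnj (a z) * b z))"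
         "Im (G v z) = Im (cnj (a z) * v) * inverse (Im (cnj (a z) * b z))"
    proof -
      have "Re (of_real p * of_real q + \<i> * (of_real r * of_real q)) = p * q"
           "Im (of_real p * of_real q + \<i> * (of_real r * of_real q)) = r * q" for p q r by simp_all
      then show "Re (G v z) = Im (cnj v * b z) * inverse (Im (cnj (a z) * b z))"
         "Im (G v z) = Im (cnj (a z) * v) * inverse (Im (cnj (a z) * b z))"
        unfolding G_def inv_d by blast+
    qed
    then have "dird \<theta> (G v z) z = (of_real (Im (cnj v * b z)) * a z + of_real (Im (cnj (a z) * v)) * b z) * inverse (d z)"
      unfolding Lexp inv_d by (simp only: of_real_mult) (simp add: algebra_simps)
    also have "\<dots> = v"
      unfolding cross_product_eq using d0 [of z] by (simp add: d_def)
    finally show ?thesis .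
  qed
  have GL: "G (dird \<theta> v z) z = v" for v z
  proof -
    have "dird \<theta> (G (dird \<theta> v z) z - v) z = 0"
      using LG [where v = "dird \<theta> v z" and z = z] by (simp add: linear_diff [OF smooth_linear [OF \<theta>]])
    then show ?thesis using Lge [of "G (dird \<theta> v z) z - v" z] by simp
  qed
  have linG: "bounded_linear (\<lambda>v. G v z)" for z
  proof -
    have "linear (\<lambda>v. G v z)"
      by (rule linearI) (simp_all add: G_def algebra_simps scaleR_conv_of_real)
    then show ?thesis by (simp add: linear_conv_bounded_linear)
  qed
  have derI: "(I has_derivative (\<lambda>v. G v (I w))) (at w)" for w
  proof (rule has_derivative_inverse_basic [where T = UNIV])
    show "(\<theta> has_derivative (\<lambda>v. dird \<theta> v (I w))) (at (I w))" by (rule smooth_has_derivative [OF \<theta>])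
    show "bounded_linear (\<lambda>v. G v (I w))" by (rule linG)
    show "(\<lambda>v. G v (I w)) \<circ> (\<lambda>v. dird \<theta> v (I w)) = id" using GL by auto
    show "continuous (at w) I" using contI by (simp add: continuous_on_eq_continuous_at)
  qed (use I in auto)
  have smG: "times_differentiable k (G v)" for k v
  proof -
    have ab: "times_differentiable k a" "times_differentiable k b"
      using smooth_dird [OF \<theta>] by (auto simp: a_def b_def smooth_def)
    note Im_rule = times_differentiable_linear_image [OF bounded_linear_of_Im]
      times_differentiable_linear_image [OF bounded_linear_cnj]
    have "times_differentiable k d"
      unfolding d_def by (intro Im_rule times_differentiable_mult ab)
    then have "times_differentiable k (\<lambda>z. inverse (d z))"
      by (rule times_differentiable_inverse [OF d0])
    then show ?thesis
      unfolding G_def by (intro times_differentiable_add times_differentiable_mult Im_rule times_differentiable_const ab)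
  qed
  \<comment> \<open>The derivative of \<open>I\<close> in direction \<open>v\<close> is
    \<open>G v\<close> composed with \<open>I\<close>, so each order of differentiability of
    \<open>I\<close> yields the next.\<close>
  have "times_differentiable k I" for k
  proof (induction k)
    case (Suc k)
    show ?case
      by (rule times_differentiable_SucI [OF derI]) (rule times_differentiable_compose [OF smG Suc])
  qed (use contI in simp)
  then show ?thesis
    unfolding smooth_diffeomorphism_def using bij \<theta> by (simp add: I_def \<theta>_def [symmetric] smooth_def \<theta>_def [abs_def, symmetric])
qed

section \<open>Lifting perturbations through holomorphic maps\<close>

lemma compact_collar:
  fixes Y :: "complex set"
  assumes "compact Y" "open G" "Y \<subseteq> G"
  obtains r L where "r > 0" "r \<le> 1" "compact L" "L \<subseteq> G" "\<And>y. y \<in> Y \<Longrightarrow> cball y r \<subseteq> L"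
    "\<And>x. x \<in> L \<Longrightarrow> \<exists>y\<in>Y. x \<in> cball y r"
proof -
  obtain e where e: "e > 0" "(\<Union>x\<in>Y. cball x e) \<subseteq> G"
    using compact_subset_open_imp_cball_epsilon_subset [OF assms] by blast
  define r where "r = min e 1"
  define L where "L = {x + y | x y. x \<in> Y \<and> y \<in> cball 0 r}"
  have L: "x \<in> L \<longleftrightarrow> (\<exists>y\<in>Y. x \<in> cball y r)" for x
  proof
    assume "x \<in> L"
    then obtain y v where "y \<in> Y" "x = y + v" "norm v \<le> r" by (auto simp: L_def)
    then show "\<exists>y\<in>Y. x \<in> cball y r" by (intro bexI [of _ y]) (auto simp: dist_norm)
  next
    assume "\<exists>y\<in>Y. x \<in> cball y r"
    then obtain y where "y \<in> Y" "x - y \<in> cball 0 r" by (auto simp: dist_norm norm_minus_commute)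
    moreover have "x = y + (x - y)" by simp
    ultimately show "x \<in> L" unfolding L_def by blast
  qed
  show ?thesis
  proof (rule that [of r L])
    show "compact L" unfolding L_def using assms by (intro compact_sums) auto
    have "cball y r \<subseteq> cball y e" for y by (auto simp: r_def)
    then show "L \<subseteq> G" using L e(2) by blast
  qed (use e L in \<open>auto simp: r_def\<close>)
qed

lemma compact_neighbourhood:
  fixes Y :: "complex set"
  assumes "compact Y" "open G" "Y \<subseteq> G"
  obtains L where "compact L" "Y \<subseteq> interior L" "L \<subseteq> G"
proof -
  obtain r L where "r > 0" "compact L" "L \<subseteq> G" "\<And>y. y \<in> Y \<Longrightarrow> cball y r \<subseteq> L"
    using compact_collar [OF assms] by metis
  moreover have "Y \<subseteq> interior L"
  proof
    fix y assume "y \<in> Y"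
    then have "ball y r \<subseteq> L" using calculation by (meson ball_subset_cball order_trans)
    then show "y \<in> interior L" using \<open>r > 0\<close> by (meson centre_in_ball interior_maximal open_ball subsetD)
  qed
  ultimately show ?thesis using that by blast
qed

lemma holomorphic_bounded_on_compact:
  assumes "f holomorphic_on G" "compact L" "L \<subseteq> G"
  obtains B where "B > 0" "\<And>z. z \<in> L \<Longrightarrow> norm (f z) \<le> B"
proof -
  have "compact (f ` L)"
    using assms by (intro compact_continuous_image) (auto intro: holomorphic_on_imp_continuous_on holomorphic_on_subset)
  then obtain B where "B > 0" "\<forall>x\<in>f ` L. norm x \<le> B"
    using compact_imp_bounded bounded_pos by metis
  then show ?thesis using that by auto
qed

text \<open>Truncating the distance at 1 makes its powers decrease with the exponent, and gives the
  value 1 when no point is marked.\<close>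

definition wt :: "complex set \<Rightarrow> complex \<Rightarrow> real" where
  "wt M z = Min (insert 1 (dist z ` M))"

context
  fixes M :: "complex set"
  assumes fin: "finite M"
begin

lemma wt_le_1: "wt M z \<le> 1"
  using fin by (simp add: wt_def)

lemma wt_le_dist: "c \<in> M \<Longrightarrow> wt M z \<le> dist z c"
  using fin by (simp add: wt_def)

lemma wt_cases: "wt M z = 1 \<or> (\<exists>c\<in>M. wt M z = dist z c)"
proof -
  have "wt M z \<in> insert 1 (dist z ` M)"
    unfolding wt_def using fin by (intro Min_in) auto
  then show ?thesis by auto
qed

lemma wt_nonneg: "wt M z \<ge> 0"
  using wt_cases [of z] by auto

lemma wt_pos: "z \<notin> M \<Longrightarrow> wt M z > 0"
  using wt_cases [of z] by auto

lemma wt_zero: "z \<in> M \<Longrightarrow> wt M z = 0"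
  using wt_le_dist [of z z] wt_nonneg [of z] by simp

lemma wt_triangle: "wt M z \<le> wt M w + dist z w"
  using wt_cases [of w]
proof
  assume "wt M w = 1" then show ?thesis using wt_le_1 [of z] zero_le_dist [of z w] by linarith
next
  assume "\<exists>c\<in>M. wt M w = dist w c"
  then show ?thesis using wt_le_dist dist_triangle [of z _ w] by (smt (verit))
qed

lemma wt_power_mono: "a \<le> b \<Longrightarrow> wt M z ^ b \<le> wt M z ^ a"
  by (rule power_decreasing) (use wt_nonneg wt_le_1 in auto)

lemma wt_power_le_1: "wt M z ^ a \<le> 1"
  by (rule power_le_one) (use wt_nonneg wt_le_1 in auto)

lemma wt_power_nonneg: "wt M z ^ a \<ge> 0"
  using wt_nonneg by simp

end

lemma wt_image_le:
  assumes "finite M" "finite M'" "\<And>c. c \<in> M \<Longrightarrow> f c \<in> M'" "L \<ge> 1"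
    "\<And>c. c \<in> M \<Longrightarrow> dist (f z) (f c) \<le> L * dist z c"
  shows "wt M' (f z) \<le> L * wt M z"
  using wt_cases [OF assms(1), of z]
proof
  assume "wt M z = 1" then show ?thesis using wt_le_1 [OF assms(2), of "f z"] assms(4) by simp
next
  assume "\<exists>c\<in>M. wt M z = dist z c"
  then obtain c where "c \<in> M" "wt M z = dist z c" by blast
  then show ?thesis using wt_le_dist [OF assms(2) assms(3), of c "f z"] assms(5) [of c] by simp
qed

lemma wt_subset: "finite M' \<Longrightarrow> M \<subseteq> M' \<Longrightarrow> wt M' z \<le> wt M z"
  unfolding wt_def by (intro Min_antimono) auto

text \<open>\<open>N\<close> need not be convex, so a bound on the derivative would not do. The
  difference quotient at each \<open>c\<close> extends holomorphically over \<open>c\<close> and is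
  bounded on the compact set \<open>N\<close>.\<close>

lemma holomorphic_lipschitz_at_points:
  assumes "f holomorphic_on G" "open G" "compact N" "N \<subseteq> G" "finite M"
  obtains L where "L \<ge> 1" "\<And>z c. z \<in> N \<Longrightarrow> c \<in> M \<Longrightarrow> dist (f z) (f c) \<le> L * dist z c"
proof -
  have "\<exists>B>0. \<forall>z\<in>N. dist (f z) (f c) \<le> B * dist z c" for c
  proof -
    let ?q = "\<lambda>z. if z = c then deriv f c else (f z - f c) / (z - c)"
    have "?q holomorphic_on G" using assms by (intro pole_lemma_open)
    then obtain B where B: "B > 0" "\<And>z. z \<in> N \<Longrightarrow> norm (?q z) \<le> B"
      using holomorphic_bounded_on_compact assms(3,4) by blast
    have "dist (f z) (f c) \<le> B * dist z c" if "z \<in> N" for z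
    proof (cases "z = c")
      case False
      then show ?thesis using B(2) [OF that] by (simp add: dist_norm norm_divide divide_le_eq)
    qed simp
    then show ?thesis using B(1) by blast
  qed
  then obtain B where B: "\<And>c. B c > 0" "\<And>c z. z \<in> N \<Longrightarrow> dist (f z) (f c) \<le> B c * dist z c"
    by metis
  define L where "L = Max (insert 1 (B ` M))"
  have "dist (f z) (f c) \<le> L * dist z c" if "z \<in> N" "c \<in> M" for z c
  proof -
    have "B c \<le> L" using assms(5) that by (simp add: L_def)
    then show ?thesis using B(2) [OF that(1), of c] mult_right_mono [of "B c" L "dist z c"] by simp
  qed
  moreover have "L \<ge> 1" using assms(5) by (simp add: L_def)
  ultimately show ?thesis using that by blast
qed

lemma continuous_on_open_less:
  assumes "continuous_on U (h :: complex \<Rightarrow> complex)" "open U"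
  shows "open {z \<in> U. b < norm (h z)}"
proof -
  have "open (U \<inter> h -` {w. b < norm w})"
    using assms by (intro continuous_open_preimage open_Collect_less continuous_intros) auto
  then show ?thesis by (simp add: vimage_def Int_def)
qed

text \<open>Near a zero in \<open>X\<close>, which must be a marked point \<open>c\<close>,
  \<open>h\<close> is a power of \<open>z - c\<close> times a nonvanishing function, and the weight
  is at most the distance to \<open>c\<close>. By compactness one exponent and one constant serve
  for all of \<open>X\<close>.\<close>

lemma finite_order_lower_bound:
  assumes X: "compact X" "X \<subseteq> U" "open U" and h: "h holomorphic_on U" and M: "finite M"
    and nz: "\<And>z. z \<in> X - M \<Longrightarrow> h z \<noteq> 0"
    and nc: "\<And>c r. c \<in> X \<Longrightarrow> r > 0 \<Longrightarrow> \<exists>z\<in>ball c r. h z \<noteq> 0"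
  obtains W e m where "open W" "X \<subseteq> W" "W \<subseteq> U" "e > 0" "\<And>z. z \<in> W \<Longrightarrow> e * wt M z ^ m \<le> norm (h z)"
proof -
  have contU: "continuous_on U h" using h holomorphic_on_imp_continuous_on by blast
  have "\<exists>W e m. open W \<and> x \<in> W \<and> W \<subseteq> U \<and> e > 0 \<and> (\<forall>z\<in>W. e * wt M z ^ m \<le> norm (h z))" if x: "x \<in> X" for x
  proof (cases "h x = 0")
    case False
    define W where "W = {z \<in> U. norm (h x) / 2 < norm (h z)}"
    have "open W" unfolding W_def using contU X(3) by (rule continuous_on_open_less)
    moreover have "x \<in> W" using False x X(2) by (auto simp: W_def)
    ultimately show ?thesis using False
      by (intro exI [of _ W] exI [of _ "norm (h x) / 2"] exI [of _ 0]) (auto simp: W_def)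
  next
    case True
    then have "x \<in> M" using nz x by blast
    obtain r0 where r0: "r0 > 0" "ball x r0 \<subseteq> U" using x X by (meson open_contains_ball subsetD)
    have "\<not> h constant_on ball x r0"
      using nc [OF x r0(1)] True r0(1) unfolding constant_on_def by (metis centre_in_ball)
    then obtain g r n where g: "0 < r" "ball x r \<subseteq> ball x r0" "g holomorphic_on ball x r"
        "\<And>w. w \<in> ball x r \<Longrightarrow> h w = (w - x) ^ n * g w" "\<And>w. w \<in> ball x r \<Longrightarrow> g w \<noteq> 0"
      using holomorphic_factor_zero_nonconstant [of h "ball x r0" x] h holomorphic_on_subset r0 True
      by (metis centre_in_ball connected_ball open_ball)
    have contg: "continuous_on (ball x r) g" using g(3) holomorphic_on_imp_continuous_on by blast
    define W where "W = {z \<in> ball x r. norm (g x) / 2 < norm (g z)}"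
    have "open W" unfolding W_def using contg open_ball by (rule continuous_on_open_less)
    moreover have "x \<in> W" using g(1) g(5) [of x] by (auto simp: W_def)
    moreover have "norm (g x) / 2 * wt M z ^ n \<le> norm (h z)" if "z \<in> W" for z
    proof -
      have "wt M z ^ n \<le> norm (z - x) ^ n"
        using wt_le_dist [OF M \<open>x \<in> M\<close>, of z] wt_nonneg [OF M, of z] by (intro power_mono) (auto simp: dist_norm)
      then have "norm (g x) / 2 * wt M z ^ n \<le> norm (g z) * norm (z - x) ^ n"
        using that wt_power_nonneg [OF M] by (intro mult_mono) (auto simp: W_def)
      then show ?thesis using g(4) [of z] that by (simp add: W_def norm_mult norm_power mult.commute)
    qed
    moreover have "norm (g x) / 2 > 0" using g(1) g(5) [of x] by auto
    moreover have "W \<subseteq> U" using g(2) r0(2) by (auto simp: W_def)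
    ultimately show ?thesis by blast
  qed
  then obtain W e m where W: "\<And>x. x \<in> X \<Longrightarrow> open (W x)" "\<And>x. x \<in> X \<Longrightarrow> x \<in> W x" "\<And>x. x \<in> X \<Longrightarrow> W x \<subseteq> U"
      "\<And>x. x \<in> X \<Longrightarrow> e x > 0" "\<And>x z. x \<in> X \<Longrightarrow> z \<in> W x \<Longrightarrow> e x * wt M z ^ m x \<le> norm (h z)"
    by metis
  have "X \<subseteq> (\<Union>x\<in>X. W x)" using W(2) by blast
  then obtain F where F: "F \<subseteq> X" "finite F" "X \<subseteq> (\<Union>x\<in>F. W x)"
    using compactE_image [OF X(1), of X W] W(1) by auto
  define e0 where "e0 = Min (insert 1 (e ` F))"
  define m0 where "m0 = Max (insert 0 (m ` F))"
  show ?thesis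
  proof (rule that [of "\<Union>x\<in>F. W x" e0 m0])
    show "open (\<Union>x\<in>F. W x)" using W(1) F(1) by blast
    show "X \<subseteq> (\<Union>x\<in>F. W x)" by (rule F)
    show "(\<Union>x\<in>F. W x) \<subseteq> U" using W(3) F(1) by blast
    show "e0 > 0" unfolding e0_def using F W(4) by (subst Min_gr_iff) auto
    show "e0 * wt M z ^ m0 \<le> norm (h z)" if "z \<in> (\<Union>x\<in>F. W x)" for z
    proof -
      obtain x where x: "x \<in> F" "z \<in> W x" using \<open>z \<in> _\<close> by auto
      have "e0 \<le> e x" "m x \<le> m0" using x F(2) by (auto simp: e0_def m0_def)
      then have "e0 * wt M z ^ m0 \<le> e x * wt M z ^ m x"
        using W(4) x(1) F(1) by (intro mult_mono wt_power_mono [OF M] wt_power_nonneg [OF M]) (auto simp: less_imp_le subset_iff)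
      then show ?thesis using W(5) [of x z] x F(1) by force
    qed
  qed
qed

text \<open>Newton's iteration with frozen derivative, holomorphically dependent on the parameter.\<close>

lemma contraction_solution:
  assumes W: "open W" and \<theta>: "\<theta> holomorphic_on W" and G: "G holomorphic_on W"
    and F: "F holomorphic_on H" and H: "open H"
    and s: "\<And>z. z \<in> W \<Longrightarrow> 0 \<le> s z \<and> s z \<le> 1"
    and sub: "\<And>z. z \<in> W \<Longrightarrow> cball (\<theta> z) (s z) \<subseteq> H"
    and nz: "\<And>z. z \<in> W \<Longrightarrow> deriv F (\<theta> z) \<noteq> 0"
    and var: "\<And>z w. z \<in> W \<Longrightarrow> w \<in> cball (\<theta> z) (s z) \<Longrightarrow>
        norm (deriv F w - deriv F (\<theta> z)) \<le> 1/2 * norm (deriv F (\<theta> z))"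
    and err: "\<And>z. z \<in> W \<Longrightarrow> norm (G z - F (\<theta> z)) \<le> s z / 2 * norm (deriv F (\<theta> z))"
  obtains u where "u holomorphic_on W" "\<And>z. z \<in> W \<Longrightarrow> norm (u z) \<le> s z"
    "\<And>z. z \<in> W \<Longrightarrow> F (\<theta> z + u z) = G z"
proof -
  define D where "D z = deriv F (\<theta> z)" for z
  define T where "T z u = u - (F (\<theta> z + u) - G z) / D z" for z u
  have inH: "\<theta> z + u \<in> H" if "z \<in> W" "norm u \<le> s z" for z u
  proof -
    have "\<theta> z + u \<in> cball (\<theta> z) (s z)" using that by (simp add: dist_norm)
    then show ?thesis using sub [OF that(1)] by blast
  qed
  have contr: "norm (T z u - T z v) \<le> 1/2 * norm (u - v)" if z: "z \<in> W" and "norm u \<le> s z" "norm v \<le> s z" for z u v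
  proof (rule field_differentiable_bound [of "cball 0 (s z)" _ "\<lambda>u. 1 - deriv F (\<theta> z + u) / D z"])
    fix w :: complex assume w: "w \<in> cball 0 (s z)"
    have "(F has_field_derivative deriv F (\<theta> z + w)) (at (\<theta> z + w))"
      using inH [OF z, of w] w F H holomorphic_derivI by auto
    then have "((\<lambda>u. F (\<theta> z + u)) has_field_derivative deriv F (\<theta> z + w)) (at w)"
      by (simp add: DERIV_shift add.commute)
    then have "((\<lambda>u. F (\<theta> z + u)) has_field_derivative deriv F (\<theta> z + w)) (at w within cball 0 (s z))"
      by (rule has_field_derivative_at_within)
    then show "(T z has_field_derivative 1 - deriv F (\<theta> z + w) / D z) (at w within cball 0 (s z))"
      unfolding T_def [abs_def] using nz [OF z] by (auto intro!: derivative_eq_intros simp: D_def)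
    have "1 - deriv F (\<theta> z + w) / D z = (D z - deriv F (\<theta> z + w)) / D z"
      using nz [OF z] by (simp add: D_def diff_divide_distrib)
    then show "norm (1 - deriv F (\<theta> z + w) / D z) \<le> 1/2"
      using var [OF z, of "\<theta> z + w"] w nz [OF z]
      by (simp add: norm_divide D_def divide_le_eq dist_norm norm_minus_commute)
  qed (use that in auto)
  have T0: "norm (T z 0) \<le> s z / 2" if "z \<in> W" for z
    using err [OF that] nz [OF that] by (simp add: T_def norm_divide D_def divide_le_eq norm_minus_commute)
  have Tle: "norm (T z u) \<le> s z" if "z \<in> W" "norm u \<le> s z" for z u
  proof -
    have "norm (T z u) \<le> norm (T z u - T z 0) + norm (T z 0)"
      using norm_triangle_ineq [of "T z u - T z 0" "T z 0"] by simp
    also have "\<dots> \<le> 1/2 * s z + s z / 2"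
      using contr [OF that(1,2), of 0] T0 [OF that(1)] s [OF that(1)] that(2) by simp
    finally show ?thesis by simp
  qed
  define v where "v k z = (T z ^^ k) 0" for k z
  have v_Suc: "v (Suc k) z = T z (v k z)" for k z by (simp add: v_def)
  have v0: "v 0 z = 0" for z by (simp add: v_def)
  have v_le: "norm (v k z) \<le> s z" if "z \<in> W" for k z
  proof (induction k)
    case 0
    then show ?case using s [OF that] by (simp add: v0)
  next
    case (Suc k)
    then show ?case using Tle [OF that] by (simp add: v_Suc)
  qed
  have D_hol: "D holomorphic_on W"
    unfolding D_def
  proof (rule holomorphic_on_compose_gen [OF \<theta> holomorphic_deriv [OF F H], unfolded comp_def])
    show "\<theta> ` W \<subseteq> H" using inH [of _ 0] s by force
  qed
  have v_hol: "v k holomorphic_on W" for k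
  proof (induction k)
    case 0
    have "v 0 = (\<lambda>z. 0)" by (auto simp: v0)
    then show ?case by simp
  next
    case (Suc k)
    have "(\<lambda>z. F (\<theta> z + v k z)) holomorphic_on W"
    proof (rule holomorphic_on_compose_gen [OF _ F, unfolded comp_def])
      show "(\<lambda>z. \<theta> z + v k z) holomorphic_on W" using \<theta> Suc by (intro holomorphic_intros)
      show "(\<lambda>z. \<theta> z + v k z) ` W \<subseteq> H" using inH v_le by blast
    qed
    then have "(\<lambda>z. T z (v k z)) holomorphic_on W"
    proof -
      have "D z \<noteq> 0" if "z \<in> W" for z using nz [OF that] by (simp add: D_def)
      then show ?thesis
        unfolding T_def using Suc G D_hol \<open>(\<lambda>z. F (\<theta> z + v k z)) holomorphic_on W\<close> by (intro holomorphic_intros) auto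
    qed
    then show ?case by (simp add: v_Suc [abs_def])
  qed
  \<comment> \<open>The bound rests on \<open>s z \<le> 1\<close> and is independent of
    \<open>z\<close>; it therefore yields uniform convergence and a holomorphic limit.\<close>
  have diff_le: "norm (v (Suc k) z - v k z) \<le> (1/2) ^ k" if z: "z \<in> W" for k z
  proof (induction k)
    case 0
    then show ?case using v_le [OF z, of 1] s [OF z] by (simp add: v0)
  next
    case (Suc k)
    have "norm (v (Suc (Suc k)) z - v (Suc k) z) \<le> 1/2 * norm (v (Suc k) z - v k z)"
      unfolding v_Suc [of "Suc k"] v_Suc [of k] using v_le [OF z] Tle [OF z] by (intro contr z) (auto simp: v_Suc [symmetric])
    then show ?case using Suc by simp
  qed
  define u where "u z = (\<Sum>k. v (Suc k) z - v k z)" for z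
  have "uniform_limit W (\<lambda>n z. \<Sum>k<n. v (Suc k) z - v k z) u sequentially"
    unfolding u_def by (rule Weierstrass_m_test [of _ _ "\<lambda>k. (1/2) ^ k"]) (use diff_le in \<open>auto intro: summable_geometric\<close>)
  then have ul: "uniform_limit W v u sequentially"
  proof -
    have "(\<Sum>k<n. v (Suc k) z - v k z) = v n z" for n z
      using sum_lessThan_telescope [of "\<lambda>k. v k z" n] by (simp add: v0)
    then have "(\<lambda>n z. \<Sum>k<n. v (Suc k) z - v k z) = v" by (intro ext)
    then show ?thesis using \<open>uniform_limit W (\<lambda>n z. \<Sum>k<n. v (Suc k) z - v k z) u sequentially\<close> by simp
  qed
  have lim: "(\<lambda>k. v k z) \<longlonglongrightarrow> u z" if "z \<in> W" for z
    using ul that by (rule tendsto_uniform_limitI)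
  show ?thesis
  proof (rule that [of u])
    show "u holomorphic_on W"
    proof (rule holomorphic_uniform_sequence [OF W v_hol])
      fix x assume "x \<in> W"
      then obtain d where "d > 0" "cball x d \<subseteq> W" using W open_contains_cball by blast
      then show "\<exists>d>0. cball x d \<subseteq> W \<and> uniform_limit (cball x d) v u sequentially"
        using uniform_limit_on_subset [OF ul] by blast
    qed
    show u_le: "norm (u z) \<le> s z" if "z \<in> W" for z
      by (rule Lim_norm_ubound [OF _ lim [OF that]]) (use v_le [OF that] in auto)
    show "F (\<theta> z + u z) = G z" if z: "z \<in> W" for z
    proof -
      have "(\<lambda>k. T z (v k z) - T z (u z)) \<longlonglongrightarrow> 0"
      proof (rule Lim_null_comparison)
        show "\<forall>\<^sub>F k in sequentially. norm (T z (v k z) - T z (u z)) \<le> 1/2 * norm (v k z - u z)"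
          using contr [OF z v_le [OF z] u_le [OF z]] by simp
        show "(\<lambda>k. 1/2 * norm (v k z - u z)) \<longlonglongrightarrow> 0"
          using tendsto_norm_zero [OF LIM_zero [OF lim [OF z]]] by (simp add: tendsto_mult_right_zero)
      qed
      then have "(\<lambda>k. v (Suc k) z) \<longlonglongrightarrow> T z (u z)"
        using LIM_zero_cancel by (simp add: v_Suc)
      moreover have "(\<lambda>k. v (Suc k) z) \<longlonglongrightarrow> u z" using LIMSEQ_Suc [OF lim [OF z]] .
      ultimately have "T z (u z) = u z" by (rule LIMSEQ_unique)
      then show ?thesis using nz [OF z] by (simp add: T_def D_def)
    qed
  qed
qed

lemma near_identity_deriv:
  fixes \<theta> :: "complex \<Rightarrow> complex"
  assumes near: "\<And>x y. norm ((\<theta> x - \<theta> y) - (x - y)) \<le> 1/2 * norm (x - y)"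
    and der: "(\<theta> has_field_derivative d) (at z)"
  shows "norm (d - 1) \<le> 1/2"
proof -
  have "(\<lambda>h. (\<theta> (z + h) - \<theta> z) / h - 1) \<midarrow>0\<rightarrow> d - 1"
    using der by (intro tendsto_diff tendsto_const) (simp add: DERIV_def)
  moreover have "\<forall>\<^sub>F h in at 0. norm ((\<theta> (z + h) - \<theta> z) / h - 1) \<le> 1/2"
    unfolding eventually_at_filter
  proof (intro always_eventually allI impI)
    fix h :: complex assume h: "h \<noteq> 0"
    then have "(\<theta> (z + h) - \<theta> z) / h - 1 = ((\<theta> (z + h) - \<theta> z) - ((z + h) - z)) / h"
      by (simp add: diff_divide_distrib)
    then show "norm ((\<theta> (z + h) - \<theta> z) / h - 1) \<le> 1/2"
      using near [of "z + h" z] h by (simp add: norm_divide divide_le_eq)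
  qed
  ultimately show ?thesis by (rule Lim_norm_ubound [rotated]) simp
qed

lemma near_identity_lipschitz:
  fixes \<theta> :: "complex \<Rightarrow> complex"
  assumes "norm ((\<theta> x - \<theta> y) - (x - y)) \<le> 1/2 * norm (x - y)"
  shows "dist (\<theta> x) (\<theta> y) \<le> 3/2 * dist x y"
  using assms norm_triangle_ineq [of "(\<theta> x - \<theta> y) - (x - y)" "x - y"] by (simp add: dist_norm)

text \<open>Two Cauchy estimates, for the first derivative on radius \<open>r / 2\<close> and for
  the second on radius \<open>r / 4\<close>, followed by the mean value inequality; the constants
  multiply to 32.\<close>

lemma deriv_variation_le:
  assumes F: "F holomorphic_on G" "open G" and sub: "cball y r \<subseteq> G" and r: "r > 0"
    and B: "\<And>w. w \<in> cball y r \<Longrightarrow> norm (F w) \<le> B" and w: "w \<in> cball y (r / 4)"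
  shows "norm (deriv F w - deriv F y) \<le> 32 * B / r\<^sup>2 * norm (w - y)"
proof -
  have d1: "norm (deriv F x) \<le> 2 * B / (r / 2)" if x: "x \<in> cball y (r / 2)" for x
  proof (rule deriv_norm_le)
    have b: "ball x (r / 2) \<subseteq> cball y r"
    proof
      fix t assume "t \<in> ball x (r / 2)"
      then show "t \<in> cball y r" using x dist_triangle [of y t x] by (simp add: dist_commute)
    qed
    then show "F holomorphic_on ball x (r / 2)" using F sub holomorphic_on_subset by blast
    show "norm (F t) \<le> B" if "t \<in> ball x (r / 2)" for t using that b B by blast
  qed (use r in simp)
  have dF: "deriv F holomorphic_on G" using F by (rule holomorphic_deriv)
  have d2: "norm (deriv (deriv F) x) \<le> 2 * (2 * B / (r / 2)) / (r / 4)" if x: "x \<in> cball y (r / 4)" for x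
  proof (rule deriv_norm_le)
    have b: "ball x (r / 4) \<subseteq> cball y (r / 2)"
    proof
      fix t assume "t \<in> ball x (r / 4)"
      then show "t \<in> cball y (r / 2)" using x dist_triangle [of y t x] by (simp add: dist_commute)
    qed
    moreover have "cball y (r / 2) \<subseteq> cball y r" using r by auto
    ultimately show "deriv F holomorphic_on ball x (r / 4)" using dF sub holomorphic_on_subset by blast
    show "norm (deriv F t) \<le> 2 * B / (r / 2)" if "t \<in> ball x (r / 4)" for t using that b d1 by blast
  qed (use r in simp)
  have "norm (deriv F w - deriv F y) \<le> 2 * (2 * B / (r / 2)) / (r / 4) * norm (w - y)"
  proof (rule field_differentiable_bound [of "cball y (r / 4)"])
    fix x assume x: "x \<in> cball y (r / 4)"
    then have "x \<in> G" using sub r by auto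
    then show "(deriv F has_field_derivative deriv (deriv F) x) (at x within cball y (r / 4))"
      using dF F(2) holomorphic_derivI has_field_derivative_at_within by blast
    show "norm (deriv (deriv F) x) \<le> 2 * (2 * B / (r / 2)) / (r / 4)" using d2 [OF x] .
  qed (use r w in auto)
  then show ?thesis using r by (simp add: power2_eq_square field_simps)
qed

text \<open>The quantities are arranged so that the unknown \<open>u\<close> with
  \<open>F' (\<theta> + u) = \<theta> \<circ> \<phi> + u' \<circ> \<phi>\<close> has a controlled order of vanishing at the marked points; this
  compensates for the zeros of the derivative that one divides by.\<close>

lemma lift_perturbation:
  assumes X: "compact X" and M: "finite M" "M \<subseteq> X" and T: "open T" "X \<subseteq> T"
    and \<phi>: "\<phi> holomorphic_on T" and \<theta>: "\<theta> holomorphic_on T"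
    and nz: "\<And>z. z \<in> X - M \<Longrightarrow> deriv \<phi> z \<noteq> 0"
    and nc: "\<And>c r. c \<in> X \<Longrightarrow> r > 0 \<Longrightarrow> \<exists>z\<in>ball c r. deriv \<phi> z \<noteq> 0"
    and M': "finite M'" "\<phi> ` M \<subseteq> M'"
    and near: "\<And>x y. norm ((\<theta> x - \<theta> y) - (x - y)) \<le> 1/2 * norm (x - y)"
    and fix\<theta>: "\<And>c. c \<in> M \<Longrightarrow> \<theta> c = c"
    and O': "open O'" "\<phi> ` T \<subseteq> O'" "\<theta> holomorphic_on O'"
    and H: "open H" "\<theta> ` T \<subseteq> H" "F holomorphic_on H"
    and eq: "\<And>z. z \<in> T \<Longrightarrow> F (\<theta> z) = \<theta> (\<phi> z)"
  obtains W where "open W" "X \<subseteq> W" "W \<subseteq> T"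
    "\<And>b \<epsilon>. \<epsilon> > 0 \<Longrightarrow> \<exists>a \<delta>. \<delta> > 0 \<and> (\<forall>F' u'. F' holomorphic_on H \<and> (\<forall>w\<in>H. norm (F' w - F w) \<le> \<delta> * wt M w ^ a) \<and>
       u' holomorphic_on O' \<and> (\<forall>w\<in>O'. norm (u' w) \<le> \<delta> * wt M' w ^ a) \<longrightarrow>
       (\<exists>u. u holomorphic_on W \<and> (\<forall>z\<in>W. norm (u z) \<le> \<epsilon> * wt M z ^ b \<and> \<theta> z + u z \<in> H \<and>
          F' (\<theta> z + u z) = \<theta> (\<phi> z) + u' (\<phi> z))))"
proof -
  note wtM = wt_nonneg [OF M(1)] wt_le_1 [OF M(1)]
  obtain N where N: "compact N" "X \<subseteq> interior N" "N \<subseteq> T"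
    using compact_neighbourhood X T by metis
  have cont\<theta>: "continuous_on N \<theta>" using \<theta> N(3) holomorphic_on_imp_continuous_on holomorphic_on_subset by blast
  obtain r L where r: "r > 0" "r \<le> 1" and L: "compact L" "L \<subseteq> H" "\<And>y. y \<in> \<theta> ` N \<Longrightarrow> cball y r \<subseteq> L"
  proof (rule compact_collar [of "\<theta> ` N" H])
    show "compact (\<theta> ` N)" using cont\<theta> N(1) by (rule compact_continuous_image)
    show "\<theta> ` N \<subseteq> H" using H(2) N(3) by blast
  qed (use H in auto)
  obtain B where B: "B > 0" "\<And>w. w \<in> L \<Longrightarrow> norm (F w) \<le> B"
    using holomorphic_bounded_on_compact [OF H(3) L(1,2)] by blast
  obtain L\<phi> where L\<phi>: "L\<phi> \<ge> 1" "\<And>z c. z \<in> N \<Longrightarrow> c \<in> M \<Longrightarrow> dist (\<phi> z) (\<phi> c) \<le> L\<phi> * dist z c"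
    using holomorphic_lipschitz_at_points [OF \<phi> T(1) N(1,3) M(1)] by blast
  obtain W1 e m where W1: "open W1" "X \<subseteq> W1" "W1 \<subseteq> T" "e > 0" "\<And>z. z \<in> W1 \<Longrightarrow> e * wt M z ^ m \<le> norm (deriv \<phi> z)"
    using finite_order_lower_bound [OF X T(2,1) holomorphic_deriv [OF \<phi> T(1)] M(1) nz nc] by metis
  define W where "W = interior N \<inter> W1"
  \<comment> \<open>Differentiating \<open>F \<circ> \<theta> = \<theta> \<circ> \<phi>\<close>,
    with \<theta>' at most 3/2 at \<open>z\<close> and at least 1/2 at \<open>\<phi> z\<close> in
    modulus, turns the constant \<open>e\<close> for \<phi> into \<open>e / 3\<close> for
    \<open>F\<close>. Half of this is reserved for the perturbation of \<open>F\<close>.\<close>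
  define e0 where "e0 = e / 6"
  define C where "C = 32 * (B + 1) / r\<^sup>2"
  have e0: "e0 > 0" and C: "C > 0" using W1(4) B(1) r(1) by (auto simp: e0_def C_def)
  have W: "open W" "X \<subseteq> W" "W \<subseteq> T" "W \<subseteq> N"
    using N W1 interior_subset [of N] by (auto simp: W_def)
  have in_sets: "z \<in> T" "\<theta> z \<in> H" "\<phi> z \<in> O'" "z \<in> N" if "z \<in> W" for z
    using that W(3,4) H(2) O'(2) by blast+
  have wt\<theta>: "wt M (\<theta> z) \<le> 3/2 * wt M z" for z
  proof (rule wt_image_le [OF M(1) M(1)])
    show "dist (\<theta> z) (\<theta> c) \<le> 3/2 * dist z c" for c
      by (rule near_identity_lipschitz [where \<theta> = \<theta>, OF near])
  qed (use fix\<theta> in auto)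
  have F_lower: "2 * e0 * wt M z ^ m \<le> norm (deriv F (\<theta> z))" if z: "z \<in> W" for z
  proof -
    have zT: "z \<in> T" "\<theta> z \<in> H" "\<phi> z \<in> O'" using in_sets [OF z] by auto
    have d\<theta>: "(\<theta> has_field_derivative deriv \<theta> z) (at z)" "(\<theta> has_field_derivative deriv \<theta> (\<phi> z)) (at (\<phi> z))"
      "(\<phi> has_field_derivative deriv \<phi> z) (at z)" "(F has_field_derivative deriv F (\<theta> z)) (at (\<theta> z))"
      using zT \<theta> \<phi> T O' H holomorphic_derivI by blast+
    have "((\<lambda>z. F (\<theta> z)) has_field_derivative deriv F (\<theta> z) * deriv \<theta> z) (at z)"
      using DERIV_chain [OF d\<theta>(4) d\<theta>(1)] by (simp add: comp_def)
    moreover have "((\<lambda>z. \<theta> (\<phi> z)) has_field_derivative deriv \<theta> (\<phi> z) * deriv \<phi> z) (at z)"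
      using DERIV_chain [OF d\<theta>(2) d\<theta>(3)] by (simp add: comp_def)
    then have "((\<lambda>z. F (\<theta> z)) has_field_derivative deriv \<theta> (\<phi> z) * deriv \<phi> z) (at z)"
      by (rule has_field_derivative_transform_within_open [OF _ T(1) zT(1)]) (simp add: eq)
    ultimately have eqd: "deriv F (\<theta> z) * deriv \<theta> z = deriv \<theta> (\<phi> z) * deriv \<phi> z"
      by (rule DERIV_unique)
    have a: "norm (deriv \<theta> z) \<le> 3/2" "norm (deriv \<theta> (\<phi> z)) \<ge> 1/2"
      using near_identity_deriv [where \<theta> = \<theta>, OF near d\<theta>(1)] near_identity_deriv [where \<theta> = \<theta>, OF near d\<theta>(2)]
        norm_triangle_ineq [of "deriv \<theta> z - 1" 1] norm_triangle_ineq2 [of 1 "1 - deriv \<theta> (\<phi> z)"]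
      by (auto simp: norm_minus_commute)
    have "e * wt M z ^ m \<le> norm (deriv \<phi> z)" using W1(5) z by (auto simp: W_def)
    then have "1/2 * (e * wt M z ^ m) \<le> norm (deriv \<theta> (\<phi> z)) * norm (deriv \<phi> z)"
      using a(2) W1(4) wt_power_nonneg [OF M(1)] by (intro mult_mono) auto
    also have "\<dots> = norm (deriv F (\<theta> z)) * norm (deriv \<theta> z)"
      using arg_cong [OF eqd, of norm] by (simp add: norm_mult)
    also have "\<dots> \<le> norm (deriv F (\<theta> z)) * (3/2)" using a(1) by (intro mult_left_mono) auto
    finally show ?thesis by (simp add: e0_def)
  qed
  have main: "\<exists>a \<delta>. \<delta> > 0 \<and> (\<forall>F' u'. F' holomorphic_on H \<and> (\<forall>w\<in>H. norm (F' w - F w) \<le> \<delta> * wt M w ^ a) \<and>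
       u' holomorphic_on O' \<and> (\<forall>w\<in>O'. norm (u' w) \<le> \<delta> * wt M' w ^ a) \<longrightarrow>
       (\<exists>u. u holomorphic_on W \<and> (\<forall>z\<in>W. norm (u z) \<le> \<epsilon> * wt M z ^ b \<and> \<theta> z + u z \<in> H \<and>
          F' (\<theta> z + u z) = \<theta> (\<phi> z) + u' (\<phi> z))))" if \<epsilon>: "\<epsilon> > 0" for b :: nat and \<epsilon> :: real
  proof -
    \<comment> \<open>The exponent is at least \<open>b\<close> for the claim, at least
      \<open>m\<close> so that the derivative of \<open>F'\<close> varies little on discs of radius
      \<open>s z\<close> compared with its own size, and positive so that \<open>u\<close> tends to
      0 at marked points.\<close>
    define \<beta> where "\<beta> = max b (m + 1)"
    define \<epsilon>' where "\<epsilon>' = min \<epsilon> (min (r / 4) (e0 / (2 * C)))"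
    have \<epsilon>': "\<epsilon>' > 0" "\<epsilon>' \<le> \<epsilon>" "\<epsilon>' \<le> r / 4" "C * \<epsilon>' \<le> e0 / 2"
    proof -
      show "\<epsilon>' > 0" using \<epsilon> r e0 C by (simp add: \<epsilon>'_def)
      show "\<epsilon>' \<le> \<epsilon>" "\<epsilon>' \<le> r / 4" by (simp_all add: \<epsilon>'_def)
      have "\<epsilon>' \<le> e0 / (2 * C)" by (simp add: \<epsilon>'_def)
      then show "C * \<epsilon>' \<le> e0 / 2" using C by (simp add: field_simps)
    qed
    define s where "s z = \<epsilon>' * wt M z ^ \<beta>" for z
    \<comment> \<open>Solving the equation calls for errors of order \<open>m + \<beta>\<close>; one
      more order offsets the loss in Cauchy's estimate for the derivative of
      \<open>F' - F\<close>.\<close>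
    define a where "a = m + \<beta> + 1"
    \<comment> \<open>The three bounds serve, in this order, to keep \<open>F'\<close> bounded on
      \<open>L\<close>, to lose at most half of the lower bound for the derivative, and to make the
      initial error admissible for the iteration.\<close>
    define \<delta> where "\<delta> = min 1 (min (e0 * r / (4 * 2 ^ a)) (\<epsilon>' * e0 / (2 * (L\<phi> ^ a + 2 ^ a))))"
    have La: "L\<phi> ^ a + 2 ^ a > 0" using L\<phi>(1) by (intro add_nonneg_pos) auto
    have \<delta>: "\<delta> > 0" "\<delta> \<le> 1" "\<delta> * (4 * 2 ^ a) \<le> e0 * r" "\<delta> * (L\<phi> ^ a + 2 ^ a) \<le> \<epsilon>' * e0 / 2"
    proof -
      show "\<delta> > 0" using e0 r \<epsilon>'(1) La by (simp add: \<delta>_def)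
      show "\<delta> \<le> 1" by (simp add: \<delta>_def)
      have "\<delta> \<le> e0 * r / (4 * 2 ^ a)" by (simp add: \<delta>_def)
      then show "\<delta> * (4 * 2 ^ a) \<le> e0 * r" by (simp add: le_divide_eq)
      have "\<delta> \<le> \<epsilon>' * e0 / (2 * (L\<phi> ^ a + 2 ^ a))" by (simp add: \<delta>_def)
      then show "\<delta> * (L\<phi> ^ a + 2 ^ a) \<le> \<epsilon>' * e0 / 2" using La by (simp add: le_divide_eq field_simps)
    qed
    have "\<exists>u. u holomorphic_on W \<and> (\<forall>z\<in>W. norm (u z) \<le> \<epsilon> * wt M z ^ b \<and> \<theta> z + u z \<in> H \<and>
          F' (\<theta> z + u z) = \<theta> (\<phi> z) + u' (\<phi> z))"
      if F': "F' holomorphic_on H" "\<forall>w\<in>H. norm (F' w - F w) \<le> \<delta> * wt M w ^ a"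
        and u': "u' holomorphic_on O'" "\<forall>w\<in>O'. norm (u' w) \<le> \<delta> * wt M' w ^ a" for F' u'
    proof -
      have ballL: "cball (\<theta> z) r \<subseteq> L" if "z \<in> W" for z using L(3) W that by blast
      have F'B: "norm (F' w) \<le> B + 1" if w: "w \<in> L" for w
      proof -
        have "norm (F' w - F w) \<le> \<delta> * wt M w ^ a" using F'(2) L(2) w by blast
        also have "\<dots> \<le> 1 * 1" using \<delta> wt_power_le_1 [OF M(1)] wt_power_nonneg [OF M(1)] by (intro mult_mono) auto
        finally show ?thesis using B(2) [OF w] norm_triangle_ineq [of "F' w - F w" "F w"] by simp
      qed
      have F'lower: "e0 * wt M z ^ m \<le> norm (deriv F' (\<theta> z))" if z: "z \<in> W" "z \<notin> M" for z
      proof -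
        define \<omega> where "\<omega> = wt M z"
        have \<omega>: "\<omega> > 0" "\<omega> \<le> 1" using wt_pos [OF M(1) z(2)] wtM by (auto simp: \<omega>_def)
        \<comment> \<open>The radius is proportional to the weight, so that the weight stays below
          \<open>2 * \<omega>\<close> on the disc around \<open>\<theta> z\<close>.\<close>
        define \<rho> where "\<rho> = r * \<omega> / 2"
        have \<rho>: "\<rho> > 0" "\<rho> \<le> r" "\<rho> \<le> \<omega> / 2" using r \<omega> mult_mono [of r 1 \<omega> 1] by (auto simp: \<rho>_def mult_le_cancel_left1 mult_le_cancel_right1)
        have b: "ball (\<theta> z) \<rho> \<subseteq> H" using ballL [OF z(1)] \<rho>(2) L(2) by (meson ball_subset_cball cball_subset_ball_iff order_trans subset_ball subset_cball)
        have "norm (deriv (\<lambda>w. F' w - F w) (\<theta> z)) \<le> 2 * (\<delta> * (2 * \<omega>) ^ a) / \<rho>"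
        proof (rule deriv_norm_le)
          show "(\<lambda>w. F' w - F w) holomorphic_on ball (\<theta> z) \<rho>"
            using F'(1) H(3) b by (intro holomorphic_intros) (auto elim: holomorphic_on_subset)
          show "norm (F' w - F w) \<le> \<delta> * (2 * \<omega>) ^ a" if w: "w \<in> ball (\<theta> z) \<rho>" for w
          proof -
            have "wt M w \<le> wt M (\<theta> z) + dist w (\<theta> z)" by (rule wt_triangle [OF M(1)])
            also have "\<dots> \<le> 3/2 * \<omega> + \<omega> / 2" using wt\<theta> [of z] w \<rho>(3) by (intro add_mono) (auto simp: \<omega>_def dist_commute)
            finally have "wt M w ^ a \<le> (2 * \<omega>) ^ a" using wtM by (intro power_mono) auto
            moreover have "norm (F' w - F w) \<le> \<delta> * wt M w ^ a" using F'(2) b w by blast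
            ultimately show ?thesis using mult_left_mono [of "wt M w ^ a" "(2 * \<omega>) ^ a" \<delta>] \<delta>(1) by linarith
          qed
        qed (rule \<rho>(1))
        also have "2 * (\<delta> * (2 * \<omega>) ^ a) / \<rho> = \<delta> * (4 * 2 ^ a) / r * \<omega> ^ (m + \<beta>)"
          using \<omega> r by (simp add: \<rho>_def a_def power_mult_distrib field_simps)
        also have "\<dots> \<le> e0 * \<omega> ^ (m + \<beta>)"
          using \<delta>(3) r \<omega> by (intro mult_right_mono) (auto simp: divide_le_eq)
        also have "\<dots> \<le> e0 * \<omega> ^ m"
          using e0 \<omega> by (intro mult_left_mono power_decreasing) auto
        finally have "norm (deriv (\<lambda>w. F' w - F w) (\<theta> z)) \<le> e0 * \<omega> ^ m" .
        moreover have "\<theta> z \<in> H" using H(2) W(3) z by blast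
        then have "deriv (\<lambda>w. F' w - F w) (\<theta> z) = deriv F' (\<theta> z) - deriv F (\<theta> z)"
          using F'(1) H holomorphic_on_imp_differentiable_at by (intro deriv_diff) blast+
        ultimately have "norm (deriv F' (\<theta> z) - deriv F (\<theta> z)) \<le> e0 * \<omega> ^ m" by simp
        then show ?thesis
          using F_lower [OF z(1)] norm_triangle_ineq2 [of "deriv F (\<theta> z)" "deriv F' (\<theta> z)"]
          by (simp add: \<omega>_def norm_minus_commute)
      qed
      have s: "0 \<le> s z" "s z \<le> r / 4" for z
      proof -
        show "0 \<le> s z" using \<epsilon>'(1) wt_power_nonneg [OF M(1)] by (simp add: s_def)
        have "s z \<le> \<epsilon>' * 1" unfolding s_def using \<epsilon>'(1) wt_power_le_1 [OF M(1)] by (intro mult_left_mono) auto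
        then show "s z \<le> r / 4" using \<epsilon>'(3) by simp
      qed
      have w\<beta>: "wt M z ^ \<beta> \<le> wt M z ^ m" "wt M z ^ \<beta> \<le> wt M z ^ b" "wt M z ^ \<beta> \<le> wt M z" "wt M z ^ a \<le> wt M z ^ m * wt M z ^ \<beta>" for z
      proof -
        show "wt M z ^ \<beta> \<le> wt M z ^ m" "wt M z ^ \<beta> \<le> wt M z ^ b"
          by (intro wt_power_mono [OF M(1)]; simp add: \<beta>_def)+
        show "wt M z ^ \<beta> \<le> wt M z" using wt_power_mono [OF M(1), of 1 \<beta> z] by (simp add: \<beta>_def)
        show "wt M z ^ a \<le> wt M z ^ m * wt M z ^ \<beta>"
          unfolding power_add [symmetric] by (intro wt_power_mono [OF M(1)]) (simp add: a_def)
      qed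
      define G where "G z = \<theta> (\<phi> z) + u' (\<phi> z)" for z
      \<comment> \<open>The derivative may vanish at marked points, so the equation is solved on
        \<open>W - M\<close> only. As \<open>u0\<close> tends to 0 there, it extends holomorphically
        by 0, and at the marked points the equation holds because all errors vanish.\<close>
      obtain u0 where u0: "u0 holomorphic_on (W - M)" "\<And>z. z \<in> W - M \<Longrightarrow> norm (u0 z) \<le> s z"
          "\<And>z. z \<in> W - M \<Longrightarrow> F' (\<theta> z + u0 z) = G z"
      proof (rule contraction_solution [of "W - M" \<theta> G F' H s])
        show "open (W - M)" using W(1) M(1) by (intro open_Diff finite_imp_closed)
        show "\<theta> holomorphic_on W - M" using \<theta> W(3) by (meson Diff_subset holomorphic_on_subset subset_trans)
        have "\<phi> holomorphic_on W - M" using \<phi> W(3) by (meson Diff_subset holomorphic_on_subset subset_trans)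
        moreover have "\<phi> ` (W - M) \<subseteq> O'" using O'(2) W(3) by blast
        ultimately show "G holomorphic_on W - M"
          unfolding G_def using holomorphic_on_compose_gen [of \<phi> "W - M" _ O', unfolded comp_def] O'(3) u'(1)
          by (intro holomorphic_on_add) auto
        fix z assume z: "z \<in> W - M"
        show "0 \<le> s z \<and> s z \<le> 1" using s [of z] r by linarith
        have sub: "cball (\<theta> z) (s z) \<subseteq> cball (\<theta> z) (r / 4)" using s(2) [of z] by (simp add: subset_cball)
        moreover have "cball (\<theta> z) (r / 4) \<subseteq> cball (\<theta> z) r" using r(1) by (simp add: subset_cball)
        ultimately show "cball (\<theta> z) (s z) \<subseteq> H" using ballL [of z] L(2) z by blast
        have low: "e0 * wt M z ^ m \<le> norm (deriv F' (\<theta> z))" using F'lower z by blast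
        have "wt M z > 0" using wt_pos [OF M(1)] z by blast
        then have "e0 * wt M z ^ m > 0" using e0 by simp
        then show "deriv F' (\<theta> z) \<noteq> 0" using low by auto
        show "norm (deriv F' w - deriv F' (\<theta> z)) \<le> 1/2 * norm (deriv F' (\<theta> z))" if w: "w \<in> cball (\<theta> z) (s z)" for w
        proof -
          have "norm (deriv F' w - deriv F' (\<theta> z)) \<le> 32 * (B + 1) / r\<^sup>2 * norm (w - \<theta> z)"
          proof (rule deriv_variation_le [OF F'(1) H(1) _ r(1)])
            show "cball (\<theta> z) r \<subseteq> H" using ballL [of z] L(2) z by blast
            show "norm (F' t) \<le> B + 1" if "t \<in> cball (\<theta> z) r" for t using that ballL [of z] z F'B by blast
            show "w \<in> cball (\<theta> z) (r / 4)" using w sub by blast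
          qed
          also have "\<dots> \<le> C * s z"
            unfolding C_def [symmetric] using w C by (intro mult_left_mono) (auto simp: dist_norm norm_minus_commute)
          also have "\<dots> = (C * \<epsilon>') * wt M z ^ \<beta>" by (simp add: s_def)
          also have "\<dots> \<le> (e0 / 2) * wt M z ^ m"
            using \<epsilon>'(4) w\<beta>(1) [of z] e0 wt_power_nonneg [OF M(1)] by (intro mult_mono) auto
          finally show ?thesis using low by simp
        qed
        show "norm (G z - F' (\<theta> z)) \<le> s z / 2 * norm (deriv F' (\<theta> z))"
        proof -
          have zz: "z \<in> T" "\<theta> z \<in> H" "\<phi> z \<in> O'" "z \<in> N" using in_sets [of z] z by auto
          have "G z - F' (\<theta> z) = u' (\<phi> z) - (F' (\<theta> z) - F (\<theta> z))" using eq [OF zz(1)] by (simp add: G_def)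
          then have "norm (G z - F' (\<theta> z)) \<le> norm (u' (\<phi> z)) + norm (F' (\<theta> z) - F (\<theta> z))"
            by (metis norm_triangle_ineq4)
          also have "\<dots> \<le> \<delta> * wt M' (\<phi> z) ^ a + \<delta> * wt M (\<theta> z) ^ a"
            using u'(2) F'(2) zz by (intro add_mono) auto
          also have "\<dots> \<le> \<delta> * (L\<phi> * wt M z) ^ a + \<delta> * (2 * wt M z) ^ a"
          proof -
            have "wt M' (\<phi> z) \<le> L\<phi> * wt M z"
              using M' L\<phi> zz by (intro wt_image_le M(1)) auto
            moreover have "wt M (\<theta> z) \<le> 2 * wt M z" using wt\<theta> [of z] wtM(1) [of z] by linarith
            ultimately show ?thesis
              using \<delta>(1) wt_nonneg [OF M'(1)] wtM(1) by (intro add_mono mult_left_mono power_mono) auto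
          qed
          also have "\<dots> = \<delta> * (L\<phi> ^ a + 2 ^ a) * wt M z ^ a" by (simp add: power_mult_distrib algebra_simps)
          also have "\<dots> \<le> (\<epsilon>' * e0 / 2) * (wt M z ^ m * wt M z ^ \<beta>)"
            using \<delta>(4) w\<beta>(4) [of z] \<epsilon>'(1) e0 wt_power_nonneg [OF M(1)] by (intro mult_mono) auto
          also have "\<dots> = s z / 2 * (e0 * wt M z ^ m)" by (simp add: s_def)
          also have "\<dots> \<le> s z / 2 * norm (deriv F' (\<theta> z))" using s(1) [of z] low by (intro mult_left_mono) auto
          finally show ?thesis .
        qed
      qed (use F' H in auto)
      define u where "u z = (if z \<in> M then 0 else u0 z)" for z
      have u_le: "norm (u z) \<le> s z" if "z \<in> W" for z
        using u0(2) [of z] s(1) [of z] that by (auto simp: u_def)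
      have "u holomorphic_on W"
      proof (rule no_isolated_singularity' [of M])
        have "u holomorphic_on (W - M) \<longleftrightarrow> u0 holomorphic_on (W - M)"
          by (rule holomorphic_cong) (auto simp: u_def)
        then show "u holomorphic_on (W - M)" using u0(1) by simp
        fix c assume c: "c \<in> M"
        have "(u \<longlongrightarrow> 0) (at c within W)"
        proof (rule Lim_null_comparison)
          show "\<forall>\<^sub>F z in at c within W. norm (u z) \<le> \<epsilon>' * dist z c"
            unfolding eventually_at_filter
          proof (intro always_eventually allI impI)
            fix z assume "z \<in> W"
            then have "norm (u z) \<le> \<epsilon>' * wt M z ^ \<beta>" using u_le by (simp add: s_def)
            also have "\<dots> \<le> \<epsilon>' * dist z c"
              using \<epsilon>'(1) order_trans [OF w\<beta>(3) wt_le_dist [OF M(1) c]] by (intro mult_left_mono) auto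
            finally show "norm (u z) \<le> \<epsilon>' * dist z c" .
          qed
          show "((\<lambda>z. \<epsilon>' * dist z c) \<longlongrightarrow> 0) (at c within W)" by (auto intro!: tendsto_eq_intros)
        qed
        then show "(u \<longlongrightarrow> u c) (at c within W)" using c by (simp add: u_def)
      qed (use W M in auto)
      moreover have "norm (u z) \<le> \<epsilon> * wt M z ^ b \<and> \<theta> z + u z \<in> H \<and> F' (\<theta> z + u z) = \<theta> (\<phi> z) + u' (\<phi> z)" if z: "z \<in> W" for z
      proof (intro conjI)
        have "s z \<le> \<epsilon> * wt M z ^ b"
          unfolding s_def using \<epsilon>' w\<beta>(2) [of z] \<epsilon> wt_power_nonneg [OF M(1)] by (intro mult_mono) auto
        then show "norm (u z) \<le> \<epsilon> * wt M z ^ b" using u_le [OF z] by linarith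
        have "\<theta> z + u z \<in> cball (\<theta> z) r" using u_le [OF z] s(2) [of z] r(1) by (simp add: dist_norm)
        then show "\<theta> z + u z \<in> H" using ballL [OF z] L(2) by blast
        show "F' (\<theta> z + u z) = \<theta> (\<phi> z) + u' (\<phi> z)"
        proof (cases "z \<in> M")
          case False
          then show ?thesis using u0(3) [of z] z by (simp add: u_def G_def)
        next
          case True
          have zz: "z \<in> T" "z \<in> H" "\<phi> z \<in> O'" using in_sets [OF z] fix\<theta> [OF True] by auto
          have "wt M z ^ a = 0" "wt M' (\<phi> z) ^ a = 0"
            using wt_zero [OF M(1) True] wt_zero [OF M'(1), of "\<phi> z"] M'(2) True by (auto simp: a_def)
          then have "norm (F' z - F z) \<le> 0" "norm (u' (\<phi> z)) \<le> 0"
            using F'(2) u'(2) zz by (metis mult_zero_right)+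
          then show ?thesis using eq [OF zz(1)] True fix\<theta> [OF True] by (simp add: u_def)
        qed
      qed
      ultimately show ?thesis by blast
    qed
    then show ?thesis using \<delta>(1) by blast
  qed
  show ?thesis by (rule that [OF W(1-3) main])
qed

section \<open>Perturbation of iterates and of several sets at once\<close>

lemma funpow_holomorphic:
  assumes "\<And>i w. i < k \<Longrightarrow> w \<in> H \<Longrightarrow> (f ^^ i) w \<in> G i" "\<And>i. i < k \<Longrightarrow> f holomorphic_on G i"
  shows "(f ^^ k) holomorphic_on H"
  using assms
proof (induction k)
  case 0
  then show ?case by (simp add: holomorphic_on_id id_def)
next
  case (Suc k)
  have "f \<circ> (f ^^ k) holomorphic_on H"
  proof (rule holomorphic_on_compose_gen)
    show "(f ^^ k) holomorphic_on H" using Suc.prems by (intro Suc.IH) auto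
    show "f holomorphic_on G k" "(f ^^ k) ` H \<subseteq> G k" using Suc.prems by auto
  qed
  then show ?case by (simp add: comp_def)
qed

text \<open>The error of a single step vanishes at the images of \<open>M\<close> along the orbit.
  Since the iterates are Lipschitz at marked points, the weight at an iterate of \<open>w\<close> is
  at most a constant times \<open>wt M w\<close>, and the accumulated error keeps the factor
  \<open>wt M w ^ a\<close>; \<open>a \<ge> 1\<close> lets the displacement of the orbit itself be
  dominated by \<open>wt M w\<close>. The neighbourhood \<open>H\<close> is chosen before
  \<open>a\<close> and \<delta>.\<close>

lemma iterate_perturbation:
  fixes f :: "complex \<Rightarrow> complex"
  assumes Y: "compact Y" "finite M" "M \<subseteq> Y"
    and G: "\<And>i. i < k \<Longrightarrow> open (G i)" "\<And>i. i < k \<Longrightarrow> f holomorphic_on G i" "\<And>i. i < k \<Longrightarrow> (f ^^ i) ` Y \<subseteq> G i"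
  shows "\<exists>H. open H \<and> Y \<subseteq> H \<and> (\<forall>i<k. \<forall>w\<in>H. (f ^^ i) w \<in> G i) \<and>
    (\<forall>a \<delta>. a \<ge> 1 \<longrightarrow> \<delta> > 0 \<longrightarrow> (\<exists>\<delta>'>0. \<forall>F.
       (\<forall>i<k. \<forall>w\<in>G i. norm (F w - f w) \<le> \<delta>' * wt (\<Union>i<k. (f ^^ i) ` M) w ^ a) \<longrightarrow>
       (\<forall>w\<in>H. (\<forall>i<k. (F ^^ i) w \<in> G i) \<and> norm ((F ^^ k) w - (f ^^ k) w) \<le> \<delta> * wt M w ^ a)))"
  using G
proof (induction k)
  case 0
  show ?case
    by (rule exI [of _ UNIV]) (use wt_nonneg [OF Y(2)] zero_less_one in \<open>auto intro!: exI [of _ "1::real"]\<close>)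
next
  case (Suc k)
  have "\<exists>H. open H \<and> Y \<subseteq> H \<and> (\<forall>i<k. \<forall>w\<in>H. (f ^^ i) w \<in> G i) \<and>
    (\<forall>a \<delta>. a \<ge> 1 \<longrightarrow> \<delta> > 0 \<longrightarrow> (\<exists>\<delta>'>0. \<forall>F.
       (\<forall>i<k. \<forall>w\<in>G i. norm (F w - f w) \<le> \<delta>' * wt (\<Union>i<k. (f ^^ i) ` M) w ^ a) \<longrightarrow>
       (\<forall>w\<in>H. (\<forall>i<k. (F ^^ i) w \<in> G i) \<and> norm ((F ^^ k) w - (f ^^ k) w) \<le> \<delta> * wt M w ^ a)))"
    using Suc.prems by (intro Suc.IH) auto
  then obtain H where H: "open H" "Y \<subseteq> H" "\<And>i w. i < k \<Longrightarrow> w \<in> H \<Longrightarrow> (f ^^ i) w \<in> G i"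
    and step: "\<And>a \<delta>. a \<ge> 1 \<Longrightarrow> \<delta> > 0 \<Longrightarrow> \<exists>\<delta>'>0. \<forall>F.
       (\<forall>i<k. \<forall>w\<in>G i. norm (F w - f w) \<le> \<delta>' * wt (\<Union>i<k. (f ^^ i) ` M) w ^ a) \<longrightarrow>
       (\<forall>w\<in>H. (\<forall>i<k. (F ^^ i) w \<in> G i) \<and> norm ((F ^^ k) w - (f ^^ k) w) \<le> \<delta> * wt M w ^ a)"
    by metis
  define MM where "MM j = (\<Union>i<j. (f ^^ i) ` M)" for j
  have finMM: "finite (MM j)" for j unfolding MM_def using Y(2) by auto
  have hol_k: "(f ^^ k) holomorphic_on H"
    by (rule funpow_holomorphic [of k H f G]) (use H Suc.prems in auto)
  then have cont_k: "continuous_on H (f ^^ k)" by (rule holomorphic_on_imp_continuous_on)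
  obtain r L where r: "r > 0" "r \<le> 1" and L: "compact L" "L \<subseteq> G k" "\<And>y. y \<in> (f ^^ k) ` Y \<Longrightarrow> cball y r \<subseteq> L"
  proof (rule compact_collar [of "(f ^^ k) ` Y" "G k"])
    show "compact ((f ^^ k) ` Y)"
      using continuous_on_subset [OF cont_k H(2)] Y(1) by (rule compact_continuous_image)
  qed (use Suc.prems in auto)
  obtain B where B: "B > 0" "\<And>z. z \<in> L \<Longrightarrow> norm (f z) \<le> B"
    using holomorphic_bounded_on_compact [OF Suc.prems(2) L(1,2)] by auto
  obtain N where N: "compact N" "Y \<subseteq> interior N" "N \<subseteq> H"
    using compact_neighbourhood [OF Y(1) H(1,2)] by blast
  obtain L1 where L1: "L1 \<ge> 1" "\<And>z c. z \<in> N \<Longrightarrow> c \<in> M \<Longrightarrow> dist ((f ^^ k) z) ((f ^^ k) c) \<le> L1 * dist z c"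
    using holomorphic_lipschitz_at_points [OF hol_k H(1) N(1,3) Y(2)] by blast
  \<comment> \<open>Points of \<open>H'\<close> have their \<open>k\<close>-th iterate within
    \<open>r / 4\<close> of the image of \<open>Y\<close>, which leaves a disc of radius
    \<open>r / 2\<close> inside \<open>L\<close> for the perturbed orbit and for the bound on the
    derivative of \<open>f\<close>.\<close>
  define H' where "H' = interior N \<inter> (H \<inter> (f ^^ k) -` (\<Union>y\<in>(f ^^ k) ` Y. ball y (r / 4)))"
  have H'_open: "open H'"
    unfolding H'_def using cont_k H(1) by (intro open_Int open_interior continuous_open_preimage open_UN) auto
  have H'_sub: "Y \<subseteq> H'" "H' \<subseteq> H" "H' \<subseteq> N"
  proof -
    have "(f ^^ k) y \<in> (\<Union>y\<in>(f ^^ k) ` Y. ball y (r / 4))" if "y \<in> Y" for y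
      using that r(1) by (intro UN_I [of "(f ^^ k) y"]) auto
    then show "Y \<subseteq> H'" unfolding H'_def
      by (intro subsetI IntI vimageI2 subsetD [OF N(2)] subsetD [OF H(2)])
    show "H' \<subseteq> H" "H' \<subseteq> N" using interior_subset [of N] by (auto simp: H'_def)
  qed
  have near: "cball ((f ^^ k) w) (r / 2) \<subseteq> L" "(f ^^ k) w \<in> L" if w: "w \<in> H'" for w
  proof -
    obtain y where y: "y \<in> (f ^^ k) ` Y" "(f ^^ k) w \<in> ball y (r / 4)" using w by (auto simp: H'_def)
    have "cball ((f ^^ k) w) (r / 2) \<subseteq> cball y r"
    proof
      fix t assume "t \<in> cball ((f ^^ k) w) (r / 2)"
      then show "t \<in> cball y r" using y(2) dist_triangle [of y t "(f ^^ k) w"] r(1) by simp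
    qed
    then show "cball ((f ^^ k) w) (r / 2) \<subseteq> L" using L(3) [OF y(1)] by blast
    then show "(f ^^ k) w \<in> L" using r(1) by auto
  qed
  define C where "C = 8 * B / r"
  have C: "C > 0" using B r by (simp add: C_def)
  have lip: "norm (f v - f ((f ^^ k) w)) \<le> C * norm (v - (f ^^ k) w)"
    if w: "w \<in> H'" and v: "v \<in> cball ((f ^^ k) w) (r / 4)" for v w
  proof (rule field_differentiable_bound [of "cball ((f ^^ k) w) (r / 4)"])
    fix x assume x: "x \<in> cball ((f ^^ k) w) (r / 4)"
    have sub: "ball x (r / 4) \<subseteq> L"
    proof
      fix t assume "t \<in> ball x (r / 4)"
      then have "t \<in> cball ((f ^^ k) w) (r / 2)" using x dist_triangle [of "(f ^^ k) w" t x] by simp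
      then show "t \<in> L" using near(1) [OF w] by blast
    qed
    have "x \<in> L" using sub r(1) by auto
    then show "(f has_field_derivative deriv f x) (at x within cball ((f ^^ k) w) (r / 4))"
      using L(2) Suc.prems(1,2) [of k] holomorphic_derivI has_field_derivative_at_within by blast
    have "norm (deriv f x) \<le> 2 * B / (r / 4)"
    proof (rule deriv_norm_le)
      show "f holomorphic_on ball x (r / 4)" using sub L(2) Suc.prems(2) [of k] holomorphic_on_subset by blast
    qed (use sub B r in auto)
    then show "norm (deriv f x) \<le> C" by (simp add: C_def)
  qed (use v r in auto)
  have main: "\<exists>\<delta>'>0. \<forall>F.
       (\<forall>i<Suc k. \<forall>w\<in>G i. norm (F w - f w) \<le> \<delta>' * wt (MM (Suc k)) w ^ a) \<longrightarrow>
       (\<forall>w\<in>H'. (\<forall>i<Suc k. (F ^^ i) w \<in> G i) \<and> norm ((F ^^ Suc k) w - (f ^^ Suc k) w) \<le> \<delta> * wt M w ^ a)"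
    if a: "a \<ge> 1" and \<delta>: "\<delta> > 0" for a :: nat and \<delta> :: real
  proof -
    \<comment> \<open>Half of \<delta> is allotted to the deviation from the first \<open>k\<close>
      steps, magnified by at most \<open>C\<close> in the last step, and the other half to the error
      committed in the last step.\<close>
    define \<delta>1 where "\<delta>1 = min (\<delta> / (2 * C)) (r / 4)"
    have \<delta>1: "\<delta>1 > 0" "\<delta>1 \<le> r / 4" "C * \<delta>1 \<le> \<delta> / 2"
    proof -
      show "\<delta>1 > 0" "\<delta>1 \<le> r / 4" using \<delta> C r by (simp_all add: \<delta>1_def)
      have "\<delta>1 \<le> \<delta> / (2 * C)" by (simp add: \<delta>1_def)
      then show "C * \<delta>1 \<le> \<delta> / 2" using C by (simp add: field_simps)
    qed
    obtain \<delta>2 where \<delta>2: "\<delta>2 > 0" "\<And>F. (\<forall>i<k. \<forall>w\<in>G i. norm (F w - f w) \<le> \<delta>2 * wt (MM k) w ^ a) \<Longrightarrow>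
       (\<forall>w\<in>H. (\<forall>i<k. (F ^^ i) w \<in> G i) \<and> norm ((F ^^ k) w - (f ^^ k) w) \<le> \<delta>1 * wt M w ^ a)"
      using step [OF a \<delta>1(1)] unfolding MM_def by blast
    define \<delta>' where "\<delta>' = min \<delta>2 (\<delta> / (2 * (L1 + 1) ^ a))"
    have L1a: "(L1 + 1) ^ a > 0" using L1(1) by simp
    have \<delta>': "\<delta>' > 0" "\<delta>' \<le> \<delta>2" "\<delta>' * (L1 + 1) ^ a \<le> \<delta> / 2"
    proof -
      show "\<delta>' > 0" "\<delta>' \<le> \<delta>2" using \<delta> \<delta>2 L1a by (simp_all add: \<delta>'_def)
      have "\<delta>' \<le> \<delta> / (2 * (L1 + 1) ^ a)" by (simp add: \<delta>'_def)
      then show "\<delta>' * (L1 + 1) ^ a \<le> \<delta> / 2" using L1a by (simp add: field_simps)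
    qed
    have "(\<forall>i<Suc k. (F ^^ i) w \<in> G i) \<and> norm ((F ^^ Suc k) w - (f ^^ Suc k) w) \<le> \<delta> * wt M w ^ a"
      if F: "\<forall>i<Suc k. \<forall>w\<in>G i. norm (F w - f w) \<le> \<delta>' * wt (MM (Suc k)) w ^ a" and w: "w \<in> H'" for F w
    proof -
      have "norm (F v - f v) \<le> \<delta>2 * wt (MM k) v ^ a" if "i < k" "v \<in> G i" for i v
      proof -
        have "norm (F v - f v) \<le> \<delta>' * wt (MM (Suc k)) v ^ a" using F that less_SucI by blast
        also have "\<dots> \<le> \<delta>2 * wt (MM k) v ^ a"
        proof (intro mult_mono power_mono)
          show "wt (MM (Suc k)) v \<le> wt (MM k) v" by (intro wt_subset finMM) (auto simp: MM_def lessThan_Suc)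
        qed (use \<delta>' \<delta>2 wt_nonneg [OF finMM] in auto)
        finally show ?thesis .
      qed
      then have IH: "\<And>i. i < k \<Longrightarrow> (F ^^ i) w \<in> G i" "norm ((F ^^ k) w - (f ^^ k) w) \<le> \<delta>1 * wt M w ^ a"
        using \<delta>2(2) [of F] w H'_sub(2) by blast+
      let ?x = "(f ^^ k) w" and ?y = "(F ^^ k) w"
      have d: "norm (?y - ?x) \<le> \<delta>1"
        using IH(2) mult_left_mono [OF wt_power_le_1 [OF Y(2), of w a], of \<delta>1] \<delta>1(1) by linarith
      have yb: "?y \<in> cball ?x (r / 4)" using d \<delta>1(2) by (simp add: dist_norm norm_minus_commute)
      moreover have "cball ?x (r / 4) \<subseteq> cball ?x (r / 2)" using r by (simp add: subset_cball)
      ultimately have yG: "?y \<in> G k" using near(1) [OF w] L(2) by blast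
      have t1: "norm (F ?y - f ?y) \<le> \<delta> / 2 * wt M w ^ a"
      proof -
        have "wt (MM (Suc k)) ?y \<le> wt (MM (Suc k)) ?x + dist ?y ?x" by (rule wt_triangle [OF finMM])
        also have "\<dots> \<le> L1 * wt M w + wt M w"
        proof (rule add_mono)
          show "wt (MM (Suc k)) ?x \<le> L1 * wt M w"
            using L1 w H'_sub(3) by (intro wt_image_le Y(2) finMM) (auto simp: MM_def)
          have "dist ?y ?x \<le> \<delta>1 * wt M w ^ a" using IH(2) by (simp add: dist_norm)
          also have "\<dots> \<le> 1 * wt M w ^ 1"
            using \<delta>1 r a wt_nonneg [OF Y(2)] by (intro mult_mono wt_power_mono [OF Y(2)]) auto
          finally show "dist ?y ?x \<le> wt M w" by simp
        qed
        finally have "wt (MM (Suc k)) ?y ^ a \<le> ((L1 + 1) * wt M w) ^ a"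
          using wt_nonneg [OF finMM] by (intro power_mono) (auto simp: algebra_simps)
        then have "\<delta>' * wt (MM (Suc k)) ?y ^ a \<le> \<delta>' * ((L1 + 1) * wt M w) ^ a"
          using \<delta>'(1) by (intro mult_left_mono) auto
        also have "\<dots> = (\<delta>' * (L1 + 1) ^ a) * wt M w ^ a" by (simp add: power_mult_distrib)
        also have "\<dots> \<le> \<delta> / 2 * wt M w ^ a"
          using \<delta>'(3) wt_power_nonneg [OF Y(2)] by (intro mult_right_mono) auto
        finally show ?thesis using F yG by force
      qed
      have t2: "norm (f ?y - f ?x) \<le> \<delta> / 2 * wt M w ^ a"
      proof -
        have "norm (f ?y - f ?x) \<le> C * norm (?y - ?x)" by (rule lip [OF w yb])
        also have "\<dots> \<le> C * (\<delta>1 * wt M w ^ a)" using IH(2) C by (intro mult_left_mono) auto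
        also have "\<dots> = (C * \<delta>1) * wt M w ^ a" by simp
        also have "\<dots> \<le> \<delta> / 2 * wt M w ^ a"
          using \<delta>1(3) wt_power_nonneg [OF Y(2)] by (intro mult_right_mono) auto
        finally show ?thesis .
      qed
      have "(F ^^ Suc k) w - (f ^^ Suc k) w = (F ?y - f ?y) + (f ?y - f ?x)" by simp
      then have "norm ((F ^^ Suc k) w - (f ^^ Suc k) w) \<le> norm (F ?y - f ?y) + norm (f ?y - f ?x)"
        by (metis norm_triangle_ineq)
      also have "\<dots> \<le> \<delta> * wt M w ^ a" using t1 t2 by simp
      finally show ?thesis using IH(1) yG by (auto simp: less_Suc_eq)
    qed
    then show ?thesis using \<delta>'(1) by blast
  qed
  have "(f ^^ i) w \<in> G i" if "i < Suc k" "w \<in> H'" for i w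
    using that H(3) H'_sub(2) near(2) L(2) by (auto simp: less_Suc_eq)
  then show ?case
    using H'_open H'_sub(1) main unfolding MM_def by blast
qed

text \<open>The sets are treated in the order \<open>N, N - 1, \<dots>, 0\<close>: the perturbation of \<open>\<theta>\<close> near \<open>X (Suc n)\<close>
  enters the equation that determines the perturbation near \<open>X n\<close>.\<close>

lemma simultaneous_perturbation:
  fixes X M :: "nat \<Rightarrow> complex set" and f :: "complex \<Rightarrow> complex" and k :: "nat \<Rightarrow> nat"
  assumes X: "\<And>n. n \<le> N \<Longrightarrow> compact (X n)" "\<And>n. n \<le> N \<Longrightarrow> \<phi> ` X n \<subseteq> X (Suc n)"
    and M: "\<And>n. finite (M n)" "\<And>n. n \<le> N \<Longrightarrow> M n \<subseteq> X n" "\<And>n. n \<le> N \<Longrightarrow> \<phi> ` M n \<subseteq> M (Suc n)"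
    and nz: "\<And>n z. n \<le> N \<Longrightarrow> z \<in> X n - M n \<Longrightarrow> deriv \<phi> z \<noteq> 0"
    and nc: "\<And>n c r. n \<le> N \<Longrightarrow> c \<in> X n \<Longrightarrow> r > 0 \<Longrightarrow> \<exists>z\<in>ball c r. deriv \<phi> z \<noteq> 0"
    and near: "\<And>x y. norm ((\<theta> x - \<theta> y) - (x - y)) \<le> 1/2 * norm (x - y)"
    and fix\<theta>: "\<And>n c. n \<le> N \<Longrightarrow> c \<in> M n \<Longrightarrow> \<theta> c = c"
    and T: "\<And>n. n \<le> Suc N \<Longrightarrow> open (T n)" "\<And>n. n \<le> Suc N \<Longrightarrow> X n \<subseteq> T n" "\<And>n. n \<le> Suc N \<Longrightarrow> \<theta> holomorphic_on T n"
    and \<phi>: "\<And>n. n \<le> N \<Longrightarrow> \<phi> holomorphic_on T n"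
    and G: "\<And>n i. n \<le> N \<Longrightarrow> i < k n \<Longrightarrow> open (G n i)" "\<And>n i. n \<le> N \<Longrightarrow> i < k n \<Longrightarrow> f holomorphic_on G n i"
      "\<And>n i. n \<le> N \<Longrightarrow> i < k n \<Longrightarrow> (f ^^ i) ` \<theta> ` X n \<subseteq> G n i"
    and eq: "\<And>n z. n \<le> N \<Longrightarrow> z \<in> T n \<Longrightarrow> (f ^^ k n) (\<theta> z) = \<theta> (\<phi> z)"
  defines "Mk \<equiv> (\<Union>n\<le>N. \<Union>i<k n. (f ^^ i) ` M n)"
  shows "\<exists>W. (\<forall>n\<le>N. open (W n) \<and> X n \<subseteq> W n \<and> W n \<subseteq> T n \<and> (n < N \<longrightarrow> \<phi> ` W n \<subseteq> W (Suc n))) \<and>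
    (\<forall>\<epsilon>>0. \<exists>a \<delta>. \<delta> > 0 \<and> (\<forall>F. (\<forall>n\<le>N. \<forall>i<k n. F holomorphic_on G n i \<and> (\<forall>w\<in>G n i. norm (F w - f w) \<le> \<delta> * wt Mk w ^ a)) \<longrightarrow>
       (\<exists>u. \<forall>n\<le>N. u n holomorphic_on W n \<and> (\<forall>z\<in>W n. norm (u n z) \<le> \<epsilon> \<and> (z \<in> M n \<longrightarrow> u n z = 0) \<and>
          (\<forall>i<k n. (F ^^ i) (\<theta> z + u n z) \<in> G n i) \<and>
          (F ^^ k n) (\<theta> z + u n z) = \<theta> (\<phi> z) + (if n = N then 0 else u (Suc n) (\<phi> z))))))"
proof -
  define close where "close F a \<delta> \<longleftrightarrow> (\<forall>n\<le>N. \<forall>i<k n. F holomorphic_on G n i \<and> (\<forall>w\<in>G n i. norm (F w - f w) \<le> \<delta> * wt Mk w ^ a))"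
    for F and a :: nat and \<delta> :: real
  have finMk: "finite Mk" unfolding Mk_def using M(1) by auto
  have close_mono: "close F a' \<delta>'" if "close F a \<delta>" "a' \<le> a" "\<delta> \<le> \<delta>'" "\<delta>' \<ge> 0" for F a \<delta> a' \<delta>'
  proof -
    have "\<delta> * wt Mk w ^ a \<le> \<delta>' * wt Mk w ^ a'" for w
      using that wt_power_nonneg [OF finMk] by (intro mult_mono wt_power_mono [OF finMk]) auto
    then show ?thesis using that(1) unfolding close_def by (meson order_trans)
  qed
  define good where "good j W \<longleftrightarrow> (\<forall>n. j \<le> n \<and> n \<le> N \<longrightarrow> open (W n) \<and> X n \<subseteq> W n \<and> W n \<subseteq> T n \<and> (n < N \<longrightarrow> \<phi> ` W n \<subseteq> W (Suc n)))"
    for j and W :: "nat \<Rightarrow> complex set"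
  \<comment> \<open>The order \<open>b\<close> at which \<open>u n\<close> vanishes on
    \<open>M n\<close> is kept arbitrary, because the equation at the preceding set prescribes the
    order it needs.\<close>
  define sol where "sol F W u b \<epsilon> n \<longleftrightarrow> u n holomorphic_on W n \<and> (\<forall>z\<in>W n. norm (u n z) \<le> \<epsilon> * wt (M n) z ^ b \<and>
          (\<forall>i<k n. (F ^^ i) (\<theta> z + u n z) \<in> G n i) \<and>
          (F ^^ k n) (\<theta> z + u n z) = \<theta> (\<phi> z) + (if n = N then 0 else u (Suc n) (\<phi> z)))"
    for F :: "complex \<Rightarrow> complex" and W :: "nat \<Rightarrow> complex set" and u :: "nat \<Rightarrow> complex \<Rightarrow> complex" and b :: nat and \<epsilon> :: real and n
  have sol_mono: "sol F W u b' \<epsilon>' n" if "sol F W u b \<epsilon> n" "b' \<le> b" "\<epsilon> \<le> \<epsilon>'" "\<epsilon>' \<ge> 0" for F W u b \<epsilon> b' \<epsilon>' n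
  proof -
    have "\<epsilon> * wt (M n) w ^ b \<le> \<epsilon>' * wt (M n) w ^ b'" for w
      using that wt_power_nonneg [OF M(1)] by (intro mult_mono wt_power_mono [OF M(1)]) auto
    then show ?thesis using that(1) unfolding sol_def by (meson order_trans)
  qed
  \<comment> \<open>The neighbourhoods \<open>W\<close> are the same for all orders and accuracies.
    This order of quantifiers matters: cut-offs are later built on \<open>W\<close>, and they
    dictate how small the solution must be.\<close>
  have "\<exists>W. good j W \<and> (\<forall>b \<epsilon>. \<epsilon> > 0 \<longrightarrow> (\<exists>a \<delta>. \<delta> > 0 \<and> (\<forall>F. close F a \<delta> \<longrightarrow> (\<exists>u. \<forall>n. j \<le> n \<and> n \<le> N \<longrightarrow> sol F W u b \<epsilon> n))))"
    if "j \<le> Suc N" for j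
    using that
  proof (induction j rule: inc_induct)
    case base
    show ?case
      by (intro exI [of _ T] conjI allI impI exI [of _ "0::nat"] exI [of _ "1::real"]) (auto simp: good_def)
  next
    case (step j)
    then have j: "j \<le> N" by simp
    obtain W where W: "good (Suc j) W" and IH: "\<And>b \<epsilon>. \<epsilon> > 0 \<Longrightarrow>
        \<exists>a \<delta>. \<delta> > 0 \<and> (\<forall>F. close F a \<delta> \<longrightarrow> (\<exists>u. \<forall>n. Suc j \<le> n \<and> n \<le> N \<longrightarrow> sol F W u b \<epsilon> n))"
      using step.IH by blast
    \<comment> \<open>Near \<open>X (Suc N)\<close> the map \<theta> is left alone; there the
      incoming perturbation is 0 and all of \<open>T (Suc N)\<close> can serve as its
      domain.\<close>
    define O' where "O' = (if j = N then T (Suc N) else W (Suc j))"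
    have O': "open O'" "X (Suc j) \<subseteq> O'" "\<theta> holomorphic_on O'"
      using W T [of "Suc j"] j holomorphic_on_subset [of \<theta> "T (Suc j)" "W (Suc j)"] unfolding O'_def good_def by auto
    have MY: "M j \<subseteq> \<theta> ` X j"
      using M(2) [OF j] fix\<theta> [OF j] by (force simp: image_iff)
    have compY: "compact (\<theta> ` X j)"
      using T [of j] j X(1) [OF j] continuous_on_subset [OF holomorphic_on_imp_continuous_on, of \<theta> "T j" "X j"]
      by (intro compact_continuous_image) auto
    have "\<exists>H. open H \<and> \<theta> ` X j \<subseteq> H \<and> (\<forall>i<k j. \<forall>w\<in>H. (f ^^ i) w \<in> G j i) \<and>
      (\<forall>a \<delta>. a \<ge> 1 \<longrightarrow> \<delta> > 0 \<longrightarrow> (\<exists>\<delta>'>0. \<forall>F.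
       (\<forall>i<k j. \<forall>w\<in>G j i. norm (F w - f w) \<le> \<delta>' * wt (\<Union>i<k j. (f ^^ i) ` M j) w ^ a) \<longrightarrow>
       (\<forall>w\<in>H. (\<forall>i<k j. (F ^^ i) w \<in> G j i) \<and> norm ((F ^^ k j) w - (f ^^ k j) w) \<le> \<delta> * wt (M j) w ^ a)))"
      by (rule iterate_perturbation [OF compY M(1) MY]) (use G [OF j] in auto)
    then obtain H where H: "open H" "\<theta> ` X j \<subseteq> H" "\<forall>i<k j. \<forall>w\<in>H. (f ^^ i) w \<in> G j i"
      and iter: "\<forall>a \<delta>. a \<ge> 1 \<longrightarrow> \<delta> > 0 \<longrightarrow> (\<exists>\<delta>'>0. \<forall>F.
       (\<forall>i<k j. \<forall>w\<in>G j i. norm (F w - f w) \<le> \<delta>' * wt (\<Union>i<k j. (f ^^ i) ` M j) w ^ a) \<longrightarrow>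
       (\<forall>w\<in>H. (\<forall>i<k j. (F ^^ i) w \<in> G j i) \<and> norm ((F ^^ k j) w - (f ^^ k j) w) \<le> \<delta> * wt (M j) w ^ a))"
      by (elim exE conjE) (rule that)
    define T' where "T' = (T j \<inter> \<theta> -` H) \<inter> (T j \<inter> \<phi> -` O')"
    have T': "open T'" "X j \<subseteq> T'" "T' \<subseteq> T j" "\<theta> ` T' \<subseteq> H" "\<phi> ` T' \<subseteq> O'"
    proof -
      show "open T'" unfolding T'_def
        using T [of j] j \<phi> [OF j] holomorphic_on_imp_continuous_on H(1) O'(1)
        by (intro open_Int continuous_open_preimage) auto
      have "X j \<subseteq> T j" "X j \<subseteq> \<theta> -` H" "X j \<subseteq> \<phi> -` O'"
        using T(2) [of j] j H(2) order_trans [OF X(2) [OF j] O'(2)] by (simp_all add: image_subset_iff_subset_vimage)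
      then show "X j \<subseteq> T'" unfolding T'_def by (intro Int_greatest)
    qed (auto simp: T'_def)
    obtain Wj where Wj: "open Wj" "X j \<subseteq> Wj" "Wj \<subseteq> T'" and lift:
      "\<And>b \<epsilon>. \<epsilon> > 0 \<Longrightarrow> \<exists>a \<delta>. \<delta> > 0 \<and> (\<forall>F' u'. F' holomorphic_on H \<and> (\<forall>w\<in>H. norm (F' w - (f ^^ k j) w) \<le> \<delta> * wt (M j) w ^ a) \<and>
       u' holomorphic_on O' \<and> (\<forall>w\<in>O'. norm (u' w) \<le> \<delta> * wt (M (Suc j)) w ^ a) \<longrightarrow>
       (\<exists>u. u holomorphic_on Wj \<and> (\<forall>z\<in>Wj. norm (u z) \<le> \<epsilon> * wt (M j) z ^ b \<and> \<theta> z + u z \<in> H \<and>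
          F' (\<theta> z + u z) = \<theta> (\<phi> z) + u' (\<phi> z))))"
    proof (rule lift_perturbation [of "X j" "M j" T' \<phi> \<theta> "M (Suc j)" O' H "f ^^ k j"])
      show "\<phi> holomorphic_on T'" "\<theta> holomorphic_on T'"
        using T' \<phi> [OF j] T(3) [of j] j holomorphic_on_subset by auto
      show "(f ^^ k j) holomorphic_on H"
        by (rule funpow_holomorphic [of "k j" H f "G j"]) (use H G [OF j] in auto)
    qed (use X M nz nc near fix\<theta> T' O' H eq j in \<open>auto simp: subset_iff\<close>)
    define W' where "W' = W(j := Wj)"
    have "good j W'"
      unfolding good_def
    proof (intro allI impI)
      fix n assume n: "j \<le> n \<and> n \<le> N"
      show "open (W' n) \<and> X n \<subseteq> W' n \<and> W' n \<subseteq> T n \<and> (n < N \<longrightarrow> \<phi> ` W' n \<subseteq> W' (Suc n))"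
      proof (cases "n = j")
        case True
        have "\<phi> ` Wj \<subseteq> O'" using Wj(3) T'(5) by blast
        then show ?thesis using True Wj order_trans [OF Wj(3) T'(3)] by (auto simp: W'_def O'_def split: if_splits)
      next
        case False
        then show ?thesis using W n by (auto simp: W'_def good_def)
      qed
    qed
    moreover have "\<exists>a \<delta>. \<delta> > 0 \<and> (\<forall>F. close F a \<delta> \<longrightarrow> (\<exists>u. \<forall>n. j \<le> n \<and> n \<le> N \<longrightarrow> sol F W' u b \<epsilon> n))" if \<epsilon>: "\<epsilon> > 0" for b \<epsilon>
    proof -
      obtain a1 \<delta>1 where \<delta>1: "\<delta>1 > 0" and lift1: "\<And>F' u'. F' holomorphic_on H \<Longrightarrow> (\<forall>w\<in>H. norm (F' w - (f ^^ k j) w) \<le> \<delta>1 * wt (M j) w ^ a1) \<Longrightarrow>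
         u' holomorphic_on O' \<Longrightarrow> (\<forall>w\<in>O'. norm (u' w) \<le> \<delta>1 * wt (M (Suc j)) w ^ a1) \<Longrightarrow>
         \<exists>u. u holomorphic_on Wj \<and> (\<forall>z\<in>Wj. norm (u z) \<le> \<epsilon> * wt (M j) z ^ b \<and> \<theta> z + u z \<in> H \<and>
            F' (\<theta> z + u z) = \<theta> (\<phi> z) + u' (\<phi> z))"
        using lift [OF \<epsilon>, of b] by blast
      define a2 where "a2 = max 1 a1"
      have "a2 \<ge> 1" by (simp add: a2_def)
      obtain \<delta>2 where \<delta>2: "\<delta>2 > 0" "\<forall>F. (\<forall>i<k j. \<forall>w\<in>G j i. norm (F w - f w) \<le> \<delta>2 * wt (\<Union>i<k j. (f ^^ i) ` M j) w ^ a2) \<longrightarrow>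
         (\<forall>w\<in>H. (\<forall>i<k j. (F ^^ i) w \<in> G j i) \<and> norm ((F ^^ k j) w - (f ^^ k j) w) \<le> \<delta>1 * wt (M j) w ^ a2)"
        using iter [rule_format, OF \<open>a2 \<ge> 1\<close> \<delta>1] by (elim exE conjE) (rule that)
      obtain a3 \<delta>3 where \<delta>3: "\<delta>3 > 0" "\<And>F. close F a3 \<delta>3 \<Longrightarrow> \<exists>u. \<forall>n. Suc j \<le> n \<and> n \<le> N \<longrightarrow> sol F W u (max b a1) (min \<epsilon> \<delta>1) n"
        using IH [of "min \<epsilon> \<delta>1" "max b a1"] \<epsilon> \<delta>1 by auto
      have "\<exists>u. \<forall>n. j \<le> n \<and> n \<le> N \<longrightarrow> sol F W' u b \<epsilon> n" if F: "close F (max a2 a3) (min \<delta>2 \<delta>3)" for F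
      proof -
        have "close F a3 \<delta>3" by (rule close_mono [OF F]) (use \<delta>3 in auto)
        then obtain u where u: "\<And>n. Suc j \<le> n \<Longrightarrow> n \<le> N \<Longrightarrow> sol F W u (max b a1) (min \<epsilon> \<delta>1) n"
          using \<delta>3(2) by blast
        have F2: "close F a2 \<delta>2" by (rule close_mono [OF F]) (use \<delta>2 in auto)
        have "norm (F w - f w) \<le> \<delta>2 * wt (\<Union>i<k j. (f ^^ i) ` M j) w ^ a2" if "i < k j" "w \<in> G j i" for i w
        proof -
          have "norm (F w - f w) \<le> \<delta>2 * wt Mk w ^ a2" using F2 that j unfolding close_def by blast
          also have "\<dots> \<le> \<delta>2 * wt (\<Union>i<k j. (f ^^ i) ` M j) w ^ a2"
          proof (intro mult_left_mono power_mono wt_subset finMk)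
            show "(\<Union>i<k j. (f ^^ i) ` M j) \<subseteq> Mk" using j by (auto simp: Mk_def)
          qed (use \<delta>2 wt_nonneg [OF finMk] in auto)
          finally show ?thesis .
        qed
        then have orb: "\<And>w i. w \<in> H \<Longrightarrow> i < k j \<Longrightarrow> (F ^^ i) w \<in> G j i"
          and cl: "\<And>w. w \<in> H \<Longrightarrow> norm ((F ^^ k j) w - (f ^^ k j) w) \<le> \<delta>1 * wt (M j) w ^ a2"
          using \<delta>2(2) [rule_format, of F] by blast+
        define u' where "u' = (if j = N then (\<lambda>z. 0) else u (Suc j))"
        have "\<exists>v. v holomorphic_on Wj \<and> (\<forall>z\<in>Wj. norm (v z) \<le> \<epsilon> * wt (M j) z ^ b \<and> \<theta> z + v z \<in> H \<and>
            (F ^^ k j) (\<theta> z + v z) = \<theta> (\<phi> z) + u' (\<phi> z))"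
        proof (rule lift1)
          show "(F ^^ k j) holomorphic_on H"
            by (rule funpow_holomorphic [of "k j" H F "G j"]) (use orb F2 j in \<open>auto simp: close_def\<close>)
          have "\<delta>1 * wt (M j) w ^ a2 \<le> \<delta>1 * wt (M j) w ^ a1" for w
            using \<delta>1 by (intro mult_left_mono wt_power_mono [OF M(1)]) (auto simp: a2_def)
          then show "\<forall>w\<in>H. norm ((F ^^ k j) w - (f ^^ k j) w) \<le> \<delta>1 * wt (M j) w ^ a1"
            using cl order_trans by blast
          have s: "sol F W u a1 \<delta>1 (Suc j)" if "j \<noteq> N"
            by (rule sol_mono [OF u]) (use that j \<delta>1 in auto)
          show "u' holomorphic_on O'"
            using s by (auto simp: u'_def O'_def sol_def)
          show "\<forall>w\<in>O'. norm (u' w) \<le> \<delta>1 * wt (M (Suc j)) w ^ a1"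
            using s \<delta>1 wt_power_nonneg [OF M(1)] by (auto simp: u'_def O'_def sol_def)
        qed
        then obtain v where v: "v holomorphic_on Wj" "\<And>z. z \<in> Wj \<Longrightarrow> norm (v z) \<le> \<epsilon> * wt (M j) z ^ b"
            "\<And>z. z \<in> Wj \<Longrightarrow> \<theta> z + v z \<in> H" "\<And>z. z \<in> Wj \<Longrightarrow> (F ^^ k j) (\<theta> z + v z) = \<theta> (\<phi> z) + u' (\<phi> z)"
          by blast
        define u2 where "u2 = u(j := v)"
        have "sol F W' u2 b \<epsilon> n" if n: "j \<le> n \<and> n \<le> N" for n
        proof (cases "n = j")
          case True
          have "u' (\<phi> z) = (if j = N then 0 else u2 (Suc j) (\<phi> z))" for z by (simp add: u'_def u2_def)
          then show ?thesis
            unfolding True sol_def using v orb by (simp add: u2_def W'_def)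
        next
          case False
          then have "sol F W u b \<epsilon> n" using n \<epsilon> by (intro sol_mono [OF u]) auto
          then show ?thesis using False n by (simp add: sol_def u2_def W'_def)
        qed
        then show ?thesis by blast
      qed
      moreover have "min \<delta>2 \<delta>3 > 0" using \<delta>2 \<delta>3 by simp
      ultimately show ?thesis by blast
    qed
    ultimately show ?case by blast
  qed
  from this [of 0] obtain W where W: "good 0 W" and main: "\<And>b \<epsilon>. \<epsilon> > 0 \<Longrightarrow>
      \<exists>a \<delta>. \<delta> > 0 \<and> (\<forall>F. close F a \<delta> \<longrightarrow> (\<exists>u. \<forall>n. 0 \<le> n \<and> n \<le> N \<longrightarrow> sol F W u b \<epsilon> n))"
    by auto
  have "\<exists>a \<delta>. \<delta> > 0 \<and> (\<forall>F. close F a \<delta> \<longrightarrow> (\<exists>u. \<forall>n\<le>N. u n holomorphic_on W n \<and> (\<forall>z\<in>W n. norm (u n z) \<le> \<epsilon> \<and> (z \<in> M n \<longrightarrow> u n z = 0) \<and>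
          (\<forall>i<k n. (F ^^ i) (\<theta> z + u n z) \<in> G n i) \<and>
          (F ^^ k n) (\<theta> z + u n z) = \<theta> (\<phi> z) + (if n = N then 0 else u (Suc n) (\<phi> z)))))" if \<epsilon>: "\<epsilon> > 0" for \<epsilon>
  proof -
    \<comment> \<open>At the end order 1 is enough: it makes \<open>u n\<close> vanish on
      \<open>M n\<close>.\<close>
    obtain a \<delta> where a: "\<delta> > 0" "\<forall>F. close F a \<delta> \<longrightarrow> (\<exists>u. \<forall>n. 0 \<le> n \<and> n \<le> N \<longrightarrow> sol F W u 1 \<epsilon> n)"
      using main [OF \<epsilon>, of 1] by (elim exE conjE) (rule that)
    have le: "\<epsilon> * wt (M n) z ^ 1 \<le> \<epsilon>" for n z
      using \<epsilon> wt_le_1 [OF M(1)] by simp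
    have z0: "\<epsilon> * wt (M n) z ^ 1 = 0" if "z \<in> M n" for n z
      using wt_zero [OF M(1) that] by simp
    have "\<exists>u. \<forall>n\<le>N. u n holomorphic_on W n \<and> (\<forall>z\<in>W n. norm (u n z) \<le> \<epsilon> \<and> (z \<in> M n \<longrightarrow> u n z = 0) \<and>
          (\<forall>i<k n. (F ^^ i) (\<theta> z + u n z) \<in> G n i) \<and>
          (F ^^ k n) (\<theta> z + u n z) = \<theta> (\<phi> z) + (if n = N then 0 else u (Suc n) (\<phi> z)))" if F: "close F a \<delta>" for F
    proof -
      obtain u where u: "\<And>n. n \<le> N \<Longrightarrow> sol F W u 1 \<epsilon> n" using a(2) [rule_format, OF F] by auto
      have "norm (u n z) \<le> \<epsilon>" "z \<in> M n \<longrightarrow> u n z = 0" if "n \<le> N" "z \<in> W n" for n z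
      proof -
        have "norm (u n z) \<le> \<epsilon> * wt (M n) z ^ 1" using u that by (auto simp: sol_def)
        then show "norm (u n z) \<le> \<epsilon>" "z \<in> M n \<longrightarrow> u n z = 0" using le [of n z] z0 [of z n] by auto
      qed
      then show ?thesis using u unfolding sol_def by (intro exI [of _ u]) blast
    qed
    then show ?thesis using a(1) by blast
  qed
  moreover have "\<forall>n\<le>N. open (W n) \<and> X n \<subseteq> W n \<and> W n \<subseteq> T n \<and> (n < N \<longrightarrow> \<phi> ` W n \<subseteq> W (Suc n))"
    using W unfolding good_def by simp
  ultimately show ?thesis unfolding close_def by blast
qed

section \<open>The inductive construction\<close>

lemma holomorphic_glue:
  assumes "compact K1" "compact K2" "K1 \<inter> K2 = {}"
    and "open U1" "K1 \<subseteq> U1" "f1 holomorphic_on U1" and "open U2" "K2 \<subseteq> U2" "f2 holomorphic_on U2"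
  obtains g \<Omega> where "open \<Omega>" "K1 \<union> K2 \<subseteq> \<Omega>" "g holomorphic_on \<Omega>"
    "\<And>z. z \<in> K1 \<Longrightarrow> g z = f1 z" "\<And>z. z \<in> K2 \<Longrightarrow> g z = f2 z"
proof -
  obtain V1 V2 where V: "open V1" "open V2" "K1 \<subseteq> V1" "K2 \<subseteq> V2" "V1 \<inter> V2 = {}"
    using separation_normal [of K1 K2] assms compact_imp_closed by metis
  define g where "g z = (if z \<in> V1 then f1 z else f2 z)" for z
  have 1: "g holomorphic_on (U1 \<inter> V1)"
  proof -
    have "g holomorphic_on (U1 \<inter> V1) \<longleftrightarrow> f1 holomorphic_on (U1 \<inter> V1)"
      by (rule holomorphic_cong) (auto simp: g_def)
    then show ?thesis using assms(6) holomorphic_on_subset by blast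
  qed
  have 2: "g holomorphic_on (U2 \<inter> V2)"
  proof -
    have "g holomorphic_on (U2 \<inter> V2) \<longleftrightarrow> f2 holomorphic_on (U2 \<inter> V2)"
      by (rule holomorphic_cong) (use V(5) in \<open>auto simp: g_def\<close>)
    then show ?thesis using assms(9) holomorphic_on_subset by blast
  qed
  show ?thesis
  proof (rule that [of "U1 \<inter> V1 \<union> U2 \<inter> V2" g])
    show "g holomorphic_on U1 \<inter> V1 \<union> U2 \<inter> V2"
      using 1 2 assms V by (intro holomorphic_on_Un) auto
    show "K1 \<union> K2 \<subseteq> U1 \<inter> V1 \<union> U2 \<inter> V2" using assms(5,8) V(3,4) by blast
    show "g z = f1 z" if "z \<in> K1" for z using that V(3) by (auto simp: g_def)
    show "g z = f2 z" if "z \<in> K2" for z using that V(4,5) by (auto simp: g_def)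
  qed (use assms V in auto)
qed

lemma poly_marking: "finite M \<Longrightarrow> poly (marking_poly M a) z = (\<Prod>c\<in>M. (z - c) ^ a)"
  by (simp add: marking_poly_def poly_prod poly_power)

text \<open>In the product of the distances to the marked points, the factor of the nearest point
  accounts for the weight and the others are bounded by the diameter \<open>R\<close>.\<close>

lemma marking_poly_bound:
  assumes "finite M" "bounded K"
  obtains C where "C > 0" "\<And>z. z \<in> K \<Longrightarrow> norm (poly (marking_poly M a) z) \<le> C * wt M z ^ a"
proof -
  obtain R where R: "R \<ge> 1" "\<And>z c. z \<in> K \<Longrightarrow> c \<in> M \<Longrightarrow> dist z c \<le> R"
  proof -
    have "bounded (K \<union> M)" using assms finite_imp_bounded by simp
    then obtain B where B: "B > 0" "\<And>x. x \<in> K \<union> M \<Longrightarrow> norm x \<le> B" by (auto simp: bounded_pos)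
    have "dist z c \<le> max 1 (2 * B)" if "z \<in> K" "c \<in> M" for z c
      using B(2) [of z] B(2) [of c] that norm_triangle_ineq4 [of z c] by (simp add: dist_norm)
    then show ?thesis using that [of "max 1 (2 * B)"] by simp
  qed
  define C where "C = (R ^ card M) ^ a"
  have prod_le: "(\<Prod>c\<in>M. dist z c) \<le> R ^ card M * wt M z" if z: "z \<in> K" for z
    using wt_cases [OF assms(1), of z]
  proof
    assume "wt M z = 1"
    moreover have "(\<Prod>c\<in>M. dist z c) \<le> (\<Prod>c\<in>M. R)" using R(2) [OF z] by (intro prod_mono) auto
    ultimately show ?thesis by simp
  next
    assume "\<exists>c\<in>M. wt M z = dist z c"
    then obtain c where c: "c \<in> M" "wt M z = dist z c" by blast
    have "(\<Prod>c\<in>M. dist z c) = dist z c * (\<Prod>c\<in>M - {c}. dist z c)" using assms(1) c(1) by (rule prod.remove)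
    also have "\<dots> \<le> dist z c * (\<Prod>c\<in>M - {c}. R)" using R(2) [OF z] by (intro mult_left_mono prod_mono) auto
    also have "\<dots> \<le> dist z c * R ^ card M"
    proof (rule mult_left_mono)
      have "(\<Prod>c\<in>M - {c}. R) = R ^ card (M - {c})" by simp
      also have "\<dots> \<le> R ^ card M" using R(1) assms(1) by (intro power_increasing card_mono) auto
      finally show "(\<Prod>c\<in>M - {c}. R) \<le> R ^ card M" .
    qed simp
    finally show ?thesis using c(2) by (simp add: mult.commute)
  qed
  have "norm (poly (marking_poly M a) z) \<le> C * wt M z ^ a" if z: "z \<in> K" for z
  proof -
    have "norm (poly (marking_poly M a) z) = (\<Prod>c\<in>M. dist z c) ^ a"
      using assms(1) by (simp add: poly_marking prod_norm [symmetric] norm_power dist_norm prod_power_distrib)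
    also have "\<dots> \<le> (R ^ card M * wt M z) ^ a"
      using prod_le [OF z] by (intro power_mono prod_nonneg) auto
    finally show ?thesis by (simp add: C_def power_mult_distrib)
  qed
  moreover have "C > 0" using R(1) by (simp add: C_def)
  ultimately show ?thesis using that by blast
qed

text \<open>Around a repelling fixed point the iterates cannot stay in a bounded set, so some iterate of the
  disc leaves \<open>A\<close>; before it does so for the first time, the orbit stays inside \<open>A\<close>.\<close>

lemma relay:
  assumes f: "f holomorphic_on UNIV" "f p = p" "deriv f p = 2" and r: "r > 0"
    and A: "compact A" "cball p r \<subseteq> interior A" and V: "open V" "A \<subseteq> V"
  obtains l e t b where "t > 0" "cball e t \<subseteq> V - A" "b holomorphic_on ball e t" "b ` ball e t \<subseteq> ball p r"
    "\<And>y. y \<in> ball e t \<Longrightarrow> (f ^^ l) (b y) = y" "\<And>y i. y \<in> ball e t \<Longrightarrow> i < l \<Longrightarrow> (f ^^ i) (b y) \<in> interior A"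
proof -
  have hol: "(f ^^ l) holomorphic_on UNIV" for l
    by (rule funpow_holomorphic [where G = "\<lambda>i. UNIV"]) (use f in auto)
  have fp: "(f ^^ l) p = p" for l using f(2) by (induction l) auto
  have der: "deriv (f ^^ l) p = 2 ^ l" for l
  proof (induction l)
    case 0
    then show ?case by simp
  next
    case (Suc l)
    have d: "g field_differentiable at z" if "g holomorphic_on UNIV" for g and z :: complex
      using holomorphic_on_imp_differentiable_at [OF that open_UNIV] by auto
    have "deriv (f \<circ> (f ^^ l)) p = deriv f ((f ^^ l) p) * deriv (f ^^ l) p"
      using d [OF hol] d [OF f(1)] by (rule deriv_chain)
    then show ?case using Suc f(3) fp by (simp add: comp_def)
  qed
  define D where "D = ball p r"
  have D: "open D" "connected D" "p \<in> D" "D \<subseteq> interior A" using r A ball_subset_cball [of p r] by (auto simp: D_def)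
  have nonconst: "\<not> (f ^^ l) constant_on UNIV" for l
  proof
    assume "(f ^^ l) constant_on UNIV"
    then obtain c where "\<And>z. (f ^^ l) z = c" by (auto simp: constant_on_def)
    then have "f ^^ l = (\<lambda>z. c)" by auto
    then have "deriv (f ^^ l) p = 0" by simp
    then show False using der [of l] by simp
  qed
  have opn: "open ((f ^^ l) ` S)" if "open S" for l S
    by (rule open_mapping_thm [OF hol]) (use that nonconst in auto)
  have "\<exists>l. \<not> (f ^^ l) ` D \<subseteq> A"
  proof (rule ccontr)
    assume "\<not> ?thesis"
    then have sub: "(f ^^ l) ` D \<subseteq> A" for l by blast
    obtain B where B: "B > 0" "\<And>x. x \<in> A \<Longrightarrow> norm x \<le> B" using compact_imp_bounded [OF A(1)] by (auto simp: bounded_pos)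
    \<comment> \<open>Cauchy's estimate would bound the multipliers \<open>2 ^ l\<close> of all
      iterates at \<open>p\<close> at once.\<close>
    have "norm (deriv (f ^^ l) p) \<le> 2 * B / r" for l
    proof (rule deriv_norm_le)
      show "(f ^^ l) holomorphic_on ball p r" using hol holomorphic_on_subset by blast
      show "norm ((f ^^ l) w) \<le> B" if "w \<in> ball p r" for w
        using sub [of l] B(2) that unfolding D_def by blast
    qed (rule r)
    then have "2 ^ l \<le> 2 * B / r" for l using der by (simp add: norm_power)
    moreover obtain l :: nat where "2 * B / r < 2 ^ l" using real_arch_pow [of 2 "2 * B / r"] by auto
    ultimately show False by (meson not_le)
  qed
  then obtain l where l: "\<not> (f ^^ l) ` D \<subseteq> A" "\<And>i. i < l \<Longrightarrow> (f ^^ i) ` D \<subseteq> A"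
    using exists_least_iff [of "\<lambda>l. \<not> (f ^^ l) ` D \<subseteq> A"] by blast
  have inner: "(f ^^ i) ` D \<subseteq> interior A" if "i < l" for i
    using l(2) [OF that] opn [OF D(1)] by (rule interior_maximal)
  \<comment> \<open>The image of the disc is connected and contains \<open>p\<close>; not being
    contained in \<open>A\<close>, it meets the frontier of \<open>A\<close>. Near such a point the
    open image has points of \<open>V - A\<close>.\<close>
  have "connected ((f ^^ l) ` D)"
    using D(2) continuous_on_subset [OF holomorphic_on_imp_continuous_on [OF hol]]
    by (intro connected_continuous_image) auto
  moreover have "p \<in> (f ^^ l) ` D \<inter> A" using fp [of l] D(3,4) interior_subset [of A] by (metis IntI image_eqI subsetD)
  ultimately have "(f ^^ l) ` D \<inter> frontier A \<noteq> {}"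
    using l(1) by (intro connected_Int_frontier) auto
  then obtain y where y: "y \<in> (f ^^ l) ` D" "y \<in> frontier A" by blast
  have clA: "closed A" using A(1) compact_imp_closed by blast
  then have "y \<in> V" using y(2) V(2) frontier_subset_closed by blast
  have "open ((f ^^ l) ` D \<inter> V)" using opn [OF D(1)] V(1) by blast
  moreover have "y \<in> (f ^^ l) ` D \<inter> V" using y \<open>y \<in> V\<close> by blast
  ultimately have "((f ^^ l) ` D \<inter> V) - A \<noteq> {}"
    using y(2) unfolding frontier_straddle by (metis Diff_eq_empty_iff open_contains_ball mem_ball subsetD)
  define Q where "Q = D \<inter> (f ^^ l) -` (V - A)"
  have "Q \<noteq> {}" using \<open>((f ^^ l) ` D \<inter> V) - A \<noteq> {}\<close> by (auto simp: Q_def)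
  have "open Q" unfolding Q_def
    using D(1) continuous_on_subset [OF holomorphic_on_imp_continuous_on [OF hol]] V(1) clA
    by (intro continuous_open_preimage open_Diff) auto
  \<comment> \<open>A point with nonzero derivative admits a local inverse \<open>b\<close>. One
    exists because the derivative of the iterate is not identically 0, being \<open>2 ^ l\<close> at
    \<open>p\<close>.\<close>
  have "\<exists>x\<in>Q. deriv (f ^^ l) x \<noteq> 0"
  proof (rule ccontr)
    assume "\<not> ?thesis"
    then have "deriv (f ^^ l) p = (\<lambda>z. 0) p"
      using \<open>open Q\<close> \<open>Q \<noteq> {}\<close> holomorphic_deriv [OF hol open_UNIV]
      by (intro analytic_continuation_open [of Q UNIV "deriv (f ^^ l)" "\<lambda>z. 0" p]) (auto simp: connected_UNIV)
    then show False using der [of l] by simp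
  qed
  then obtain x where x: "x \<in> Q" "deriv (f ^^ l) x \<noteq> 0" by blast
  obtain \<rho> where \<rho>: "\<rho> > 0" "ball x \<rho> \<subseteq> Q" "inj_on (f ^^ l) (ball x \<rho>)"
    using has_complex_derivative_locally_injective [OF _ x(1) \<open>open Q\<close> x(2)] hol holomorphic_on_subset by blast
  obtain b where "b holomorphic_on ((f ^^ l) ` ball x \<rho>)"
    "\<And>z. z \<in> ball x \<rho> \<Longrightarrow> deriv (f ^^ l) z * deriv b ((f ^^ l) z) = 1" "\<And>z. z \<in> ball x \<rho> \<Longrightarrow> b ((f ^^ l) z) = z"
    by (rule holomorphic_has_inverse [OF holomorphic_on_subset [OF hol subset_UNIV] open_ball \<rho>(3)]) (rule that)
  note b = this(1,3)
  define e where "e = (f ^^ l) x"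
  have "e \<in> (f ^^ l) ` ball x \<rho>" using \<rho>(1) by (auto simp: e_def)
  then obtain t where t: "t > 0" "cball e t \<subseteq> (f ^^ l) ` ball x \<rho>"
    using opn [of "ball x \<rho>" l] open_contains_cball by blast
  have preimg: "\<exists>z\<in>ball x \<rho>. (f ^^ l) z = y \<and> b y = z" if "y \<in> ball e t" for y
  proof -
    have "y \<in> (f ^^ l) ` ball x \<rho>" using that t(2) ball_subset_cball by blast
    then show ?thesis using b(2) by blast
  qed
  show ?thesis
  proof (rule that [of t e b l])
    show "t > 0" by (rule t)
    show "cball e t \<subseteq> V - A" using t(2) \<rho>(2) by (auto simp: Q_def)
    show "b holomorphic_on ball e t" using b(1) t(2) ball_subset_cball holomorphic_on_subset by blast
    have bD: "b y \<in> D" if y: "y \<in> ball e t" for y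
    proof -
      obtain z where "z \<in> ball x \<rho>" "b y = z" using preimg [OF y] by blast
      then have "b y \<in> Q" using \<rho>(2) by blast
      then show ?thesis unfolding Q_def by (rule IntD1)
    qed
    then show "b ` ball e t \<subseteq> ball p r" unfolding D_def by blast
    show "(f ^^ l) (b y) = y" if "y \<in> ball e t" for y using preimg [OF that] by auto
    show "(f ^^ i) (b y) \<in> interior A" if "y \<in> ball e t" "i < l" for y i
      using bD [OF that(1)] inner [OF that(2)] by blast
  qed
qed

lemma smooth_continuous: "smooth f \<Longrightarrow> continuous_on UNIV f"
  using times_differentiable_continuous unfolding smooth_def by blast

text \<open>\<open>M n\<close> contains the critical points in \<open>X n\<close> and the points that \<open>\<theta>\<close> has to fix; the flag \<open>osc\<close> selects
  the oscillating case, in which the orbits return to the disc of radius \<open>r\<close> around \<open>p\<close>.\<close>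

locale wandering_system = compact_sequence X for X :: "nat \<Rightarrow> complex set" +
  fixes M :: "nat \<Rightarrow> complex set" and \<phi> :: "complex \<Rightarrow> complex" and U :: "complex set"
    and \<epsilon> :: "nat \<Rightarrow> real" and p :: complex and r :: real and A :: "nat \<Rightarrow> complex set" and osc :: bool
  assumes U: "open U" "\<And>n. X n \<subseteq> U" "\<phi> holomorphic_on U"
    and deriv_nonzero_near: "\<And>n x \<rho>. x \<in> X n \<Longrightarrow> \<rho> > 0 \<Longrightarrow> \<exists>z\<in>ball x \<rho>. deriv \<phi> z \<noteq> 0"
    and \<phi>X: "\<And>n. \<phi> ` X n \<subseteq> X (Suc n)" and \<phi>frontier: "\<And>n. \<phi> ` frontier (X n) \<subseteq> frontier (X (Suc n))"
    and M: "\<And>n. finite (M n)" "\<And>n. M n \<subseteq> X n" "\<And>n. \<phi> ` M n \<subseteq> M (Suc n)"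
    and deriv_nonzero: "\<And>n z. z \<in> X n - M n \<Longrightarrow> deriv \<phi> z \<noteq> 0"
    and \<epsilon>: "\<And>n. \<epsilon> n > 0" and r: "r > 0"
    and A: "\<And>n. separator X n (A n)" "\<And>n. A n \<subseteq> interior (A (Suc n))" "(\<Union>n. interior (A n)) = UNIV"
      "cball p r \<subseteq> interior (A 0)"
    and margin: "\<And>n z w. z \<in> X n \<Longrightarrow> dist w z \<le> \<epsilon> n \<Longrightarrow> w \<in> interior (A (Suc n)) - A n"
begin

lemma A_nonsep: "nonseparating (A n)" and A_compact: "compact (A n)" and A_closed: "closed (A n)"
  using A(1) [of n] by (auto simp: separator_def nonseparating_def compact_imp_closed)

lemma A_mono: "m \<le> n \<Longrightarrow> A m \<subseteq> A n"
  by (rule lift_Suc_mono_le [of A]) (use A(2) interior_subset in blast)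

lemma interior_A_mono: "m \<le> n \<Longrightarrow> interior (A m) \<subseteq> interior (A n)"
  by (intro interior_mono A_mono)

lemma X_inside: "m < n \<Longrightarrow> X m \<subseteq> interior (A n)"
  using A(1) [of n] by (simp add: separator_def)

lemma X_outside: "n \<le> m \<Longrightarrow> X m \<inter> A n = {}"
  using A(1) [of n] by (simp add: separator_def)

lemma disc_inside: "cball p r \<subseteq> interior (A n)"
  using A(4) interior_A_mono [of 0 n] by auto

lemma p_inside: "p \<in> interior (A n)"
  using disc_inside [of n] r by auto

text \<open>\<open>Fr\<close> is the set of points at which all later approximations of the entire function agree with \<open>f\<close>.
  The point \<open>p\<close> is kept repelling so that the construction can leave \<open>A N\<close> from any small disc around it.\<close>

definition stage :: "nat \<Rightarrow> (complex \<Rightarrow> complex) \<Rightarrow> (complex \<Rightarrow> complex) \<Rightarrow> (nat \<Rightarrow> nat) \<Rightarrow> complex set \<Rightarrow> bool" where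
  "stage N f \<theta> k Fr \<longleftrightarrow>
     f holomorphic_on UNIV \<and> f p = p \<and> deriv f p = 2 \<and> smooth \<theta> \<and>
     (\<forall>x y. norm ((\<theta> x - \<theta> y) - (x - y)) \<le> (1/2 - (1/2) ^ (N + 2)) * norm (x - y)) \<and>
     (\<forall>n. \<exists>Q. open Q \<and> X n \<subseteq> Q \<and> \<theta> holomorphic_on Q \<and> (n \<ge> N \<longrightarrow> (\<forall>z\<in>Q. \<theta> z = z))) \<and>
     (\<forall>n. \<forall>c\<in>M n. \<theta> c = c) \<and>
     (\<forall>n<N. k n > 0 \<and> (\<exists>Q. open Q \<and> X n \<subseteq> Q \<and> (\<forall>z\<in>Q. (f ^^ k n) (\<theta> z) = \<theta> (\<phi> z))) \<and>
        (\<forall>i<k n. (f ^^ i) ` \<theta> ` X n \<subseteq> interior (A (Suc n))) \<and>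
        (if osc then 1 < k n \<and> f ` \<theta> ` X n \<subseteq> ball p r else k n = 1)) \<and>
     finite Fr \<and> Fr \<subseteq> interior (A N) \<and> p \<in> Fr"

lemma stageD:
  assumes "stage N f \<theta> k Fr"
  shows "f holomorphic_on UNIV" "f p = p" "deriv f p = 2" "smooth \<theta>"
    "norm ((\<theta> x - \<theta> y) - (x - y)) \<le> (1/2 - (1/2) ^ (N + 2)) * norm (x - y)"
    "\<exists>Q. open Q \<and> X n \<subseteq> Q \<and> \<theta> holomorphic_on Q \<and> (n \<ge> N \<longrightarrow> (\<forall>z\<in>Q. \<theta> z = z))"
    "c \<in> M n \<Longrightarrow> \<theta> c = c"
    "n < N \<Longrightarrow> k n > 0"
    "n < N \<Longrightarrow> \<exists>Q. open Q \<and> X n \<subseteq> Q \<and> (\<forall>z\<in>Q. (f ^^ k n) (\<theta> z) = \<theta> (\<phi> z))"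
    "n < N \<Longrightarrow> i < k n \<Longrightarrow> (f ^^ i) ` \<theta> ` X n \<subseteq> interior (A (Suc n))"
    "n < N \<Longrightarrow> if osc then 1 < k n \<and> f ` \<theta> ` X n \<subseteq> ball p r else k n = 1"
    "finite Fr" "Fr \<subseteq> interior (A N)" "p \<in> Fr"
proof -
  note st = assms [unfolded stage_def]
  show "f holomorphic_on UNIV" using st by (elim conjE)
  show "f p = p" using st by (elim conjE)
  show "deriv f p = 2" using st by (elim conjE)
  show "smooth \<theta>" using st by (elim conjE)
  show "finite Fr" using st by (elim conjE)
  show "Fr \<subseteq> interior (A N)" using st by (elim conjE)
  show "p \<in> Fr" using st by (elim conjE)
  show "norm ((\<theta> x - \<theta> y) - (x - y)) \<le> (1/2 - (1/2) ^ (N + 2)) * norm (x - y)"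
    using st by (elim conjE) (drule spec, erule spec)
  show "\<exists>Q. open Q \<and> X n \<subseteq> Q \<and> \<theta> holomorphic_on Q \<and> (n \<ge> N \<longrightarrow> (\<forall>z\<in>Q. \<theta> z = z))"
    using st by (elim conjE) (erule spec)
  show "\<theta> c = c" if "c \<in> M n" using st that by (elim conjE) (drule spec, erule bspec)
  assume "n < N"
  then have D: "k n > 0 \<and> (\<exists>Q. open Q \<and> X n \<subseteq> Q \<and> (\<forall>z\<in>Q. (f ^^ k n) (\<theta> z) = \<theta> (\<phi> z))) \<and>
        (\<forall>i<k n. (f ^^ i) ` \<theta> ` X n \<subseteq> interior (A (Suc n))) \<and>
        (if osc then 1 < k n \<and> f ` \<theta> ` X n \<subseteq> ball p r else k n = 1)"
    using st by (elim conjE) (drule spec, erule mp)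
  show "k n > 0" using D by (elim conjE)
  show "\<exists>Q. open Q \<and> X n \<subseteq> Q \<and> (\<forall>z\<in>Q. (f ^^ k n) (\<theta> z) = \<theta> (\<phi> z))" using D by (elim conjE)
  show "if osc then 1 < k n \<and> f ` \<theta> ` X n \<subseteq> ball p r else k n = 1" using D by (elim conjE)
  show "(f ^^ i) ` \<theta> ` X n \<subseteq> interior (A (Suc n))" if "i < k n" using D that by (elim conjE) (drule spec, erule mp)
qed

lemma stage_continuous:
  assumes "stage N f \<theta> k Fr"
  shows "continuous_on UNIV (\<lambda>z. (f ^^ i) (\<theta> z))"
proof -
  have "(f ^^ i) holomorphic_on UNIV"
    by (rule funpow_holomorphic [where G = "\<lambda>i. UNIV"]) (use stageD(1) [OF assms] in auto)
  moreover have "continuous_on UNIV \<theta>"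
    using smooth_continuous [OF stageD(4) [OF assms]] .
  ultimately show ?thesis
    using continuous_on_compose2 [of UNIV "f ^^ i" UNIV \<theta>] holomorphic_on_imp_continuous_on by auto
qed

text \<open>Points near the frontier of \<open>X n\<close> whose orbit arrives close to \<open>X N\<close> but not in \<open>X N\<close>. They exist
  because \<open>\<phi>\<close> is open and maps frontiers to frontiers.\<close>

lemma frontier_net:
  assumes st: "stage N f \<theta> k Fr" and V: "open V" "X N \<subseteq> V"
  obtains Z where "finite Z" "\<And>\<zeta> j. (\<zeta>, j) \<in> Z \<Longrightarrow> (\<forall>i<j. (f ^^ i) \<zeta> \<in> interior (A N)) \<and> (f ^^ j) \<zeta> \<in> V - X N"
    "\<And>n z. n \<le> N \<Longrightarrow> z \<in> frontier (X n) \<Longrightarrow> \<exists>\<zeta> j. (\<zeta>, j) \<in> Z \<and> dist \<zeta> (\<theta> z) \<le> 1 / real (Suc N)"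
proof -
  have chain: "\<exists>Q j. open Q \<and> X n \<subseteq> Q \<and> (\<forall>z\<in>Q. (\<forall>i<j. (f ^^ i) (\<theta> z) \<in> interior (A N)) \<and> (f ^^ j) (\<theta> z) \<in> V) \<and>
      (\<forall>z\<in>frontier (X n). \<forall>\<rho>>0. \<exists>z'\<in>ball z \<rho> \<inter> Q. (f ^^ j) (\<theta> z') \<notin> X N)" (is "\<exists>Q j. ?P n Q j") if "n \<le> N" for n
    using that
  proof (induction n rule: inc_induct)
    case base
    obtain Q where Q: "open Q" "X N \<subseteq> Q" "\<And>z. z \<in> Q \<Longrightarrow> \<theta> z = z"
      using stageD(6) [OF st, of N] by auto
    have "\<exists>z'\<in>ball z \<rho> \<inter> (Q \<inter> V). \<theta> z' \<notin> X N" if z: "z \<in> frontier (X N)" and \<rho>: "\<rho> > 0" for z \<rho>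
    proof -
      have "z \<in> X N" using z closed_each frontier_subset_closed by blast
      then have zz: "z \<in> ball z \<rho> \<inter> (Q \<inter> V)" using Q V \<rho> by auto
      have "open (ball z \<rho> \<inter> (Q \<inter> V))" using Q V by auto
      then have "\<not> ball z \<rho> \<inter> (Q \<inter> V) \<subseteq> X N"
        using zz z by (metis DiffD2 frontier_def interior_maximal subsetD)
      then show ?thesis using Q(3) by force
    qed
    then show ?case
      using Q V by (intro exI [of _ "Q \<inter> V"] exI [of _ 0]) auto
  next
    case (step n)
    then have n: "n < N" by simp
    obtain Q' j' where Q': "open Q'" "X (Suc n) \<subseteq> Q'"
        "\<And>z i. z \<in> Q' \<Longrightarrow> i < j' \<Longrightarrow> (f ^^ i) (\<theta> z) \<in> interior (A N)" "\<And>z. z \<in> Q' \<Longrightarrow> (f ^^ j') (\<theta> z) \<in> V"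
        "\<And>z \<rho>. z \<in> frontier (X (Suc n)) \<Longrightarrow> \<rho> > 0 \<Longrightarrow> \<exists>z'\<in>ball z \<rho> \<inter> Q'. (f ^^ j') (\<theta> z') \<notin> X N"
      using step.IH by metis
    obtain Q1 where Q1: "open Q1" "X n \<subseteq> Q1" "\<And>z. z \<in> Q1 \<Longrightarrow> (f ^^ k n) (\<theta> z) = \<theta> (\<phi> z)"
      using stageD(9) [OF st n] by blast
    have orb: "(f ^^ i) (\<theta> z) \<in> interior (A N)" if "i < k n" "z \<in> X n" for i z
    proof -
      have "(f ^^ i) ` \<theta> ` X n \<subseteq> interior (A (Suc n))" using stageD(10) [OF st n that(1)] .
      then show ?thesis using that(2) interior_A_mono [of "Suc n" N] n by auto
    qed
    define Q where "Q = (Q1 \<inter> (U \<inter> \<phi> -` Q')) \<inter> (\<Inter>i\<in>{..<k n}. (\<lambda>z. (f ^^ i) (\<theta> z)) -` interior (A N))"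
    have "open (U \<inter> \<phi> -` Q')"
      using holomorphic_on_imp_continuous_on [OF U(3)] U(1) Q'(1) by (rule continuous_open_preimage)
    moreover have "open (\<Inter>i\<in>{..<k n}. (\<lambda>z. (f ^^ i) (\<theta> z)) -` interior (A N))"
      using stage_continuous [OF st] by (intro open_INT ballI open_vimage) auto
    ultimately have "open Q" unfolding Q_def using open_Int [OF Q1(1)] by (intro open_Int [of "Q1 \<inter> (U \<inter> \<phi> -` Q')"])
    have "X n \<subseteq> Q"
    proof
      fix z assume z: "z \<in> X n"
      then have "\<phi> z \<in> Q'" using \<phi>X [of n] Q'(2) by blast
      then show "z \<in> Q" unfolding Q_def using z Q1(2) U(2) [of n] orb by auto
    qed
    have QD: "z \<in> Q1" "z \<in> U" "\<phi> z \<in> Q'" "\<And>i. i < k n \<Longrightarrow> (f ^^ i) (\<theta> z) \<in> interior (A N)" if "z \<in> Q" for z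
      using that unfolding Q_def by auto
    have it: "(f ^^ (i + k n)) (\<theta> z) = (f ^^ i) (\<theta> (\<phi> z))" if "z \<in> Q" for z i
      using Q1(3) [OF QD(1) [OF that]] by (simp add: funpow_add)
    show ?case
    proof (intro exI [of _ Q] exI [of _ "j' + k n"] conjI ballI allI impI)
      fix z i assume z: "z \<in> Q" and i: "i < j' + k n"
      show "(f ^^ i) (\<theta> z) \<in> interior (A N)"
      proof (cases "i < k n")
        case True
        then show ?thesis using QD(4) [OF z] by blast
      next
        case False
        then have "(f ^^ i) (\<theta> z) = (f ^^ (i - k n)) (\<theta> (\<phi> z))" using it [OF z, of "i - k n"] by simp
        then show ?thesis using Q'(3) [OF QD(3) [OF z], of "i - k n"] i False by simp
      qed
    next
      fix z assume z: "z \<in> Q"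
      show "(f ^^ (j' + k n)) (\<theta> z) \<in> V" using it [OF z] Q'(4) [OF QD(3) [OF z]] by simp
    next
      fix z and \<rho> :: real assume z: "z \<in> frontier (X n)" and \<rho>: "\<rho> > 0"
      have zX: "z \<in> X n" using z closed_each frontier_subset_closed by blast
      then have "z \<in> ball z \<rho> \<inter> Q" using \<open>X n \<subseteq> Q\<close> \<rho> by auto
      moreover have "open (ball z \<rho> \<inter> Q)" using \<open>open Q\<close> by auto
      ultimately obtain \<sigma> where \<sigma>: "\<sigma> > 0" "ball z \<sigma> \<subseteq> ball z \<rho> \<inter> Q" by (meson open_contains_ball)
      have hol: "\<phi> holomorphic_on ball z \<sigma>"
        using \<sigma>(2) QD(2) U(3) holomorphic_on_subset by blast
      have "\<not> \<phi> constant_on ball z \<sigma>"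
      proof
        assume "\<phi> constant_on ball z \<sigma>"
        then obtain c where c: "\<And>w. w \<in> ball z \<sigma> \<Longrightarrow> \<phi> w = c" by (auto simp: constant_on_def)
        obtain w where w: "w \<in> ball z \<sigma>" "deriv \<phi> w \<noteq> 0" using deriv_nonzero_near [OF zX \<sigma>(1)] by blast
        have "deriv \<phi> w = deriv (\<lambda>z. c) w"
        proof (rule deriv_cong_ev)
          show "\<forall>\<^sub>F x in nhds w. \<phi> x = c"
            unfolding eventually_nhds using w(1) c by (intro exI [of _ "ball z \<sigma>"]) auto
        qed simp
        then show False using w(2) by simp
      qed
      then have "open (\<phi> ` ball z \<sigma>)" by (intro open_mapping_thm [OF hol]) auto
      moreover have "\<phi> z \<in> \<phi> ` ball z \<sigma>" using \<sigma>(1) by simp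
      ultimately obtain t where t: "t > 0" "ball (\<phi> z) t \<subseteq> \<phi> ` ball z \<sigma>" by (meson open_contains_ball)
      have "\<phi> z \<in> frontier (X (Suc n))" using \<phi>frontier [of n] z by blast
      then obtain y where y: "y \<in> ball (\<phi> z) t" "(f ^^ j') (\<theta> y) \<notin> X N" using Q'(5) t(1) by blast
      then obtain z' where z': "z' \<in> ball z \<sigma>" "y = \<phi> z'" using t(2) by blast
      then have "z' \<in> ball z \<rho> \<inter> Q" using \<sigma>(2) by blast
      then show "\<exists>z'\<in>ball z \<rho> \<inter> Q. (f ^^ (j' + k n)) (\<theta> z') \<notin> X N" using y(2) z'(2) it by auto
    qed (use \<open>open Q\<close> \<open>X n \<subseteq> Q\<close> in auto)
  qed
  have "\<forall>n. \<exists>Q. \<exists>j. n \<le> N \<longrightarrow> ?P n Q j"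
  proof
    fix n
    show "\<exists>Q. \<exists>j. n \<le> N \<longrightarrow> ?P n Q j"
    proof (cases "n \<le> N")
      case True
      from chain [OF True] show ?thesis by (elim exE) (intro exI impI, assumption)
    qed simp
  qed
  from choice [OF this] obtain Q where "\<forall>n. \<exists>j. n \<le> N \<longrightarrow> ?P n (Q n) j" by (elim exE)
  from choice [OF this] obtain j where "\<forall>n. n \<le> N \<longrightarrow> ?P n (Q n) (j n)" by (elim exE)
  then have Q: "\<And>n. n \<le> N \<Longrightarrow> open (Q n)" "\<And>n. n \<le> N \<Longrightarrow> X n \<subseteq> Q n"
      "\<And>n z i. n \<le> N \<Longrightarrow> z \<in> Q n \<Longrightarrow> i < j n \<Longrightarrow> (f ^^ i) (\<theta> z) \<in> interior (A N)"
      "\<And>n z. n \<le> N \<Longrightarrow> z \<in> Q n \<Longrightarrow> (f ^^ j n) (\<theta> z) \<in> V"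
      "\<And>n z \<rho>. n \<le> N \<Longrightarrow> z \<in> frontier (X n) \<Longrightarrow> \<rho> > 0 \<Longrightarrow> \<exists>z'\<in>ball z \<rho> \<inter> Q n. (f ^^ j n) (\<theta> z') \<notin> X N"
    by blast+
  \<comment> \<open>Two net radii times the Lipschitz constant 3/2 of \<theta> give
    \<open>3 * \<eta>\<close>, which stays below \<open>1 / real (Suc N)\<close>.\<close>
  define \<eta> where "\<eta> = 1 / (4 * real (Suc N))"
  have \<eta>: "\<eta> > 0" by (simp add: \<eta>_def)
  have "\<exists>S. S \<subseteq> frontier (X n) \<and> finite S \<and> frontier (X n) \<subseteq> (\<Union>s\<in>S. ball s \<eta>)" for n
  proof -
    have "compact (frontier (X n))" using compact_X by (simp add: compact_frontier)
    moreover have "frontier (X n) \<subseteq> (\<Union>s\<in>frontier (X n). ball s \<eta>)" using \<eta> by force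
    ultimately show ?thesis using compactE_image [of "frontier (X n)" "frontier (X n)" "\<lambda>s. ball s \<eta>"] by (metis open_ball)
  qed
  then obtain S where S: "\<And>n. S n \<subseteq> frontier (X n)" "\<And>n. finite (S n)" "\<And>n. frontier (X n) \<subseteq> (\<Union>s\<in>S n. ball s \<eta>)"
    by metis
  have "\<forall>n s. \<exists>z'. n \<le> N \<longrightarrow> s \<in> S n \<longrightarrow> z' \<in> ball s \<eta> \<inter> Q n \<and> (f ^^ j n) (\<theta> z') \<notin> X N"
    using Q(5) [OF _ subsetD [OF S(1)] \<eta>] by meson
  then obtain z' where z': "\<And>n s. n \<le> N \<Longrightarrow> s \<in> S n \<Longrightarrow> z' n s \<in> ball s \<eta> \<inter> Q n \<and> (f ^^ j n) (\<theta> (z' n s)) \<notin> X N"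
    by metis
  define Z where "Z = (\<Union>n\<le>N. (\<lambda>s. (\<theta> (z' n s), j n)) ` S n)"
  show ?thesis
  proof (rule that [of Z])
    show "finite Z" unfolding Z_def using S(2) by auto
    show "(\<forall>i<i'. (f ^^ i) \<zeta> \<in> interior (A N)) \<and> (f ^^ i') \<zeta> \<in> V - X N" if Z: "(\<zeta>, i') \<in> Z" for \<zeta> i'
    proof -
      obtain n s where ns: "n \<le> N" "s \<in> S n" "\<zeta> = \<theta> (z' n s)" "i' = j n" using Z by (auto simp: Z_def)
      then show ?thesis using z' [OF ns(1,2)] Q(3,4) [OF ns(1)] by auto
    qed
    show "\<exists>\<zeta> i'. (\<zeta>, i') \<in> Z \<and> dist \<zeta> (\<theta> z) \<le> 1 / real (Suc N)" if n: "n \<le> N" and z: "z \<in> frontier (X n)" for n z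
    proof -
      obtain s where s: "s \<in> S n" "z \<in> ball s \<eta>" using S(3) z by blast
      have "(1/2 - (1/2) ^ (N + 2)) * norm (z' n s - z) \<le> 1/2 * norm (z' n s - z)"
        by (intro mult_right_mono) auto
      then have "norm ((\<theta> (z' n s) - \<theta> z) - (z' n s - z)) \<le> 1/2 * norm (z' n s - z)"
        using stageD(5) [OF st] by (rule order_trans [rotated])
      then have "dist (\<theta> (z' n s)) (\<theta> z) \<le> 3/2 * dist (z' n s) z" by (rule near_identity_lipschitz)
      also have "dist (z' n s) z \<le> 2 * \<eta>"
        using z' [OF n s(1)] s(2) dist_triangle [of "z' n s" z s] by (simp add: dist_commute)
      finally have "dist (\<theta> (z' n s)) (\<theta> z) \<le> 4 * \<eta>" using \<eta> by simp
      moreover have "4 * \<eta> = 1 / real (Suc N)" by (simp add: \<eta>_def field_simps)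
      moreover have "(\<theta> (z' n s), j n) \<in> Z" using n s(1) by (auto simp: Z_def)
      ultimately show ?thesis by auto
    qed
  qed
qed

text \<open>The pieces are nonseparating and pairwise disjoint, hence their union does not separate
  the plane and Runge's theorem will apply to it. Sending \<open>W\<close> to \<open>p\<close>
  creates new preimages of \<open>p\<close>; the two values at \<open>a\<close> and \<open>b\<close>
  keep the limit from being a polynomial. In the oscillating case \<open>E\<close> is the disc from
  which orbits are moved to the next set; in the escaping case it is empty.\<close>

lemma piecewise_model:
  assumes f: "f holomorphic_on UNIV" and W: "finite W" "W \<subseteq> interior (A (Suc N)) - A N - X N"
    and ab: "a \<in> interior (A (Suc N)) - A N - X N - W" "b \<in> interior (A (Suc N)) - A N - X N - W" "a \<noteq> b"
    and E: "nonseparating E" "E \<subseteq> interior (A (Suc N)) - A N - X N - W - {a, b}"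
    and \<tau>E: "\<tau>E holomorphic_on UNIV" and \<tau>: "open S" "X N \<subseteq> S" "\<tau> holomorphic_on S"
  obtains K \<Omega> g V where "nonseparating K" "open \<Omega>" "K \<subseteq> \<Omega>" "g holomorphic_on \<Omega>"
    "X N \<subseteq> interior V" "V \<subseteq> S \<inter> interior (A (Suc N))" "A N \<union> V \<union> E \<union> W \<union> {a, b} \<subseteq> K"
    "\<And>z. z \<in> A N \<Longrightarrow> g z = f z" "\<And>z. z \<in> V \<Longrightarrow> g z = \<tau> z" "\<And>z. z \<in> E \<Longrightarrow> g z = \<tau>E z"
    "\<And>z. z \<in> W \<Longrightarrow> g z = p" "g a = p" "g b = p + 1"
proof -
  have cl: "closed E" using E(1) by (simp add: nonseparating_def compact_imp_closed)
  define Y where "Y = S \<inter> interior (A (Suc N)) - (A N \<union> E \<union> W \<union> {a, b})"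
  have "closed W" using W(1) by (rule finite_imp_closed)
  then have "open Y" unfolding Y_def using \<tau>(1) cl A_closed
    by (intro open_Diff open_Int closed_Un) auto
  moreover have "X N \<inter> A N = {}" "X N \<subseteq> interior (A (Suc N))" using X_outside [of N N] X_inside [of N "Suc N"] by auto
  then have "X N \<subseteq> Y" unfolding Y_def using \<tau>(2) E(2) W(2) ab by blast
  ultimately obtain V where V: "nonseparating V" "X N \<subseteq> interior V" "V \<subseteq> Y"
    using nonseparating_fatten [OF nonseparating_X] by blast
  define Wa where "Wa = W \<union> {a}"
  have ns: "nonseparating Wa" "nonseparating {b}" using W(1) by (auto simp: Wa_def intro: nonseparating_finite)
  have comp: "compact Wa" "compact {b}" "compact E" "compact V" "compact (A N)"
    using ns E(1) V(1) A_compact by (auto simp: nonseparating_def)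
  have d1: "Wa \<inter> {b} = {}" using ab by (auto simp: Wa_def)
  have d2: "E \<inter> (Wa \<union> {b}) = {}" using E(2) by (auto simp: Wa_def)
  have d3: "V \<inter> (E \<union> (Wa \<union> {b})) = {}" using V(3) by (auto simp: Wa_def Y_def)
  have d4: "A N \<inter> (V \<union> (E \<union> (Wa \<union> {b}))) = {}" using V(3) E(2) W(2) ab by (auto simp: Wa_def Y_def)
  obtain g1 \<Omega>1 where g1: "open \<Omega>1" "Wa \<union> {b} \<subseteq> \<Omega>1" "g1 holomorphic_on \<Omega>1" "\<And>z. z \<in> Wa \<Longrightarrow> g1 z = p" "\<And>z. z \<in> {b} \<Longrightarrow> g1 z = p + 1"
    using holomorphic_glue [OF comp(1,2) d1 open_UNIV subset_UNIV holomorphic_on_const open_UNIV subset_UNIV holomorphic_on_const] by metis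
  obtain g2 \<Omega>2 where g2: "open \<Omega>2" "E \<union> (Wa \<union> {b}) \<subseteq> \<Omega>2" "g2 holomorphic_on \<Omega>2" "\<And>z. z \<in> E \<Longrightarrow> g2 z = \<tau>E z" "\<And>z. z \<in> Wa \<union> {b} \<Longrightarrow> g2 z = g1 z"
    using holomorphic_glue [OF comp(3) compact_Un [OF comp(1,2)] d2 open_UNIV subset_UNIV \<tau>E g1(1-3)] by metis
  have VS: "V \<subseteq> S" using V(3) by (auto simp: Y_def)
  obtain g3 \<Omega>3 where g3: "open \<Omega>3" "V \<union> (E \<union> (Wa \<union> {b})) \<subseteq> \<Omega>3" "g3 holomorphic_on \<Omega>3" "\<And>z. z \<in> V \<Longrightarrow> g3 z = \<tau> z" "\<And>z. z \<in> E \<union> (Wa \<union> {b}) \<Longrightarrow> g3 z = g2 z"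
    using holomorphic_glue [OF comp(4) compact_Un [OF comp(3) compact_Un [OF comp(1,2)]] d3 \<tau>(1) VS \<tau>(3) g2(1-3)] by metis
  obtain g \<Omega> where g: "open \<Omega>" "A N \<union> (V \<union> (E \<union> (Wa \<union> {b}))) \<subseteq> \<Omega>" "g holomorphic_on \<Omega>" "\<And>z. z \<in> A N \<Longrightarrow> g z = f z" "\<And>z. z \<in> V \<union> (E \<union> (Wa \<union> {b})) \<Longrightarrow> g z = g3 z"
    using holomorphic_glue [OF comp(5) compact_Un [OF comp(4) compact_Un [OF comp(3) compact_Un [OF comp(1,2)]]] d4 open_UNIV subset_UNIV f g3(1-3)] by metis
  show ?thesis
  proof (rule that [of "A N \<union> (V \<union> (E \<union> (Wa \<union> {b})))" \<Omega> g V])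
    show "nonseparating (A N \<union> (V \<union> (E \<union> (Wa \<union> {b}))))"
      by (intro nonseparating_Un A_nonsep V(1) E(1) ns d1 d2 d3 d4)
    show "V \<subseteq> S \<inter> interior (A (Suc N))" using V(3) by (auto simp: Y_def)
    show "A N \<union> V \<union> E \<union> W \<union> {a, b} \<subseteq> A N \<union> (V \<union> (E \<union> (Wa \<union> {b})))" by (auto simp: Wa_def)
    show "g z = p" if "z \<in> W" for z using that g(5) [of z] g3(5) [of z] g2(5) [of z] g1(4) [of z] by (simp add: Wa_def)
    show "g a = p" using g(5) [of a] g3(5) [of a] g2(5) [of a] g1(4) [of a] by (simp add: Wa_def)
    show "g b = p + 1" using g(5) [of b] g3(5) [of b] g2(5) [of b] g1(5) [of b] by (simp add: Wa_def)
    show "g z = \<tau>E z" if "z \<in> E" for z using that g(5) [of z] g3(5) [of z] g2(4) [of z] by simp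
    show "g z = \<tau> z" if "z \<in> V" for z using that g(5) [of z] g3(4) [of z] by simp
  qed (use g V in auto)
qed

text \<open>A frontier point of \<open>A N\<close> lies in the open set \<open>Y\<close>, so
  \<open>Y - A N\<close> is open and nonempty and has at least two points.\<close>

lemma fresh_points:
  assumes W: "finite W" "W \<subseteq> interior (A (Suc N)) - A N - X N"
  obtains a b where "a \<in> interior (A (Suc N)) - A N - X N - W" "b \<in> interior (A (Suc N)) - A N - X N - W" "a \<noteq> b"
proof -
  define Y where "Y = interior (A (Suc N)) - X N - W"
  have "closed W" using W(1) by (rule finite_imp_closed)
  then have opY: "open Y" unfolding Y_def using closed_each by (intro open_Diff) auto
  have AY: "A N \<subseteq> Y" unfolding Y_def using A(2) [of N] X_outside [of N N] W(2) by blast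
  have "A N \<noteq> {}" using p_inside [of N] interior_subset by blast
  moreover have "A N \<noteq> UNIV" using A_compact [of N] not_compact_UNIV by metis
  ultimately obtain y where y: "y \<in> frontier (A N)" using frontier_not_empty by blast
  then have "y \<in> Y" using AY A_closed frontier_subset_closed by blast
  then have "Y - A N \<noteq> {}"
    using y opY unfolding frontier_straddle by (metis Diff_eq_empty_iff open_contains_ball mem_ball subsetD)
  then obtain a where a: "a \<in> Y - A N" by blast
  have op: "open (Y - A N)" using opY A_closed by (rule open_Diff)
  have "Y - A N \<noteq> {a}" using op finite_imp_not_open [of "{a}"] by auto
  then obtain b where "b \<in> Y - A N" "b \<noteq> a" using a by blast
  then show ?thesis using that [of a b] a by (auto simp: Y_def)
qed

text \<open>The open sets \<open>G i\<close> follow the orbit from \<open>X N\<close> to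
  \<open>X (Suc N)\<close>. They lie in the interior of \<open>K\<close>, where the polynomial will
  be close to the model, so that the perturbed map has the same itinerary.\<close>

lemma step_model:
  assumes st: "stage N f \<theta> k Fr" and W: "finite W" "W \<subseteq> interior (A (Suc N)) - A N - X N"
  obtains K \<Omega> g m G T a b where "nonseparating K" "open \<Omega>" "K \<subseteq> \<Omega>" "g holomorphic_on \<Omega>"
    "A N \<subseteq> K" "\<And>z. z \<in> A N \<Longrightarrow> g z = f z" "W \<subseteq> K" "\<And>w. w \<in> W \<Longrightarrow> g w = p"
    "a \<in> K" "b \<in> K" "a \<in> interior (A (Suc N)) - A N" "b \<in> interior (A (Suc N)) - A N" "g a = p" "g b = p + 1"
    "0 < m" "if osc then 1 < m \<and> G 1 \<subseteq> ball p r else m = 1"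
    "\<And>i. i < m \<Longrightarrow> open (G i)" "\<And>i. i < m \<Longrightarrow> G i \<subseteq> interior K" "\<And>i. i < m \<Longrightarrow> G i \<subseteq> interior (A (Suc N))"
    "\<And>i z. i < m \<Longrightarrow> z \<in> T \<Longrightarrow> (g ^^ i) z \<in> G i"
    "open T" "X N \<subseteq> T" "T \<subseteq> U" "\<And>z. z \<in> T \<Longrightarrow> (g ^^ m) z = \<phi> z"
proof -
  note f = stageD(1) [OF st]
  obtain a b where ab: "a \<in> interior (A (Suc N)) - A N - X N - W" "b \<in> interior (A (Suc N)) - A N - X N - W" "a \<noteq> b"
    using fresh_points [OF W] .
  show ?thesis
  proof (cases osc)
    case False
    have E: "nonseparating {}" "{} \<subseteq> interior (A (Suc N)) - A N - X N - W - {a, b}" by (auto intro: nonseparating_finite)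
    obtain K \<Omega> g V where g: "nonseparating K" "open \<Omega>" "K \<subseteq> \<Omega>" "g holomorphic_on \<Omega>"
      "X N \<subseteq> interior V" "V \<subseteq> U \<inter> interior (A (Suc N))" "A N \<union> V \<union> {} \<union> W \<union> {a, b} \<subseteq> K"
      "\<And>z. z \<in> A N \<Longrightarrow> g z = f z" "\<And>z. z \<in> V \<Longrightarrow> g z = \<phi> z" "\<And>z. z \<in> {} \<Longrightarrow> g z = id z"
      "\<And>z. z \<in> W \<Longrightarrow> g z = p" "g a = p" "g b = p + 1"
      by (rule piecewise_model [OF f W ab E holomorphic_on_id U(1) U(2) U(3)]) (rule that)
    have VU: "interior V \<subseteq> U" "interior V \<subseteq> interior (A (Suc N))" "interior V \<subseteq> interior K" "interior V \<subseteq> V"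
      using g(6,7) interior_subset [of V] interior_mono [of V K] by auto
    show ?thesis
    proof (rule that [of K \<Omega> g a b 1 "\<lambda>i. interior V" "interior V"])
      show "A N \<subseteq> K" "W \<subseteq> K" "a \<in> K" "b \<in> K" using g(7) by auto
      show "(g ^^ 1) z = \<phi> z" if "z \<in> interior V" for z
        using g(9) VU(4) that by auto
      show "a \<in> interior (A (Suc N)) - A N" "b \<in> interior (A (Suc N)) - A N" using ab by auto
    qed (use g(1-6,8-13) VU False in auto)
  next
    case True
    define Y where "Y = interior (A (Suc N)) - X N - W - {a, b}"
    have Y: "open Y" "A N \<subseteq> Y"
    proof -
      have "closed W" using W(1) by (rule finite_imp_closed)
      then show "open Y" unfolding Y_def using closed_each by (intro open_Diff) auto
      show "A N \<subseteq> Y" unfolding Y_def using A(2) [of N] X_outside [of N N] W(2) ab by blast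
    qed
    obtain l e t h where relay: "t > 0" "cball e t \<subseteq> Y - A N" "h holomorphic_on ball e t" "h ` ball e t \<subseteq> ball p r"
      "\<And>y. y \<in> ball e t \<Longrightarrow> (f ^^ l) (h y) = y" "\<And>y i. y \<in> ball e t \<Longrightarrow> i < l \<Longrightarrow> (f ^^ i) (h y) \<in> interior (A N)"
      using relay [OF f stageD(2,3) [OF st] r A_compact disc_inside Y] by metis
    have "l > 0"
    proof (rule ccontr)
      assume "\<not> l > 0"
      then have "h e = e" using relay(1) relay(5) [of e] by simp
      then have "e \<in> ball p r" using relay(1,4) by (metis centre_in_ball image_subset_iff)
      then have "e \<in> A N" using disc_inside [of N] interior_subset [of "A N"] ball_subset_cball [of p r] by blast
      moreover have "e \<in> cball e t" using relay(1) by simp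
      ultimately show False using relay(2) by blast
    qed
    obtain R where R: "R > 0" "X (Suc N) \<subseteq> ball 0 R" using compact_imp_bounded [OF compact_X] bounded_subset_ballD by metis
    \<comment> \<open>The affine map \<open>q\<close> shrinks the disc of radius \<open>R\<close>,
      which contains \<open>X (Suc N)\<close>, into the disc of radius \<open>t / 4\<close> around
      \<open>e\<close>; \<open>\<tau>E\<close> is its inverse.\<close>
    define c where "c = complex_of_real (4 * R / t)"
    have c: "c \<noteq> 0" "norm c = 4 * R / t" using R(1) relay(1) by (auto simp: c_def norm_divide norm_mult)
    define q where "q v = e + v / c" for v
    have q: "q v \<in> ball e (t / 4)" if "norm v < R" for v
    proof -
      have "norm (v / c) < t / 4" using that c R(1) relay(1) by (simp add: norm_divide divide_less_eq field_simps)
      then show ?thesis by (simp add: q_def dist_norm)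
    qed
    define S where "S = U \<inter> \<phi> -` ball 0 R"
    have S: "open S" "X N \<subseteq> S" "S \<subseteq> U"
    proof -
      show "open S" unfolding S_def using holomorphic_on_imp_continuous_on [OF U(3)] U(1) by (intro continuous_open_preimage) auto
      show "X N \<subseteq> S" unfolding S_def using U(2) \<phi>X [of N] R(2) by blast
    qed (auto simp: S_def)
    have qS: "q (\<phi> z) \<in> ball e (t / 4)" if "z \<in> S" for z using q that by (auto simp: S_def)
    have t4: "ball e (t / 4) \<subseteq> ball e t" using relay(1) by (intro subset_ball) auto
    \<comment> \<open>The itinerary: \<open>h\<close> starts in the disc around \<open>p\<close>,
      \<open>l\<close> applications of \<open>f\<close> lead to \<open>q (\<phi> z)\<close> near
      \<open>e\<close>, and \<open>\<tau>E\<close> expands this to \<open>\<phi> z\<close>. With the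
      entry into the disc this makes \<open>l + 2\<close> steps.\<close>
    define \<tau> where "\<tau> z = h (q (\<phi> z))" for z
    have \<tau>: "\<tau> holomorphic_on S"
    proof -
      have "(\<lambda>z. q (\<phi> z)) holomorphic_on S"
        unfolding q_def using U(3) S(3) c(1) by (intro holomorphic_intros) (auto elim: holomorphic_on_subset)
      then have "h \<circ> (\<lambda>z. q (\<phi> z)) holomorphic_on S"
        by (rule holomorphic_on_compose_gen [OF _ relay(3)]) (use qS t4 in auto)
      then show ?thesis by (simp add: \<tau>_def [abs_def] comp_def)
    qed
    define \<tau>E where "\<tau>E w = (w - e) * c" for w
    have \<tau>E: "\<tau>E holomorphic_on UNIV" unfolding \<tau>E_def by (intro holomorphic_intros)
    define E where "E = cball e (t / 2)"
    have E: "nonseparating E" "E \<subseteq> interior (A (Suc N)) - A N - X N - W - {a, b}"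
    proof -
      show "nonseparating E" unfolding E_def by (rule nonseparating_cball)
      have "E \<subseteq> cball e t" using relay(1) unfolding E_def by (intro subset_cball) auto
      then show "E \<subseteq> interior (A (Suc N)) - A N - X N - W - {a, b}" using relay(2) unfolding Y_def by blast
    qed
    obtain K \<Omega> g V where g: "nonseparating K" "open \<Omega>" "K \<subseteq> \<Omega>" "g holomorphic_on \<Omega>"
      "X N \<subseteq> interior V" "V \<subseteq> S \<inter> interior (A (Suc N))" "A N \<union> V \<union> E \<union> W \<union> {a, b} \<subseteq> K"
      "\<And>z. z \<in> A N \<Longrightarrow> g z = f z" "\<And>z. z \<in> V \<Longrightarrow> g z = \<tau> z" "\<And>z. z \<in> E \<Longrightarrow> g z = \<tau>E z"
      "\<And>z. z \<in> W \<Longrightarrow> g z = p" "g a = p" "g b = p + 1"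
      by (rule piecewise_model [OF f W ab E \<tau>E S(1,2) \<tau>]) (rule that)
    define G where "G i = (if i = 0 then interior V else if i = 1 then ball p r else if i \<le> l then interior (A N) else ball e (t / 2))" for i :: nat
    have orb: "(g ^^ Suc i) z = (f ^^ i) (\<tau> z)" if z: "z \<in> interior V" and "i \<le> l" for i z
      using that(2)
    proof (induction i)
      case 0
      then show ?case using g(9) z interior_subset [of V] by auto
    next
      case (Suc i)
      have "z \<in> S" using z interior_subset [of V] g(6) by blast
      then have "q (\<phi> z) \<in> ball e t" using qS t4 by blast
      then have "(f ^^ i) (\<tau> z) \<in> interior (A N)" using Suc.prems relay(6) unfolding \<tau>_def by simp
      then have "g ((f ^^ i) (\<tau> z)) = f ((f ^^ i) (\<tau> z))" using g(8) interior_subset [of "A N"] by blast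
      then show ?case using Suc by simp
    qed
    have VS: "interior V \<subseteq> S" "interior V \<subseteq> interior (A (Suc N))" using g(6) interior_subset [of V] by auto
    have orbG: "(g ^^ i) z \<in> G i" if i: "i < l + 2" and z: "z \<in> interior V" for i z
    proof -
      have zS: "z \<in> S" using z VS by blast
      have qt: "q (\<phi> z) \<in> ball e t" using qS [OF zS] t4 by blast
      consider "i = 0" | j where "i = Suc j" "j \<le> l" using i by (cases i) auto
      then show ?thesis
      proof cases
        case 1
        then show ?thesis using z by (simp add: G_def)
      next
        case 2
        then have eq: "(g ^^ i) z = (f ^^ j) (\<tau> z)" using orb [OF z] by simp
        show ?thesis
        proof (cases "j = 0 \<or> j = l")
          case False
          then have "(f ^^ j) (\<tau> z) \<in> interior (A N)" using relay(6) [OF qt, of j] 2 by (simp add: \<tau>_def)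
          then show ?thesis using eq False 2 by (simp add: G_def)
        next
          case True
          show ?thesis
          proof (cases "j = 0")
            case True
            have "\<tau> z \<in> ball p r" using relay(4) qt unfolding \<tau>_def by blast
            then show ?thesis using eq True 2 by (simp add: G_def)
          next
            case False
            then have "j = l" using True by simp
            then have "(g ^^ i) z = q (\<phi> z)" using eq relay(5) [OF qt] by (simp add: \<tau>_def)
            moreover have "q (\<phi> z) \<in> ball e (t / 2)" using qS [OF zS] relay(1) by simp
            ultimately show ?thesis using 2 \<open>j = l\<close> \<open>l > 0\<close> by (simp add: G_def)
          qed
        qed
      qed
    qed
    have final: "(g ^^ (l + 2)) z = \<phi> z" if z: "z \<in> interior V" for z
    proof -
      have zS: "z \<in> S" using z VS by blast
      have qt: "q (\<phi> z) \<in> ball e t" "q (\<phi> z) \<in> E" using qS [OF zS] t4 relay(1) by (auto simp: E_def)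
      have "(g ^^ Suc l) z = q (\<phi> z)" using orb [OF z, of l] relay(5) [OF qt(1)] by (simp add: \<tau>_def)
      then have "(g ^^ (l + 2)) z = \<tau>E (q (\<phi> z))" using g(10) [OF qt(2)] by simp
      then show ?thesis using c(1) by (simp add: \<tau>E_def q_def)
    qed
    have intA: "interior (A N) \<subseteq> interior (A (Suc N))" "interior (A N) \<subseteq> interior K"
      using interior_A_mono [of N "Suc N"] g(7) interior_mono [of "A N" K] by auto
    have bp: "ball p r \<subseteq> interior (A N)" using disc_inside [of N] ball_subset_cball by blast
    have "E \<subseteq> interior (A (Suc N))" "E \<subseteq> K" using E(2) g(7) by auto
    then have be: "ball e (t / 2) \<subseteq> interior (A (Suc N))" "ball e (t / 2) \<subseteq> interior K"
      unfolding E_def using ball_subset_cball [of e "t / 2"] by (blast, intro interior_maximal) (blast, simp)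
    have VK: "interior V \<subseteq> interior K" using g(7) by (intro interior_mono) auto
    show ?thesis
    proof (rule that [of K \<Omega> g a b "l + 2" G "interior V"])
      show "if osc then 1 < l + 2 \<and> G 1 \<subseteq> ball p r else l + 2 = 1" using True by (simp add: G_def)
      show "open (G i)" for i by (simp add: G_def)
      show "G i \<subseteq> interior K" for i using intA bp be VK by (auto simp: G_def)
      show "G i \<subseteq> interior (A (Suc N))" for i using intA bp be VS by (auto simp: G_def)
      show "interior V \<subseteq> U" using VS S by blast
      show "A N \<subseteq> K" "W \<subseteq> K" "a \<in> K" "b \<in> K" using g(7) by auto
      show "a \<in> interior (A (Suc N)) - A N" "b \<in> interior (A (Suc N)) - A N" using ab by auto
    qed (use g(1-6,8-13) orbG final in auto)
  qed
qed

end

section \<open>One step of the construction\<close>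

lemma funpow_agree:
  assumes "\<And>i. i < j \<Longrightarrow> (f ^^ i) x \<in> S" "\<And>z. z \<in> S \<Longrightarrow> g z = f z" "i \<le> j"
  shows "(g ^^ i) x = (f ^^ i) x"
  using assms(3)
proof (induction i)
  case (Suc i)
  then show ?case using assms(1) [of i] assms(2) by simp
qed simp

lemma deriv_eq_if_close:
  assumes "f holomorphic_on UNIV" "g holomorphic_on UNIV" "open S" "p \<in> S"
    and le: "\<And>z. z \<in> S \<Longrightarrow> norm (g z - f z) \<le> C * (norm (z - p))\<^sup>2"
  shows "deriv g p = deriv f p"
proof -
  define d where "d z = g z - f z" for z
  have "d p = 0" using le [OF assms(4)] by (simp add: d_def)
  have "(\<lambda>h. (d (p + h) - d p) / h) \<midarrow>0\<rightarrow> 0"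
  proof (rule Lim_null_comparison)
    obtain e where e: "e > 0" "ball p e \<subseteq> S" using assms(3,4) open_contains_ball by blast
    show "\<forall>\<^sub>F h in at 0. norm ((d (p + h) - d p) / h) \<le> C * norm h"
      unfolding eventually_at
    proof (intro exI [of _ e] conjI e(1) ballI impI)
      fix h :: complex assume h: "h \<noteq> 0 \<and> dist h 0 < e"
      then have "p + h \<in> S" using e(2) by (auto simp: dist_norm)
      then have "norm (d (p + h)) \<le> C * (norm h)\<^sup>2" using le [of "p + h"] by (simp add: d_def)
      then show "norm ((d (p + h) - d p) / h) \<le> C * norm h"
        using h \<open>d p = 0\<close> by (simp add: norm_divide divide_le_eq power2_eq_square mult.assoc)
    qed
    show "((\<lambda>h. C * norm h) \<longlongrightarrow> 0) (at (0::complex))" by (auto intro!: tendsto_eq_intros)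
  qed
  then have "(d has_field_derivative 0) (at p)" by (simp add: DERIV_def)
  moreover have "(f has_field_derivative deriv f p) (at p)" using assms(1) holomorphic_derivI by blast
  ultimately have "((\<lambda>z. d z + f z) has_field_derivative 0 + deriv f p) (at p)" by (rule DERIV_add)
  moreover have "(\<lambda>z. d z + f z) = g" by (auto simp: d_def)
  ultimately show ?thesis by (simp add: DERIV_imp_deriv)
qed

context wandering_system
begin

text \<open>The increment of \<theta> is bounded up to order \<open>Suc N\<close>, which grows with
  \<open>N\<close>, in order that the limit be smooth. Exact agreement on \<open>Fr\<close>
  preserves finite orbits in the limit. The last two clauses feed the arguments for the Julia set
  and for transcendence.\<close>

definition successor where
  "successor N f \<theta> (k :: nat \<Rightarrow> nat) Fr f' \<theta>' k' Fr' \<longleftrightarrow>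
     (\<forall>n<N. k' n = k n) \<and> (\<forall>z\<in>A N. norm (f' z - f z) \<le> (1/2) ^ N) \<and> (\<forall>z\<in>Fr. f' z = f z) \<and> Fr \<subseteq> Fr' \<and>
     smooth (\<lambda>z. \<theta>' z - \<theta> z) \<and> derivatives_bounded (Suc N) ((1/2) ^ (N + 4)) (\<lambda>z. \<theta>' z - \<theta> z) \<and>
     (\<forall>n\<le>N. \<forall>z. norm (\<theta>' z - \<theta> z) \<le> \<epsilon> n * (1/2) ^ (N + 1)) \<and>
     (\<forall>n\<le>N. \<forall>z\<in>frontier (X n). \<exists>\<zeta> j. dist \<zeta> (\<theta> z) \<le> 1 / real (Suc N) \<and> (f' ^^ j) \<zeta> = p \<and> (\<forall>i\<le>j. (f' ^^ i) \<zeta> \<in> Fr')) \<and>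
     (\<exists>a b. a \<in> Fr' - A N \<and> b \<in> Fr' - A N \<and> f' a = p \<and> f' b = p + 1)"

text \<open>The error committed in replacing the model map by \<open>F\<close> is absorbed by \<open>u\<close>: the map \<open>\<theta> + u\<close> conjugates
  near \<open>X 0, \<dots>, X N\<close>, where \<open>\<theta>\<close> is still unperturbed near \<open>X (Suc N)\<close>.\<close>

definition absorbs where
  "absorbs N \<theta> (k :: nat \<Rightarrow> nat) Wn F e u \<longleftrightarrow>
     (\<forall>n\<le>N. u n holomorphic_on Wn n \<and> (\<forall>z\<in>Wn n. norm (u n z) \<le> e \<and> (z \<in> M n \<longrightarrow> u n z = 0) \<and>
        (\<forall>i<k n. (F ^^ i) (\<theta> z + u n z) \<in> interior (A (Suc n))) \<and> (osc \<longrightarrow> F (\<theta> z + u n z) \<in> ball p r) \<and>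
        (F ^^ k n) (\<theta> z + u n z) = \<theta> (\<phi> z) + (if n = N then 0 else u (Suc n) (\<phi> z))))"

text \<open>The shells \<open>interior (A (Suc n)) - A n\<close> are pairwise disjoint and contain
  the \<open>X n\<close>. Cut-offs supported in them do not interfere, and near \<open>X n\<close>
  the sum reduces to \<open>u n\<close>. The bound \<open>\<epsilon>0\<close> depends on the
  neighbourhoods and on \<kappa>, not on \<open>u\<close>.\<close>

lemma cutoff_sum:
  assumes Wn: "\<And>n. n \<le> N \<Longrightarrow> open (Wn n)" "\<And>n. n \<le> N \<Longrightarrow> X n \<subseteq> Wn n" and \<kappa>: "\<kappa> > 0"
  obtains R Q \<epsilon>0 where "\<epsilon>0 > 0" "\<forall>n\<le>N. open (R n) \<and> X n \<subseteq> R n \<and> R n \<subseteq> Wn n"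
    "open Q" "\<And>n. n > N \<Longrightarrow> X n \<subseteq> Q"
    "\<forall>u. (\<forall>n\<le>N. u n holomorphic_on Wn n) \<longrightarrow> (\<forall>n\<le>N. \<forall>z\<in>Wn n. norm (u n z) \<le> \<epsilon>0) \<longrightarrow>
       (\<exists>\<upsilon>. smooth \<upsilon> \<and> derivatives_bounded (Suc N) \<kappa> \<upsilon> \<and> (\<forall>n\<le>N. \<forall>z\<in>R n. \<upsilon> z = u n z) \<and> (\<forall>z\<in>Q. \<upsilon> z = 0))"
proof -
  define D where "D n = interior (A (Suc n)) - A n" for n
  have D_disj: "z \<notin> D m" if "z \<in> D n" "m < n" for z m n
    using that A_mono [of "Suc m" n] interior_subset [of "A (Suc m)"] by (auto simp: D_def)
  have D_disj2: "m = n" if "z \<in> D n" "z \<in> D m" for z m n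
    using D_disj [of z n m] D_disj [of z m n] that by (cases m n rule: linorder_cases) auto
  have XD: "X n \<subseteq> D n" for n using X_inside [of n "Suc n"] X_outside [of n n] by (auto simp: D_def)
  define cf where "cf n \<beta> S R \<longleftrightarrow> smooth \<beta> \<and> compact S \<and> S \<subseteq> Wn n \<inter> D n \<and> open R \<and> X n \<subseteq> R \<and> R \<subseteq> S \<and> (\<forall>z\<in>R. \<beta> z = 1) \<and> (\<forall>z. z \<notin> S \<longrightarrow> \<beta> z = 0)"
    for n and \<beta> :: "complex \<Rightarrow> complex" and S R
  have "\<exists>\<beta> S R. cf n \<beta> S R" if n: "n \<le> N" for n
  proof -
    have "open (Wn n \<inter> D n)" using Wn(1) [OF n] A_closed by (auto simp: D_def)
    moreover have "X n \<subseteq> Wn n \<inter> D n" using Wn(2) [OF n] XD by blast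
    ultimately obtain \<beta> S R where "smooth \<beta>" "compact S" "S \<subseteq> Wn n \<inter> D n" "open R" "X n \<subseteq> R" "R \<subseteq> S"
        "\<And>z. z \<in> R \<Longrightarrow> \<beta> z = 1" "\<And>z. z \<notin> S \<Longrightarrow> \<beta> z = 0"
      by (rule smooth_cutoff [OF compact_X [of n]]) (rule that)
    then show ?thesis unfolding cf_def by (intro exI [of _ \<beta>] exI [of _ S] exI [of _ R] conjI ballI allI impI)
  qed
  then obtain \<beta> S R where cf: "\<And>n. n \<le> N \<Longrightarrow> cf n (\<beta> n) (S n) (R n)" by metis
  have cut: "\<And>n. n \<le> N \<Longrightarrow> smooth (\<beta> n)" "\<And>n. n \<le> N \<Longrightarrow> compact (S n)" "\<And>n. n \<le> N \<Longrightarrow> S n \<subseteq> Wn n \<inter> D n"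
      "\<And>n. n \<le> N \<Longrightarrow> open (R n)" "\<And>n. n \<le> N \<Longrightarrow> X n \<subseteq> R n" "\<And>n. n \<le> N \<Longrightarrow> R n \<subseteq> S n"
      "\<And>n z. n \<le> N \<Longrightarrow> z \<in> R n \<Longrightarrow> \<beta> n z = 1" "\<And>n z. n \<le> N \<Longrightarrow> z \<notin> S n \<Longrightarrow> \<beta> n z = 0"
    using cf unfolding cf_def by simp_all
  have "\<exists>C\<ge>0. \<forall>u \<delta>. u holomorphic_on Wn n \<longrightarrow> \<delta> \<ge> 0 \<longrightarrow> (\<forall>z\<in>Wn n. norm (u z) \<le> \<delta>) \<longrightarrow>
     times_differentiable (Suc N) (\<lambda>z. \<beta> n z * u z) \<and> derivatives_bounded (Suc N) (C * \<delta>) (\<lambda>z. \<beta> n z * u z)" if n: "n \<le> N" for n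
    by (rule cutoff_times_holomorphic [OF cut(1) [OF n] Wn(1) [OF n] cut(2) [OF n]])
       (use cut(3) [OF n] cut(8) [OF n] in auto)
  then obtain C where C: "\<And>n. n \<le> N \<Longrightarrow> C n \<ge> 0" "\<And>n u \<delta>. n \<le> N \<Longrightarrow> u holomorphic_on Wn n \<Longrightarrow> \<delta> \<ge> 0 \<Longrightarrow> (\<forall>z\<in>Wn n. norm (u z) \<le> \<delta>) \<Longrightarrow>
      derivatives_bounded (Suc N) (C n * \<delta>) (\<lambda>z. \<beta> n z * u z)"
    by metis
  define Cs where "Cs = 1 + (\<Sum>n\<le>N. C n)"
  have Cs: "C n \<le> Cs" if "n \<le> N" for n
  proof -
    have "C n \<le> (\<Sum>n\<le>N. C n)" using that C(1) by (intro member_le_sum) auto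
    then show ?thesis by (simp add: Cs_def)
  qed
  have Cs0: "Cs > 0" unfolding Cs_def using C(1) by (intro add_pos_nonneg sum_nonneg) auto
  \<comment> \<open>There are \<open>Suc N\<close> summands, each magnified by at most
    \<open>Cs\<close>.\<close>
  define \<epsilon>0 where "\<epsilon>0 = \<kappa> / (real (Suc N) * Cs)"
  have \<epsilon>0: "\<epsilon>0 > 0" using \<kappa> Cs0 by (simp add: \<epsilon>0_def)
  have C\<epsilon>0: "C n * \<epsilon>0 \<le> \<kappa> / real (Suc N)" if "n \<le> N" for n
  proof -
    have "C n * \<epsilon>0 \<le> Cs * \<epsilon>0" using Cs [OF that] \<epsilon>0 by (intro mult_right_mono) auto
    also have "\<dots> = \<kappa> / real (Suc N)" using Cs0 by (simp add: \<epsilon>0_def)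
    finally show ?thesis .
  qed
  show ?thesis
  proof (rule that [of \<epsilon>0 R "- (\<Union>n\<le>N. S n)"])
    have "closed (\<Union>n\<le>N. S n)" using cut(2) compact_imp_closed by (intro closed_UN) auto
    then show "open (- (\<Union>n\<le>N. S n))" by (rule open_Compl)
    show "\<forall>n\<le>N. open (R n) \<and> X n \<subseteq> R n \<and> R n \<subseteq> Wn n" using cut(3-6) by blast
    show "X n \<subseteq> - (\<Union>m\<le>N. S m)" if n: "n > N" for n
    proof -
      have "z \<notin> S m" if "m \<le> N" "z \<in> X n" for m z
      proof
        assume "z \<in> S m"
        then have "z \<in> D m" using cut(3) [OF that(1)] by blast
        moreover have "z \<in> D n" using XD that(2) by blast
        ultimately have "m = n" using D_disj2 by blast
        then show False using that(1) n by simp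
      qed
      then show ?thesis by blast
    qed
    show "\<forall>u. (\<forall>n\<le>N. u n holomorphic_on Wn n) \<longrightarrow> (\<forall>n\<le>N. \<forall>z\<in>Wn n. norm (u n z) \<le> \<epsilon>0) \<longrightarrow>
      (\<exists>\<upsilon>. smooth \<upsilon> \<and> derivatives_bounded (Suc N) \<kappa> \<upsilon> \<and> (\<forall>n\<le>N. \<forall>z\<in>R n. \<upsilon> z = u n z) \<and> (\<forall>z\<in>- (\<Union>n\<le>N. S n). \<upsilon> z = 0))"
    proof (intro allI impI)
    fix u assume "\<forall>n\<le>N. u n holomorphic_on Wn n" "\<forall>n\<le>N. \<forall>z\<in>Wn n. norm (u n z) \<le> \<epsilon>0"
    then have u: "\<And>n. n \<le> N \<Longrightarrow> u n holomorphic_on Wn n" "\<And>n z. n \<le> N \<Longrightarrow> z \<in> Wn n \<Longrightarrow> norm (u n z) \<le> \<epsilon>0" by blast+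
    define \<upsilon> where "\<upsilon> z = (\<Sum>n\<in>{..N}. \<beta> n z * u n z)" for z
    have sm: "smooth (\<lambda>z. \<beta> n z * u n z)" if n: "n \<le> N" for n
      by (rule smooth_cutoff_times_holomorphic [OF cut(1) [OF n] Wn(1) [OF n] cut(2) [OF n], of "u n" \<epsilon>0])
         (use cut(3) [OF n] cut(8) [OF n] u [OF n] \<epsilon>0 in auto)
    have "smooth \<upsilon>" unfolding \<upsilon>_def using sm by (intro smooth_sum) auto
    moreover have "derivatives_bounded (Suc N) \<kappa> \<upsilon>"
    proof -
      have "derivatives_bounded (Suc N) (real (card {..N}) * (\<kappa> / real (Suc N))) \<upsilon>"
        unfolding \<upsilon>_def
      proof (rule derivatives_bounded_sum)
        fix n assume n: "n \<in> {..N}"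
        show "derivatives_bounded (Suc N) (\<kappa> / real (Suc N)) (\<lambda>z. \<beta> n z * u n z)"
          by (rule derivatives_bounded_mono_B [OF C(2) C\<epsilon>0]) (use n u \<epsilon>0 in auto)
        show "times_differentiable (Suc N) (\<lambda>z. \<beta> n z * u n z)" using sm n unfolding smooth_def by blast
      qed simp
      then show ?thesis by (simp only: card_atMost nonzero_mult_div_cancel_left times_divide_eq_right of_nat_eq_0_iff nat.distinct not_False_eq_True)
    qed
    moreover have "\<upsilon> z = u n z" if n: "n \<le> N" and z: "z \<in> R n" for n z
    proof -
      have "\<beta> m z = 0" if m: "m \<le> N" "m \<noteq> n" for m
      proof (rule cut(8) [OF m(1)])
        show "z \<notin> S m" using cut(3,6) [OF n] cut(3) [OF m(1)] z D_disj2 m(2) by blast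
      qed
      then have "\<upsilon> z = (\<Sum>m\<in>{..N}. if m = n then u n z else 0)"
        unfolding \<upsilon>_def using cut(7) [OF n z] by (intro sum.cong) auto
      then show ?thesis using n by simp
    qed
    moreover have "\<upsilon> z = 0" if "z \<in> - (\<Union>n\<le>N. S n)" for z
      unfolding \<upsilon>_def using that cut(8) by (intro sum.neutral) auto
    ultimately show "\<exists>\<upsilon>. smooth \<upsilon> \<and> derivatives_bounded (Suc N) \<kappa> \<upsilon> \<and> (\<forall>n\<le>N. \<forall>z\<in>R n. \<upsilon> z = u n z) \<and> (\<forall>z\<in>- (\<Union>n\<le>N. S n). \<upsilon> z = 0)"
      by blast
    qed
  qed (use \<epsilon>0 cut in auto)
qed

text \<open>For \<open>n < N\<close> the first \<open>k n\<close> points of an orbit starting in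
  \<open>\<theta> (X n)\<close> lie in \<open>A N\<close>, where the model agrees with
  \<open>f\<close>. The old conjugacies therefore hold for \<open>g\<close> too, and all sets up to
  \<open>X N\<close> are handled by one application of
  \<open>simultaneous_perturbation\<close>.\<close>

lemma step_solution:
  assumes st: "stage N f \<theta> k Fr" and K: "open \<Omega>" "K \<subseteq> \<Omega>" "g holomorphic_on \<Omega>" "A N \<subseteq> K" "\<And>z. z \<in> A N \<Longrightarrow> g z = f z"
    and m: "0 < m" "if osc then 1 < m \<and> G 1 \<subseteq> ball p r else m = 1"
    and G: "\<And>i. i < m \<Longrightarrow> open (G i)" "\<And>i. i < m \<Longrightarrow> G i \<subseteq> interior K" "\<And>i. i < m \<Longrightarrow> G i \<subseteq> interior (A (Suc N))"
      "\<And>i z. i < m \<Longrightarrow> z \<in> T \<Longrightarrow> (g ^^ i) z \<in> G i"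
    and T: "open T" "X N \<subseteq> T" "T \<subseteq> U" "\<And>z. z \<in> T \<Longrightarrow> (g ^^ m) z = \<phi> z"
  defines "k' \<equiv> k(N := m)"
  obtains Wn Mk where "finite Mk" "\<And>n. n \<le> N \<Longrightarrow> open (Wn n)" "\<And>n. n \<le> N \<Longrightarrow> X n \<subseteq> Wn n"
    "\<And>n. n \<le> N \<Longrightarrow> \<theta> holomorphic_on Wn n" "\<And>n. n \<le> N \<Longrightarrow> Wn n \<subseteq> U"
    "\<And>\<epsilon>0. \<epsilon>0 > 0 \<Longrightarrow> \<exists>a \<delta>. \<delta> > 0 \<and> (\<forall>F. F holomorphic_on UNIV \<longrightarrow> (\<forall>w\<in>K. norm (F w - g w) \<le> \<delta> * wt Mk w ^ a) \<longrightarrow>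
       (\<exists>u. absorbs N \<theta> k' Wn F \<epsilon>0 u))"
proof -
  have "\<forall>n. \<exists>Q. open Q \<and> X n \<subseteq> Q \<and> \<theta> holomorphic_on Q \<and> (n \<ge> N \<longrightarrow> (\<forall>z\<in>Q. \<theta> z = z))"
    using stageD(6) [OF st] by (rule allI)
  from choice [OF this] obtain Q where "\<forall>n. open (Q n) \<and> X n \<subseteq> Q n \<and> \<theta> holomorphic_on Q n \<and> (n \<ge> N \<longrightarrow> (\<forall>z\<in>Q n. \<theta> z = z))"
    by (elim exE)
  then have Q: "\<And>n. open (Q n)" "\<And>n. X n \<subseteq> Q n" "\<And>n. \<theta> holomorphic_on Q n" "\<And>n z. n \<ge> N \<Longrightarrow> z \<in> Q n \<Longrightarrow> \<theta> z = z"
    by blast+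
  have "\<forall>n. \<exists>Q1. n < N \<longrightarrow> open Q1 \<and> X n \<subseteq> Q1 \<and> (\<forall>z\<in>Q1. (f ^^ k n) (\<theta> z) = \<theta> (\<phi> z))"
    using stageD(9) [OF st] by blast
  from choice [OF this] obtain Q1 where "\<forall>n<N. open (Q1 n) \<and> X n \<subseteq> Q1 n \<and> (\<forall>z\<in>Q1 n. (f ^^ k n) (\<theta> z) = \<theta> (\<phi> z))"
    by (elim exE)
  then have Q1: "\<And>n. n < N \<Longrightarrow> open (Q1 n)" "\<And>n. n < N \<Longrightarrow> X n \<subseteq> Q1 n" "\<And>n z. n < N \<Longrightarrow> z \<in> Q1 n \<Longrightarrow> (f ^^ k n) (\<theta> z) = \<theta> (\<phi> z)"
    by blast+
  have near: "norm ((\<theta> x - \<theta> y) - (x - y)) \<le> 1/2 * norm (x - y)" for x y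
  proof -
    have "(1/2 - (1/2) ^ (N + 2)) * norm (x - y) \<le> 1/2 * norm (x - y)" by (intro mult_right_mono) auto
    with stageD(5) [OF st, of x y] show ?thesis by (rule order_trans)
  qed
  \<comment> \<open>In the oscillating case the disc around \<open>p\<close> is built into the
    domain of the first iterate, so that the perturbed orbits visit it as well.\<close>
  define GG where "GG n i = (if n = N then G i else interior (A (Suc n)) \<inter> (if osc \<and> i = 1 then ball p r else UNIV))" for n i :: nat
  \<comment> \<open>For \<open>n < N\<close> these points have an \<open>f\<close>-orbit that stays
    in \<open>A N\<close> long enough to be a \<open>g\<close>-orbit. For \<open>n = N\<close> the
    map \<theta> is the identity both at the point and at its image, so the conjugacy reduces to
    \<open>(g ^^ m) z = \<phi> z\<close>.\<close>
  define TT where "TT n = (if n < N then Q n \<inter> U \<inter> Q1 n \<inter> (\<Inter>i\<in>{..<k n}. (\<lambda>z. (f ^^ i) (\<theta> z)) -` interior (A N))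
     else if n = N then T \<inter> Q N \<inter> (U \<inter> \<phi> -` Q (Suc N)) else Q n)" for n
  have k': "k' n = k n" if "n < N" for n using that by (simp add: k'_def)
  have k'N: "k' N = m" by (simp add: k'_def)
  have agree: "(g ^^ i) (\<theta> z) = (f ^^ i) (\<theta> z)" if n: "n < N" "i \<le> k n" and z: "\<And>i. i < k n \<Longrightarrow> (f ^^ i) (\<theta> z) \<in> A N" for n i z
  proof (rule funpow_agree)
    show "(f ^^ i) (\<theta> z) \<in> A N" if "i < k n" for i using z that .
  qed (use K(5) n in auto)
  have AN: "interior (A (Suc n)) \<subseteq> A N" if "n < N" for n
    using interior_A_mono [of "Suc n" N] that interior_subset [of "A N"] by auto
  have stX: "(f ^^ i) (\<theta> z) \<in> interior (A (Suc n))" if "n < N" "i < k n" "z \<in> X n" for n i z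
    using stageD(10) [OF st that(1,2)] that(3) by blast
  have k1: "f (\<theta> z) \<in> ball p r" if "n < N" osc "z \<in> X n" for n z
  proof -
    have "f ` \<theta> ` X n \<subseteq> ball p r" using stageD(11) [OF st that(1)] that(2) by simp
    then show ?thesis using that(3) by blast
  qed
  have GGK: "GG n i \<subseteq> interior K" if "n \<le> N" "i < k' n" for n i
  proof (cases "n = N")
    case True then show ?thesis using that G(2) k'N by (simp add: GG_def)
  next
    case False
    then have "interior (A (Suc n)) \<subseteq> A N" using AN that by simp
    then have "interior (A (Suc n)) \<subseteq> interior K" using K(4) by (intro interior_maximal) auto
    then show ?thesis using False by (auto simp: GG_def)
  qed
  have GGA: "GG n i \<subseteq> interior (A (Suc n))" if "n \<le> N" "i < k' n" for n i
    using G(3) [of i] that k'N by (auto simp: GG_def)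
  have GG1: "1 < k' n \<and> GG n 1 \<subseteq> ball p r" if "n \<le> N" osc for n
  proof (cases "n = N")
    case True
    then show ?thesis using m(2) that(2) k'N by (simp add: GG_def)
  next
    case False
    then have "n < N" using that by simp
    then show ?thesis using stageD(11) [OF st, of n] that(2) by (auto simp: GG_def k')
  qed
  have "\<exists>W. (\<forall>n\<le>N. open (W n) \<and> X n \<subseteq> W n \<and> W n \<subseteq> TT n \<and> (n < N \<longrightarrow> \<phi> ` W n \<subseteq> W (Suc n))) \<and>
    (\<forall>\<epsilon>>0. \<exists>a \<delta>. \<delta> > 0 \<and> (\<forall>F. (\<forall>n\<le>N. \<forall>i<k' n. F holomorphic_on GG n i \<and> (\<forall>w\<in>GG n i. norm (F w - g w) \<le> \<delta> * wt (\<Union>n\<le>N. \<Union>i<k' n. (g ^^ i) ` M n) w ^ a)) \<longrightarrow>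
       (\<exists>u. \<forall>n\<le>N. u n holomorphic_on W n \<and> (\<forall>z\<in>W n. norm (u n z) \<le> \<epsilon> \<and> (z \<in> M n \<longrightarrow> u n z = 0) \<and>
          (\<forall>i<k' n. (F ^^ i) (\<theta> z + u n z) \<in> GG n i) \<and>
          (F ^^ k' n) (\<theta> z + u n z) = \<theta> (\<phi> z) + (if n = N then 0 else u (Suc n) (\<phi> z))))))"
  proof (rule simultaneous_perturbation)
    show "compact (X n)" for n by (rule compact_X)
    show "\<phi> ` X n \<subseteq> X (Suc n)" for n by (rule \<phi>X)
    show "finite (M n)" "M n \<subseteq> X n" "\<phi> ` M n \<subseteq> M (Suc n)" for n by (rule M)+
    show "deriv \<phi> z \<noteq> 0" if "z \<in> X n - M n" for n z using that by (rule deriv_nonzero)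
    show "\<exists>z\<in>ball c r. deriv \<phi> z \<noteq> 0" if "c \<in> X n" "r > 0" for n c r using that by (rule deriv_nonzero_near)
    show "norm ((\<theta> x - \<theta> y) - (x - y)) \<le> 1/2 * norm (x - y)" for x y by (rule near)
    show "\<theta> c = c" if "c \<in> M n" for n c using stageD(7) [OF st that] .
    have op1: "open (\<Inter>i\<in>{..<k n}. (\<lambda>z. (f ^^ i) (\<theta> z)) -` interior (A N))" for n
      using stage_continuous [OF st] by (intro open_INT ballI open_vimage) auto
    have op2: "open (U \<inter> \<phi> -` Q (Suc N))"
      using holomorphic_on_imp_continuous_on [OF U(3)] U(1) Q(1) by (rule continuous_open_preimage)
    show "open (TT n)" for n
      unfolding TT_def using op1 op2 Q(1) Q1(1) U(1) T(1) by (auto intro!: open_Int)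
    show "X n \<subseteq> TT n" if n: "n \<le> Suc N" for n
    proof
      fix z assume z: "z \<in> X n"
      consider "n < N" | "n = N" | "n = Suc N" using n by linarith
      then show "z \<in> TT n"
      proof cases
        case 1
        have "(f ^^ i) (\<theta> z) \<in> interior (A N)" if "i < k n" for i
          using stX [OF 1 that z] interior_A_mono [of "Suc n" N] 1 by auto
        then show ?thesis using 1 z Q(2) [of n] U(2) [of n] Q1(2) [OF 1] by (auto simp: TT_def)
      next
        case 2
        have "\<phi> z \<in> Q (Suc N)" using \<phi>X [of N] Q(2) [of "Suc N"] z 2 by blast
        then show ?thesis using 2 z T(2) Q(2) [of N] U(2) [of N] by (auto simp: TT_def)
      next
        case 3
        then show ?thesis using z Q(2) [of n] by (auto simp: TT_def)
      qed
    qed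
    show "\<theta> holomorphic_on TT n" for n
      by (rule holomorphic_on_subset [OF Q(3) [of n]]) (auto simp: TT_def)
    show "\<phi> holomorphic_on TT n" if "n \<le> N" for n
      by (rule holomorphic_on_subset [OF U(3)]) (use that in \<open>auto simp: TT_def\<close>)
    show "open (GG n i)" if "n \<le> N" "i < k' n" for n i
      using that G(1) k'N by (auto simp: GG_def)
    show "g holomorphic_on GG n i" if "n \<le> N" "i < k' n" for n i
      by (rule holomorphic_on_subset [OF K(3)]) (use GGK [OF that] interior_subset [of K] K(2) in blast)
    show "(g ^^ i) ` \<theta> ` X n \<subseteq> GG n i" if n: "n \<le> N" "i < k' n" for n i
    proof -
      have "(g ^^ i) (\<theta> z) \<in> GG n i" if z: "z \<in> X n" for z
      proof (cases "n = N")
        case True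
        then have "\<theta> z = z" using Q(2) [of N] Q(4) [of N z] z by blast
        then show ?thesis using True G(4) [of i z] T(2) z n k'N by (auto simp: GG_def)
      next
        case False
        then have n': "n < N" using n by simp
        then have i: "i < k n" using n k' by simp
        have "(g ^^ i) (\<theta> z) = (f ^^ i) (\<theta> z)"
          using n' i by (rule agree [OF _ less_imp_le]) (use stX [OF n' _ z] AN [OF n'] in blast)
        then show ?thesis using stX [OF n' i z] k1 [OF n' _ z] False by (simp add: GG_def)
      qed
      then show ?thesis by blast
    qed
    show "(g ^^ k' n) (\<theta> z) = \<theta> (\<phi> z)" if n: "n \<le> N" and z: "z \<in> TT n" for n z
    proof (cases "n = N")
      case True
      then have z': "z \<in> T" "z \<in> Q N" "\<phi> z \<in> Q (Suc N)" using z by (auto simp: TT_def)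
      show ?thesis using True Q(4) [OF _ z'(2)] Q(4) [OF _ z'(3)] T(4) [OF z'(1)] k'N by simp
    next
      case False
      then have n': "n < N" using n by simp
      have z': "z \<in> Q1 n" "\<And>i. i < k n \<Longrightarrow> (f ^^ i) (\<theta> z) \<in> interior (A N)" using z n' by (auto simp: TT_def)
      have "(g ^^ k n) (\<theta> z) = (f ^^ k n) (\<theta> z)"
        using n' order_refl by (rule agree) (use z'(2) interior_subset [of "A N"] in blast)
      then show ?thesis using Q1(3) [OF n' z'(1)] k' [OF n'] by simp
    qed
  qed
  then obtain Wn where W: "\<forall>n\<le>N. open (Wn n) \<and> X n \<subseteq> Wn n \<and> Wn n \<subseteq> TT n \<and> (n < N \<longrightarrow> \<phi> ` Wn n \<subseteq> Wn (Suc n))"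
    "\<forall>\<epsilon>>0. \<exists>a \<delta>. \<delta> > 0 \<and> (\<forall>F. (\<forall>n\<le>N. \<forall>i<k' n. F holomorphic_on GG n i \<and> (\<forall>w\<in>GG n i. norm (F w - g w) \<le> \<delta> * wt (\<Union>n\<le>N. \<Union>i<k' n. (g ^^ i) ` M n) w ^ a)) \<longrightarrow>
       (\<exists>u. \<forall>n\<le>N. u n holomorphic_on Wn n \<and> (\<forall>z\<in>Wn n. norm (u n z) \<le> \<epsilon> \<and> (z \<in> M n \<longrightarrow> u n z = 0) \<and>
          (\<forall>i<k' n. (F ^^ i) (\<theta> z + u n z) \<in> GG n i) \<and>
          (F ^^ k' n) (\<theta> z + u n z) = \<theta> (\<phi> z) + (if n = N then 0 else u (Suc n) (\<phi> z)))))"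
    by (elim exE conjE)
  show ?thesis
  proof (rule that [of "\<Union>n\<le>N. \<Union>i<k' n. (g ^^ i) ` M n" Wn])
    show "finite (\<Union>n\<le>N. \<Union>i<k' n. (g ^^ i) ` M n)" using M(1) by auto
    show "open (Wn n)" "X n \<subseteq> Wn n" if "n \<le> N" for n using W(1) that by auto
    have WT: "Wn n \<subseteq> TT n" if "n \<le> N" for n using W(1) that by auto
    show "\<theta> holomorphic_on Wn n" if "n \<le> N" for n
      by (rule holomorphic_on_subset [OF Q(3) [of n]]) (use WT [OF that] in \<open>auto simp: TT_def split: if_splits\<close>)
    show "Wn n \<subseteq> U" if "n \<le> N" for n
      using WT [OF that] that by (auto simp: TT_def split: if_splits)
    fix \<epsilon>0 :: real assume "\<epsilon>0 > 0"
    then have "\<exists>a \<delta>. \<delta> > 0 \<and> (\<forall>F. (\<forall>n\<le>N. \<forall>i<k' n. F holomorphic_on GG n i \<and> (\<forall>w\<in>GG n i. norm (F w - g w) \<le> \<delta> * wt (\<Union>n\<le>N. \<Union>i<k' n. (g ^^ i) ` M n) w ^ a)) \<longrightarrow>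
       (\<exists>u. \<forall>n\<le>N. u n holomorphic_on Wn n \<and> (\<forall>z\<in>Wn n. norm (u n z) \<le> \<epsilon>0 \<and> (z \<in> M n \<longrightarrow> u n z = 0) \<and>
          (\<forall>i<k' n. (F ^^ i) (\<theta> z + u n z) \<in> GG n i) \<and>
          (F ^^ k' n) (\<theta> z + u n z) = \<theta> (\<phi> z) + (if n = N then 0 else u (Suc n) (\<phi> z)))))" (is "\<exists>a \<delta>. \<delta> > 0 \<and> ?S a \<delta>")
      using W(2) by (elim allE [of _ \<epsilon>0] mp)
    then obtain a \<delta> where \<delta>: "\<delta> > 0" "?S a \<delta>" by (elim exE conjE)
    show "\<exists>a \<delta>. \<delta> > 0 \<and> (\<forall>F. F holomorphic_on UNIV \<longrightarrow> (\<forall>w\<in>K. norm (F w - g w) \<le> \<delta> * wt (\<Union>n\<le>N. \<Union>i<k' n. (g ^^ i) ` M n) w ^ a) \<longrightarrow>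
       (\<exists>u. absorbs N \<theta> k' Wn F \<epsilon>0 u))"
    proof (intro exI [of _ a] exI [of _ \<delta>] conjI \<delta>(1) allI impI)
      fix F assume F: "F holomorphic_on UNIV" "\<forall>w\<in>K. norm (F w - g w) \<le> \<delta> * wt (\<Union>n\<le>N. \<Union>i<k' n. (g ^^ i) ` M n) w ^ a"
      have "\<forall>n\<le>N. \<forall>i<k' n. F holomorphic_on GG n i \<and> (\<forall>w\<in>GG n i. norm (F w - g w) \<le> \<delta> * wt (\<Union>n\<le>N. \<Union>i<k' n. (g ^^ i) ` M n) w ^ a)"
      proof (intro allI impI conjI ballI)
        fix n i assume n: "n \<le> N" "i < k' n"
        show "F holomorphic_on GG n i" using F(1) by (rule holomorphic_on_subset) simp
        fix w assume "w \<in> GG n i"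
        then have "w \<in> K" using GGK [OF n] interior_subset [of K] by blast
        then show "norm (F w - g w) \<le> \<delta> * wt (\<Union>n\<le>N. \<Union>i<k' n. (g ^^ i) ` M n) w ^ a" using F(2) by (elim bspec [rotated])
      qed
      then have "\<exists>u. \<forall>n\<le>N. u n holomorphic_on Wn n \<and> (\<forall>z\<in>Wn n. norm (u n z) \<le> \<epsilon>0 \<and> (z \<in> M n \<longrightarrow> u n z = 0) \<and>
          (\<forall>i<k' n. (F ^^ i) (\<theta> z + u n z) \<in> GG n i) \<and>
          (F ^^ k' n) (\<theta> z + u n z) = \<theta> (\<phi> z) + (if n = N then 0 else u (Suc n) (\<phi> z)))"
        using \<delta>(2) by (elim allE [of _ F] mp)
      then obtain u where u: "\<And>n. n \<le> N \<Longrightarrow> u n holomorphic_on Wn n" "\<And>n z. n \<le> N \<Longrightarrow> z \<in> Wn n \<Longrightarrow> norm (u n z) \<le> \<epsilon>0"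
          "\<And>n z. n \<le> N \<Longrightarrow> z \<in> Wn n \<Longrightarrow> z \<in> M n \<Longrightarrow> u n z = 0"
          "\<And>n z i. n \<le> N \<Longrightarrow> z \<in> Wn n \<Longrightarrow> i < k' n \<Longrightarrow> (F ^^ i) (\<theta> z + u n z) \<in> GG n i"
          "\<And>n z. n \<le> N \<Longrightarrow> z \<in> Wn n \<Longrightarrow> (F ^^ k' n) (\<theta> z + u n z) = \<theta> (\<phi> z) + (if n = N then 0 else u (Suc n) (\<phi> z))"
        by blast
      show "\<exists>u. absorbs N \<theta> k' Wn F \<epsilon>0 u"
        unfolding absorbs_def
      proof (intro exI [of _ u] allI impI conjI ballI)
        fix n z i assume "n \<le> N" "z \<in> Wn n" "i < k' n"
        then show "(F ^^ i) (\<theta> z + u n z) \<in> interior (A (Suc n))" using u(4) GGA by blast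
      next
        fix n z assume nz: "n \<le> N" "z \<in> Wn n" and osc
        have "1 < k' n" "GG n 1 \<subseteq> ball p r" using GG1 [OF nz(1) \<open>osc\<close>] by auto
        then have "(F ^^ 1) (\<theta> z + u n z) \<in> ball p r" using u(4) [OF nz] by blast
        then show "F (\<theta> z + u n z) \<in> ball p r" by simp
      qed (use u in auto)
    qed
  qed
qed

text \<open>The choices depend on one another in this order: the model gives the neighbourhoods
  \<open>Wn\<close>, these give the cut-offs and \<open>\<epsilon>0\<close>, then come the order
  \<open>e\<close> and the accuracy \<delta>, and the polynomial is last.\<close>

lemma step:
  assumes st: "stage N f \<theta> k Fr"
  shows "\<exists>f' \<theta>' k' Fr'. stage (Suc N) f' \<theta>' k' Fr' \<and> successor N f \<theta> k Fr f' \<theta>' k' Fr'"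
proof -
  have V0: "open (interior (A (Suc N)) - A N)" "X N \<subseteq> interior (A (Suc N)) - A N"
    using A_closed X_inside [of N "Suc N"] X_outside [of N N] by auto
  obtain Z where Z: "finite Z"
      "\<And>\<zeta> j. (\<zeta>, j) \<in> Z \<Longrightarrow> (\<forall>i<j. (f ^^ i) \<zeta> \<in> interior (A N)) \<and> (f ^^ j) \<zeta> \<in> (interior (A (Suc N)) - A N) - X N"
      "\<And>n z. n \<le> N \<Longrightarrow> z \<in> frontier (X n) \<Longrightarrow> \<exists>\<zeta> j. (\<zeta>, j) \<in> Z \<and> dist \<zeta> (\<theta> z) \<le> 1 / real (Suc N)"
    by (rule frontier_net [OF st V0]) (rule that)
  \<comment> \<open>\<open>W\<close> holds the end points of the net's orbits, which the model sends
    to \<open>p\<close>; \<open>Zo\<close> holds the earlier points of these orbits, at which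
    \<open>f\<close> must not be changed.\<close>
  define W where "W = (\<lambda>(\<zeta>, j). (f ^^ j) \<zeta>) ` Z"
  define Zo where "Zo = (\<Union>(\<zeta>, j)\<in>Z. (\<lambda>i. (f ^^ i) \<zeta>) ` {..<j})"
  have W: "finite W" "W \<subseteq> interior (A (Suc N)) - A N - X N" using Z(1,2) by (auto simp: W_def)
  have Zo: "finite Zo" "Zo \<subseteq> interior (A N)" using Z(1,2) by (auto simp: Zo_def)
  obtain K \<Omega> g m G T a b where K: "nonseparating K" "open \<Omega>" "K \<subseteq> \<Omega>" "g holomorphic_on \<Omega>"
    "A N \<subseteq> K" "\<And>z. z \<in> A N \<Longrightarrow> g z = f z" "W \<subseteq> K" "\<And>w. w \<in> W \<Longrightarrow> g w = p"
    and ab: "a \<in> K" "b \<in> K" "a \<in> interior (A (Suc N)) - A N" "b \<in> interior (A (Suc N)) - A N" "g a = p" "g b = p + 1"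
    and m: "0 < m" "if osc then 1 < m \<and> G 1 \<subseteq> ball p r else m = 1"
    and G: "\<And>i. i < m \<Longrightarrow> open (G i)" "\<And>i. i < m \<Longrightarrow> G i \<subseteq> interior K" "\<And>i. i < m \<Longrightarrow> G i \<subseteq> interior (A (Suc N))"
    "\<And>i z. i < m \<Longrightarrow> z \<in> T \<Longrightarrow> (g ^^ i) z \<in> G i"
    and T: "open T" "X N \<subseteq> T" "T \<subseteq> U" "\<And>z. z \<in> T \<Longrightarrow> (g ^^ m) z = \<phi> z"
    by (rule step_model [OF st W]) (rule that)
  define k' where "k' = k(N := m)"
  obtain Wn Mk where Wn: "finite Mk" "\<And>n. n \<le> N \<Longrightarrow> open (Wn n)" "\<And>n. n \<le> N \<Longrightarrow> X n \<subseteq> Wn n"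
    "\<And>n. n \<le> N \<Longrightarrow> \<theta> holomorphic_on Wn n" "\<And>n. n \<le> N \<Longrightarrow> Wn n \<subseteq> U"
    and sol: "\<And>\<epsilon>0. \<epsilon>0 > 0 \<Longrightarrow> \<exists>a \<delta>. \<delta> > 0 \<and> (\<forall>F. F holomorphic_on UNIV \<longrightarrow> (\<forall>w\<in>K. norm (F w - g w) \<le> \<delta> * wt Mk w ^ a) \<longrightarrow>
       (\<exists>u. absorbs N \<theta> (k(N := m)) Wn F \<epsilon>0 u))"
    by (rule step_solution [OF st K(2-6) m G T]) (assumption | rule that)+
  note sol = sol [folded k'_def]
  \<comment> \<open>The first entry makes the increments of \<theta> summable with all derivatives
    and keeps the limit close to the identity; the others make the displacements on
    \<open>X n\<close> add up to at most \<open>\<epsilon> n\<close>.\<close>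
  define \<kappa> where "\<kappa> = Min (insert ((1/2) ^ (N + 4)) ((\<lambda>n. \<epsilon> n * (1/2) ^ (N + 1)) ` {..N}))"
  have \<kappa>: "\<kappa> > 0" "\<kappa> \<le> (1/2) ^ (N + 4)" "\<And>n. n \<le> N \<Longrightarrow> \<kappa> \<le> \<epsilon> n * (1/2) ^ (N + 1)"
    unfolding \<kappa>_def by (subst Min_gr_iff, simp, simp, use \<epsilon> in simp, rule Min_le, simp, simp, rule Min_le, simp, blast)
  obtain R Q \<epsilon>0 where \<epsilon>0: "\<epsilon>0 > 0" and RWn: "\<forall>n\<le>N. open (R n) \<and> X n \<subseteq> R n \<and> R n \<subseteq> Wn n"
    and Q: "open Q" "\<And>n. n > N \<Longrightarrow> X n \<subseteq> Q"
    and cutoff: "\<forall>u. (\<forall>n\<le>N. u n holomorphic_on Wn n) \<longrightarrow> (\<forall>n\<le>N. \<forall>z\<in>Wn n. norm (u n z) \<le> \<epsilon>0) \<longrightarrow>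
       (\<exists>\<upsilon>. smooth \<upsilon> \<and> derivatives_bounded (Suc N) \<kappa> \<upsilon> \<and> (\<forall>n\<le>N. \<forall>z\<in>R n. \<upsilon> z = u n z) \<and> (\<forall>z\<in>Q. \<upsilon> z = 0))"
    by (rule cutoff_sum [of N Wn \<kappa>]) (erule Wn(2), erule Wn(3), rule \<kappa>(1), rule that)
  have RQ: "\<epsilon>0 > 0" "\<And>n. n \<le> N \<Longrightarrow> open (R n)" "\<And>n. n \<le> N \<Longrightarrow> X n \<subseteq> R n" "\<And>n. n \<le> N \<Longrightarrow> R n \<subseteq> Wn n"
    "open Q" "\<And>n. n > N \<Longrightarrow> X n \<subseteq> Q"
    using \<epsilon>0 RWn Q by blast+
  obtain e \<delta> where \<delta>: "\<delta> > 0" and sol': "\<forall>F. F holomorphic_on UNIV \<longrightarrow> (\<forall>w\<in>K. norm (F w - g w) \<le> \<delta> * wt Mk w ^ e) \<longrightarrow>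
       (\<exists>u. absorbs N \<theta> k' Wn F \<epsilon>0 u)"
    using sol [OF RQ(1)] by (elim exE conjE)
  \<comment> \<open>Besides \<open>Mk\<close>, which the solvability of the equations demands, the
    marked points comprise everything whose image has to be exact from now on.\<close>
  define Ms where "Ms = Mk \<union> Fr \<union> Zo \<union> W \<union> {a, b}"
  \<comment> \<open>Order at least 2 at \<open>p\<close> preserves the derivative of
    \<open>f\<close> there.\<close>
  define E where "E = max e 2"
  have finMs: "finite Ms" unfolding Ms_def using Wn(1) stageD(12) [OF st] Zo(1) W(1) by simp
  have "bounded K" using K(1) by (simp add: nonseparating_def compact_imp_bounded)
  then obtain C0 where C0: "C0 > 0" "\<And>z. z \<in> K \<Longrightarrow> norm (poly (marking_poly Ms E) z) \<le> C0 * wt Ms z ^ E"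
    using marking_poly_bound [OF finMs] by metis
  define \<eta> where "\<eta> = min \<delta> ((1/2) ^ N)"
  have \<eta>: "\<eta> > 0" "\<eta> \<le> \<delta>" "\<eta> \<le> (1/2) ^ N" using \<delta> by (auto simp: \<eta>_def)
  obtain P where P: "\<And>z. z \<in> K \<Longrightarrow> norm (poly P z - g z) \<le> \<eta> / C0 * norm (poly (marking_poly Ms E) z)"
    using runge_hermite [OF K(1-4), of "\<eta> / C0"] \<eta>(1) C0(1) by (metis divide_pos_pos)
  define f' where "f' = poly P"
  have f'hol: "f' holomorphic_on UNIV" unfolding f'_def by (intro holomorphic_intros)
  have close: "norm (f' z - g z) \<le> \<eta> * wt Ms z ^ E" if z: "z \<in> K" for z
  proof -
    have "norm (f' z - g z) \<le> \<eta> / C0 * norm (poly (marking_poly Ms E) z)" using P [OF z] by (simp add: f'_def)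
    also have "\<dots> \<le> \<eta> / C0 * (C0 * wt Ms z ^ E)" using C0 z \<eta>(1) by (intro mult_left_mono) auto
    finally show ?thesis using C0(1) by simp
  qed
  have wE: "wt Ms z ^ E \<le> wt Ms z ^ 2" "wt Ms z ^ E \<le> wt Ms z ^ e" for z
    by (rule wt_power_mono [OF finMs]; simp add: E_def)+
  have agree: "f' z = g z" if z: "z \<in> K" "z \<in> Ms" for z
  proof -
    have "wt Ms z ^ E = 0" using wt_zero [OF finMs z(2)] by (simp add: E_def)
    then have "norm (f' z - g z) \<le> 0" using close [OF z(1)] by (simp only: mult_zero_right)
    then show ?thesis by simp
  qed
  have "\<forall>w\<in>K. norm (f' w - g w) \<le> \<delta> * wt Mk w ^ e"
  proof
    fix w assume "w \<in> K"
    then have "norm (f' w - g w) \<le> \<eta> * wt Ms w ^ E" by (rule close)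
    also have "\<dots> \<le> \<delta> * wt Mk w ^ e"
    proof (rule mult_mono)
      have "wt Ms w ^ e \<le> wt Mk w ^ e"
        by (intro power_mono wt_subset finMs wt_nonneg) (auto simp: Ms_def)
      then show "wt Ms w ^ E \<le> wt Mk w ^ e" using wE(2) by (rule order_trans [rotated])
    qed (use \<eta> \<delta> wt_power_nonneg [OF finMs] in auto)
    finally show "norm (f' w - g w) \<le> \<delta> * wt Mk w ^ e" .
  qed
  then have "\<exists>u. absorbs N \<theta> k' Wn f' \<epsilon>0 u"
    using sol' f'hol by (elim allE [of _ f'] mp [THEN mp])
  then obtain u where u: "\<And>n. n \<le> N \<Longrightarrow> u n holomorphic_on Wn n" "\<And>n z. n \<le> N \<Longrightarrow> z \<in> Wn n \<Longrightarrow> norm (u n z) \<le> \<epsilon>0"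
      "\<And>n z. n \<le> N \<Longrightarrow> z \<in> Wn n \<Longrightarrow> z \<in> M n \<Longrightarrow> u n z = 0"
      "\<And>n z i. n \<le> N \<Longrightarrow> z \<in> Wn n \<Longrightarrow> i < k' n \<Longrightarrow> (f' ^^ i) (\<theta> z + u n z) \<in> interior (A (Suc n))"
      "\<And>n z. n \<le> N \<Longrightarrow> z \<in> Wn n \<Longrightarrow> osc \<Longrightarrow> f' (\<theta> z + u n z) \<in> ball p r"
      "\<And>n z. n \<le> N \<Longrightarrow> z \<in> Wn n \<Longrightarrow> (f' ^^ k' n) (\<theta> z + u n z) = \<theta> (\<phi> z) + (if n = N then 0 else u (Suc n) (\<phi> z))"
    unfolding absorbs_def by blast
  obtain \<upsilon> where \<upsilon>: "smooth \<upsilon>" "derivatives_bounded (Suc N) \<kappa> \<upsilon>" "\<forall>n\<le>N. \<forall>z\<in>R n. \<upsilon> z = u n z" "\<forall>z\<in>Q. \<upsilon> z = 0"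
    using cutoff u(1,2) by (elim allE [of _ u] mp [THEN mp] impE exE conjE) auto
  define \<theta>' where "\<theta>' z = \<theta> z + \<upsilon> z" for z
  have \<upsilon>\<theta>: "(\<lambda>z. \<theta>' z - \<theta> z) = \<upsilon>" by (auto simp: \<theta>'_def)
  have \<theta>'R: "\<theta>' z = \<theta> z + u n z" if "n \<le> N" "z \<in> R n" for n z using \<upsilon>(3) that by (simp add: \<theta>'_def)
  have \<theta>'Q: "\<theta>' z = \<theta> z" if "z \<in> Q" for z using \<upsilon>(4) that by (simp add: \<theta>'_def)
  define Fr' where "Fr' = Fr \<union> Zo \<union> W \<union> {a, b}"
  have ANK: "interior (A N) \<subseteq> A N" "interior (A N) \<subseteq> K" using K(5) interior_subset [of "A N"] by auto
  have FrZo: "f' z = f z" if "z \<in> Fr \<union> Zo" for z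
  proof -
    have "z \<in> interior (A N)" using that stageD(13) [OF st] Zo(2) by auto
    then have "z \<in> A N" "z \<in> K" using ANK by auto
    moreover have "z \<in> Ms" using that by (auto simp: Ms_def)
    ultimately show ?thesis using agree K(6) by simp
  qed
  have closeA: "norm (f' z - f z) \<le> \<eta> * wt Ms z ^ E" if "z \<in> A N" for z
    using close [of z] K(5,6) that by auto
  have k'n: "k' n = k n" if "n < N" for n using that by (simp add: k'_def)
  have k'N: "k' N = m" by (simp add: k'_def)
  have stage: "stage (Suc N) f' \<theta>' k' Fr'"
    unfolding stage_def
  proof (intro conjI allI impI ballI)
    show "f' holomorphic_on UNIV" by (rule f'hol)
    show "f' p = p" using FrZo [of p] stageD(2,14) [OF st] by simp
    have "deriv f' p = deriv f p"
    proof (rule deriv_eq_if_close [OF stageD(1) [OF st] f'hol, of "interior (A N)"])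
      show "p \<in> interior (A N)" by (rule p_inside)
      fix z assume "z \<in> interior (A N)"
      then have "z \<in> A N" using ANK by blast
      then have "norm (f' z - f z) \<le> \<eta> * wt Ms z ^ E" by (rule closeA)
      also have "\<dots> \<le> \<eta> * (norm (z - p))\<^sup>2"
      proof (rule mult_left_mono)
        have "p \<in> Ms" using stageD(14) [OF st] by (simp add: Ms_def)
        then have "wt Ms z \<le> norm (z - p)" using wt_le_dist [OF finMs, of p z] by (simp add: dist_norm)
        then have "wt Ms z ^ 2 \<le> (norm (z - p))\<^sup>2" using wt_nonneg [OF finMs] by (intro power_mono) auto
        then show "wt Ms z ^ E \<le> (norm (z - p))\<^sup>2" using wE(1) by (rule order_trans [rotated])
      qed (use \<eta> in simp)
      finally show "norm (f' z - f z) \<le> \<eta> * (norm (z - p))\<^sup>2" .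
    qed simp
    then show "deriv f' p = 2" using stageD(3) [OF st] by simp
    show "smooth \<theta>'" unfolding \<theta>'_def using stageD(4) [OF st] \<upsilon>(1) by (rule smooth_add)
    show "norm ((\<theta>' x - \<theta>' y) - (x - y)) \<le> (1/2 - (1/2) ^ (Suc N + 2)) * norm (x - y)" for x y
    proof -
      have "derivatives_bounded 1 \<kappa> \<upsilon>" using \<upsilon>(2) by (rule derivatives_bounded_mono) simp
      then have "norm (dird \<upsilon> v z) \<le> 2 * \<kappa> * norm v" for v z using dird_norm_le [OF \<upsilon>(1)] by metis
      then have "norm (\<upsilon> x - \<upsilon> y) \<le> 2 * \<kappa> * norm (x - y)" by (rule smooth_lipschitz [OF \<upsilon>(1)])
      \<comment> \<open>This is the difference between the allowances
        \<open>1/2 - (1/2) ^ (N + 2)\<close> and \<open>1/2 - (1/2) ^ (N + 3)\<close> of two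
        consecutive stages.\<close>
      also have "\<dots> \<le> (1/2) ^ (N + 3) * norm (x - y)"
        using \<kappa>(2) by (intro mult_right_mono) (simp_all add: power_add power3_eq_cube power4_eq_xxxx)
      finally have 1: "norm (\<upsilon> x - \<upsilon> y) \<le> (1/2) ^ (N + 3) * norm (x - y)" .
      have "(\<theta>' x - \<theta>' y) - (x - y) = ((\<theta> x - \<theta> y) - (x - y)) + (\<upsilon> x - \<upsilon> y)" by (simp add: \<theta>'_def)
      then have "norm ((\<theta>' x - \<theta>' y) - (x - y)) \<le> norm ((\<theta> x - \<theta> y) - (x - y)) + norm (\<upsilon> x - \<upsilon> y)"
        by (metis norm_triangle_ineq)
      also have "\<dots> \<le> (1/2 - (1/2) ^ (N + 2)) * norm (x - y) + (1/2) ^ (N + 3) * norm (x - y)"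
        using stageD(5) [OF st] 1 by (rule add_mono)
      also have "\<dots> = (1/2 - (1/2) ^ (Suc N + 2)) * norm (x - y)" by (simp add: algebra_simps power_add power3_eq_cube)
      finally show ?thesis .
    qed
    show "\<exists>Q. open Q \<and> X n \<subseteq> Q \<and> \<theta>' holomorphic_on Q \<and> (n \<ge> Suc N \<longrightarrow> (\<forall>z\<in>Q. \<theta>' z = z))" for n
    proof (cases "n \<le> N")
      case True
      have "(\<lambda>z. \<theta> z + u n z) holomorphic_on R n"
        using Wn(4) [OF True] u(1) [OF True] RQ(4) [OF True] by (intro holomorphic_on_add) (auto elim: holomorphic_on_subset)
      moreover have "\<theta>' holomorphic_on R n \<longleftrightarrow> (\<lambda>z. \<theta> z + u n z) holomorphic_on R n"
        by (rule holomorphic_cong) (use \<theta>'R [OF True] in auto)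
      ultimately show ?thesis using RQ(2,3) [OF True] True by (intro exI [of _ "R n"]) auto
    next
      case False
      then have nN: "n > N" "n \<ge> N" by auto
      obtain Q' where Q': "open Q'" "X n \<subseteq> Q'" "\<And>z. z \<in> Q' \<Longrightarrow> \<theta> z = z"
        using stageD(6) [OF st, of n] nN(2) by auto
      have id: "\<theta>' z = z" if "z \<in> Q \<inter> Q'" for z using that \<theta>'Q Q'(3) by auto
      have "\<theta>' holomorphic_on Q \<inter> Q' \<longleftrightarrow> (\<lambda>z. z) holomorphic_on Q \<inter> Q'"
        by (rule holomorphic_cong) (use id in auto)
      then show ?thesis using Q' RQ(5,6) nN id by (intro exI [of _ "Q \<inter> Q'"]) (auto simp: holomorphic_on_ident)
    qed
    show "\<theta>' c = c" if c: "c \<in> M n" for n c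
    proof (cases "n \<le> N")
      case True
      then show ?thesis using \<theta>'R [OF True] RQ(3,4) [OF True] M(2) [of n] u(3) [OF True _ c] c stageD(7) [OF st c] by (metis add_0_right subsetD)
    next
      case False
      then show ?thesis using \<theta>'Q [of c] RQ(6) [of n] M(2) [of n] c stageD(7) [OF st c] by auto
    qed
    show "finite Fr'" unfolding Fr'_def using stageD(12) [OF st] Zo(1) W(1) by simp
    show "Fr' \<subseteq> interior (A (Suc N))"
      unfolding Fr'_def using stageD(13) [OF st] Zo(2) W(2) ab interior_A_mono [of N "Suc N"] by auto
    show "p \<in> Fr'" using stageD(14) [OF st] by (simp add: Fr'_def)
    fix n assume "n < Suc N"
    then have n: "n \<le> N" by simp
    have XW: "z \<in> Wn n" "\<theta>' z = \<theta> z + u n z" if "z \<in> X n" for z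
      using RQ(3,4) [OF n] \<theta>'R [OF n] that by auto
    show "k' n > 0" using m(1) stageD(8) [OF st, of n] n by (simp add: k'_def)
    show "(f' ^^ i) ` \<theta>' ` X n \<subseteq> interior (A (Suc n))" if i: "i < k' n" for i
      using u(4) [OF n _ i] XW by auto
    have "f' ` \<theta>' ` X n \<subseteq> ball p r" if osc
    proof -
      have "f' (\<theta>' z) \<in> ball p r" if z: "z \<in> X n" for z using u(5) [OF n XW(1) [OF z] \<open>osc\<close>] XW(2) [OF z] by simp
      then show ?thesis by blast
    qed
    moreover have "if osc then 1 < k' n else k' n = 1"
      using m(2) stageD(11) [OF st, of n] n k'n [of n] k'N by (cases "n = N") auto
    ultimately show "if osc then 1 < k' n \<and> f' ` \<theta>' ` X n \<subseteq> ball p r else k' n = 1" by auto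
    show "\<exists>Q. open Q \<and> X n \<subseteq> Q \<and> (\<forall>z\<in>Q. (f' ^^ k' n) (\<theta>' z) = \<theta>' (\<phi> z))"
    proof -
      \<comment> \<open>The region in which \<open>\<phi> z\<close> must lie: for
        \<open>n = N\<close> it is one where \<theta> has not been changed, otherwise one where the
        change is exactly \<open>u (Suc n)\<close>.\<close>
      define Y where "Y = (if n = N then Q else R (Suc n))"
      have Y: "open Y" "X (Suc n) \<subseteq> Y" using n RQ by (auto simp: Y_def)
      have "open (U \<inter> \<phi> -` Y)"
        using holomorphic_on_imp_continuous_on [OF U(3)] U(1) Y(1) by (rule continuous_open_preimage)
      moreover have "X n \<subseteq> U \<inter> \<phi> -` Y" using U(2) [of n] \<phi>X [of n] Y(2) by blast
      moreover have "(f' ^^ k' n) (\<theta>' z) = \<theta>' (\<phi> z)" if z: "z \<in> R n" "\<phi> z \<in> Y" for z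
      proof -
        have "(f' ^^ k' n) (\<theta>' z) = \<theta> (\<phi> z) + (if n = N then 0 else u (Suc n) (\<phi> z))"
          using u(6) [OF n, of z] \<theta>'R [OF n z(1)] RQ(4) [OF n] z(1) by auto
        also have "\<dots> = \<theta>' (\<phi> z)"
          using \<theta>'Q [of "\<phi> z"] \<theta>'R [of "Suc n" "\<phi> z"] z(2) n by (auto simp: Y_def split: if_splits)
        finally show ?thesis .
      qed
      ultimately show ?thesis using RQ(2,3) [OF n] by (intro exI [of _ "R n \<inter> (U \<inter> \<phi> -` Y)"]) auto
    qed
  qed
  have "successor N f \<theta> k Fr f' \<theta>' k' Fr'"
    unfolding successor_def \<upsilon>\<theta>
  proof (intro conjI allI impI ballI)
    show "k' n = k n" if "n < N" for n using k'n [OF that] .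
    show "norm (f' z - f z) \<le> (1/2) ^ N" if "z \<in> A N" for z
    proof -
      have "\<eta> * wt Ms z ^ E \<le> \<eta> * 1" using wt_power_le_1 [OF finMs] \<eta>(1) by (intro mult_left_mono) auto
      then show ?thesis using closeA [OF that] \<eta>(3) by linarith
    qed
    show "f' z = f z" if "z \<in> Fr" for z using FrZo that by blast
    show "Fr \<subseteq> Fr'" by (auto simp: Fr'_def)
    show "smooth \<upsilon>" by (rule \<upsilon>)
    show "derivatives_bounded (Suc N) ((1/2) ^ (N + 4)) \<upsilon>" using \<upsilon>(2) \<kappa>(2) by (rule derivatives_bounded_mono_B)
    show "norm (\<theta>' z - \<theta> z) \<le> \<epsilon> n * (1/2) ^ (N + 1)" if "n \<le> N" for n z
      using derivatives_bounded_norm [OF \<upsilon>(2), of z] \<kappa>(3) [OF that] by (simp add: \<theta>'_def)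
    show "\<exists>\<zeta> j. dist \<zeta> (\<theta> z) \<le> 1 / real (Suc N) \<and> (f' ^^ j) \<zeta> = p \<and> (\<forall>i\<le>j. (f' ^^ i) \<zeta> \<in> Fr')"
      if n: "n \<le> N" and z: "z \<in> frontier (X n)" for n z
    proof -
      obtain \<zeta> j where \<zeta>: "(\<zeta>, j) \<in> Z" "dist \<zeta> (\<theta> z) \<le> 1 / real (Suc N)" using Z(3) [OF n z] by blast
      have W\<zeta>: "(f ^^ j) \<zeta> \<in> W" unfolding W_def using \<zeta>(1) by force
      have Zo\<zeta>: "(f ^^ i) \<zeta> \<in> Zo" if "i < j" for i unfolding Zo_def using \<zeta>(1) that by force
      have eq: "(f' ^^ i) \<zeta> = (f ^^ i) \<zeta>" if "i \<le> j" for i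
        using Zo\<zeta> _ that by (rule funpow_agree) (use FrZo in auto)
      have "f' ((f ^^ j) \<zeta>) = p"
        using agree [of "(f ^^ j) \<zeta>"] K(7,8) W\<zeta> by (auto simp: Ms_def)
      \<comment> \<open>The net's orbit acquires one further point, its arrival at
        \<open>p\<close>.\<close>
      then have last: "(f' ^^ Suc j) \<zeta> = p" using eq [of j] by simp
      have "(f' ^^ i) \<zeta> \<in> Fr'" if ij: "i \<le> Suc j" for i
      proof -
        consider "i < j" | "i = j" | "i = Suc j" using ij by linarith
        then show ?thesis
        proof cases
          case 1 then show ?thesis using eq [of i] Zo\<zeta> [OF 1] by (simp add: Fr'_def)
        next
          case 2 then show ?thesis using eq [of i] W\<zeta> by (simp add: Fr'_def)
        next
          case 3 then show ?thesis using last stageD(14) [OF st] by (simp add: Fr'_def del: funpow.simps)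
        qed
      qed
      then show ?thesis using last \<zeta>(2) by (intro exI [of _ \<zeta>] exI [of _ "Suc j"] conjI allI impI)
    qed
    have "f' a = p" "f' b = p + 1" using agree [of a] agree [of b] ab by (auto simp: Ms_def)
    then show "\<exists>a b. a \<in> Fr' - A N \<and> b \<in> Fr' - A N \<and> f' a = p \<and> f' b = p + 1"
      using ab(3,4) by (intro exI [of _ a] exI [of _ b]) (auto simp: Fr'_def)
  qed
  with stage show ?thesis by (intro exI conjI)
qed

end

section \<open>The limit functions\<close>

text \<open>Expressing the limit by the pointwise \<open>lim\<close> gives the same function for
  every \<open>S\<close>.\<close>

lemma telescoping_uniform_limit:
  fixes f :: "nat \<Rightarrow> 'a \<Rightarrow> 'b :: banach"
  assumes le: "\<And>m z. m \<ge> N \<Longrightarrow> z \<in> S \<Longrightarrow> norm (f (Suc m) z - f m z) \<le> b m" and "summable b"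
  shows "uniform_limit S f (\<lambda>z. lim (\<lambda>m. f m z)) sequentially"
proof -
  have sb: "summable (\<lambda>i. b (i + N))" using assms(2) by (simp add: summable_ignore_initial_segment)
  have tel: "(\<Sum>i<n. f (Suc (i + N)) z - f (i + N) z) = f (n + N) z - f N z" for n z
    by (induction n) auto
  have "uniform_limit S (\<lambda>n z. \<Sum>i<n. f (Suc (i + N)) z - f (i + N) z) (\<lambda>z. \<Sum>i. f (Suc (i + N)) z - f (i + N) z) sequentially"
    using sb by (rule Weierstrass_m_test [rotated]) (use le in auto)
  then have "uniform_limit S (\<lambda>n z. (f (n + N) z - f N z) + f N z) (\<lambda>z. (\<Sum>i. f (Suc (i + N)) z - f (i + N) z) + f N z) sequentially"
    unfolding tel by (intro uniform_limit_intros)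
  then obtain g where "uniform_limit S (\<lambda>n. f (n + N)) g sequentially" by simp
  then have g: "uniform_limit S f g sequentially"
    unfolding uniform_limit_iff by (simp add: eventually_sequentially_seg [of "\<lambda>n. \<forall>x\<in>S. dist (f n x) (g x) < _"])
  have "g z = lim (\<lambda>m. f m z)" if "z \<in> S" for z
    using tendsto_uniform_limitI [OF g that] by (simp add: limI)
  then have "uniform_limit S f (\<lambda>z. lim (\<lambda>m. f m z)) sequentially \<longleftrightarrow> uniform_limit S f g sequentially"
    by (intro uniform_limit_cong') auto
  with g show ?thesis by simp
qed

lemma uniform_limit_diagonal:
  fixes f :: "nat \<Rightarrow> 'a :: t2_space \<Rightarrow> 'b :: real_normed_vector"
  assumes "uniform_limit S f F sequentially" "open S" "x0 \<in> S" "x \<longlonglongrightarrow> x0" "isCont F x0"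
  shows "(\<lambda>n. f n (x n)) \<longlonglongrightarrow> F x0"
proof -
  have ev: "\<forall>\<^sub>F n in sequentially. x n \<in> S" using assms(2-4) topological_tendstoD by blast
  have "(\<lambda>n. f n (x n) - F (x n)) \<longlonglongrightarrow> 0"
  proof (rule tendstoI)
    fix e :: real assume "e > 0"
    then have "\<forall>\<^sub>F n in sequentially. \<forall>y\<in>S. dist (f n y) (F y) < e" using assms(1) unfolding uniform_limit_iff by blast
    with ev show "\<forall>\<^sub>F n in sequentially. dist (f n (x n) - F (x n)) 0 < e"
      by eventually_elim (auto simp: dist_norm)
  qed
  moreover have "(\<lambda>n. F (x n)) \<longlonglongrightarrow> F x0" using assms(5,4) by (rule isCont_tendsto_compose)
  ultimately have "(\<lambda>n. (f n (x n) - F (x n)) + F (x n)) \<longlonglongrightarrow> 0 + F x0" by (rule tendsto_add)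
  then show ?thesis by simp
qed

context wandering_system
begin

text \<open>With no set treated yet, only the repelling fixed point is required; doubling about
  \<open>p\<close> provides it.\<close>

lemma stage_0: "stage 0 (\<lambda>z. p + 2 * (z - p)) id k {p}"
  unfolding stage_def
proof (intro conjI allI impI ballI)
  show "(\<lambda>z. p + 2 * (z - p)) holomorphic_on UNIV" by (intro holomorphic_intros)
  have "((\<lambda>z. p + 2 * (z - p)) has_field_derivative 2) (at p)" by (auto intro!: derivative_eq_intros)
  then show "deriv (\<lambda>z. p + 2 * (z - p)) p = 2" by (rule DERIV_imp_deriv)
  show "smooth id"
    unfolding smooth_def id_def using times_differentiable_bounded_linear [OF bounded_linear_ident] by blast
  show "\<exists>Q. open Q \<and> X n \<subseteq> Q \<and> id holomorphic_on Q \<and> (n \<ge> 0 \<longrightarrow> (\<forall>z\<in>Q. id z = z))" for n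
    by (intro exI [of _ UNIV]) (auto simp: holomorphic_on_id)
  show "{p} \<subseteq> interior (A 0)" using p_inside by simp
qed auto

lemma stage_sequence:
  obtains f \<theta> k Fr where "\<And>N. stage N (f N) (\<theta> N) (k N) (Fr N)" "\<theta> 0 = id"
    "\<And>N. successor N (f N) (\<theta> N) (k N) (Fr N) (f (Suc N)) (\<theta> (Suc N)) (k (Suc N)) (Fr (Suc N))"
proof -
  define P where "P N s \<longleftrightarrow> (case s of (f, \<theta>, k, Fr) \<Rightarrow> stage N f \<theta> k Fr \<and> (N = 0 \<longrightarrow> \<theta> = id))" for N s
  define S where "S N s s' \<longleftrightarrow> (case s of (f, \<theta>, k, Fr) \<Rightarrow> case s' of (f', \<theta>', k', Fr') \<Rightarrow> successor N f \<theta> k Fr f' \<theta>' k' Fr')" for N s s'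
  have "P 0 (\<lambda>z. p + 2 * (z - p), id, (\<lambda>_. 0), {p})" using stage_0 by (simp add: P_def)
  then have "\<exists>s. P 0 s" by blast
  moreover have "\<exists>s'. P (Suc N) s' \<and> S N s s'" if "P N s" for s N
  proof -
    obtain f \<theta> k Fr where s: "s = (f, \<theta>, k, Fr)" by (cases s) auto
    then have "stage N f \<theta> k Fr" using that by (simp add: P_def)
    then obtain f' \<theta>' k' Fr' where "stage (Suc N) f' \<theta>' k' Fr'" "successor N f \<theta> k Fr f' \<theta>' k' Fr'"
      using step by blast
    then show ?thesis by (intro exI [of _ "(f', \<theta>', k', Fr')"]) (simp add: P_def S_def s)
  qed
  ultimately have "\<exists>s. \<forall>N. P N (s N) \<and> S N (s N) (s (Suc N))" by (rule dependent_nat_choice)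
  then obtain s where s: "\<And>N. P N (s N)" "\<And>N. S N (s N) (s (Suc N))" by blast
  define f where "f N = fst (s N)" for N
  define \<theta> where "\<theta> N = fst (snd (s N))" for N
  define k where "k N = fst (snd (snd (s N)))" for N
  define Fr where "Fr N = snd (snd (snd (s N)))" for N
  have eq: "s N = (f N, \<theta> N, k N, Fr N)" for N by (simp add: f_def \<theta>_def k_def Fr_def)
  show ?thesis
  proof (rule that [of f \<theta> k Fr])
    show "stage N (f N) (\<theta> N) (k N) (Fr N)" for N using s(1) [of N] by (simp add: P_def eq)
    show "\<theta> 0 = id" using s(1) [of 0] by (simp add: P_def eq)
    show "successor N (f N) (\<theta> N) (k N) (Fr N) (f (Suc N)) (\<theta> (Suc N)) (k (Suc N)) (Fr (Suc N))" for N
      using s(2) [of N] by (simp add: S_def eq)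
  qed
qed

end

locale wandering_sequence = wandering_system +
  fixes f \<theta> :: "nat \<Rightarrow> complex \<Rightarrow> complex" and k :: "nat \<Rightarrow> nat \<Rightarrow> nat" and Fr :: "nat \<Rightarrow> complex set"
  assumes stage: "\<And>N. stage N (f N) (\<theta> N) (k N) (Fr N)" and \<theta>0: "\<theta> 0 = id"
    and succ: "\<And>N. successor N (f N) (\<theta> N) (k N) (Fr N) (f (Suc N)) (\<theta> (Suc N)) (k (Suc N)) (Fr (Suc N))"
begin

text \<open>The suffix \<open>l\<close> marks limits. Only \<open>k N n\<close> with \<open>n < N\<close> is meaningful.\<close>

definition "kl n = k (Suc n) n"
definition "fl z = lim (\<lambda>N. f N z)"
definition "h z = (\<Sum>N. \<theta> (Suc N) z - \<theta> N z)"
definition "\<theta>l z = z + h z"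

lemma succD:
  "n < N \<Longrightarrow> k (Suc N) n = k N n" "z \<in> A N \<Longrightarrow> norm (f (Suc N) z - f N z) \<le> (1/2) ^ N"
  "z \<in> Fr N \<Longrightarrow> f (Suc N) z = f N z" "Fr N \<subseteq> Fr (Suc N)" "smooth (\<lambda>z. \<theta> (Suc N) z - \<theta> N z)"
  "derivatives_bounded (Suc N) ((1/2) ^ (N + 4)) (\<lambda>z. \<theta> (Suc N) z - \<theta> N z)"
  "n \<le> N \<Longrightarrow> norm (\<theta> (Suc N) z - \<theta> N z) \<le> \<epsilon> n * (1/2) ^ (N + 1)"
  "n \<le> N \<Longrightarrow> z \<in> frontier (X n) \<Longrightarrow> \<exists>\<zeta> j. dist \<zeta> (\<theta> N z) \<le> 1 / real (Suc N) \<and> (f (Suc N) ^^ j) \<zeta> = p \<and> (\<forall>i\<le>j. (f (Suc N) ^^ i) \<zeta> \<in> Fr (Suc N))"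
  "\<exists>a b. a \<in> Fr (Suc N) - A N \<and> b \<in> Fr (Suc N) - A N \<and> f (Suc N) a = p \<and> f (Suc N) b = p + 1"
proof -
  note s = succ [of N, unfolded successor_def]
  show "n < N \<Longrightarrow> k (Suc N) n = k N n" using s by (elim conjE) (drule spec, erule mp)
  show "z \<in> A N \<Longrightarrow> norm (f (Suc N) z - f N z) \<le> (1/2) ^ N" using s by (elim conjE) (erule bspec)
  show "z \<in> Fr N \<Longrightarrow> f (Suc N) z = f N z" using s by (elim conjE) (erule bspec)
  show "Fr N \<subseteq> Fr (Suc N)" using s by (elim conjE)
  show "smooth (\<lambda>z. \<theta> (Suc N) z - \<theta> N z)" using s by (elim conjE)
  show "derivatives_bounded (Suc N) ((1/2) ^ (N + 4)) (\<lambda>z. \<theta> (Suc N) z - \<theta> N z)" using s by (elim conjE)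
  show "n \<le> N \<Longrightarrow> norm (\<theta> (Suc N) z - \<theta> N z) \<le> \<epsilon> n * (1/2) ^ (N + 1)" using s by (elim conjE) blast
  show "n \<le> N \<Longrightarrow> z \<in> frontier (X n) \<Longrightarrow> \<exists>\<zeta> j. dist \<zeta> (\<theta> N z) \<le> 1 / real (Suc N) \<and> (f (Suc N) ^^ j) \<zeta> = p \<and> (\<forall>i\<le>j. (f (Suc N) ^^ i) \<zeta> \<in> Fr (Suc N))"
    using s by (elim conjE) blast
  show "\<exists>a b. a \<in> Fr (Suc N) - A N \<and> b \<in> Fr (Suc N) - A N \<and> f (Suc N) a = p \<and> f (Suc N) b = p + 1"
    using s by (elim conjE)
qed

lemma k_eq: "n < N \<Longrightarrow> k N n = kl n"
proof (induction N)
  case (Suc N)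
  then show ?case using succD(1) [of n N] by (cases "n = N") (simp_all add: kl_def)
qed simp

lemma summable_half: "summable (\<lambda>N. (1/2) ^ (N + 4) :: real)"
  using summable_ignore_initial_segment [OF summable_geometric [of "1/2::real"], of 4] by simp

lemma uniform_f: "uniform_limit (A N) f fl sequentially"
proof -
  have "uniform_limit (A N) f (\<lambda>z. lim (\<lambda>m. f m z)) sequentially"
  proof (rule telescoping_uniform_limit)
    show "norm (f (Suc m) z - f m z) \<le> (1/2) ^ m" if m: "N \<le> m" and z: "z \<in> A N" for m z
      using A_mono [OF m] z by (intro succD(2)) auto
    show "summable (\<lambda>m. (1/2) ^ m :: real)" by (simp add: summable_geometric)
  qed
  then show ?thesis by (simp add: fl_def [abs_def])
qed

lemma exhaust: obtains N where "z \<in> interior (A N)"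
  using A(3) by (metis UNIV_I UN_E)

lemma fl_holomorphic: "fl holomorphic_on UNIV"
proof (rule holomorphic_uniform_sequence)
  show "f N holomorphic_on UNIV" for N using stageD(1) [OF stage] .
  fix z :: complex
  obtain N where "z \<in> interior (A N)" by (rule exhaust)
  then obtain d where "d > 0" "cball z d \<subseteq> interior (A N)" using open_contains_cball [of "interior (A N)"] by auto
  then have "cball z d \<subseteq> A N" using interior_subset by blast
  then have "uniform_limit (cball z d) f fl sequentially" using uniform_limit_on_subset uniform_f by blast
  then show "\<exists>d>0. cball z d \<subseteq> UNIV \<and> uniform_limit (cball z d) f fl sequentially"
    using \<open>d > 0\<close> by blast
qed simp

text \<open>Locally uniform convergence allows the starting point to move with \<open>N\<close>.
  Relations between \<open>f N\<close> and \<open>\<theta> N\<close> pass to the limit in this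
  way.\<close>

lemma fl_tendsto:
  assumes "x \<longlonglongrightarrow> x0"
  shows "(\<lambda>N. (f N ^^ i) (x N)) \<longlonglongrightarrow> (fl ^^ i) x0"
proof (induction i)
  case 0
  then show ?case using assms by simp
next
  case (Suc i)
  obtain N where N: "(fl ^^ i) x0 \<in> interior (A N)" by (rule exhaust)
  have "uniform_limit (interior (A N)) f fl sequentially" using uniform_limit_on_subset [OF uniform_f interior_subset] .
  moreover have "isCont fl ((fl ^^ i) x0)"
    using holomorphic_on_imp_continuous_on [OF fl_holomorphic] by (simp add: continuous_on_eq_continuous_at)
  ultimately have "(\<lambda>M. f M ((f M ^^ i) (x M))) \<longlonglongrightarrow> fl ((fl ^^ i) x0)"
    by (rule uniform_limit_diagonal [OF _ open_interior N Suc])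
  then show ?case by simp
qed

lemma h_sums: "(\<lambda>N. \<theta> (Suc N) z - \<theta> N z) sums h z"
  unfolding h_def
  by (intro summable_sums summable_comparison_test' [OF summable_half, of 0] derivatives_bounded_norm [OF succD(6)])

lemma \<theta>_tendsto: "(\<lambda>N. \<theta> N z) \<longlonglongrightarrow> \<theta>l z"
proof -
  have "(\<Sum>i<N. \<theta> (Suc i) z - \<theta> i z) = \<theta> N z - z" for N by (induction N) (auto simp: \<theta>0)
  then have "(\<lambda>N. \<theta> N z - z) \<longlonglongrightarrow> h z" using h_sums [of z] unfolding sums_def by simp
  then have "(\<lambda>N. z + (\<theta> N z - z)) \<longlonglongrightarrow> z + h z" by (intro tendsto_intros)
  then show ?thesis by (simp add: \<theta>l_def)
qed

lemma orbit_tendsto: "(\<lambda>N. (f N ^^ i) (\<theta> N z)) \<longlonglongrightarrow> (fl ^^ i) (\<theta>l z)"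
  by (rule fl_tendsto [OF \<theta>_tendsto])

lemma h_smooth: "smooth h"
proof -
  have "smooth (\<lambda>z. \<Sum>N. \<theta> (Suc N) z - \<theta> N z)"
  proof (rule smooth_suminf)
    show "derivatives_bounded N ((1/2) ^ (N + 4)) (\<lambda>z. \<theta> (Suc N) z - \<theta> N z)" for N
      using succD(6) by (rule derivatives_bounded_mono) simp
  qed (rule succD(5) summable_half)+
  then show ?thesis by (simp add: h_def [abs_def])
qed

lemma h_bounded_1: "derivatives_bounded 1 ((1/2) ^ (N + 4)) (\<lambda>z. \<theta> (Suc N) z - \<theta> N z)"
  using succD(6) by (rule derivatives_bounded_mono) simp

lemma dird_h: "dird h v z = (\<Sum>N. dird (\<lambda>z. \<theta> (Suc N) z - \<theta> N z) v z)"
proof (rule dird_eqI)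
  show "(h has_derivative (\<lambda>v. \<Sum>N. dird (\<lambda>z. \<theta> (Suc N) z - \<theta> N z) v z)) (at z)"
    unfolding h_def [abs_def] by (rule sums_dird [OF succD(5) h_bounded_1 summable_half])
qed

lemma dird_summand_le: "norm (dird (\<lambda>z. \<theta> (Suc N) z - \<theta> N z) v z) \<le> 2 * (1/2) ^ (N + 4) * norm v"
  by (rule dird_norm_le [OF succD(5) h_bounded_1])

lemma summable_dird: "summable (\<lambda>N. norm (dird (\<lambda>z. \<theta> (Suc N) z - \<theta> N z) v z))"
  by (rule summable_comparison_test' [of "\<lambda>N. 2 * (1/2) ^ (N + 4) * norm v" 0])
     (use dird_summand_le summable_half in \<open>auto intro!: summable_mult2 summable_mult\<close>)

lemma \<theta>l_diffeomorphism: "smooth_diffeomorphism \<theta>l"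
proof -
  have "norm (dird h v z) \<le> 1/2 * norm v" for v z
  proof -
    have "norm (dird h v z) \<le> (\<Sum>N. norm (dird (\<lambda>z. \<theta> (Suc N) z - \<theta> N z) v z))"
      unfolding dird_h by (rule summable_norm [OF summable_dird])
    also have "\<dots> \<le> (\<Sum>N. 2 * (1/2) ^ (N + 4) * norm v)"
      by (intro suminf_le dird_summand_le summable_dird summable_mult summable_mult2 summable_half)
    \<comment> \<open>The series has first term \<open>1/8 * norm v\<close> and ratio 1/2; the
      resulting 1/4 is within the bound 1/2 needed for a diffeomorphism.\<close>
    also have "(\<lambda>N. 2 * (1/2) ^ (N + 4) * norm v) sums (1/4 * norm v)"
    proof -
      have "(\<lambda>N. (1/8 * norm v) * (1/2) ^ N) sums ((1/8 * norm v) * (1 / (1 - 1/2)))"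
        by (intro sums_mult geometric_sums) simp
      then show ?thesis by (simp add: power_add power4_eq_xxxx mult_ac)
    qed
    then have "(\<Sum>N. 2 * (1/2) ^ (N + 4) * norm v) = 1/4 * norm v" by (rule sums_unique [symmetric])
    also have "\<dots> \<le> 1/2 * norm v" by simp
    finally show ?thesis .
  qed
  then show ?thesis unfolding \<theta>l_def [abs_def] by (rule smooth_diffeomorphism_near_identity [OF h_smooth])
qed

lemma conjugacy: "z \<in> X n \<Longrightarrow> (fl ^^ kl n) (\<theta>l z) = \<theta>l (\<phi> z)"
proof -
  assume z: "z \<in> X n"
  have "\<forall>\<^sub>F N in sequentially. (f N ^^ kl n) (\<theta> N z) = \<theta> N (\<phi> z)"
    using eventually_gt_at_top [of n]
  proof eventually_elim
    case (elim N)
    then show ?case using stageD(9) [OF stage elim] z k_eq [OF elim] by auto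
  qed
  then have "(\<lambda>N. \<theta> N (\<phi> z)) \<longlonglongrightarrow> (fl ^^ kl n) (\<theta>l z)"
    using orbit_tendsto by (rule Lim_transform_eventually [rotated])
  then show ?thesis using \<theta>_tendsto LIMSEQ_unique by blast
qed

lemma \<theta>_early: "z \<in> X n \<Longrightarrow> \<theta> n z = z"
  using stageD(6) [OF stage, of n n] by auto

text \<open>Up to stage \<open>n\<close> nothing moves on \<open>X n\<close>; from then on the
  displacements of at most \<open>\<epsilon> n * (1/2) ^ (N + 1)\<close> add up to at most
  \<open>\<epsilon> n\<close>.\<close>

lemma \<theta>l_close: 
  assumes z: "z \<in> X n"
  shows "norm (\<theta>l z - z) \<le> \<epsilon> n"
proof -
  have le: "norm (\<theta> (n + j) z - z) \<le> \<epsilon> n * ((1/2) ^ n - (1/2) ^ (n + j))" for j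
  proof (induction j)
    case 0
    then show ?case using \<theta>_early [OF z] by simp
  next
    case (Suc j)
    have "norm (\<theta> (n + Suc j) z - z) \<le> norm (\<theta> (n + Suc j) z - \<theta> (n + j) z) + norm (\<theta> (n + j) z - z)"
      using norm_triangle_ineq [of "\<theta> (n + Suc j) z - \<theta> (n + j) z" "\<theta> (n + j) z - z"] by simp
    also have "\<dots> \<le> \<epsilon> n * (1/2) ^ (n + j + 1) + \<epsilon> n * ((1/2) ^ n - (1/2) ^ (n + j))"
      using succD(7) [of n "n + j" z] Suc by (intro add_mono) auto
    also have "\<dots> = \<epsilon> n * ((1/2) ^ n - (1/2) ^ (n + Suc j))" by (simp add: algebra_simps)
    finally show ?case .
  qed
  have "norm (\<theta> (n + j) z - z) \<le> \<epsilon> n" for j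
  proof -
    have "(1/2) ^ n - (1/2) ^ (n + j) \<le> (1::real)" using power_le_one [of "1/2::real" n] zero_le_power [of "1/2::real" "n + j"] by (simp only: diff_le_eq) linarith
    then have "\<epsilon> n * ((1/2) ^ n - (1/2) ^ (n + j)) \<le> \<epsilon> n * 1" using \<epsilon> [of n] by (intro mult_left_mono) auto
    then show ?thesis using le [of j] by simp
  qed
  moreover have "(\<lambda>j. norm (\<theta> (n + j) z - z)) \<longlonglongrightarrow> norm (\<theta>l z - z)"
    using LIMSEQ_ignore_initial_segment [OF \<theta>_tendsto [of z], of n] by (intro tendsto_intros) (simp add: add.commute)
  ultimately show ?thesis by (intro LIMSEQ_le_const2) auto
qed

lemma \<theta>l_fix: "c \<in> M n \<Longrightarrow> \<theta>l c = c"
  using \<theta>_tendsto [of c] stageD(7) [OF stage, of c n] LIMSEQ_unique by (simp add: LIMSEQ_const_iff)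

text \<open>The neighbourhoods of \<open>X n\<close> on which the \<open>\<theta> N\<close> are
  holomorphic may shrink as \<open>N\<close> grows, so holomorphy near \<open>X n\<close> is not
  inherited by the limit. The Cauchy-Riemann equations at points of \<open>X n\<close> are, since
  they pass through the series of derivatives.\<close>

lemma \<theta>l_cauchy_riemann:
  assumes z: "z \<in> X n"
  shows "cauchy_riemann_at \<theta>l z"
proof -
  have 1: "dird (\<lambda>z. \<theta> (Suc N) z - \<theta> N z) \<i> z = \<i> * dird (\<lambda>z. \<theta> (Suc N) z - \<theta> N z) 1 z" for N
  proof -
    obtain Q Q' where "open Q" "X n \<subseteq> Q" "\<theta> N holomorphic_on Q" "open Q'" "X n \<subseteq> Q'" "\<theta> (Suc N) holomorphic_on Q'"
      using stageD(6) [OF stage, of n] by metis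
    then have "(\<lambda>z. \<theta> (Suc N) z - \<theta> N z) holomorphic_on (Q \<inter> Q')" "open (Q \<inter> Q')" "z \<in> Q \<inter> Q'"
      using z by (auto intro!: holomorphic_on_diff elim: holomorphic_on_subset)
    then have "((\<lambda>z. \<theta> (Suc N) z - \<theta> N z) has_field_derivative deriv (\<lambda>z. \<theta> (Suc N) z - \<theta> N z) z) (at z)"
      by (rule holomorphic_derivI)
    then have "dird (\<lambda>z. \<theta> (Suc N) z - \<theta> N z) v z = deriv (\<lambda>z. \<theta> (Suc N) z - \<theta> N z) z * v" for v
      by (intro dird_eqI) (simp add: has_field_derivative_def)
    then show ?thesis by (simp add: mult.commute)
  qed
  have 2: "dird h \<i> z = \<i> * dird h 1 z"
    unfolding dird_h 1 using summable_norm_cancel [OF summable_dird] by (rule suminf_mult)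
  have "(\<theta>l has_derivative (\<lambda>v. v + dird h v z)) (at z)"
    unfolding \<theta>l_def [abs_def] using smooth_has_derivative [OF h_smooth] by (intro has_derivative_add has_derivative_ident)
  then have "\<theta>l differentiable (at z)" "\<And>v. dird \<theta>l v z = v + dird h v z"
    by (auto simp: differentiable_def intro: dird_eqI)
  then show ?thesis using 2 by (simp add: cauchy_riemann_at_def)
qed

lemma orbit_inside: "z \<in> X n \<Longrightarrow> i < kl n \<Longrightarrow> (fl ^^ i) (\<theta>l z) \<in> A (Suc n)"
proof (rule Lim_in_closed_set [OF A_closed _ _ orbit_tendsto])
  assume z: "z \<in> X n" and i: "i < kl n"
  show "\<forall>\<^sub>F N in sequentially. (f N ^^ i) (\<theta> N z) \<in> A (Suc n)"
    using eventually_gt_at_top [of n]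
  proof eventually_elim
    case (elim N)
    then have "(f N ^^ i) ` \<theta> N ` X n \<subseteq> interior (A (Suc n))" using stageD(10) [OF stage elim] i k_eq [OF elim] by simp
    then show ?case using z interior_subset by blast
  qed
qed simp

lemma kl: "kl n > 0" "osc \<Longrightarrow> kl n > 1" "\<not> osc \<Longrightarrow> kl n = 1"
  using stageD(8) [OF stage, of n "Suc n"] stageD(11) [OF stage, of n "Suc n"] by (simp_all add: kl_def)

lemma bounded_excursion: "osc \<Longrightarrow> z \<in> X n \<Longrightarrow> fl (\<theta>l z) \<in> cball p r"
proof (rule Lim_in_closed_set [OF closed_cball])
  assume osc: osc and z: "z \<in> X n"
  show "\<forall>\<^sub>F N in sequentially. f N (\<theta> N z) \<in> cball p r"
    using eventually_gt_at_top [of n]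
  proof eventually_elim
    case (elim N)
    then have "f N ` \<theta> N ` X n \<subseteq> ball p r" using stageD(11) [OF stage elim] osc by simp
    then show ?case using z ball_subset_cball by blast
  qed
  show "(\<lambda>N. f N (\<theta> N z)) \<longlonglongrightarrow> fl (\<theta>l z)" using orbit_tendsto [of 1] by simp
qed simp

lemma Fr_mono: "N \<le> M' \<Longrightarrow> Fr N \<subseteq> Fr M'"
  by (rule lift_Suc_mono_le [of Fr]) (rule succD(4))

lemma fl_Fr:
  assumes "z \<in> Fr N"
  shows "fl z = f N z"
proof -
  have "f (N + j) z = f N z" for j
  proof (induction j)
    case (Suc j)
    have "z \<in> Fr (N + j)" using Fr_mono [of N "N + j"] assms by auto
    then show ?case using succD(3) Suc by simp
  qed simp
  then have "(\<lambda>j. f (j + N) z) \<longlonglongrightarrow> f N z" by (simp add: add.commute)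
  then have "(\<lambda>j. f j z) \<longlonglongrightarrow> f N z" by (rule LIMSEQ_offset)
  then show ?thesis by (simp add: fl_def limI)
qed

lemma fl_p: "fl p = p"
  using fl_Fr [OF stageD(14) [OF stage, of 0]] stageD(2) [OF stage, of 0] by simp

text \<open>The finite orbit found at stage \<open>N\<close> runs inside \<open>Fr (Suc N)\<close>,
  where all later approximations agree; it is therefore an orbit of the limit.\<close>

lemma preimages_near_frontier:
  assumes z: "z \<in> frontier (X n)" and e: "e > 0"
  shows "\<exists>\<zeta> j. dist \<zeta> (\<theta>l z) < e \<and> (fl ^^ j) \<zeta> = p"
proof -
  have "\<forall>\<^sub>F N in sequentially. dist (\<theta> N z) (\<theta>l z) < e / 2" using tendstoD [OF \<theta>_tendsto, of "e / 2"] e by (simp only: half_gt_zero)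
  moreover have "\<forall>\<^sub>F N in sequentially. 1 / real (Suc N) < e / 2"
    using LIMSEQ_inverse_real_of_nat e by (intro order_tendstoD(2) [where y = 0]) (auto simp: inverse_eq_divide)
  ultimately have "\<forall>\<^sub>F N in sequentially. N \<ge> n \<and> dist (\<theta> N z) (\<theta>l z) < e / 2 \<and> 1 / real (Suc N) < e / 2"
    using eventually_ge_at_top [of n] by eventually_elim auto
  then obtain N where N: "N \<ge> n" "dist (\<theta> N z) (\<theta>l z) < e / 2" "1 / real (Suc N) < e / 2"
    using eventually_happens' [OF sequentially_bot] by blast
  obtain \<zeta> j where \<zeta>: "dist \<zeta> (\<theta> N z) \<le> 1 / real (Suc N)" "(f (Suc N) ^^ j) \<zeta> = p" "\<And>i. i \<le> j \<Longrightarrow> (f (Suc N) ^^ i) \<zeta> \<in> Fr (Suc N)"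
    using succD(8) [OF N(1) z] by blast
  have "(fl ^^ j) \<zeta> = (f (Suc N) ^^ j) \<zeta>"
    by (rule funpow_agree [of j "f (Suc N)" \<zeta> "Fr (Suc N)"]) (use \<zeta>(3) fl_Fr in auto)
  moreover have "dist \<zeta> (\<theta>l z) < e" using dist_triangle [of \<zeta> "\<theta>l z" "\<theta> N z"] \<zeta>(1) N(2,3) by simp
  ultimately show ?thesis using \<zeta>(2) by auto
qed

lemma values_at_infinity:
  shows "\<exists>a. norm a > R \<and> fl a = p" "\<exists>b. norm b > R \<and> fl b = p + 1"
proof -
  have "cball 0 R \<subseteq> (\<Union>N. interior (A N))" using A(3) by simp
  then obtain D where D: "finite D" "cball 0 R \<subseteq> (\<Union>N\<in>D. interior (A N))"
    using compactE_image [OF compact_cball, of UNIV "\<lambda>N. interior (A N)" 0 R] by auto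
  obtain N where N: "\<And>n. n \<in> D \<Longrightarrow> n \<le> N" using D(1) finite_nat_set_iff_bounded_le by auto
  have sub: "cball 0 R \<subseteq> A N" using D(2) N A_mono interior_subset by blast
  obtain a b where ab: "a \<in> Fr (Suc N) - A N" "b \<in> Fr (Suc N) - A N" "f (Suc N) a = p" "f (Suc N) b = p + 1"
    using succD(9) by blast
  have "norm a > R" "norm b > R" using ab(1,2) sub by (auto simp: subset_iff not_le)
  moreover have "fl a = p" "fl b = p + 1" using fl_Fr ab by auto
  ultimately show "\<exists>a. norm a > R \<and> fl a = p" "\<exists>b. norm b > R \<and> fl b = p + 1" by auto
qed

end

section \<open>Dynamics of the limit\<close>

lemma tendsto_to_sphere_infinity:
  assumes "filterlim s at_infinity F"
  shows "((\<lambda>x. to_sphere (s x)) \<longlongrightarrow> (0, 1)) F"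
  unfolding to_sphere_def
proof (rule tendsto_Pair)
  have n: "filterlim (\<lambda>x. norm (s x)) at_top F" using assms by (rule filterlim_at_infinity_imp_norm_at_top)
  have "((\<lambda>t::real. 2 / (t\<^sup>2 + 1) * t) \<longlongrightarrow> 0) at_top" by real_asymp
  then have "((\<lambda>x. 2 / ((norm (s x))\<^sup>2 + 1) * norm (s x)) \<longlongrightarrow> 0) F" using n by (rule filterlim_compose)
  then show "((\<lambda>x. (2 / ((norm (s x))\<^sup>2 + 1)) *\<^sub>R s x) \<longlongrightarrow> 0) F"
    by (rule Lim_null_comparison [rotated]) (auto simp: divide_simps)
  have "((\<lambda>t::real. (t\<^sup>2 - 1) / (t\<^sup>2 + 1)) \<longlongrightarrow> 1) at_top" by real_asymp
  then show "((\<lambda>x. ((norm (s x))\<^sup>2 - 1) / ((norm (s x))\<^sup>2 + 1)) \<longlongrightarrow> 1) F" using n by (rule filterlim_compose)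
qed

lemma to_sphere_neq_infinity: "to_sphere z \<noteq> (0, 1)"
proof
  assume "to_sphere z = (0, 1)"
  then have "((norm z)\<^sup>2 - 1) / ((norm z)\<^sup>2 + 1) = 1" by (simp add: to_sphere_def)
  moreover have "(norm z)\<^sup>2 + 1 \<noteq> 0" using zero_le_power2 [of "norm z"] by linarith
  ultimately show False by (simp add: divide_eq_eq)
qed

lemma continuous_on_to_sphere: "continuous_on S to_sphere"
proof -
  have "(norm z)\<^sup>2 + 1 \<noteq> 0" for z :: complex using zero_le_power2 [of "norm z"] by linarith
  then show ?thesis unfolding to_sphere_def [abs_def] by (intro continuous_intros) auto
qed

lemma bij_homeo_frontier:
  fixes \<theta> :: "'a :: topological_space \<Rightarrow> 'b :: topological_space"
  assumes "bij \<theta>" "continuous_on UNIV \<theta>" "continuous_on UNIV (inv \<theta>)"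
  shows "frontier (\<theta> ` S) = \<theta> ` frontier S"
proof -
  have "homeomorphic_map euclidean euclidean \<theta>"
    unfolding homeomorphic_map_maps homeomorphic_maps_def
    using assms by (intro exI [of _ "inv \<theta>"]) (auto simp: bij_def surj_f_inv_f)
  then show ?thesis using homeomorphic_map_frontier_of [of euclidean euclidean \<theta> S] by simp
qed

text \<open>A limit function would be continuous at \<open>w\<close> with value infinity, yet equal
  to \<open>to_sphere p\<close> at points accumulating at \<open>w\<close>. Divergence is asked for
  only along the times \<open>t\<close>, because in the oscillating case the whole orbit does not
  escape.\<close>

lemma julia_if_escaping_and_prefixed:
  assumes cont: "\<And>i. continuous_on UNIV (F ^^ i)" and fp: "F p = p"
    and esc: "filterlim (\<lambda>m. (F ^^ t m) w) at_infinity sequentially" and t: "filterlim t at_top sequentially"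
    and pre: "\<And>e. e > 0 \<Longrightarrow> \<exists>\<zeta> j. dist \<zeta> w < e \<and> (F ^^ j) \<zeta> = p"
  shows "w \<in> julia_set F"
proof -
  have False if w: "w \<in> fatou_set F"
  proof -
    obtain U where U: "open U" "w \<in> U" "normal_family_on U (range (\<lambda>n. F ^^ n))"
      using w unfolding fatou_set_def by blast
    obtain e where e: "e > 0" "cball w e \<subseteq> U" using U(1,2) open_contains_cball by blast
    have "range (\<lambda>m. F ^^ t m) \<subseteq> range (\<lambda>n. F ^^ n)" by auto
    from U(3) [unfolded normal_family_on_def, THEN spec, THEN mp, OF this]
    obtain r :: "nat \<Rightarrow> nat" and g where r: "strict_mono r"
        "\<forall>K. compact K \<and> K \<subseteq> U \<longrightarrow> uniform_limit K (\<lambda>n z. to_sphere ((F ^^ t (r n)) z)) g sequentially"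
      by (elim exE conjE)
    then have ul: "uniform_limit (cball w e) (\<lambda>n z. to_sphere ((F ^^ t (r n)) z)) g sequentially" using e(2) by simp
    have "continuous_on (cball w e) g"
    proof (rule uniform_limit_theorem [OF _ ul])
      have "continuous_on (cball w e) (\<lambda>z. to_sphere ((F ^^ t (r n)) z))" for n
        using continuous_on_compose2 [OF continuous_on_to_sphere [of UNIV] continuous_on_subset [OF cont]] by auto
      then show "\<forall>\<^sub>F n in sequentially. continuous_on (cball w e) (\<lambda>z. to_sphere ((F ^^ t (r n)) z))" by simp
    qed simp
    then have gcont: "isCont g w" using e(1) by (intro continuous_on_interior [of "cball w e"]) auto
    have r_top: "filterlim r at_top sequentially" using r(1) by (rule filterlim_subseq)
    have "filterlim (\<lambda>n. (F ^^ t (r n)) w) at_infinity sequentially"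
      using filterlim_compose [OF esc r_top] .
    then have "(\<lambda>n. to_sphere ((F ^^ t (r n)) w)) \<longlonglongrightarrow> (0, 1)" by (rule tendsto_to_sphere_infinity)
    moreover have "(\<lambda>n. to_sphere ((F ^^ t (r n)) w)) \<longlonglongrightarrow> g w"
      using tendsto_uniform_limitI [OF ul] e(1) by simp
    ultimately have gw: "g w = (0, 1)" using LIMSEQ_unique by blast
    have fpi: "(F ^^ i) p = p" for i using fp by (induction i) auto
    have gz: "g \<zeta> = to_sphere p" if "\<zeta> \<in> cball w e" "(F ^^ j) \<zeta> = p" for \<zeta> j
    proof -
      have "filterlim (\<lambda>n. t (r n)) at_top sequentially" using filterlim_compose [OF t r_top] .
      then have "\<forall>\<^sub>F n in sequentially. t (r n) \<ge> j" by (simp add: filterlim_at_top)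
      then have "\<forall>\<^sub>F n in sequentially. to_sphere ((F ^^ t (r n)) \<zeta>) = to_sphere p"
      proof eventually_elim
        case (elim n)
        then have "(F ^^ t (r n)) \<zeta> = (F ^^ (t (r n) - j)) ((F ^^ j) \<zeta>)"
          by (metis comp_apply funpow_add le_add_diff_inverse2)
        then show ?case using fpi \<open>(F ^^ j) \<zeta> = p\<close> by simp
      qed
      then have "(\<lambda>n. to_sphere ((F ^^ t (r n)) \<zeta>)) \<longlonglongrightarrow> to_sphere p" by (rule tendsto_eventually)
      then show ?thesis using tendsto_uniform_limitI [OF ul \<open>\<zeta> \<in> cball w e\<close>] LIMSEQ_unique by blast
    qed
    have "\<exists>\<zeta>. dist \<zeta> w < min e (1 / real (Suc m)) \<and> (\<exists>j. (F ^^ j) \<zeta> = p)" for m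
      using pre [of "min e (1 / real (Suc m))"] e(1) by auto
    then obtain \<zeta> where \<zeta>: "\<And>m. dist (\<zeta> m) w < min e (1 / real (Suc m))" "\<And>m. \<exists>j. (F ^^ j) (\<zeta> m) = p" by metis
    have "\<zeta> \<longlonglongrightarrow> w"
    proof (rule metric_LIMSEQ_I)
      fix \<epsilon> :: real assume "\<epsilon> > 0"
      then obtain n where n: "inverse (real (Suc n)) < \<epsilon>" using reals_Archimedean by blast
      have "dist (\<zeta> m) w < \<epsilon>" if "m \<ge> n" for m
      proof -
        have "1 / real (Suc m) \<le> inverse (real (Suc n))" using that by (simp add: divide_simps)
        then show ?thesis using \<zeta>(1) [of m] n by simp
      qed
      then show "\<exists>n. \<forall>m\<ge>n. dist (\<zeta> m) w < \<epsilon>" by blast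
    qed
    then have "(\<lambda>m. g (\<zeta> m)) \<longlonglongrightarrow> g w" using gcont isCont_tendsto_compose by blast
    moreover have "g (\<zeta> m) = to_sphere p" for m
    proof -
      have "\<zeta> m \<in> cball w e" using \<zeta>(1) [of m] by (simp add: dist_commute)
      then show ?thesis using gz \<zeta>(2) by blast
    qed
    ultimately have "g w = to_sphere p" by (simp add: LIMSEQ_const_iff)
    then show False using gw to_sphere_neq_infinity by metis
  qed
  then show ?thesis unfolding julia_set_def by blast
qed

text \<open>Without an essential singularity, \<open>f\<close> would have a finite limit or a pole
  at infinity. Two values taken arbitrarily far out exclude the former, and already one of them
  excludes the latter.\<close>

lemma transcendental_entireI:
  assumes "f holomorphic_on UNIV" "a \<noteq> b" and a: "\<And>R. \<exists>z. norm z > R \<and> f z = a" and b: "\<And>R. \<exists>z. norm z > R \<and> f z = b"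
  shows "transcendental_entire f"
proof -
  have seq: "\<exists>s. filterlim s (at 0) sequentially \<and> (\<forall>n. f (inverse (s n)) = c)"
    if c: "\<And>R. \<exists>z. norm z > R \<and> f z = c" for c
  proof -
    have "\<forall>n. \<exists>z. norm z > real (Suc n) \<and> f z = c" using c by blast
    from choice [OF this] obtain z where z: "\<And>n. norm (z n) > real (Suc n)" "\<And>n. f (z n) = c" by blast
    have "filterlim (\<lambda>n. norm (z n)) at_top sequentially"
    proof (rule filterlim_at_top_mono [OF filterlim_real_sequentially])
      have "real n \<le> norm (z n)" for n using z(1) [of n] by simp
      then show "\<forall>\<^sub>F n in sequentially. real n \<le> norm (z n)" by simp
    qed
    then have "filterlim z at_infinity sequentially" by (rule filterlim_norm_at_top_imp_at_infinity)
    then have "filterlim (\<lambda>n. inverse (z n)) (at 0) sequentially" by (simp add: filterlim_inverse_at_iff)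
    then show ?thesis using z(2) by (intro exI [of _ "\<lambda>n. inverse (z n)"]) simp
  qed
  obtain s where s: "filterlim s (at 0) sequentially" "\<And>n. f (inverse (s n)) = a" using seq [OF a] by blast
  obtain s' where s': "filterlim s' (at 0) sequentially" "\<And>n. f (inverse (s' n)) = b" using seq [OF b] by blast
  have "\<not> not_essential (\<lambda>w. f (inverse w)) 0"
    unfolding not_essential_def
  proof (intro notI, elim exE disjE)
    fix x assume x: "((\<lambda>w. f (inverse w)) \<longlongrightarrow> x) (at 0)"
    have "(\<lambda>n::nat. a) \<longlonglongrightarrow> x" "(\<lambda>n::nat. b) \<longlonglongrightarrow> x"
      using filterlim_compose [OF x s(1)] filterlim_compose [OF x s'(1)] s(2) s'(2) by auto
    then show False using \<open>a \<noteq> b\<close> by (simp add: LIMSEQ_const_iff)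
  next
    assume "is_pole (\<lambda>w. f (inverse w)) 0"
    then have "filterlim (\<lambda>n. f (inverse (s n))) at_infinity sequentially"
      unfolding is_pole_def using s(1) by (rule filterlim_compose)
    then have "filterlim (\<lambda>n::nat. a) at_infinity sequentially" using s(2) by simp
    then show False using not_tendsto_and_filterlim_at_infinity [of sequentially "\<lambda>n. a" a] by simp
  qed
  then show ?thesis using assms(1) by (simp add: transcendental_entire_def)
qed

text \<open>On an open set the equations amount to holomorphy; the nonvanishing derivative then
  comes from injectivity.\<close>

lemma conformal_on_if_cauchy_riemann:
  assumes "inj \<theta>" "open S" and cr: "\<And>z. z \<in> S \<Longrightarrow> cauchy_riemann_at \<theta> z"
  shows "conformal_on \<theta> S"
proof -
  have "\<theta> field_differentiable (at z)" if "z \<in> S" for z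
  proof -
    define D where "D = (\<lambda>v. frechet_derivative \<theta> (at z) v)"
    have D: "(\<theta> has_derivative D) (at z)" and i: "D \<i> = \<i> * D 1"
      using cr [OF that] by (auto simp: cauchy_riemann_at_def D_def frechet_derivative_works complex_eq_iff)
    have "linear D" using D has_derivative_linear by blast
    have "D v = D 1 * v" for v
    proof -
      have "D v = of_real (Re v) * D 1 + of_real (Im v) * (\<i> * D 1)"
        using linear_complex_expand [OF \<open>linear D\<close>, of v] unfolding i .
      also have "\<dots> = D 1 * (of_real (Re v) + \<i> * of_real (Im v))" by (simp only: algebra_simps)
      finally show ?thesis by (simp only: complex_eq [symmetric])
    qed
    then have "D = (*) (D 1)" by (rule ext)
    then have "(\<theta> has_field_derivative D 1) (at z)" using D by (simp add: has_field_derivative_def)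
    then show ?thesis by (auto simp: field_differentiable_def)
  qed
  then have hol: "\<theta> holomorphic_on S" using assms(2) by (simp add: holomorphic_on_open field_differentiable_def)
  moreover have "inj_on \<theta> S" using assms(1) inj_on_subset by blast
  ultimately show ?thesis
    unfolding conformal_on_def using holomorphic_injective_imp_regular [OF hol assms(2)] by blast
qed

context wandering_sequence
begin

text \<open>The number of iterates of \<open>fl\<close> that carry \<open>\<theta>l\<close> of
  \<open>X n\<close> into \<open>\<theta>l\<close> of \<open>X m\<close>, for
  \<open>n \<le> m\<close>.\<close>

definition "time n m = (\<Sum>i\<in>{n..<m}. kl i)"

lemma time_Suc: "n \<le> m \<Longrightarrow> time n (Suc m) = kl m + time n m"
  by (simp add: time_def)

lemma time_ge: "m \<le> time n (n + m)"
proof (induction m)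
  case (Suc m)
  then show ?case using kl(1) [of "n + m"] time_Suc [of n "n + m"] by simp
qed simp

lemma orbit_X: "z \<in> X n \<Longrightarrow> (\<phi> ^^ m) z \<in> X (n + m)"
  by (induction m) (use \<phi>X in auto)

lemma orbit_at_time: "z \<in> X n \<Longrightarrow> (fl ^^ time n (n + m)) (\<theta>l z) = \<theta>l ((\<phi> ^^ m) z)"
proof (induction m)
  case 0
  then show ?case by (simp add: time_def)
next
  case (Suc m)
  have "(fl ^^ time n (n + Suc m)) (\<theta>l z) = (fl ^^ kl (n + m)) (\<theta>l ((\<phi> ^^ m) z))"
    using Suc time_Suc [of n "n + m"] by (simp add: funpow_add)
  also have "\<dots> = \<theta>l (\<phi> ((\<phi> ^^ m) z))" using orbit_X [OF Suc.prems] by (rule conjugacy)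
  finally show ?case by simp
qed

lemma \<theta>l_position: "z \<in> X n \<Longrightarrow> \<theta>l z \<in> interior (A (Suc n)) - A n"
  using margin [of z n "\<theta>l z"] \<theta>l_close [of z n] by (simp add: dist_norm)

lemma outside_at_time: "z \<in> X n \<Longrightarrow> (fl ^^ time n (n + m)) (\<theta>l z) \<notin> A (n + m)"
  using orbit_at_time [of z n m] \<theta>l_position [OF orbit_X, of z n m] by simp

lemma inside_before_time: "z \<in> X n \<Longrightarrow> t < time n (n + m) \<Longrightarrow> (fl ^^ t) (\<theta>l z) \<in> A (n + m)"
proof (induction m)
  case 0
  then show ?case by (simp add: time_def)
next
  case (Suc m)
  show ?case
  proof (cases "t < time n (n + m)")
    case True
    then show ?thesis using Suc A_mono [of "n + m" "n + Suc m"] by auto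
  next
    case False
    define i where "i = t - time n (n + m)"
    have t: "t = i + time n (n + m)" using False by (simp add: i_def)
    then have "i < kl (n + m)" using Suc.prems(2) time_Suc [of n "n + m"] by simp
    then have "(fl ^^ i) (\<theta>l ((\<phi> ^^ m) z)) \<in> A (Suc (n + m))"
      using orbit_X [OF Suc.prems(1)] by (intro orbit_inside)
    then show ?thesis using orbit_at_time [OF Suc.prems(1), of m] by (simp add: t funpow_add)
  qed
qed

text \<open>Both sides are iterated further until the orbit of \<open>y\<close> reaches time
  \<open>T\<close>, when it is outside \<open>A (n + b)\<close>. The orbit of \<open>x\<close> would
  be at the same point strictly before \<open>T\<close>, but until then it stays inside
  \<open>A (n + b)\<close>.\<close>

lemma images_disjoint_aux:
  assumes "a < b" "x \<in> X n" "y \<in> X n"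
  shows "(fl ^^ a) (\<theta>l x) \<noteq> (fl ^^ b) (\<theta>l y)"
proof
  assume eq: "(fl ^^ a) (\<theta>l x) = (fl ^^ b) (\<theta>l y)"
  define T where "T = time n (n + b)"
  have T: "b \<le> T" unfolding T_def by (rule time_ge)
  have "(fl ^^ (T - b + a)) (\<theta>l x) = (fl ^^ (T - b)) ((fl ^^ b) (\<theta>l y))" using eq by (simp add: funpow_add)
  also have "\<dots> = (fl ^^ T) (\<theta>l y)" using T by (metis comp_apply funpow_add le_add_diff_inverse2)
  also have "\<dots> \<notin> A (n + b)" unfolding T_def by (rule outside_at_time [OF assms(3)])
  finally have "(fl ^^ (T - b + a)) (\<theta>l x) \<notin> A (n + b)" .
  moreover have "T - b + a < T" using T assms(1) by simp
  ultimately show False using inside_before_time [OF assms(2), of "T - b + a" b] by (simp add: T_def)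
qed

lemma images_disjoint:
  assumes "a \<noteq> b"
  shows "(fl ^^ a) ` \<theta>l ` X n \<inter> (fl ^^ b) ` \<theta>l ` X n = {}"
  using images_disjoint_aux [of a b _ n] images_disjoint_aux [of b a _ n] assms
  by (cases a b rule: linorder_cases) (auto simp: image_iff, metis+)

lemma compact_inside: "compact B \<Longrightarrow> \<exists>N. \<forall>n\<ge>N. B \<subseteq> A n"
proof -
  assume B: "compact B"
  have "B \<subseteq> (\<Union>N. interior (A N))" using A(3) by simp
  then obtain D where D: "finite D" "B \<subseteq> (\<Union>N\<in>D. interior (A N))"
    using compactE_image [OF B, of UNIV "\<lambda>N. interior (A N)"] by auto
  obtain N where N: "\<And>n. n \<in> D \<Longrightarrow> n \<le> N" using D(1) finite_nat_set_iff_bounded_le by auto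
  have "B \<subseteq> A N" using D(2) N A_mono interior_subset by blast
  then show ?thesis using A_mono by blast
qed

lemma orbit_unbounded:
  assumes z: "z \<in> X n"
  shows "filterlim (\<lambda>m. (fl ^^ time n (n + m)) (\<theta>l z)) at_infinity sequentially"
  unfolding filterlim_at_infinity [OF order_refl]
proof (intro allI impI)
  fix R :: real
  obtain N where N: "\<And>n. n \<ge> N \<Longrightarrow> cball 0 R \<subseteq> A n" using compact_inside [OF compact_cball, of 0 R] by blast
  have "R \<le> norm ((fl ^^ time n (n + m)) (\<theta>l z))" if "m \<ge> N" for m
  proof -
    have "cball 0 R \<subseteq> A (n + m)" using N [of "n + m"] that by simp
    then have "(fl ^^ time n (n + m)) (\<theta>l z) \<notin> cball 0 R" using outside_at_time [OF z, of m] by blast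
    then show ?thesis by simp
  qed
  then show "\<forall>\<^sub>F m in sequentially. R \<le> norm ((fl ^^ time n (n + m)) (\<theta>l z))"
    unfolding eventually_sequentially by blast
qed

lemma escaping: "\<not> osc \<Longrightarrow> z \<in> X n \<Longrightarrow> \<theta>l z \<in> escaping_set fl"
proof -
  assume "\<not> osc" and z: "z \<in> X n"
  then have "time n (n + m) = m" for m using kl(3) by (simp add: time_def)
  then show ?thesis using orbit_unbounded [OF z] by (simp add: escaping_set_def)
qed

lemma bungee:
  assumes osc and z: "z \<in> X n"
  shows "\<theta>l z \<in> bungee_set fl"
proof -
  let ?u = "\<lambda>t. ereal (norm ((fl ^^ t) (\<theta>l z)))"
  have time_top: "\<exists>t\<ge>T. \<exists>m. t = time n (n + m) \<and> m \<ge> T" for T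
    using time_ge [of T n] by blast
  have "liminf ?u \<le> ereal (norm p + r)"
  proof (rule ccontr)
    assume "\<not> ?thesis"
    then have "\<forall>\<^sub>F t in sequentially. ?u t > ereal (norm p + r)" by (intro less_LiminfD) (simp add: not_le)
    then obtain T where T: "\<And>t. t \<ge> T \<Longrightarrow> ?u t > ereal (norm p + r)" by (auto simp: eventually_sequentially)
    obtain t m where t: "t \<ge> T" "t = time n (n + m)" using time_top by blast
    \<comment> \<open>One step after each arrival at a set of the sequence the orbit is in the disc
      around \<open>p\<close>.\<close>
    have "(fl ^^ Suc t) (\<theta>l z) = fl (\<theta>l ((\<phi> ^^ m) z))" using orbit_at_time [OF z, of m] t(2) by simp
    also have "\<dots> \<in> cball p r" using bounded_excursion [OF \<open>osc\<close> orbit_X [OF z]] .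
    finally have "norm ((fl ^^ Suc t) (\<theta>l z)) \<le> norm p + r"
      using norm_triangle_sub [of "(fl ^^ Suc t) (\<theta>l z)" p] by (simp add: dist_norm norm_minus_commute)
    moreover have "?u (Suc t) > ereal (norm p + r)" by (rule T) (use t(1) in simp)
    ultimately show False by simp
  qed
  then have 1: "liminf ?u < \<infinity>" using less_PInf_Ex_of_nat le_less_trans by (metis ereal_infty_less(1) PInfty_neq_ereal(2))
  have "limsup ?u = \<infinity>"
  proof (rule ccontr)
    assume "limsup ?u \<noteq> \<infinity>"
    then have "limsup ?u < \<infinity>" by simp
    then obtain R where "limsup ?u < ereal (real R)" using less_PInf_Ex_of_nat by auto
    then have "\<forall>\<^sub>F t in sequentially. ?u t < ereal (real R)" by (rule Limsup_lessD)
    then obtain T where T: "\<And>t. t \<ge> T \<Longrightarrow> ?u t < ereal (real R)" by (auto simp: eventually_sequentially)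
    have "\<forall>\<^sub>F m in sequentially. real R \<le> norm ((fl ^^ time n (n + m)) (\<theta>l z))"
    proof (cases "R = 0")
      case False
      then show ?thesis using orbit_unbounded [OF z] unfolding filterlim_at_infinity [OF order_refl] by simp
    qed simp
    then obtain m0 where m0: "\<And>m. m \<ge> m0 \<Longrightarrow> real R \<le> norm ((fl ^^ time n (n + m)) (\<theta>l z))" by (auto simp: eventually_sequentially)
    have "?u (time n (n + max T m0)) < ereal (real R)" using time_ge [of "max T m0" n] by (intro T) simp
    then show False using m0 [of "max T m0"] by simp
  qed
  with 1 show ?thesis by (simp add: bungee_set_def)
qed

lemma fl_funpow_continuous: "continuous_on UNIV (fl ^^ i)"
proof -
  have "(fl ^^ i) holomorphic_on UNIV"
    by (rule funpow_holomorphic [where G = "\<lambda>i. UNIV"]) (use fl_holomorphic in auto)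
  then show ?thesis by (rule holomorphic_on_imp_continuous_on)
qed

lemma frontier_julia:
  assumes z: "z \<in> frontier (X n)"
  shows "\<theta>l z \<in> julia_set fl"
proof (rule julia_if_escaping_and_prefixed)
  show "continuous_on UNIV (fl ^^ i)" for i by (rule fl_funpow_continuous)
  show "fl p = p" by (rule fl_p)
  have "z \<in> X n" using z closed_each frontier_subset_closed by blast
  then show "filterlim (\<lambda>m. (fl ^^ time n (n + m)) (\<theta>l z)) at_infinity sequentially" by (rule orbit_unbounded)
  show "filterlim (\<lambda>m. time n (n + m)) at_top sequentially"
    by (rule filterlim_at_top_mono [OF filterlim_ident]) (use time_ge in simp)
  show "\<exists>\<zeta> j. dist \<zeta> (\<theta>l z) < e \<and> (fl ^^ j) \<zeta> = p" if "e > 0" for e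
    using preimages_near_frontier [OF z that] .
qed

lemma \<theta>l_homeo: "bij \<theta>l" "continuous_on UNIV \<theta>l" "continuous_on UNIV (inv \<theta>l)"
proof -
  have "bij \<theta>l" "times_differentiable 0 \<theta>l" "times_differentiable 0 (inv \<theta>l)"
    using \<theta>l_diffeomorphism unfolding smooth_diffeomorphism_def by blast+
  then show "bij \<theta>l" "continuous_on UNIV \<theta>l" "continuous_on UNIV (inv \<theta>l)" by auto
qed

lemma frontier_image: "frontier (\<theta>l ` S) = \<theta>l ` frontier S"
  using \<theta>l_homeo by (rule bij_homeo_frontier)

lemma frontier_Union: "frontier (\<Union>n. X n) \<subseteq> (\<Union>n. frontier (X n))"
proof
  fix z assume z: "z \<in> frontier (\<Union>n. X n)"
  then have "z \<in> (\<Union>n. X n)" using closed_X frontier_subset_closed by blast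
  then obtain n where n: "z \<in> X n" by blast
  have "interior (X n) \<subseteq> interior (\<Union>n. X n)" by (intro interior_mono) auto
  then have "z \<notin> interior (X n)" using z by (auto simp: frontier_def)
  then have "z \<in> frontier (X n)" using n closure_subset by (auto simp: frontier_def)
  then show "z \<in> (\<Union>n. frontier (X n))" by blast
qed

lemma realization:
  "transcendental_entire fl" "smooth_diffeomorphism \<theta>l"
  "frontier (\<theta>l ` (\<Union>n. X n)) \<subseteq> julia_set fl"
  "conformal_on \<theta>l (interior (\<Union>n. X n))"
  "osc \<Longrightarrow> bounded (fl ` \<theta>l ` (\<Union>n. X n))"
  "wandering_compact fl (\<theta>l ` X n)"
proof -
  show "transcendental_entire fl"
    by (rule transcendental_entireI [OF fl_holomorphic _ values_at_infinity]) simp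
  show "smooth_diffeomorphism \<theta>l" by (rule \<theta>l_diffeomorphism)
  show "frontier (\<theta>l ` (\<Union>n. X n)) \<subseteq> julia_set fl"
    unfolding frontier_image using frontier_Union frontier_julia by blast
  show "conformal_on \<theta>l (interior (\<Union>n. X n))"
  proof (rule conformal_on_if_cauchy_riemann)
    show "inj \<theta>l" using \<theta>l_homeo(1) by (rule bij_is_inj)
    fix z assume "z \<in> interior (\<Union>n. X n)"
    then have "z \<in> (\<Union>n. X n)" using interior_subset by blast
    then show "cauchy_riemann_at \<theta>l z" using \<theta>l_cauchy_riemann by blast
  qed simp
  show "bounded (fl ` \<theta>l ` (\<Union>n. X n))" if osc
  proof (rule bounded_subset [OF bounded_cball])
    show "fl ` \<theta>l ` (\<Union>n. X n) \<subseteq> cball p r" using bounded_excursion [OF that] by blast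
  qed
  show "wandering_compact fl (\<theta>l ` X n)"
    unfolding wandering_compact_def
  proof (intro conjI allI impI)
    show "compact (\<theta>l ` X n)"
      using compact_X continuous_on_subset [OF \<theta>l_homeo(2)] by (intro compact_continuous_image) auto
    show "frontier (\<theta>l ` X n) \<subseteq> julia_set fl" unfolding frontier_image using frontier_julia by blast
    show "(fl ^^ a) ` \<theta>l ` X n \<inter> (fl ^^ b) ` \<theta>l ` X n = {}" if "a \<noteq> b" for a b
      using that by (rule images_disjoint)
  qed
qed

end

section \<open>Reduction to wandering systems\<close>

lemma constant_on_ball_extends:
  assumes "\<phi> holomorphic_on ball w \<rho>" "w' \<in> ball w \<rho>" "\<rho>' > 0" "\<phi> constant_on ball w' \<rho>'"
  shows "\<phi> constant_on ball w \<rho>"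
proof -
  obtain c where c: "\<And>z. z \<in> ball w' \<rho>' \<Longrightarrow> \<phi> z = c" using assms(4) by (auto simp: constant_on_def)
  have "\<phi> z = c" if "z \<in> ball w \<rho>" for z
  proof (rule analytic_continuation_open [of "ball w \<rho> \<inter> ball w' \<rho>'" "ball w \<rho>" \<phi> "\<lambda>_. c"])
    show "ball w \<rho> \<inter> ball w' \<rho>' \<noteq> {}" using assms(2,3) centre_in_ball by blast
  qed (use assms(1) that c in auto)
  then show ?thesis by (auto simp: constant_on_def)
qed

text \<open>Where \<open>\<phi>\<close> is constant near an isolated point of \<open>Y\<close>, it is replaced by a translation near that point.\<close>

lemma nondegenerate_replacement:
  assumes U: "open U" "Y \<subseteq> U" "\<phi> holomorphic_on U" and nd: "nondegenerate_on \<phi> Y"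
  obtains \<phi>' U' where "open U'" "Y \<subseteq> U'" "\<phi>' holomorphic_on U'" "\<And>z. z \<in> Y \<Longrightarrow> \<phi>' z = \<phi> z"
    "\<And>x \<rho>. x \<in> Y \<Longrightarrow> \<rho> > 0 \<Longrightarrow> \<exists>z\<in>ball x \<rho>. deriv \<phi>' z \<noteq> 0"
proof -
  \<comment> \<open>By the identity theorem both \<open>L\<close> and \<open>U - L\<close> are open,
    so redefining \<phi> on \<open>L\<close> leaves holomorphy on the remaining part
    untouched.\<close>
  define L where "L = {w. \<exists>\<rho>>0. ball w \<rho> \<subseteq> U \<and> \<phi> constant_on ball w \<rho>}"
  have opL: "open L"
    unfolding open_contains_ball
  proof
    fix w assume "w \<in> L"
    then obtain \<rho> where \<rho>: "\<rho> > 0" "ball w \<rho> \<subseteq> U" "\<phi> constant_on ball w \<rho>" by (auto simp: L_def)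
    have "v \<in> L" if v: "v \<in> ball w \<rho>" for v
    proof -
      obtain \<sigma> where \<sigma>: "\<sigma> > 0" "ball v \<sigma> \<subseteq> ball w \<rho>" using v open_contains_ball open_ball by blast
      then have "\<phi> constant_on ball v \<sigma>" using \<rho>(3) constant_on_subset by blast
      then show ?thesis using \<sigma> \<rho>(2) unfolding L_def by blast
    qed
    then show "\<exists>e>0. ball w e \<subseteq> L" using \<rho>(1) by blast
  qed
  have opUL: "open (U - L)"
    unfolding open_contains_ball
  proof
    fix w assume w: "w \<in> U - L"
    then obtain \<rho> where \<rho>: "\<rho> > 0" "ball w \<rho> \<subseteq> U" using U(1) open_contains_ball by blast
    have hol: "\<phi> holomorphic_on ball w \<rho>" using \<rho>(2) U(3) holomorphic_on_subset by blast
    have "v \<notin> L" if v: "v \<in> ball w \<rho>" for v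
    proof
      assume "v \<in> L"
      then obtain \<sigma> where "\<sigma> > 0" "\<phi> constant_on ball v \<sigma>" by (auto simp: L_def)
      then have "\<phi> constant_on ball w \<rho>" using constant_on_ball_extends [OF hol v] by blast
      then show False using w \<rho> unfolding L_def by blast
    qed
    then show "\<exists>e>0. ball w e \<subseteq> U - L" using \<rho> by blast
  qed
  define D where "D = L \<inter> Y"
  \<comment> \<open>By \<open>nondegenerate_on\<close>, the points of \<open>Y\<close> in
    \<open>L\<close> are isolated in \<open>Y\<close>. Free discs of radius \<open>2 * e z\<close>
    make those of radius \<open>e z\<close> pairwise disjoint, so that \<open>c w\<close> below is
    well defined.\<close>
  have "\<exists>e>0. \<forall>y\<in>Y. dist y z < 2 * e \<longrightarrow> y = z" if "z \<in> D" for z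
  proof -
    have "\<exists>r>0. \<phi> constant_on ball z r" using that by (auto simp: D_def L_def)
    then have "\<not> z islimpt Y" using nd unfolding nondegenerate_on_def by blast
    then obtain e where "e > 0" "\<And>y. y \<in> Y \<Longrightarrow> dist y z < e \<Longrightarrow> y = z" by (auto simp: islimpt_approachable)
    then show ?thesis by (intro exI [of _ "e / 2"]) auto
  qed
  then obtain e where e: "\<And>z. z \<in> D \<Longrightarrow> e z > 0" "\<And>z y. z \<in> D \<Longrightarrow> y \<in> Y \<Longrightarrow> dist y z < 2 * e z \<Longrightarrow> y = z" by metis
  have uniq: "z = z'" if zz: "z \<in> D" "z' \<in> D" "w \<in> ball z (e z)" "w \<in> ball z' (e z')" for z z' w
  proof -
    have d: "dist z z' < e z + e z'" using zz(3,4) dist_triangle_less_add [of z w "e z" z' "e z'"] by (simp add: dist_commute)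
    show ?thesis
    proof (cases "e z \<le> e z'")
      case True
      then show ?thesis using e(2) [OF zz(2), of z] zz(1) d by (simp add: D_def)
    next
      case False
      then show ?thesis using e(2) [OF zz(1), of z'] zz(2) d by (simp add: D_def dist_commute)
    qed
  qed
  define c where "c w = (SOME z. z \<in> D \<and> w \<in> ball z (e z))" for w
  have c: "c w = z" if "z \<in> D" "w \<in> ball z (e z)" for z w
    unfolding c_def by (rule some_equality) (use that uniq in blast)+
  define \<phi>' where "\<phi>' w = (if w \<in> L then \<phi> (c w) + (w - c w) else \<phi> w)" for w
  have holB: "\<phi>' holomorphic_on (L \<inter> ball z (e z))" if z: "z \<in> D" for z
  proof -
    have "\<phi>' holomorphic_on (L \<inter> ball z (e z)) \<longleftrightarrow> (\<lambda>w. \<phi> z + (w - z)) holomorphic_on (L \<inter> ball z (e z))"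
      by (rule holomorphic_cong) (use c [OF z] in \<open>auto simp: \<phi>'_def\<close>)
    then show ?thesis by (auto intro!: holomorphic_intros)
  qed
  have holU: "\<phi>' holomorphic_on (U - L)"
  proof -
    have "\<phi>' holomorphic_on (U - L) \<longleftrightarrow> \<phi> holomorphic_on (U - L)"
      by (rule holomorphic_cong) (auto simp: \<phi>'_def)
    then show ?thesis using U(3) by (auto elim: holomorphic_on_subset)
  qed
  show ?thesis
  proof (rule that [of "(U - L) \<union> (\<Union>z\<in>D. L \<inter> ball z (e z))" \<phi>'])
    have opB: "open (\<Union>z\<in>D. L \<inter> ball z (e z))" using opL by (intro open_UN) auto
    then show "open ((U - L) \<union> (\<Union>z\<in>D. L \<inter> ball z (e z)))" using opUL by (rule open_Un [rotated])
    show "\<phi>' holomorphic_on (U - L) \<union> (\<Union>z\<in>D. L \<inter> ball z (e z))"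
    proof (rule holomorphic_on_Un [OF holU _ opUL opB])
      show "\<phi>' holomorphic_on (\<Union>z\<in>D. L \<inter> ball z (e z))"
        by (rule holomorphic_on_UN_open) (use holB opL in auto)
    qed
    show "Y \<subseteq> (U - L) \<union> (\<Union>z\<in>D. L \<inter> ball z (e z))"
    proof
      fix y assume y: "y \<in> Y"
      show "y \<in> (U - L) \<union> (\<Union>z\<in>D. L \<inter> ball z (e z))"
      proof (cases "y \<in> L")
        case True
        then have "y \<in> D" using y by (simp add: D_def)
        then show ?thesis using True e(1) [of y] centre_in_ball by blast
      next
        case False
        then show ?thesis using y U(2) by blast
      qed
    qed
    show "\<phi>' z = \<phi> z" if z: "z \<in> Y" for z
    proof (cases "z \<in> L")
      case True
      then have "c z = z" using z e(1) by (intro c) (auto simp: D_def)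
      then show ?thesis by (simp add: \<phi>'_def)
    qed (simp add: \<phi>'_def)
    show "\<exists>z\<in>ball x \<rho>. deriv \<phi>' z \<noteq> 0" if x: "x \<in> Y" and \<rho>: "\<rho> > 0" for x \<rho>
    proof (cases "x \<in> L")
      case True
      then have xD: "x \<in> D" using x by (simp add: D_def)
      have "deriv \<phi>' x = deriv (\<lambda>w. \<phi> x + (w - x)) x"
      proof (rule deriv_cong_ev)
        have "\<phi>' w = \<phi> x + (w - x)" if "w \<in> L \<inter> ball x (e x)" for w
          using that c [OF xD] by (simp add: \<phi>'_def)
        then show "\<forall>\<^sub>F w in nhds x. \<phi>' w = \<phi> x + (w - x)"
          unfolding eventually_nhds using opL True e(1) [OF xD] by (intro exI [of _ "L \<inter> ball x (e x)"]) auto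
      qed simp
      also have "\<dots> = 1" by (rule DERIV_imp_deriv) (auto intro!: derivative_eq_intros)
      finally show ?thesis using \<rho> by (intro bexI [of _ x]) auto
    next
      case False
      then have "x \<in> (U - L) \<inter> ball x \<rho>" using x U(2) \<rho> by auto
      moreover have "open ((U - L) \<inter> ball x \<rho>)" using opUL by auto
      ultimately obtain \<sigma> where \<sigma>: "\<sigma> > 0" "ball x \<sigma> \<subseteq> (U - L) \<inter> ball x \<rho>" by (meson open_contains_ball)
      show ?thesis
      proof (rule ccontr)
        assume contra: "\<not> ?thesis"
        have "(\<phi>' has_field_derivative 0) (at w within ball x \<sigma>)" if w: "w \<in> ball x \<sigma>" for w
        proof -
          have "\<phi>' holomorphic_on ball x \<sigma>" using holU \<sigma>(2) by (auto elim: holomorphic_on_subset)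
          then have "(\<phi>' has_field_derivative deriv \<phi>' w) (at w)" using w by (intro holomorphic_derivI [of _ "ball x \<sigma>"]) auto
          moreover have "deriv \<phi>' w = 0" using contra w \<sigma>(2) by blast
          ultimately show ?thesis by (simp add: has_field_derivative_at_within)
        qed
        then obtain a where a: "\<And>w. w \<in> ball x \<sigma> \<Longrightarrow> \<phi>' w = a"
          using has_field_derivative_zero_constant [OF convex_ball, of x \<sigma> \<phi>'] by blast
        have "\<phi> w = a" if "w \<in> ball x \<sigma>" for w
        proof -
          have "w \<notin> L" using that \<sigma>(2) by blast
          then show ?thesis using a [OF that] by (simp add: \<phi>'_def)
        qed
        then have "\<phi> constant_on ball x \<sigma>" by (auto simp: constant_on_def)
        then show False using False \<sigma> unfolding L_def by blast
      qed
    qed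
  qed
qed

lemma finite_critical_points:
  assumes "compact K" "open U" "K \<subseteq> U" "\<phi> holomorphic_on U"
    and nz: "\<And>x \<rho>. x \<in> K \<Longrightarrow> \<rho> > 0 \<Longrightarrow> \<exists>z\<in>ball x \<rho>. deriv \<phi> z \<noteq> 0"
  shows "finite {z \<in> K. deriv \<phi> z = 0}"
proof (rule ccontr)
  define T where "T = {z \<in> K. deriv \<phi> z = 0}"
  assume "infinite {z \<in> K. deriv \<phi> z = 0}"
  then have "infinite T" "T \<subseteq> K" by (auto simp: T_def)
  then obtain x where x: "x \<in> K" "x islimpt T"
    using assms(1) unfolding compact_eq_Bolzano_Weierstrass by blast
  obtain \<rho> where \<rho>: "\<rho> > 0" "ball x \<rho> \<subseteq> U" using x(1) assms(2,3) open_contains_ball by blast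
  have lim: "x islimpt (T \<inter> ball x \<rho>)"
    unfolding islimpt_approachable
  proof (intro allI impI)
    fix e :: real assume "e > 0"
    then have "min e \<rho> > 0" using \<rho>(1) by simp
    then obtain t where "t \<in> T" "t \<noteq> x" "dist t x < min e \<rho>" using x(2) unfolding islimpt_approachable by blast
    then show "\<exists>t\<in>T \<inter> ball x \<rho>. t \<noteq> x \<and> dist t x < e" by (intro bexI [of _ t]) (auto simp: dist_commute)
  qed
  have hol: "deriv \<phi> holomorphic_on ball x \<rho>"
    using assms(2,4) \<rho>(2) by (intro holomorphic_on_subset [OF holomorphic_deriv])
  have "deriv \<phi> z = 0" if "z \<in> ball x \<rho>" for z
    by (rule analytic_continuation [OF hol open_ball connected_ball _ _ lim _ that]) (use \<rho>(1) in \<open>auto simp: T_def\<close>)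
  then show False using nz [OF x(1) \<rho>(1)] by blast
qed

context compact_sequence
begin

text \<open>The empty set is connected, so the hypothesis on the complement does not rule out a
  cover of the plane. In such a cover a nonempty \<open>X n\<close> would be open, because the other
  sets have a closed union. The lemma provides room for \<open>p\<close>.\<close>

lemma Compl_X_nonempty: "- (\<Union>n. X n) \<noteq> {}"
proof
  assume "- (\<Union>n. X n) = {}"
  then have U: "(\<Union>n. X n) = UNIV" by auto
  then obtain n where n: "X n \<noteq> {}" by (metis UNIV_I UN_E empty_iff)
  have "- X n = (\<Union>m\<in>{..n} - {n}. X m) \<union> (\<Union>m\<in>{Suc n..}. X m)"
  proof -
    have eq: "- {n} = ({..n} - {n}) \<union> {Suc n..}" by auto
    have "- X n = (\<Union>m\<in>- {n}. X m)" using U disjoint_Union [of n "- {n}"] by (auto simp: set_eq_iff)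
    then show ?thesis unfolding eq by (simp only: UN_Un)
  qed
  moreover have "closed (\<Union>m\<in>{..n} - {n}. X m)" using closed_each by (intro closed_UN) auto
  ultimately have "closed (- X n)" using closed_tail [of "Suc n"] by (simp add: closed_Un)
  then have "open (X n)" by (simp add: closed_def)
  then have "X n = UNIV" using n closed_each clopen by blast
  then show False using compact_X [of n] not_compact_UNIV by metis
qed

text \<open>The two cases differ only in the model map of each step; the flag \<open>osc\<close>
  lets one construction serve both.\<close>

theorem conjugation:
  fixes C :: "nat \<Rightarrow> complex set" and \<phi> :: "complex \<Rightarrow> complex" and U :: "complex set" and \<epsilon> :: "nat \<Rightarrow> real" and osc :: bool
  assumes C: "\<And>n. finite (C n)" "\<And>n. C n \<subseteq> X n"
    and U: "open U" "(\<Union>n. X n) \<subseteq> U" "\<phi> holomorphic_on U" and nd: "nondegenerate_on \<phi> (\<Union>n. X n)"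
    and \<phi>X: "\<And>n. \<phi> ` X n \<subseteq> X (Suc n)" and \<phi>frontier: "\<And>n. \<phi> ` frontier (X n) \<subseteq> frontier (X (Suc n))"
    and \<epsilon>: "\<And>n. \<epsilon> n > 0"
  shows "\<exists>f \<theta> (k :: nat \<Rightarrow> nat). transcendental_entire f \<and> smooth_diffeomorphism \<theta> \<and>
        (\<forall>n. k n > 0) \<and> (\<forall>n. \<not> osc \<longrightarrow> k n = 1) \<and>
        (\<forall>n. \<forall>z\<in>X n. (f ^^ k n) (\<theta> z) = \<theta> (\<phi> z)) \<and>
        (\<forall>n. \<forall>z\<in>X n. norm (\<theta> z - z) \<le> \<epsilon> n) \<and>
        frontier (\<theta> ` (\<Union>n. X n)) \<subseteq> julia_set f \<and>
        (\<forall>z\<in>(\<Union>n. X n). cauchy_riemann_at \<theta> z) \<and>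
        conformal_on \<theta> (interior (\<Union>n. X n)) \<and>
        (\<forall>c\<in>(\<Union>n. C n). \<theta> c = c) \<and>
        (osc \<longrightarrow> bounded (f ` \<theta> ` (\<Union>n. X n)) \<and> \<theta> ` (\<Union>n. X n) \<subseteq> bungee_set f) \<and>
        (\<not> osc \<longrightarrow> \<theta> ` (\<Union>n. X n) \<subseteq> escaping_set f) \<and>
        (\<forall>n. wandering_compact f (\<theta> ` X n))"
proof -
  obtain \<psi> V where V: "open V" "(\<Union>n. X n) \<subseteq> V" "\<psi> holomorphic_on V" "\<And>z. z \<in> (\<Union>n. X n) \<Longrightarrow> \<psi> z = \<phi> z"
    "\<And>x \<rho>. x \<in> (\<Union>n. X n) \<Longrightarrow> \<rho> > 0 \<Longrightarrow> \<exists>z\<in>ball x \<rho>. deriv \<psi> z \<noteq> 0"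
    by (rule nondegenerate_replacement [OF U nd]) (rule that)
  have eq: "\<psi> z = \<phi> z" if "z \<in> X n" for z n using V(4) that by blast
  have nz: "\<exists>z\<in>ball x \<rho>. deriv \<psi> z \<noteq> 0" if "x \<in> X n" "\<rho> > 0" for n x \<rho> using V(5) that by blast
  have XV: "X n \<subseteq> V" for n using V(2) by blast
  have \<psi>X: "\<psi> ` X n \<subseteq> X (Suc n)" for n using \<phi>X [of n] eq [of _ n] by auto
  have \<psi>frontier: "\<psi> ` frontier (X n) \<subseteq> frontier (X (Suc n))" for n
  proof -
    have "frontier (X n) \<subseteq> X n" using closed_each by (rule frontier_subset_closed)
    then have "\<psi> z = \<phi> z" if "z \<in> frontier (X n)" for z using eq [of z n] that by blast
    then show ?thesis using \<phi>frontier [of n] by auto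
  qed
  define Cr where "Cr n = {z \<in> X n. deriv \<psi> z = 0}" for n
  have Cr: "finite (Cr n)" for n
    unfolding Cr_def by (rule finite_critical_points [OF compact_X V(1) XV V(3) nz])
  \<comment> \<open>The lifting argument requires \<psi> to map marked points to marked points,
    hence all earlier ones are pushed forward. Each \<open>M n\<close> remains finite because only
    \<open>C n\<close>, \<open>Cr n\<close> and one finite image enter.\<close>
  define M where "M = rec_nat (C 0 \<union> Cr 0) (\<lambda>n S. C (Suc n) \<union> Cr (Suc n) \<union> \<psi> ` S)"
  have M0: "M 0 = C 0 \<union> Cr 0" and MS: "M (Suc n) = C (Suc n) \<union> Cr (Suc n) \<union> \<psi> ` M n" for n
    by (simp_all add: M_def)
  have Mfin: "finite (M n)" for n by (induction n) (use C(1) Cr in \<open>auto simp: M0 MS\<close>)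
  have CrX: "Cr n \<subseteq> X n" for n by (auto simp: Cr_def)
  have MX: "M n \<subseteq> X n" for n
  proof (induction n)
    case 0
    then show ?case using C(2) CrX by (simp add: M0)
  next
    case (Suc n)
    then have "\<psi> ` M n \<subseteq> X (Suc n)" using \<psi>X [of n] by blast
    then show ?case using C(2) CrX by (simp add: MS)
  qed
  have CM: "C n \<union> Cr n \<subseteq> M n" for n by (cases n) (auto simp: M0 MS)
  \<comment> \<open>With a whole disc around \<open>p\<close> off all the sets, \<open>A 0\<close>
    can contain that disc without meeting any of them.\<close>
  obtain p where p: "p \<in> - (\<Union>n. X n)" using Compl_X_nonempty by blast
  have "open (- (\<Union>n. X n))" using closed_X by (rule open_Compl)
  then obtain r where r: "r > 0" "cball p r \<subseteq> - (\<Union>n. X n)" using p by (meson open_contains_cball)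
  then have disj: "cball p r \<inter> (\<Union>n. X n) = {}" by blast
  obtain A where A: "\<And>n. separator X n (A n)" "\<And>n. A n \<subseteq> interior (A (Suc n))"
    "(\<Union>n. interior (A n)) = UNIV" "cball p r \<subseteq> interior (A 0)"
    by (rule exhaustion [OF nonseparating_cball disj]) (rule that)
  have "\<exists>\<delta>>0. \<forall>z\<in>X n. cball z \<delta> \<subseteq> interior (A (Suc n)) - A n" for n
  proof -
    have "open (interior (A (Suc n)) - A n)" "X n \<subseteq> interior (A (Suc n)) - A n"
      using A(1) [of n] A(1) [of "Suc n"] by (auto simp: separator_def nonseparating_def compact_imp_closed)
    then obtain \<delta> L where "\<delta> > 0" "L \<subseteq> interior (A (Suc n)) - A n" "\<And>y. y \<in> X n \<Longrightarrow> cball y \<delta> \<subseteq> L"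
      using compact_collar [OF compact_X] by metis
    then show ?thesis by blast
  qed
  then obtain \<delta> where \<delta>: "\<And>n. \<delta> n > 0" "\<And>n z. z \<in> X n \<Longrightarrow> cball z (\<delta> n) \<subseteq> interior (A (Suc n)) - A n" by metis
  \<comment> \<open>The displacement is also kept below \<delta>, so that the image of
    \<open>X n\<close> remains in the shell between \<open>A n\<close> and \<open>A (Suc n)\<close>;
    this tells when orbits leave the sets \<open>A n\<close>.\<close>
  define \<epsilon>' where "\<epsilon>' n = min (\<epsilon> n) (\<delta> n)" for n
  interpret W: wandering_system X M \<psi> V \<epsilon>' p r A osc
  proof
    show "\<exists>z\<in>ball x \<rho>. deriv \<psi> z \<noteq> 0" if "x \<in> X n" "\<rho> > 0" for n x \<rho> using nz that .
    show "\<psi> ` M n \<subseteq> M (Suc n)" for n by (auto simp: MS)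
    show "deriv \<psi> z \<noteq> 0" if "z \<in> X n - M n" for n z using that CM [of n] by (auto simp: Cr_def)
    show "\<epsilon>' n > 0" for n using \<epsilon> \<delta>(1) by (simp add: \<epsilon>'_def)
    show "w \<in> interior (A (Suc n)) - A n" if "z \<in> X n" "dist w z \<le> \<epsilon>' n" for n z w
    proof -
      have "w \<in> cball z (\<delta> n)" using that(2) by (simp add: \<epsilon>'_def dist_commute)
      then show ?thesis using \<delta>(2) [OF that(1)] by blast
    qed
  qed (fact V XV \<psi>X \<psi>frontier Mfin MX r A)+
  obtain f \<theta> k Fr where seq: "\<And>N. W.stage N (f N) (\<theta> N) (k N) (Fr N)" "\<theta> 0 = id"
    "\<And>N. W.successor N (f N) (\<theta> N) (k N) (Fr N) (f (Suc N)) (\<theta> (Suc N)) (k (Suc N)) (Fr (Suc N))"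
    by (rule W.stage_sequence) (rule that)
  interpret S: wandering_sequence X M \<psi> V \<epsilon>' p r A osc f \<theta> k Fr
    by unfold_locales (fact seq)+
  show ?thesis
  proof (rule exI [of _ S.fl], rule exI [of _ S.\<theta>l], rule exI [of _ S.kl], intro conjI allI ballI impI)
    show "S.kl n > 0" for n by (rule S.kl)
    show "S.kl n = 1" if "\<not> osc" for n using that by (rule S.kl)
    show "(S.fl ^^ S.kl n) (S.\<theta>l z) = S.\<theta>l (\<phi> z)" if "z \<in> X n" for n z
      using S.conjugacy [OF that] eq [OF that] by simp
    show "norm (S.\<theta>l z - z) \<le> \<epsilon> n" if "z \<in> X n" for n z
      using S.\<theta>l_close [OF that] by (simp add: \<epsilon>'_def)
    show "cauchy_riemann_at S.\<theta>l z" if "z \<in> (\<Union>n. X n)" for z using that S.\<theta>l_cauchy_riemann by blast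
    show "S.\<theta>l c = c" if "c \<in> (\<Union>n. C n)" for c using that CM S.\<theta>l_fix by blast
    show "bounded (S.fl ` S.\<theta>l ` (\<Union>n. X n))" if osc using that by (rule S.realization)
    show "S.\<theta>l ` (\<Union>n. X n) \<subseteq> bungee_set S.fl" if osc using S.bungee [OF that] by blast
    show "S.\<theta>l ` (\<Union>n. X n) \<subseteq> escaping_set S.fl" if "\<not> osc" using S.escaping [OF that] by blast
  qed (rule S.realization)+
qed

end

theorem theorem1p5:
  fixes X C :: "nat \<Rightarrow> complex set"
    and \<phi> :: "complex \<Rightarrow> complex"
    and U :: "complex set"
    and \<epsilon> :: "nat \<Rightarrow> real"
  assumes "\<And>n. compact (X n)"
    and "\<And>n m. n \<noteq> m \<Longrightarrow> X n \<inter> X m = {}"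
    and "(\<lambda>n. INF z\<in>X n. ereal (norm z)) \<longlonglongrightarrow> \<infinity>"
    and "\<And>n. finite (C n)"
    and "\<And>n. C n \<subseteq> X n"
    and "open U" and "(\<Union>n. X n) \<subseteq> U" and "\<phi> holomorphic_on U"
    and "nondegenerate_on \<phi> (\<Union>n. X n)"
    and "\<And>n. n \<ge> 1 \<Longrightarrow> \<phi> ` X (n - 1) \<subseteq> X n"
    and "\<And>n. n \<ge> 1 \<Longrightarrow> \<phi> ` frontier (X (n - 1)) \<subseteq> frontier (X n)"
    and "\<And>n. \<epsilon> n > 0"
    and "connected (- (\<Union>n. X n))"
  shows
    "(\<exists>f \<theta>. transcendental_entire f \<and> smooth_diffeomorphism \<theta> \<and>
        (\<forall>z\<in>(\<Union>n. X n). f (\<theta> z) = \<theta> (\<phi> z)) \<and>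
        (\<forall>n. \<forall>z\<in>X n. norm (\<theta> z - z) \<le> \<epsilon> n) \<and>
        frontier (\<theta> ` (\<Union>n. X n)) \<subseteq> julia_set f \<and>
        (\<forall>z\<in>(\<Union>n. X n). cauchy_riemann_at \<theta> z) \<and>
        conformal_on \<theta> (interior (\<Union>n. X n)) \<and>
        (\<forall>c\<in>(\<Union>n. C n). \<theta> c = c) \<and>
        \<theta> ` (\<Union>n. X n) \<subseteq> escaping_set f \<and>
        (\<forall>n. wandering_compact f (\<theta> ` X n)))
     \<and>
     (\<exists>f \<theta> (k :: nat \<Rightarrow> nat). transcendental_entire f \<and> smooth_diffeomorphism \<theta> \<and>
        (\<forall>n. k n > 0) \<and>
        (\<forall>n. \<forall>z\<in>X n. (f ^^ k n) (\<theta> z) = \<theta> (\<phi> z)) \<and>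
        (\<forall>n. \<forall>z\<in>X n. norm (\<theta> z - z) \<le> \<epsilon> n) \<and>
        frontier (\<theta> ` (\<Union>n. X n)) \<subseteq> julia_set f \<and>
        (\<forall>z\<in>(\<Union>n. X n). cauchy_riemann_at \<theta> z) \<and>
        conformal_on \<theta> (interior (\<Union>n. X n)) \<and>
        (\<forall>c\<in>(\<Union>n. C n). \<theta> c = c) \<and>
        bounded (f ` \<theta> ` (\<Union>n. X n)) \<and>
        \<theta> ` (\<Union>n. X n) \<subseteq> bungee_set f \<and>
        (\<forall>n. wandering_compact f (\<theta> ` X n)))"
proof -
  interpret compact_sequence X
  proof
    show "\<exists>N. \<forall>n\<ge>N. X n \<inter> B = {}" if B: "compact B" for B
    proof -
      \<comment> \<open>For an empty \<open>X n\<close> the infimum is infinite, in accordance with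
        its missing every \<open>B\<close>.\<close>
      obtain R where R: "\<And>z. z \<in> B \<Longrightarrow> norm z \<le> R" using compact_imp_bounded [OF B] by (auto simp: bounded_iff)
      have "\<forall>\<^sub>F n in sequentially. (INF z\<in>X n. ereal (norm z)) > ereal R"
        using assms(3) by (rule order_tendstoD) simp
      then obtain N where N: "\<And>n. n \<ge> N \<Longrightarrow> (INF z\<in>X n. ereal (norm z)) > ereal R" by (auto simp: eventually_sequentially)
      have "z \<notin> B" if "n \<ge> N" "z \<in> X n" for n z
      proof
        assume "z \<in> B"
        have "ereal R < ereal (norm z)" using N [OF that(1)] INF_lower [OF that(2), of "\<lambda>z. ereal (norm z)"] by (rule less_le_trans)
        then show False using R [OF \<open>z \<in> B\<close>] by simp
      qed
      then show ?thesis by blast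
    qed
  qed (fact assms)+
  have \<phi>: "\<phi> ` X n \<subseteq> X (Suc n)" "\<phi> ` frontier (X n) \<subseteq> frontier (X (Suc n))" for n
    using assms(10,11) [of "Suc n"] by simp_all
  note conj = conjugation [where \<epsilon> = \<epsilon>, OF assms(4-9) \<phi> assms(12)]
  show ?thesis
  proof (rule conjI)
    obtain f \<theta> and k :: "nat \<Rightarrow> nat" where c: "transcendental_entire f" "smooth_diffeomorphism \<theta>"
      "\<forall>n. k n > 0" "\<forall>n. \<not> False \<longrightarrow> k n = 1" "\<forall>n. \<forall>z\<in>X n. (f ^^ k n) (\<theta> z) = \<theta> (\<phi> z)"
      "\<forall>n. \<forall>z\<in>X n. norm (\<theta> z - z) \<le> \<epsilon> n" "frontier (\<theta> ` (\<Union>n. X n)) \<subseteq> julia_set f"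
      "\<forall>z\<in>(\<Union>n. X n). cauchy_riemann_at \<theta> z" "conformal_on \<theta> (interior (\<Union>n. X n))" "\<forall>c\<in>(\<Union>n. C n). \<theta> c = c"
      "\<not> False \<longrightarrow> \<theta> ` (\<Union>n. X n) \<subseteq> escaping_set f" "\<forall>n. wandering_compact f (\<theta> ` X n)"
      using conj [where osc = False] by (elim exE conjE)
    have "k n = 1" for n using c(4) by simp
    then have feq: "\<forall>z\<in>(\<Union>n. X n). f (\<theta> z) = \<theta> (\<phi> z)" using c(5) by auto
    have esc: "\<theta> ` (\<Union>n. X n) \<subseteq> escaping_set f" using c(11) by (rule mp) simp
    show "\<exists>f \<theta>. transcendental_entire f \<and> smooth_diffeomorphism \<theta> \<and>
        (\<forall>z\<in>(\<Union>n. X n). f (\<theta> z) = \<theta> (\<phi> z)) \<and>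
        (\<forall>n. \<forall>z\<in>X n. norm (\<theta> z - z) \<le> \<epsilon> n) \<and>
        frontier (\<theta> ` (\<Union>n. X n)) \<subseteq> julia_set f \<and>
        (\<forall>z\<in>(\<Union>n. X n). cauchy_riemann_at \<theta> z) \<and>
        conformal_on \<theta> (interior (\<Union>n. X n)) \<and>
        (\<forall>c\<in>(\<Union>n. C n). \<theta> c = c) \<and>
        \<theta> ` (\<Union>n. X n) \<subseteq> escaping_set f \<and>
        (\<forall>n. wandering_compact f (\<theta> ` X n))"
      by (rule exI [of _ f], rule exI [of _ \<theta>], intro conjI) (fact c feq esc)+
    obtain f \<theta> and k :: "nat \<Rightarrow> nat" where d: "transcendental_entire f" "smooth_diffeomorphism \<theta>"
      "\<forall>n. k n > 0" "\<forall>n. \<forall>z\<in>X n. (f ^^ k n) (\<theta> z) = \<theta> (\<phi> z)"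
      "\<forall>n. \<forall>z\<in>X n. norm (\<theta> z - z) \<le> \<epsilon> n" "frontier (\<theta> ` (\<Union>n. X n)) \<subseteq> julia_set f"
      "\<forall>z\<in>(\<Union>n. X n). cauchy_riemann_at \<theta> z" "conformal_on \<theta> (interior (\<Union>n. X n))" "\<forall>c\<in>(\<Union>n. C n). \<theta> c = c"
      "True \<longrightarrow> bounded (f ` \<theta> ` (\<Union>n. X n)) \<and> \<theta> ` (\<Union>n. X n) \<subseteq> bungee_set f" "\<forall>n. wandering_compact f (\<theta> ` X n)"
      using conj [where osc = True] by (elim exE conjE)
    have osc: "bounded (f ` \<theta> ` (\<Union>n. X n))" "\<theta> ` (\<Union>n. X n) \<subseteq> bungee_set f" using d(10) by simp_all
    show "\<exists>f \<theta> (k :: nat \<Rightarrow> nat). transcendental_entire f \<and> smooth_diffeomorphism \<theta> \<and>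
        (\<forall>n. k n > 0) \<and>
        (\<forall>n. \<forall>z\<in>X n. (f ^^ k n) (\<theta> z) = \<theta> (\<phi> z)) \<and>
        (\<forall>n. \<forall>z\<in>X n. norm (\<theta> z - z) \<le> \<epsilon> n) \<and>
        frontier (\<theta> ` (\<Union>n. X n)) \<subseteq> julia_set f \<and>
        (\<forall>z\<in>(\<Union>n. X n). cauchy_riemann_at \<theta> z) \<and>
        conformal_on \<theta> (interior (\<Union>n. X n)) \<and>
        (\<forall>c\<in>(\<Union>n. C n). \<theta> c = c) \<and>
        bounded (f ` \<theta> ` (\<Union>n. X n)) \<and>
        \<theta> ` (\<Union>n. X n) \<subseteq> bungee_set f \<and>
        (\<forall>n. wandering_compact f (\<theta> ` X n))"
      by (rule exI [of _ f], rule exI [of _ \<theta>], rule exI [of _ k], intro conjI) (fact d osc)+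
  qed
qed

end
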